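(* Let $n\ge 3$, $q\ge 2$, $p=1$, $d=nq$. For type II functions in $\operatorname{H}_{p,q}^{d}$, the analytic moduli space with fixed Henry-Parusiński invariant is determined by the equivalence classes (i.e. the $\mathbb{Z}_n$-orbits) in $\mathbb{W}_0^{n-2}$ of the non-degenerate fibers of $\Upsilon_{II}:\mathbb{W}_0^{n-2}\to\mathcal{HP}_{II}=\operatorname{Im}(\Upsilon_{II})$. More precisely, for each $\rho\in\operatorname{Im}(\Upsilon_{II})$ there exist $\#[\Upsilon_{II}^{-1}(\rho)]$ analytic types of function-germs with the same Henry-Parusiński invariant $\rho$, where $[\Upsilon_{II}^{-1}(\rho)]$ is the set of $\mathbb{Z}_n$-orbits in the fiber $\Upsilon_{II}^{-1}(\rho)$, and $$\#[\Upsilon_{II}^{-1}(\rho)]\le n^{n-3}.$$ The equality $\#[\Upsilon_{II}^{-1}(\rho)]=n^{n-3}$ holds for (the invariant $\rho$ of) generic polynomials in the Zariski open set $\mathcal{Z}\subset\operatorname{H}_{p,q}^{d}$.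
   Context: Function germs $f,g:(\mathbb{C}^2,0)\to(\mathbb{C},0)$ are analytically equivalent if $g=f\circ\Phi$ for some germ of biholomorphism $\Phi\in\operatorname{Diff}(\mathbb{C}^2,0)$; an analytic type is an equivalence class. For coprime integers $1\le p<q$, $\operatorname{H}_{p,q}^{d}$ is the set of commode, monic, reduced quasi-homogeneous polynomials $f_\lambda(x,y)=\prod_{j=1}^n(y^p-\lambda_jx^q)$ with $\lambda_j\in\mathbb{C}^*$ pairwise distinct and $d=npq$; it is viewed in $\mathbb{C}^n$ through the coefficients $(\sigma_1(\lambda),\dots,\sigma_n(\lambda))$ of $Q_\lambda(t)=\prod_{j=1}^n(t-\lambda_j)$, where $\sigma_\ell$ is the $\ell$-th elementary symmetric polynomial. Type II means $p=1$. Let $\kappa_1,\dots,\kappa_{n-1}$ be the critical points of $Q_\lambda$ with multiplicity, so $Q_\lambda'(t)=n\prod_{j=1}^{n-1}(t-\kappa_j)$ and $\sigma_\ell(\kappa)=\frac{n-\ell}{n}\sigma_\ell(\lambda)$ for $0\le\ell\le n-1$. Put $\rho_\ell=\prod_{j=1}^n(\kappa_\ell-\lambda_j)=Q_\lambda(\kappa_\ell)$. Henry-Parusiński invariant (type II): let $\gamma$ run over the polar arcs $y=\kappa_\ell x^q$ of $\partial_yf_\lambda=0$ with $\kappa_\ell\neq 0$, $\gamma_\ell(s)=(s,\kappa_\ell s^q)$; then $f_\lambda(\gamma_\ell(s))=\rho_\ell s^{qn}$ and the invariant is the set of these leading coefficients, two sets $\{c_1,\dots,c_r\}$, $\{c_1',\dots,c_r'\}$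 defining the same invariant if there is $\xi\in\mathbb{C}^*$ with $\{c_1',\dots,c_r'\}=\{c_1\xi^{qn},\dots,c_r\xi^{qn}\}$. Normalization and the map $\Upsilon_{II}$: let $\mathbb{W}_0^{n-2}=\{(\kappa_1,\dots,\kappa_{n-1})\in\mathbb{C}^{n-1}:\kappa_1+\cdots+\kappa_{n-1}=0\}$, with coordinates $(\kappa_1,\dots,\kappa_{n-2})$. The group $\mathbb{Z}_n$ acts on $\mathbb{W}_0^{n-2}$ by multiplication by $n$-th roots of unity. A point $\kappa\in\mathbb{W}_0^{n-2}$ corresponds to the unordered tuple $\lambda$ with $\lambda_1+\cdots+\lambda_n=0$, $\lambda_1\cdots\lambda_n=1$ and $\sigma_\ell(\lambda)=\frac{n}{n-\ell}\sigma_\ell(\kappa)$ for $1\le\ell\le n-1$, hence to the function $f_\lambda=\prod_j(y-\lambda_jx^q)$; analytic types are represented by $\mathbb{Z}_n$-orbits of such $\kappa$. Define $\Upsilon_{II}:\mathbb{W}_0^{n-2}\to\mathbb{C}^{n-2}$ by $$\Upsilon_{II,j}(\kappa)=\kappa_j^n+\sum_{\ell=1}^{n-1}(-1)^\ell\frac{n}{n-\ell}\sigma_\ell(\kappa)\kappa_j^{n-\ell}+(-1)^n,\quad j=1,\dots,n-2,$$ so that $\Upsilon_{II}(\kappa)=(\rho_1,\dots,\rho_{n-2})$ for the corresponding $f_\lambda$. Each $\rho\in\mathcal{HP}_{II}:=\operatorname{Im}(\Upsilon_{II})$ is taken to represent a class of the Henry-Parusiński invariant, and "function-germs with Henry-Parusiński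 invariant $\rho$" are those represented by $\kappa\in\Upsilon_{II}^{-1}(\rho)$. A fiber $\Upsilon_{II}^{-1}(\rho)$ is degenerate if $\rho_j=0$ for some $j\in\{1,\dots,n-2\}$ or if the fiber has a multiple root; otherwise it is non-degenerate. The set $\mathcal{Z}$: the Zariski open set of those $f_\lambda\in\operatorname{H}_{p,q}^{d}$ such that $Q_\lambda'$ has $n-1$ distinct roots $\kappa_1,\dots,\kappa_{n-1}$ and the values $\rho_\ell=Q_\lambda(\kappa_\ell)$, $1\le\ell\le n-1$, are pairwise distinct.
   Formalization: The count of analytic types fails for some ρ (n=5, ρ_1=ρ_2, κ_1≠κ_2: swapping gives the same germ, another orbit); it is proved for every ρ for germs with numbered polar arcs, and for bare germs if the fiber lies in Z; bare equivalence is same orbit up to renumbering κ. *)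

theory Defs
  imports "HOL-Analysis.Analysis" "HOL-Computational_Algebra.Polynomial"
begin

section \<open>Germs at the origin of the complex plane and analytic equivalence\<close>

text \<open>
  A germ at the origin is handled through representatives: total functions that only matter
  near \<open>0\<close>. A map of two complex variables is holomorphic iff it is (Frechet) differentiable
  with complex-linear derivative; linearity over the complex numbers is written out because
  the product type only carries a real vector space structure.
\<close>

definition holomorphic2_on :: "(complex \<times> complex \<Rightarrow> complex \<times> complex) \<Rightarrow> (complex \<times> complex) set \<Rightarrow> bool"
  where "holomorphic2_on \<Phi> S \<longleftrightarrow>
    (\<forall>z\<in>S. \<exists>D. (\<Phi> has_derivative D) (at z) \<and>
       (\<forall>c u v. D (c * u, c * v) = (c * fst (D (u, v)), c * snd (D (u, v)))))"

definition biholomorphic_germ :: "(complex \<times> complex \<Rightarrow> complex \<times> complex) \<Rightarrow> bool"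
  where "biholomorphic_germ \<Phi> \<longleftrightarrow> \<Phi> 0 = 0 \<and>
    (\<exists>U V \<Psi>. open U \<and> open V \<and> 0 \<in> U \<and> 0 \<in> V \<and> \<Phi> ` U = V \<and> \<Psi> ` V = U \<and>
       (\<forall>z\<in>U. \<Psi> (\<Phi> z) = z) \<and> (\<forall>w\<in>V. \<Phi> (\<Psi> w) = w) \<and>
       holomorphic2_on \<Phi> U \<and> holomorphic2_on \<Psi> V)"

definition analytic_equiv :: "(complex \<times> complex \<Rightarrow> complex) \<Rightarrow> (complex \<times> complex \<Rightarrow> complex) \<Rightarrow> bool"
  where "analytic_equiv f g \<longleftrightarrow>
    (\<exists>\<Phi>. biholomorphic_germ \<Phi> \<and> (\<forall>\<^sub>F z in nhds 0. g z = f (\<Phi> z)))"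

definition analytic_type :: "(complex \<times> complex \<Rightarrow> complex) \<Rightarrow> (complex \<times> complex \<Rightarrow> complex) set"
  where "analytic_type f = {g. analytic_equiv f g}"


section \<open>Quasi-homogeneous polynomials\<close>

text \<open>Points of complex \<open>m\<close>-space are functions on \<open>{1..m}\<close>, extended by \<open>undefined\<close>.\<close>

definition cvec :: "nat \<Rightarrow> (nat \<Rightarrow> complex) set"
  where "cvec m = {1..m} \<rightarrow>\<^sub>E UNIV"

text \<open>The \<open>k\<close>-th elementary symmetric polynomial in the variables \<open>x 1, \<dots>, x m\<close>.\<close>

definition esym :: "nat \<Rightarrow> nat \<Rightarrow> (nat \<Rightarrow> complex) \<Rightarrow> complex"
  where "esym m k x = (\<Sum>S | S \<subseteq> {1..m} \<and> card S = k. \<Prod>i\<in>S. x i)"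

definition qh :: "nat \<Rightarrow> nat \<Rightarrow> nat \<Rightarrow> (nat \<Rightarrow> complex) \<Rightarrow> complex \<times> complex \<Rightarrow> complex"
  where "qh p q n lam = (\<lambda>(x, y). \<Prod>j\<in>{1..n}. (y ^ p - lam j * x ^ q))"

definition Qpoly :: "nat \<Rightarrow> (nat \<Rightarrow> complex) \<Rightarrow> complex poly"
  where "Qpoly n lam = (\<Prod>j\<in>{1..n}. [:- lam j, 1:])"

text \<open>
  The roots of the members of the family: nonzero (\<open>qh p q n lam\<close> is commode) and pairwise
  distinct (it is reduced).
\<close>

definition H_roots :: "nat \<Rightarrow> (nat \<Rightarrow> complex) set"
  where "H_roots n = {lam \<in> cvec n. (\<forall>j\<in>{1..n}. lam j \<noteq> 0) \<and> inj_on lam {1..n}}"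

text \<open>The embedding of the family into complex \<open>n\<close>-space, \<open>qh p q n lam\<close> being sent to:\<close>

definition sigma_coords :: "nat \<Rightarrow> (nat \<Rightarrow> complex) \<Rightarrow> nat \<Rightarrow> complex"
  where "sigma_coords n lam = (\<lambda>l\<in>{1..n}. esym n l lam)"

text \<open>
  The set of those members for which the derivative of \<open>Qpoly\<close> has \<open>n - 1\<close> distinct roots,
  with pairwise distinct critical values.
\<close>

definition Z_roots :: "nat \<Rightarrow> (nat \<Rightarrow> complex) set"
  where "Z_roots n = {lam \<in> H_roots n.
     card {t. poly (pderiv (Qpoly n lam)) t = 0} = n - 1 \<and>
     inj_on (poly (Qpoly n lam)) {t. poly (pderiv (Qpoly n lam)) t = 0}}"

definition Z_set :: "nat \<Rightarrow> (nat \<Rightarrow> complex) set"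
  where "Z_set n = sigma_coords n ` Z_roots n"


section \<open>Zariski topology of complex affine space\<close>

text \<open>
  Affine space is irreducible, so a nonempty Zariski open set is dense: a property is generic
  in an open set \<open>Z\<close> iff it holds on some nonempty Zariski open subset of \<open>Z\<close>.
\<close>

definition poly_fun :: "nat \<Rightarrow> ((nat \<Rightarrow> complex) \<Rightarrow> complex) \<Rightarrow> bool"
  where "poly_fun n P \<longleftrightarrow> (\<exists>(M :: (nat \<Rightarrow> nat) set) c. finite M \<and>
     P = (\<lambda>a. \<Sum>m\<in>M. c m * (\<Prod>i\<in>{1..n}. a i ^ m i)))"

definition zariski_open :: "nat \<Rightarrow> (nat \<Rightarrow> complex) set \<Rightarrow> bool"
  where "zariski_open n U \<longleftrightarrow>
     (\<exists>F. (\<forall>P\<in>F. poly_fun n P) \<and> U = {a \<in> cvec n. \<exists>P\<in>F. P a \<noteq> 0})"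


section \<open>The normalized parameters and the map to the critical values\<close>

definition W0 :: "nat \<Rightarrow> (nat \<Rightarrow> complex) set"
  where "W0 n = {\<kappa> \<in> cvec (n - 1). (\<Sum>j\<in>{1..n - 1}. \<kappa> j) = 0}"

definition roots_of :: "nat \<Rightarrow> (nat \<Rightarrow> complex) \<Rightarrow> (nat \<Rightarrow> complex) \<Rightarrow> bool"
  where "roots_of n \<kappa> lam \<longleftrightarrow> lam \<in> cvec n \<and>
     (\<Sum>j\<in>{1..n}. lam j) = 0 \<and> (\<Prod>j\<in>{1..n}. lam j) = 1 \<and>
     (\<forall>l\<in>{1..n - 1}. esym n l lam = of_nat n / of_nat (n - l) * esym (n - 1) l \<kappa>)"

text \<open>
  The condition \<open>roots_of n \<kappa> lam\<close> determines \<open>lam\<close> up to order, so that it determines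
  the function \<open>f\<close> uniquely.
\<close>

definition represents :: "nat \<Rightarrow> nat \<Rightarrow> (nat \<Rightarrow> complex) \<Rightarrow> (complex \<times> complex \<Rightarrow> complex) \<Rightarrow> bool"
  where "represents n q \<kappa> f \<longleftrightarrow> (\<exists>lam. roots_of n \<kappa> lam \<and> f = qh 1 q n lam)"

definition Upsilon :: "nat \<Rightarrow> (nat \<Rightarrow> complex) \<Rightarrow> nat \<Rightarrow> complex"
  where "Upsilon n \<kappa> = (\<lambda>j\<in>{1..n - 2}.
     \<kappa> j ^ n + (\<Sum>l\<in>{1..n - 1}. (-1) ^ l * (of_nat n / of_nat (n - l)) * esym (n - 1) l \<kappa> * \<kappa> j ^ (n - l))
       + (-1) ^ n)"

definition HP_II :: "nat \<Rightarrow> (nat \<Rightarrow> complex) set"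
  where "HP_II n = Upsilon n ` W0 n"

definition fiber :: "nat \<Rightarrow> (nat \<Rightarrow> complex) \<Rightarrow> (nat \<Rightarrow> complex) set"
  where "fiber n \<rho> = {\<kappa> \<in> W0 n. Upsilon n \<kappa> = \<rho>}"

definition Zn_orbit :: "nat \<Rightarrow> (nat \<Rightarrow> complex) \<Rightarrow> (nat \<Rightarrow> complex) set"
  where "Zn_orbit n \<kappa> = {(\<lambda>j\<in>{1..n - 1}. \<zeta> * \<kappa> j) | \<zeta>. \<zeta> ^ n = 1}"

definition fiber_orbits :: "nat \<Rightarrow> (nat \<Rightarrow> complex) \<Rightarrow> (nat \<Rightarrow> complex) set set"
  where "fiber_orbits n \<rho> = Zn_orbit n ` fiber n \<rho>"

text \<open>
  A solution of the polynomial system \<open>Upsilon n \<kappa> = \<rho>\<close> is multiple iff the differential of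
  \<open>Upsilon\<close> at it is singular, i.e. kills a nonzero vector \<open>v\<close> tangent to \<open>W0 n\<close>.
\<close>

definition multiple_root :: "nat \<Rightarrow> (nat \<Rightarrow> complex) \<Rightarrow> bool"
  where "multiple_root n \<kappa> \<longleftrightarrow>
     (\<exists>v\<in>W0 n. (\<exists>i\<in>{1..n - 1}. v i \<noteq> 0) \<and>
        (\<forall>j\<in>{1..n - 2}. ((\<lambda>t. Upsilon n (\<lambda>i\<in>{1..n - 1}. \<kappa> i + t * v i) j)
            has_field_derivative 0) (at 0)))"

definition degenerate :: "nat \<Rightarrow> (nat \<Rightarrow> complex) \<Rightarrow> bool"
  where "degenerate n \<rho> \<longleftrightarrow>
     (\<exists>j\<in>{1..n - 2}. \<rho> j = 0) \<or> (\<exists>\<kappa>\<in>fiber n \<rho>. multiple_root n \<kappa>)"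


section \<open>Analytic types with a given Henry-Parusinski invariant\<close>

definition has_HP_invariant :: "nat \<Rightarrow> nat \<Rightarrow> (complex \<times> complex \<Rightarrow> complex) \<Rightarrow> (nat \<Rightarrow> complex) \<Rightarrow> bool"
  where "has_HP_invariant n q f \<rho> \<longleftrightarrow>
     (\<exists>\<kappa>\<in>fiber n \<rho>. \<exists>g. represents n q \<kappa> g \<and> analytic_equiv g f)"

definition analytic_types :: "nat \<Rightarrow> nat \<Rightarrow> (nat \<Rightarrow> complex) \<Rightarrow> (complex \<times> complex \<Rightarrow> complex) set set"
  where "analytic_types n q \<rho> = {analytic_type f | f \<kappa>. \<kappa> \<in> fiber n \<rho> \<and> represents n q \<kappa> f}"

text \<open>
  Since \<open>\<kappa>\<close> and \<open>\<rho>\<close> are ordered tuples, a point of a fiber is a function germ together with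
  a numbering of its polar arcs \<open>y = \<kappa> l * x ^ q\<close>, and two such points may carry the same
  germ with two numberings. A labelled germ is a pair \<open>(f, c)\<close>, \<open>c l\<close> being the leading
  coefficient of the \<open>l\<close>-th arc. Equivalence of labelled germs is analytic equivalence
  by some \<open>\<Phi>\<close> respecting the numbering: as the polar arcs are not preserved by \<open>\<Phi>\<close> exactly,
  but only up to terms of order larger than \<open>q\<close>, it is required that the image by \<open>\<Phi>\<close> of the
  \<open>l\<close>-th arc \<open>y = d l * x ^ q\<close> of \<open>g\<close> agrees to that order with the
  \<open>l\<close>-th arc \<open>y = c l * x ^ q\<close> of \<open>f\<close>.
\<close>

definition labelled_equiv :: "nat \<Rightarrow> nat \<Rightarrow>
    (complex \<times> complex \<Rightarrow> complex) \<times> (nat \<Rightarrow> complex) \<Rightarrow>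
    (complex \<times> complex \<Rightarrow> complex) \<times> (nat \<Rightarrow> complex) \<Rightarrow> bool"
  where "labelled_equiv n q = (\<lambda>(f, c) (g, d).
    (\<exists>\<Phi>. biholomorphic_germ \<Phi> \<and> (\<forall>\<^sub>F z in nhds 0. g z = f (\<Phi> z)) \<and>
       (\<forall>l\<in>{1..n - 1}.
          ((\<lambda>s. (snd (\<Phi> (s, d l * s ^ q)) - c l * fst (\<Phi> (s, d l * s ^ q)) ^ q) / s ^ q) \<longlongrightarrow> 0) (at 0))))"

definition labelled_type :: "nat \<Rightarrow> nat \<Rightarrow>
    (complex \<times> complex \<Rightarrow> complex) \<times> (nat \<Rightarrow> complex) \<Rightarrow>
    ((complex \<times> complex \<Rightarrow> complex) \<times> (nat \<Rightarrow> complex)) set"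
  where "labelled_type n q X = {(g, d). d \<in> cvec (n - 1) \<and> labelled_equiv n q X (g, d)}"

definition labelled_types :: "nat \<Rightarrow> nat \<Rightarrow> (nat \<Rightarrow> complex) \<Rightarrow>
    ((complex \<times> complex \<Rightarrow> complex) \<times> (nat \<Rightarrow> complex)) set set"
  where "labelled_types n q \<rho> = {labelled_type n q (f, \<kappa>) | f \<kappa>. \<kappa> \<in> fiber n \<rho> \<and> represents n q \<kappa> f}"


text \<open>\<open>Upsilon\<close> does compute the leading coefficients along the polar arcs.\<close>

lemma prod_diff_esym:
  "(\<Prod>j\<in>{1..n}. (t - x j)) = (\<Sum>k\<in>{0..n}. (-1) ^ k * esym n k x * (t::complex) ^ (n - k))"
proof -
  have "(\<Prod>j\<in>{1..n}. (t - x j)) = (\<Prod>j\<in>{1..n}. (- x j + t))"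
    by (intro prod.cong) auto
  also have "\<dots> = (\<Sum>S\<in>Pow {1..n}. (\<Prod>j\<in>S. - x j) * (\<Prod>j\<in>{1..n} - S. t))"
    by (rule prod_add) simp
  also have "\<dots> = (\<Sum>S\<in>Pow {1..n}. (-1) ^ card S * (\<Prod>j\<in>S. x j) * t ^ (n - card S))"
  proof (intro sum.cong refl)
    fix S assume S: "S \<in> Pow {1..n}"
    then have "finite S" by (auto intro: finite_subset)
    with S show "(\<Prod>j\<in>S. - x j) * (\<Prod>j\<in>{1..n} - S. t) = (-1) ^ card S * (\<Prod>j\<in>S. x j) * t ^ (n - card S)"
      by (simp add: prod_uminus card_Diff_subset)
  qed
  also have "\<dots> = (\<Sum>k\<in>{0..n}. \<Sum>S\<in>{S \<in> Pow {1..n}. card S = k}.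
      (-1) ^ card S * (\<Prod>j\<in>S. x j) * t ^ (n - card S))"
  proof (rule sum.group [symmetric])
    show "card ` Pow {1..n} \<subseteq> {0..n}"
    proof
      fix k assume "k \<in> card ` Pow {1..n}"
      then obtain S where "S \<subseteq> {1..n}" "k = card S" by auto
      then show "k \<in> {0..n}" using card_mono[of "{1..n}" S] by simp
    qed
  qed auto
  also have "\<dots> = (\<Sum>k\<in>{0..n}. (-1) ^ k * esym n k x * t ^ (n - k))"
    unfolding esym_def
    by (intro sum.cong refl) (auto simp: sum_distrib_left sum_distrib_right intro!: sum.cong)
  finally show ?thesis .
qed

lemma Upsilon_leading_coeff:
  assumes "represents n q \<kappa> f" "j \<in> {1..n - 2}"
  shows "f (s, \<kappa> j * s ^ q) = Upsilon n \<kappa> j * s ^ (q * n)"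
proof -
  from assms(1) obtain lam where lam: "roots_of n \<kappa> lam" and f: "f = qh 1 q n lam"
    by (auto simp: represents_def)
  have n: "{0..n} = insert 0 (insert n {1..n - 1})" "n > 0" using assms(2) by auto
  have "{S. S \<subseteq> {1..n} \<and> card S = n} = {{1..n}}"
    using card_subset_eq[of "{1..n}"] by auto
  with lam have en: "esym n n lam = 1" by (simp add: esym_def roots_of_def)
  have "{S. S \<subseteq> {1..n} \<and> card S = 0} = {{}}"
    by (auto simp: card_eq_0_iff dest: finite_subset[OF _ finite_atLeastAtMost])
  then have e0: "esym n 0 lam = 1" by (simp add: esym_def)
  have "f (s, \<kappa> j * s ^ q) = (\<Prod>i\<in>{1..n}. s ^ q * (\<kappa> j - lam i))"
    by (simp add: f qh_def algebra_simps)
  also have "\<dots> = s ^ (q * n) * (\<Prod>i\<in>{1..n}. (\<kappa> j - lam i))"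
    by (simp add: prod.distrib power_mult)
  also have "(\<Prod>i\<in>{1..n}. (\<kappa> j - lam i)) = (\<Sum>k\<in>{0..n}. (-1) ^ k * esym n k lam * \<kappa> j ^ (n - k))"
    by (rule prod_diff_esym)
  also have "\<dots> = \<kappa> j ^ n + (-1) ^ n + (\<Sum>k\<in>{1..n - 1}. (-1) ^ k * esym n k lam * \<kappa> j ^ (n - k))"
    using n(2) by (subst n(1)) (simp add: e0 en)
  also have "(\<Sum>k\<in>{1..n - 1}. (-1) ^ k * esym n k lam * \<kappa> j ^ (n - k)) =
      (\<Sum>l\<in>{1..n - 1}. (-1) ^ l * (of_nat n / of_nat (n - l)) * esym (n - 1) l \<kappa> * \<kappa> j ^ (n - l))"
    using lam unfolding roots_of_def by (intro sum.cong) (auto simp: mult.assoc)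
  finally show ?thesis using assms(2) by (simp add: Upsilon_def algebra_simps)
qed

end

theory Submission
  imports Defs "HOL-Complex_Analysis.Complex_Analysis" "HOL-Combinatorics.Permutations"
    "HOL-Computational_Algebra.Fundamental_Theorem_Algebra"
begin

text \<open>
  Write \<open>Q\<close> for the polynomial of a normalized function (sum of the roots \<open>0\<close>, product of the
  roots \<open>1\<close>), so that the function is \<open>Q t * s ^ (q * n)\<close> on the arc
  \<open>(s, t * s ^ q)\<close>.

  \<^bold>\<open>Equivalences are rotations.\<close> A change of coordinates between two normalized functions maps the arc
  \<open>y = t * x ^ q\<close> to \<open>y = (\<mu> + \<zeta> * t) * x ^ q\<close> up to higher order. Comparing the leading
  coefficients along all arcs, the normalization forces \<open>\<mu> = 0\<close> and \<open>\<zeta> ^ n = 1\<close>, and one polynomial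
  becomes the other one by \<open>t \<mapsto> \<zeta> * t\<close> (\<open>arcs_of_equivalence\<close>). Conversely such a rotation
  is induced by one of \<open>y\<close>. So \<open>\<kappa>\<close> and \<open>\<kappa>'\<close> give equivalent functions iff they are in the same
  orbit up to a renumbering of the critical points. An equivalence of labelled functions allows no
  renumbering, and for distinct critical values two points of one fibre admit only the trivial one.

  \<^bold>\<open>The number of points of a fibre.\<close> Up to the constant \<open>(-1) ^ n\<close>, the map \<open>Upsilon\<close> consists of the
  values at \<open>\<kappa> 1, \<dots>, \<kappa> (n - 2)\<close> of the polynomial \<open>crit_poly n \<kappa>\<close> with the critical
  points \<open>\<kappa>\<close> and constant term \<open>0\<close>. These are homogeneous of degree \<open>n\<close> in \<open>n - 2\<close> free
  variables and vanish together only at \<open>\<kappa> = 0\<close> (\<open>critical_roots_imp_zero\<close>). By Bezout's theorem for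
  such maps (\<open>bezout_bound\<close>, \<open>bezout_generic\<close>) a fibre has at most \<open>n ^ (n - 2)\<close> points, and exactly
  that many over the complement of a hypersurface. The roots of unity act freely on the fibres, except
  that \<open>0\<close> is a fibre of its own, so there are at most \<open>n ^ (n - 3)\<close> orbits.

  \<^bold>\<open>Bezout's theorem\<close> for a homogeneous map of degree \<open>n\<close> of complex \<open>m\<close>-space whose only zero is \<open>0\<close>
  is proved by analysis on complex lines. The map is proper, so over the complement of a hypersurface
  that contains the images of the ramification points it is a covering with a constant number of points.
  The product of the values of a polynomial \<open>f\<close> over the fibre, its norm, extends to an entire function
  on each line that meets this complement and grows there at most like a power given by the degree
  of \<open>f\<close>. The norm of a polynomial that vanishes at a point of a special fibre tends to \<open>0\<close> there, hence
  special fibres are not larger than generic ones (\<open>card_subset_fib_le\<close>). With fewer than \<open>n ^ m\<close> points in a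
  generic fibre, a nonzero polynomial would vanish there to an order that its growth forbids
  (\<open>generic_card_ge\<close>); with more than \<open>n ^ m\<close> points there would be too many polynomials that are
  linearly independent over those in the components of the map (\<open>generic_card_le\<close>).

  \<^bold>\<open>Generic members of the family.\<close> The critical points and the product of the roots are coordinates on the
  monic polynomials of degree \<open>n\<close>, up to the numbering of the critical points, and the coefficients
  are polynomials in them. That the invariant of a function lies in the hypersurface above is a polynomial
  condition in these coordinates; by \<open>elimination\<close> it only concerns a hypersurface of the family
  (\<open>generic_family_members\<close>).
\<close>


section \<open>Linear systems and polynomial functions\<close>

text \<open>This is the source of the polynomial relations and of the polynomials with prescribed vanishing below: a family of coefficients \<open>c\<close> indexed by \<open>A\<close>
  subject to linear conditions indexed by \<open>B\<close>, where a count of monomials shows that there are fewer conditions than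
  coefficients.\<close>

lemma underdetermined_system:
  fixes M :: "'a \<Rightarrow> 'b \<Rightarrow> complex"
  assumes "finite B" "finite A" "card B < card A"
  shows "\<exists>c. (\<exists>a\<in>A. c a \<noteq> 0) \<and> (\<forall>b\<in>B. (\<Sum>a\<in>A. c a * M a b) = 0)"
  using assms
proof (induction B arbitrary: A M rule: finite_induct)
  case empty
  then obtain a where "a \<in> A" by (metis card_gt_0_iff card.empty all_not_in_conv)
  then show ?case by (intro exI[of _ "\<lambda>_. 1"]) auto
next
  case (insert b B)
  show ?case
  proof (cases "\<forall>a\<in>A. M a b = 0")
    case True
    have "card B < card A" using insert by simp
    then obtain c where "\<exists>a\<in>A. c a \<noteq> 0" "\<forall>b\<in>B. (\<Sum>a\<in>A. c a * M a b) = 0"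
      using insert.IH[of A M] insert.prems by auto
    then show ?thesis using True by (intro exI[of _ c]) auto
  next
    case False
    then obtain a0 where a0: "a0 \<in> A" "M a0 b \<noteq> 0" by auto
    define A' where "A' = A - {a0}"
    define M' where "M' = (\<lambda>a b'. M a b' - M a b / M a0 b * M a0 b')"
    have A: "A = insert a0 A'" "a0 \<notin> A'" "finite A'"
      using a0 insert.prems by (auto simp: A'_def)
    then have "card B < card A'" using insert by auto
    then obtain c where c: "\<exists>a\<in>A'. c a \<noteq> 0" "\<forall>b\<in>B. (\<Sum>a\<in>A'. c a * M' a b) = 0"
      using insert.IH[of A' M'] A by blast
    define s where "s = - (\<Sum>a\<in>A'. c a * M a b) / M a0 b"
    define c' where "c' = c(a0 := s)"
    have eq: "(\<Sum>a\<in>A. c' a * M a b') = s * M a0 b' + (\<Sum>a\<in>A'. c a * M a b')" for b'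
    proof -
      have "(\<Sum>a\<in>A'. c' a * M a b') = (\<Sum>a\<in>A'. c a * M a b')"
        using A(2) by (intro sum.cong) (auto simp: c'_def)
      then show ?thesis unfolding A(1) using A by (simp add: c'_def)
    qed
    have "(\<Sum>a\<in>A. c' a * M a b') = 0" if "b' \<in> B" for b'
    proof -
      have "0 = (\<Sum>a\<in>A'. c a * M' a b')" using c that by auto
      also have "\<dots> = (\<Sum>a\<in>A'. c a * M a b') - (\<Sum>a\<in>A'. c a * M a b) / M a0 b * M a0 b'"
        by (simp add: M'_def algebra_simps sum_subtractf sum_distrib_left sum_distrib_right sum_divide_distrib)
      finally show ?thesis unfolding eq s_def by (simp add: algebra_simps)
    qed
    moreover have "(\<Sum>a\<in>A. c' a * M a b) = 0"
      unfolding eq s_def using a0 by simp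
    moreover have "\<exists>a\<in>A. c' a \<noteq> 0" using c(1) A by (auto simp: c'_def)
    ultimately show ?thesis by (intro exI[of _ c']) auto
  qed
qed

definition mons :: "nat \<Rightarrow> nat \<Rightarrow> (nat \<Rightarrow> nat) set"
  where "mons m d = {\<beta>. (\<forall>i. i \<notin> {1..m} \<longrightarrow> \<beta> i = 0) \<and> (\<Sum>i\<in>{1..m}. \<beta> i) \<le> d}"

definition monomial :: "nat \<Rightarrow> (nat \<Rightarrow> nat) \<Rightarrow> (nat \<Rightarrow> complex) \<Rightarrow> complex"
  where "monomial m \<beta> x = (\<Prod>i\<in>{1..m}. x i ^ \<beta> i)"

text \<open>The bound \<open>d\<close> of the degree is part of the notion, since the arguments below compare dimensions of
  spaces of polynomials.\<close>

definition pfun :: "nat \<Rightarrow> nat \<Rightarrow> ((nat \<Rightarrow> complex) \<Rightarrow> complex) \<Rightarrow> bool"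
  where "pfun m d f \<longleftrightarrow> (\<exists>c. f = (\<lambda>x. \<Sum>\<beta>\<in>mons m d. c \<beta> * monomial m \<beta> x))"

lemma pfunI: "(\<And>x. f x = (\<Sum>\<beta>\<in>mons m d. c \<beta> * monomial m \<beta> x)) \<Longrightarrow> pfun m d f"
  unfolding pfun_def by blast

lemma mons_Suc: "bij_betw (\<lambda>(k, \<beta>). \<beta>(Suc m := k)) (SIGMA k:{..d}. mons m (d - k)) (mons (Suc m) d)"
proof (rule bij_betwI[where g = "\<lambda>\<beta>. (\<beta> (Suc m), \<beta>(Suc m := 0))"])
  show "(\<lambda>(k, \<beta>). \<beta>(Suc m := k)) \<in> (SIGMA k:{..d}. mons m (d - k)) \<rightarrow> mons (Suc m) d"
  proof clarify
    fix k \<beta> assume k: "k \<le> d" and b: "\<beta> \<in> mons m (d - k)"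
    have "(\<Sum>i=1..m. (\<beta>(Suc m := k)) i) = (\<Sum>i=1..m. \<beta> i)" by (intro sum.cong) auto
    then show "\<beta>(Suc m := k) \<in> mons (Suc m) d" using k b by (auto simp: mons_def)
  qed
  show "(\<lambda>\<beta>. (\<beta> (Suc m), \<beta>(Suc m := 0))) \<in> mons (Suc m) d \<rightarrow> (SIGMA k:{..d}. mons m (d - k))"
  proof
    fix \<beta> assume b: "\<beta> \<in> mons (Suc m) d"
    have "(\<Sum>i=1..m. (\<beta>(Suc m := 0)) i) = (\<Sum>i=1..m. \<beta> i)" by (intro sum.cong) auto
    then show "(\<beta> (Suc m), \<beta>(Suc m := 0)) \<in> (SIGMA k:{..d}. mons m (d - k))"
      using b by (auto simp: mons_def)
  qed
  show "(\<lambda>\<beta>. (\<beta> (Suc m), \<beta>(Suc m := 0))) ((\<lambda>(k, \<beta>). \<beta>(Suc m := k)) x) = x"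
    if "x \<in> (SIGMA k:{..d}. mons m (d - k))" for x
    using that by (auto simp: mons_def fun_eq_iff)
qed auto

lemma mons_0: "mons 0 d = {\<lambda>_. 0}" by (auto simp: mons_def)

lemma finite_mons [simp]: "finite (mons m d)"
proof (induction m arbitrary: d)
  case 0 then show ?case by (simp add: mons_0)
next
  case (Suc m)
  then have "finite (SIGMA k:{..d}. mons m (d - k))" by auto
  then show ?case using bij_betw_finite[OF mons_Suc] by blast
qed

lemma card_mons: "card (mons m d) = (d + m) choose m"
proof (induction m arbitrary: d)
  case 0 then show ?case by (simp add: mons_0)
next
  case (Suc m)
  have "card (mons (Suc m) d) = card (SIGMA k:{..d}. mons m (d - k))"
    using bij_betw_same_card[OF mons_Suc] by metis
  also have "\<dots> = (\<Sum>k\<le>d. (d - k + m) choose m)"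
    by (subst card_SigmaI) (auto simp: Suc)
  also have "\<dots> = (\<Sum>k\<le>d. (k + m) choose m)"
    by (rule sum.reindex_bij_witness[of _ "\<lambda>k. d - k" "\<lambda>k. d - k"]) auto
  also have "\<dots> = (\<Sum>k\<le>d. (m + k) choose k)"
    by (intro sum.cong refl) (metis add.commute binomial_symmetric le_add1 diff_add_inverse)
  also have "\<dots> = Suc (m + d) choose d" by (rule sum_choose_lower)
  also have "\<dots> = (d + Suc m) choose Suc m"
    using binomial_symmetric[of d "Suc (m + d)"] by (simp add: add.commute)
  finally show ?case .
qed

lemma mons_mono: "d \<le> d' \<Longrightarrow> mons m d \<subseteq> mons m d'" by (auto simp: mons_def)

lemma pfun_mono: assumes "pfun m d f" "d \<le> d'" shows "pfun m d' f"
proof -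
  from assms obtain c where c: "f = (\<lambda>x. \<Sum>\<beta>\<in>mons m d. c \<beta> * monomial m \<beta> x)"
    by (auto simp: pfun_def)
  have "f = (\<lambda>x. \<Sum>\<beta>\<in>mons m d'. (if \<beta> \<in> mons m d then c \<beta> else 0) * monomial m \<beta> x)"
    unfolding c by (intro ext sum.mono_neutral_cong_left) (use mons_mono[OF assms(2)] in auto)
  from fun_cong[OF this] show ?thesis by (rule pfunI)
qed

lemma pfun_add: assumes "pfun m d f" "pfun m d g" shows "pfun m d (\<lambda>x. f x + g x)"
proof -
  from assms obtain c c' where "f = (\<lambda>x. \<Sum>\<beta>\<in>mons m d. c \<beta> * monomial m \<beta> x)"
     "g = (\<lambda>x. \<Sum>\<beta>\<in>mons m d. c' \<beta> * monomial m \<beta> x)" by (auto simp: pfun_def)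
  then show ?thesis unfolding pfun_def
    by (intro exI[of _ "\<lambda>\<beta>. c \<beta> + c' \<beta>"]) (simp add: sum.distrib algebra_simps)
qed

lemma pfun_cmult: assumes "pfun m d f" shows "pfun m d (\<lambda>x. a * f x)"
proof -
  from assms obtain c where "f = (\<lambda>x. \<Sum>\<beta>\<in>mons m d. c \<beta> * monomial m \<beta> x)"
    by (auto simp: pfun_def)
  then show ?thesis unfolding pfun_def
    by (intro exI[of _ "\<lambda>\<beta>. a * c \<beta>"]) (simp add: sum_distrib_left mult.assoc)
qed

lemma pfun_mon: assumes "\<beta> \<in> mons m d" shows "pfun m d (monomial m \<beta>)"
proof -
  have "monomial m \<beta> = (\<lambda>x. \<Sum>\<gamma>\<in>mons m d. (if \<gamma> = \<beta> then 1 else 0) * monomial m \<gamma> x)"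
    by (intro ext) (simp add: assms if_distrib[of "\<lambda>u. u * _"] cong: if_cong)
  from fun_cong[OF this] show ?thesis by (rule pfunI)
qed

lemma pfun_const [simp, intro]: "pfun m d (\<lambda>_. a)"
proof -
  have "pfun m d (monomial m (\<lambda>_. 0))" by (rule pfun_mon) (auto simp: mons_def)
  from pfun_cmult[OF this, of a] show ?thesis by (simp add: monomial_def)
qed

lemma pfun_coord: assumes "i \<in> {1..m}" "d \<ge> 1" shows "pfun m d (\<lambda>x. x i)"
proof -
  define \<beta> :: "nat \<Rightarrow> nat" where "\<beta> = (\<lambda>j. if j = i then 1 else 0)"
  have "\<beta> \<in> mons m d" using assms by (auto simp: mons_def \<beta>_def)
  moreover have "monomial m \<beta> = (\<lambda>x. x i)"
  proof
    fix x :: "nat \<Rightarrow> complex"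
    have "monomial m \<beta> x = (\<Prod>j\<in>{1..m}. if j = i then x j else 1)"
      unfolding monomial_def \<beta>_def by (intro prod.cong) auto
    then show "monomial m \<beta> x = x i" using assms by (simp add: prod.delta)
  qed
  ultimately show ?thesis using pfun_mon by metis
qed

lemma pfun_sum: assumes "\<And>a. a \<in> A \<Longrightarrow> pfun m d (f a)" shows "pfun m d (\<lambda>x. \<Sum>a\<in>A. f a x)"
  using assms by (induction A rule: infinite_finite_induct) (auto intro!: pfun_add)

lemma monomial_add: "monomial m (\<lambda>i. \<beta> i + \<gamma> i) x = monomial m \<beta> x * monomial m \<gamma> x"
  by (simp add: monomial_def power_add prod.distrib)

lemma pfun_mult: assumes "pfun m d f" "pfun m d' g" shows "pfun m (d + d') (\<lambda>x. f x * g x)"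
proof -
  from assms obtain c c' where c: "f = (\<lambda>x. \<Sum>\<beta>\<in>mons m d. c \<beta> * monomial m \<beta> x)"
     "g = (\<lambda>x. \<Sum>\<gamma>\<in>mons m d'. c' \<gamma> * monomial m \<gamma> x)" by (auto simp: pfun_def)
  have "pfun m (d + d') (\<lambda>x. \<Sum>\<beta>\<in>mons m d. \<Sum>\<gamma>\<in>mons m d'. (c \<beta> * c' \<gamma>) * monomial m (\<lambda>i. \<beta> i + \<gamma> i) x)"
  proof (intro pfun_sum pfun_cmult)
    fix \<beta> \<gamma> assume "\<beta> \<in> mons m d" "\<gamma> \<in> mons m d'"
    then show "pfun m (d + d') (monomial m (\<lambda>i. \<beta> i + \<gamma> i))"
      by (intro pfun_mon) (auto simp: mons_def sum.distrib)
  qed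
  moreover have "(\<Sum>\<beta>\<in>mons m d. \<Sum>\<gamma>\<in>mons m d'. (c \<beta> * c' \<gamma>) * monomial m (\<lambda>i. \<beta> i + \<gamma> i) x) = f x * g x" for x
    unfolding c sum_product by (intro sum.cong refl) (simp add: monomial_add mult_ac)
  ultimately show ?thesis by simp
qed

lemma pfun_uminus: "pfun m d f \<Longrightarrow> pfun m d (\<lambda>x. - f x)"
  using pfun_cmult[of m d f "-1"] by simp

lemma pfun_diff: "pfun m d f \<Longrightarrow> pfun m d g \<Longrightarrow> pfun m d (\<lambda>x. f x - g x)"
  using pfun_add[of m d f "\<lambda>x. - g x"] pfun_uminus[of m d g] by simp

lemma pfun_prod:
  assumes "\<And>a. a \<in> A \<Longrightarrow> pfun m (d a) (f a)"
  shows "pfun m (\<Sum>a\<in>A. d a) (\<lambda>x. \<Prod>a\<in>A. f a x)"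
  using assms by (induction A rule: infinite_finite_induct) (auto intro!: pfun_mult)

lemma pfun_power: "pfun m d f \<Longrightarrow> pfun m (k * d) (\<lambda>x. f x ^ k)"
  by (induction k) (auto intro!: pfun_mult)

lemma pfun_comp_mon:
  assumes "\<And>j. j \<in> {1..r} \<Longrightarrow> pfun m e (P j)" "\<beta> \<in> mons r d"
  shows "pfun m (d * e) (\<lambda>x. monomial r \<beta> (\<lambda>j. P j x))"
proof -
  have "pfun m (\<Sum>j\<in>{1..r}. \<beta> j * e) (\<lambda>x. \<Prod>j\<in>{1..r}. P j x ^ \<beta> j)"
    by (intro pfun_prod pfun_power assms)
  moreover have "(\<Sum>j\<in>{1..r}. \<beta> j * e) \<le> d * e"
    using assms(2) by (auto simp: mons_def sum_distrib_right[symmetric])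
  ultimately show ?thesis unfolding monomial_def by (rule pfun_mono)
qed

lemma pfun_comp:
  assumes "pfun r d G" "\<And>j. j \<in> {1..r} \<Longrightarrow> pfun m e (P j)"
  shows "pfun m (d * e) (\<lambda>x. G (\<lambda>j. P j x))"
proof -
  from assms(1) obtain c where c: "G = (\<lambda>x. \<Sum>\<beta>\<in>mons r d. c \<beta> * monomial r \<beta> x)"
    by (auto simp: pfun_def)
  show ?thesis unfolding c by (intro pfun_sum pfun_cmult pfun_comp_mon assms)
qed

lemma pfun_cong:
  assumes "pfun m d f" "\<And>i. i \<in> {1..m} \<Longrightarrow> x i = y i" shows "f x = f y"
proof -
  have "monomial m \<beta> x = monomial m \<beta> y" for \<beta> unfolding monomial_def by (intro prod.cong) (auto simp: assms)
  then show ?thesis using assms(1) by (auto simp: pfun_def)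
qed

text \<open>Uniqueness of the digits in base \<open>N\<close>.\<close>

lemma digits_inj:
  fixes N :: nat
  assumes "(\<Sum>i\<in>{1..m}. \<beta> i * N ^ i) = (\<Sum>i\<in>{1..m}. \<gamma> i * N ^ i)"
    "\<And>i. i \<in> {1..m} \<Longrightarrow> \<beta> i < N" "\<And>i. i \<in> {1..m} \<Longrightarrow> \<gamma> i < N" "i \<in> {1..m}"
  shows "\<beta> i = \<gamma> i"
  using assms
proof (induction m arbitrary: i)
  case 0 then show ?case by simp
next
  case (Suc m)
  have N: "N > 0" using Suc.prems by fastforce
  have small: "(\<Sum>i\<in>{1..m}. \<alpha> i * N ^ i) < N ^ Suc m" if "\<And>i. i \<in> {1..m} \<Longrightarrow> \<alpha> i < N" for \<alpha>
    using that
  proof (induction m)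
    case 0 then show ?case using N by simp
  next
    case (Suc m)
    have "(\<Sum>i\<in>{1..Suc m}. \<alpha> i * N ^ i) < N ^ Suc m + \<alpha> (Suc m) * N ^ Suc m" using Suc by simp
    also have "\<dots> = (\<alpha> (Suc m) + 1) * N ^ Suc m" by simp
    also have "\<dots> \<le> N * N ^ Suc m" using Suc.prems[of "Suc m"] by (intro mult_right_mono) auto
    finally show ?case by simp
  qed
  define s t where "s = (\<Sum>i\<in>{1..m}. \<beta> i * N ^ i)" and "t = (\<Sum>i\<in>{1..m}. \<gamma> i * N ^ i)"
  have st: "s < N ^ Suc m" "t < N ^ Suc m" unfolding s_def t_def by (rule small, use Suc.prems in force)+
  have eq: "s + \<beta> (Suc m) * N ^ Suc m = t + \<gamma> (Suc m) * N ^ Suc m"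
    using Suc.prems(1) by (simp add: s_def t_def)
  then have "(s + \<beta> (Suc m) * N ^ Suc m) div N ^ Suc m = (t + \<gamma> (Suc m) * N ^ Suc m) div N ^ Suc m" by simp
  then have top: "\<beta> (Suc m) = \<gamma> (Suc m)" using st N by (simp del: power_Suc)
  then have "s = t" using eq by simp
  then have "\<beta> i = \<gamma> i" if "i \<in> {1..m}" for i
    using Suc.IH[of i] Suc.prems that by (auto simp: s_def t_def)
  then show ?case using top Suc.prems(4) by (cases "i = Suc m") auto
qed

text \<open>Kronecker's substitution turns distinct monomials into distinct powers of one variable.\<close>

lemma nonzero_coeff_imp_nonzero_fun:
  assumes "\<beta>0 \<in> mons m d" "c \<beta>0 \<noteq> 0"
  shows "\<exists>x. (\<Sum>\<beta>\<in>mons m d. c \<beta> * monomial m \<beta> x) \<noteq> 0"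
proof -
  define e where "e = (\<lambda>\<beta>::nat\<Rightarrow>nat. \<Sum>i\<in>{1..m}. \<beta> i * Suc d ^ i)"
  have bound: "\<beta> i < Suc d" if "\<beta> \<in> mons m d" "i \<in> {1..m}" for \<beta> i
  proof -
    have "\<beta> i \<le> (\<Sum>i\<in>{1..m}. \<beta> i)" using that by (intro member_le_sum) auto
    then show ?thesis using that by (auto simp: mons_def)
  qed
  have inj: "inj_on e (mons m d)"
  proof (rule inj_onI, rule ext)
    fix \<beta> \<gamma> i assume bg: "\<beta> \<in> mons m d" "\<gamma> \<in> mons m d" "e \<beta> = e \<gamma>"
    show "\<beta> i = \<gamma> i"
    proof (cases "i \<in> {1..m}")
      case True then show ?thesis using digits_inj[of \<beta> "Suc d" m \<gamma> i] bg bound by (auto simp: e_def)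
    next
      case False then show ?thesis using bg by (auto simp: mons_def)
    qed
  qed
  define p where "p = (\<Sum>\<beta>\<in>mons m d. monom (c \<beta>) (e \<beta>))"
  have "coeff p (e \<beta>0) = (\<Sum>\<beta>\<in>mons m d. if \<beta> = \<beta>0 then c \<beta> else 0)"
    unfolding p_def coeff_sum using inj assms(1) by (intro sum.cong) (auto simp: inj_on_def)
  also have "\<dots> = c \<beta>0" using assms(1) by simp
  finally have "p \<noteq> 0" using assms(2) by auto
  then obtain t where t: "poly p t \<noteq> 0" using poly_all_0_iff_0 by blast
  have "poly p t = (\<Sum>\<beta>\<in>mons m d. c \<beta> * monomial m \<beta> (\<lambda>i. t ^ (Suc d ^ i)))"
    unfolding p_def poly_sum poly_monom monomial_def e_def
    by (simp add: power_sum power_mult[symmetric] mult.commute)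
  then show ?thesis using t by metis
qed

lemma pfun_line:
  assumes "pfun m d f"
  shows "\<exists>p. \<forall>t. f (\<lambda>i. a i + t * v i) = poly p t"
proof -
  from assms obtain c where c: "f = (\<lambda>x. \<Sum>\<beta>\<in>mons m d. c \<beta> * monomial m \<beta> x)"
    by (auto simp: pfun_def)
  show ?thesis unfolding c monomial_def
    by (intro exI[of _ "\<Sum>\<beta>\<in>mons m d. smult (c \<beta>) (\<Prod>i\<in>{1..m}. [:a i, v i:] ^ \<beta> i)"])
      (simp add: poly_sum poly_prod mult.commute)
qed

lemma pfun_finite_zeros_on_line:
  assumes "pfun m d f" "f (\<lambda>i. a i + t0 * v i) \<noteq> 0"
  shows "finite {t. f (\<lambda>i. a i + t * v i) = 0}"
proof -
  obtain p where p: "\<And>t. f (\<lambda>i. a i + t * v i) = poly p t" using pfun_line[OF assms(1)] by blast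
  then have "p \<noteq> 0" using assms(2) by auto
  then show ?thesis using poly_roots_finite p by simp
qed

text \<open>Along the line through a point where one factor does not vanish and a point where the other does
  not, both factors are nonzero polynomials of one variable.\<close>

lemma pfun_nonzero_mult:
  assumes "pfun m d f" "pfun m d' g" "f a \<noteq> 0" "g b \<noteq> 0"
  shows "\<exists>x. f x * g x \<noteq> 0"
proof -
  let ?l = "\<lambda>t i. a i + t * (b i - a i)"
  have "finite {t. f (?l t) = 0}" by (rule pfun_finite_zeros_on_line[OF assms(1), of _ 0]) (use assms in simp)
  moreover have "finite {t. g (?l t) = 0}" by (rule pfun_finite_zeros_on_line[OF assms(2), of _ 1]) (use assms in simp)
  ultimately have "finite ({t. f (?l t) = 0} \<union> {t. g (?l t) = 0})" by simp
  then obtain t where "t \<notin> {t. f (?l t) = 0} \<union> {t. g (?l t) = 0}"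
    using ex_new_if_finite[OF infinite_UNIV_char_0] by blast
  then show ?thesis by (intro exI[of _ "?l t"]) auto
qed

lemma pfun_nonzero_prod:
  assumes "finite A" "\<And>a. a \<in> A \<Longrightarrow> pfun m (d a) (f a)" "\<And>a. a \<in> A \<Longrightarrow> \<exists>x. f a x \<noteq> 0"
  shows "\<exists>x. (\<Prod>a\<in>A. f a x) \<noteq> 0"
  using assms
proof (induction A rule: finite_induct)
  case (insert a A)
  have "\<exists>x. f a x \<noteq> 0" "\<exists>y. (\<Prod>a\<in>A. f a y) \<noteq> 0" using insert by blast+
  then obtain x y where "f a x \<noteq> 0" "(\<Prod>a\<in>A. f a y) \<noteq> 0" by blast
  then show ?case using pfun_nonzero_mult[of m "d a" "f a" "sum d A" "\<lambda>x. \<Prod>a\<in>A. f a x"] insert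
    by (simp add: pfun_prod)
qed auto

text \<open>The number of monomials of degree at most \<open>d\<close> in \<open>m\<close> variables grows like \<open>d ^ m / m!\<close>.\<close>

lemma choose_ratio_tendsto:
  assumes "n \<ge> 1"
  shows "(\<lambda>d. real ((n * d + c + m) choose m) / real ((d + m) choose m)) \<longlonglongrightarrow> real n ^ m"
proof -
  have ch: "real ((D + m) choose m) = (\<Prod>i\<in>{1..m}. (real D + real i)) / fact m" for D
  proof -
    have "real ((D + m) choose m) = pochhammer (real D + 1) m / fact m"
      using binomial_gbinomial[of "D + m" m, where ?'a = real] gbinomial_pochhammer'[of "real (D + m)" m]
      by (simp add: algebra_simps)
    also have "pochhammer (real D + 1) m = (\<Prod>i\<in>{1..m}. (real D + real i))"
      unfolding pochhammer_prod
      by (rule prod.reindex_bij_witness[of _ "\<lambda>i. i - 1" "\<lambda>i. i + 1"]) auto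
    finally show ?thesis .
  qed
  have "(\<lambda>d. \<Prod>i\<in>{1..m}. (real (n * d + c) + real i) / (real d + real i)) \<longlonglongrightarrow> (\<Prod>i\<in>{1..m}. real n)"
  proof (rule tendsto_prod)
    fix i
    show "(\<lambda>d. (real (n * d + c) + real i) / (real d + real i)) \<longlonglongrightarrow> real n"
    proof -
      have "(\<lambda>d. real n + (real c + real i - real n * real i) / (real i + real d)) \<longlonglongrightarrow> real n + 0"
        by (rule tendsto_add[OF tendsto_const tendsto_divide_0[OF tendsto_const
           filterlim_at_top_imp_at_infinity[OF filterlim_tendsto_add_at_top[OF tendsto_const filterlim_real_sequentially]]]])
      then have "(\<lambda>d. real n + (real c + real i - real n * real i) / (real i + real d)) \<longlonglongrightarrow> real n" by simp
      then show ?thesis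
      proof (rule Lim_transform_eventually)
        show "\<forall>\<^sub>F d in sequentially. real n + (real c + real i - real n * real i) / (real i + real d) =
           (real (n * d + c) + real i) / (real d + real i)"
          using eventually_gt_at_top[of 0] by eventually_elim (auto simp: field_simps)
      qed
    qed
  qed
  moreover have "real ((n * d + c + m) choose m) / real ((d + m) choose m)
     = (\<Prod>i\<in>{1..m}. (real (n * d + c) + real i) / (real d + real i))" for d
    unfolding ch by (simp add: prod_dividef)
  ultimately show ?thesis by simp
qed

text \<open>The offset \<open>c\<close> leaves room for the degrees of finitely many auxiliary polynomials; it disappears
  in the limit.\<close>

lemma choose_growth_upper:
  assumes "n \<ge> 1" "\<And>d. k * ((d + m) choose m) \<le> (n * d + c + m) choose m"
  shows "k \<le> n ^ m"
proof -
  have "real k \<le> real n ^ m"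
  proof (rule tendsto_lowerbound[OF choose_ratio_tendsto[OF assms(1), of c m]])
    show "\<forall>\<^sub>F d in sequentially. real k \<le> real ((n * d + c + m) choose m) / real ((d + m) choose m)"
    proof (intro always_eventually allI)
      fix d
      have "real k * real ((d + m) choose m) \<le> real ((n * d + c + m) choose m)"
        using assms(2)[of d] by (metis of_nat_le_iff of_nat_mult)
      then show "real k \<le> real ((n * d + c + m) choose m) / real ((d + m) choose m)"
        by (simp add: le_divide_eq zero_less_binomial_iff)
    qed
  qed simp
  then show ?thesis by (metis of_nat_le_iff of_nat_power)
qed

lemma choose_growth_lower:
  assumes "n \<ge> 1" "k < n ^ m"
  shows "\<exists>d. k * ((d + m) choose m) < (n * d + m) choose m"
proof -
  have "real k < real n ^ m" using assms(2) by (metis of_nat_less_iff of_nat_power)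
  then have "\<forall>\<^sub>F d in sequentially. real k < real ((n * d + 0 + m) choose m) / real ((d + m) choose m)"
    using order_tendstoD(1)[OF choose_ratio_tendsto[OF assms(1), of 0 m]] by simp
  then obtain d where "real k < real ((n * d + m) choose m) / real ((d + m) choose m)"
    by (auto simp: eventually_sequentially)
  then have "real k * real ((d + m) choose m) < real ((n * d + m) choose m)"
    by (simp add: less_divide_eq zero_less_binomial_iff)
  then show ?thesis by (metis of_nat_less_iff of_nat_mult)
qed

text \<open>As functions of \<open>d\<close>, the left side has order \<open>m\<close> and the right side has order \<open>m + 1\<close>.\<close>

lemma choose_growth_dimension:
  assumes "e \<ge> 1"
  shows "\<exists>d. (e * d + m) choose m < (d + Suc m) choose Suc m"
proof -
  have "\<forall>\<^sub>F d in sequentially. real ((e * d + 0 + m) choose m) / real ((d + m) choose m) < real e ^ m + 1"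
    using order_tendstoD(2)[OF choose_ratio_tendsto[OF assms, of 0 m]] by simp
  moreover have "\<forall>\<^sub>F d in sequentially. d \<ge> (e ^ m + 1) * Suc m" by (rule eventually_ge_at_top)
  ultimately have "\<forall>\<^sub>F d in sequentially. (e * d + m) choose m < (d + Suc m) choose Suc m"
  proof eventually_elim
    case (elim d)
    define b where "b = real ((d + m) choose m)"
    have b: "b > 0" by (simp add: b_def zero_less_binomial_iff)
    have "Suc (d + m) * ((d + m) choose m) = (Suc (d + m) choose Suc m) * Suc m"
      by (rule Suc_times_binomial_eq)
    then have eq: "real (Suc (d + m)) * b = real (Suc (d + m) choose Suc m) * real (Suc m)"
      unfolding b_def by (metis of_nat_mult)
    have "real ((e * d + m) choose m) < (real e ^ m + 1) * b"
      using elim(1) b by (simp add: b_def divide_less_eq)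
    then have "real ((e * d + m) choose m) * real (Suc m) < ((real e ^ m + 1) * b) * real (Suc m)"
      by (intro mult_strict_right_mono) auto
    also have "\<dots> = real ((e ^ m + 1) * Suc m) * b" by (simp add: algebra_simps)
    also have "\<dots> \<le> real (Suc (d + m)) * b"
    proof (rule mult_right_mono)
      show "real ((e ^ m + 1) * Suc m) \<le> real (Suc (d + m))" using elim(2) by (subst of_nat_le_iff) linarith
    qed (use b in simp)
    also have "\<dots> = real (Suc (d + m) choose Suc m) * real (Suc m)" by (rule eq)
    finally have "real ((e * d + m) choose m) < real (Suc (d + m) choose Suc m)"
      by (simp only: mult_less_cancel_right)
    then show ?case by simp
  qed
  then show ?thesis by (auto simp: eventually_sequentially)
qed

text \<open>There are more monomials of degree at most \<open>d\<close> in \<open>m + 1\<close> variables than the polynomials of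
  degree at most \<open>e * d\<close> in \<open>m\<close> variables have dimensions. So \<open>P 1, \<dots>, P m, B\<close> satisfy
  a polynomial relation; divided by the largest power of \<open>B\<close>, it is restricted to \<open>B = 0\<close>.\<close>

lemma elimination:
  assumes P: "\<And>j. j \<in> {1..m} \<Longrightarrow> pfun m e (P j)" and B: "pfun m e' B" and B0: "B x0 \<noteq> 0"
  shows "\<exists>d G. pfun m d G \<and> (\<exists>y. G y \<noteq> 0) \<and> (\<forall>x. B x = 0 \<longrightarrow> G (\<lambda>j. P j x) = 0)"
proof -
  \<comment> \<open>\<open>P'\<close> lists the \<open>m + 1\<close> polynomials \<open>P 1, \<dots>, P m, B\<close>, whose degrees \<open>E\<close> bounds.\<close>
  define E where "E = max (max e e') 1"
  define P' where "P' = (\<lambda>j. if j = Suc m then B else P j)"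
  have P': "pfun m E (P' j)" if "j \<in> {1..Suc m}" for j
    using that pfun_mono[OF P, of j E] pfun_mono[OF B, of E] by (auto simp: P'_def E_def)
  obtain d where d: "(E * d + m) choose m < (d + Suc m) choose Suc m"
    using choose_growth_dimension[of E m] by (auto simp: E_def)
  define A where "A = mons (Suc m) d"
  have "\<forall>\<alpha>\<in>A. \<exists>c. (\<lambda>x. monomial (Suc m) \<alpha> (\<lambda>j. P' j x)) = (\<lambda>x. \<Sum>\<beta>\<in>mons m (d * E). c \<beta> * monomial m \<beta> x)"
  proof
    fix \<alpha> assume "\<alpha> \<in> A"
    then have "pfun m (d * E) (\<lambda>x. monomial (Suc m) \<alpha> (\<lambda>j. P' j x))"
      unfolding A_def by (intro pfun_comp_mon P')
    then show "\<exists>c. (\<lambda>x. monomial (Suc m) \<alpha> (\<lambda>j. P' j x)) = (\<lambda>x. \<Sum>\<beta>\<in>mons m (d * E). c \<beta> * monomial m \<beta> x)"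
      unfolding pfun_def .
  qed
  from bchoice[OF this] obtain M where M': "\<forall>\<alpha>\<in>A. (\<lambda>x. monomial (Suc m) \<alpha> (\<lambda>j. P' j x)) = (\<lambda>x. \<Sum>\<beta>\<in>mons m (d * E). M \<alpha> \<beta> * monomial m \<beta> x)"
    by blast
  have M: "monomial (Suc m) \<alpha> (\<lambda>j. P' j x) = (\<Sum>\<beta>\<in>mons m (d * E). M \<alpha> \<beta> * monomial m \<beta> x)" if "\<alpha> \<in> A" for \<alpha> x
    using fun_cong[OF bspec[OF M' that], of x] .
  have "card (mons m (d * E)) < card A"
    using d by (simp add: A_def card_mons mult.commute)
  then obtain c where c: "\<exists>\<alpha>\<in>A. c \<alpha> \<noteq> 0" "\<And>\<beta>. \<beta> \<in> mons m (d * E) \<Longrightarrow> (\<Sum>\<alpha>\<in>A. c \<alpha> * M \<alpha> \<beta>) = 0"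
    using underdetermined_system[of "mons m (d * E)" A M] by (auto simp: A_def)
  have rel: "(\<Sum>\<alpha>\<in>A. c \<alpha> * monomial (Suc m) \<alpha> (\<lambda>j. P' j x)) = 0" for x
  proof -
    have "(\<Sum>\<alpha>\<in>A. c \<alpha> * monomial (Suc m) \<alpha> (\<lambda>j. P' j x)) = (\<Sum>\<alpha>\<in>A. \<Sum>\<beta>\<in>mons m (d * E). c \<alpha> * M \<alpha> \<beta> * monomial m \<beta> x)"
      by (simp add: M sum_distrib_left mult.assoc)
    also have "\<dots> = (\<Sum>\<beta>\<in>mons m (d * E). (\<Sum>\<alpha>\<in>A. c \<alpha> * M \<alpha> \<beta>) * monomial m \<beta> x)"
      by (subst sum.swap) (simp add: sum_distrib_right)
    also have "\<dots> = 0" by (simp add: c(2))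
    finally show ?thesis .
  qed
  \<comment> \<open>\<open>B ^ i0\<close> is the largest power of \<open>B\<close> that divides the relation, and \<open>R\<close> is the quotient.\<close>
  define i0 where "i0 = (LEAST i. \<exists>\<alpha>\<in>A. c \<alpha> \<noteq> 0 \<and> \<alpha> (Suc m) = i)"
  have "\<exists>i. \<exists>\<alpha>\<in>A. c \<alpha> \<noteq> 0 \<and> \<alpha> (Suc m) = i" using c(1) by auto
  then have "\<exists>\<alpha>\<in>A. c \<alpha> \<noteq> 0 \<and> \<alpha> (Suc m) = i0" unfolding i0_def by (rule LeastI_ex)
  then obtain \<alpha>0 where a0: "\<alpha>0 \<in> A" "c \<alpha>0 \<noteq> 0" "\<alpha>0 (Suc m) = i0" by auto
  have least: "i0 \<le> \<alpha> (Suc m)" if "\<alpha> \<in> A" "c \<alpha> \<noteq> 0" for \<alpha>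
    unfolding i0_def by (rule Least_le) (use that in auto)
  define R where "R = (\<lambda>x. \<Sum>\<alpha>\<in>A. c \<alpha> * (monomial m \<alpha> (\<lambda>j. P j x) * B x ^ (\<alpha> (Suc m) - i0)))"
  have split: "monomial (Suc m) \<alpha> (\<lambda>j. P' j x) = monomial m \<alpha> (\<lambda>j. P j x) * B x ^ \<alpha> (Suc m)" for \<alpha> x
  proof -
    have "(\<Prod>i\<in>{1..m}. P' i x ^ \<alpha> i) = (\<Prod>i\<in>{1..m}. P i x ^ \<alpha> i)" by (intro prod.cong) (auto simp: P'_def)
    then show ?thesis by (simp add: monomial_def) (simp add: P'_def)
  qed
  have BR: "B x ^ i0 * R x = 0" for x
  proof -
    have "B x ^ i0 * R x = (\<Sum>\<alpha>\<in>A. c \<alpha> * monomial (Suc m) \<alpha> (\<lambda>j. P' j x))"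
      unfolding R_def sum_distrib_left
    proof (intro sum.cong refl)
      fix \<alpha> assume "\<alpha> \<in> A"
      show "B x ^ i0 * (c \<alpha> * (monomial m \<alpha> (\<lambda>j. P j x) * B x ^ (\<alpha> (Suc m) - i0))) = c \<alpha> * monomial (Suc m) \<alpha> (\<lambda>j. P' j x)"
      proof (cases "c \<alpha> = 0")
        case False
        then have "B x ^ \<alpha> (Suc m) = B x ^ i0 * B x ^ (\<alpha> (Suc m) - i0)"
          using least[OF \<open>\<alpha> \<in> A\<close>] by (simp add: power_add[symmetric])
        then show ?thesis by (simp add: split)
      qed simp
    qed
    then show ?thesis using rel by simp
  qed
  have "pfun m (d * E + d * E) R" unfolding R_def
  proof (intro pfun_sum pfun_cmult pfun_mult)
    fix \<alpha> assume a: "\<alpha> \<in> A"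
    have "\<alpha>(Suc m := 0) \<in> mons m d"
    proof -
      have "(\<Sum>i=1..m. (\<alpha>(Suc m := 0)) i) = (\<Sum>i=1..m. \<alpha> i)" by (intro sum.cong) auto
      then show ?thesis using a by (auto simp: A_def mons_def)
    qed
    then have "pfun m (d * E) (\<lambda>x. monomial m (\<alpha>(Suc m := 0)) (\<lambda>j. P j x))"
      using pfun_mono[OF P, of _ E] by (intro pfun_comp_mon) (auto simp: E_def)
    moreover have "monomial m (\<alpha>(Suc m := 0)) = monomial m \<alpha>"
      unfolding monomial_def by (intro ext prod.cong) auto
    ultimately show "pfun m (d * E) (\<lambda>x. monomial m \<alpha> (\<lambda>j. P j x))" by simp
    have "pfun m ((\<alpha> (Suc m) - i0) * E) (\<lambda>x. B x ^ (\<alpha> (Suc m) - i0))"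
      by (intro pfun_power pfun_mono[OF B]) (auto simp: E_def)
    then show "pfun m (d * E) (\<lambda>x. B x ^ (\<alpha> (Suc m) - i0))"
    proof (rule pfun_mono)
      have "\<alpha> (Suc m) \<le> d" using a by (auto simp: A_def mons_def)
      then show "(\<alpha> (Suc m) - i0) * E \<le> d * E" by (intro mult_right_mono) auto
    qed
  qed
  moreover have "pfun m (i0 * e') (\<lambda>x. B x ^ i0)" by (intro pfun_power B)
  ultimately have R0: "R x = 0" for x
    using pfun_nonzero_mult[of m "i0 * e'" "\<lambda>x. B x ^ i0" "d * E + d * E" R x0 x] BR B0 by auto
  \<comment> \<open>The terms of \<open>R\<close> that survive where \<open>B = 0\<close>.\<close>
  define A0 where "A0 = {\<alpha>\<in>A. \<alpha> (Suc m) = i0}"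
  define G where "G = (\<lambda>y. \<Sum>\<beta>\<in>mons m d. (if \<beta>(Suc m := i0) \<in> A then c (\<beta>(Suc m := i0)) else 0) * monomial m \<beta> y)"
  have Geq: "G y = (\<Sum>\<alpha>\<in>A0. c \<alpha> * monomial m \<alpha> y)" for y
  proof -
    have "(\<Sum>\<alpha>\<in>A0. c \<alpha> * monomial m \<alpha> y) = (\<Sum>\<beta>\<in>{\<beta>\<in>mons m d. \<beta>(Suc m := i0) \<in> A}. c (\<beta>(Suc m := i0)) * monomial m \<beta> y)"
    proof (rule sum.reindex_bij_witness[of _ "\<lambda>\<beta>. \<beta>(Suc m := i0)" "\<lambda>\<alpha>. \<alpha>(Suc m := 0)"])
      fix \<alpha> assume a: "\<alpha> \<in> A0"
      then have a': "\<alpha> \<in> A" "\<alpha> (Suc m) = i0" by (auto simp: A0_def)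
      then show u: "(\<alpha>(Suc m := 0))(Suc m := i0) = \<alpha>" by auto
      have "(\<Sum>i=1..m. (\<alpha>(Suc m := 0)) i) = (\<Sum>i=1..m. \<alpha> i)" by (intro sum.cong) auto
      then show "\<alpha>(Suc m := 0) \<in> {\<beta> \<in> mons m d. \<beta>(Suc m := i0) \<in> A}"
        using a' u by (auto simp: A_def mons_def)
      have "monomial m (\<alpha>(Suc m := 0)) = monomial m \<alpha>"
        unfolding monomial_def by (intro ext prod.cong) auto
      then show "c ((\<alpha>(Suc m := 0))(Suc m := i0)) * monomial m (\<alpha>(Suc m := 0)) y = c \<alpha> * monomial m \<alpha> y"
        using u by simp
    next
      fix \<beta> assume b: "\<beta> \<in> {\<beta> \<in> mons m d. \<beta>(Suc m := i0) \<in> A}"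
      then have "\<beta> (Suc m) = 0" by (auto simp: mons_def)
      then show "(\<beta>(Suc m := i0))(Suc m := 0) = \<beta>" by (auto simp: fun_eq_iff)
      show "\<beta>(Suc m := i0) \<in> A0" using b by (auto simp: A0_def)
    qed
    also have "\<dots> = G y" unfolding G_def by (rule sum.mono_neutral_cong_left) auto
    finally show ?thesis by simp
  qed
  have "\<alpha>0(Suc m := 0) \<in> mons m d \<and> (\<alpha>0(Suc m := 0))(Suc m := i0) = \<alpha>0"
  proof -
    have "(\<Sum>i=1..m. (\<alpha>0(Suc m := 0)) i) = (\<Sum>i=1..m. \<alpha>0 i)" by (intro sum.cong) auto
    then show ?thesis using a0 by (auto simp: A_def mons_def fun_eq_iff)
  qed
  then have "\<exists>y. G y \<noteq> 0" unfolding G_def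
    using a0 by (intro nonzero_coeff_imp_nonzero_fun[of "\<alpha>0(Suc m := 0)"]) auto
  moreover have "pfun m d G" unfolding G_def by (rule pfunI[OF refl])
  moreover have "G (\<lambda>j. P j x) = 0" if "B x = 0" for x
  proof -
    have "R x = (\<Sum>\<alpha>\<in>A0. c \<alpha> * monomial m \<alpha> (\<lambda>j. P j x))"
      unfolding R_def
    proof (rule sum.mono_neutral_cong_right)
      show "\<forall>i\<in>A - A0. c i * (monomial m i (\<lambda>j. P j x) * B x ^ (i (Suc m) - i0)) = 0"
      proof
        fix \<alpha> assume a: "\<alpha> \<in> A - A0"
        show "c \<alpha> * (monomial m \<alpha> (\<lambda>j. P j x) * B x ^ (\<alpha> (Suc m) - i0)) = 0"
        proof (cases "c \<alpha> = 0")
          case False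
          then have "i0 \<le> \<alpha> (Suc m)" "\<alpha> (Suc m) \<noteq> i0" using least[of \<alpha>] a by (auto simp: A0_def)
          then show ?thesis using that by simp
        qed simp
      qed
    qed (auto simp: A_def A0_def)
    then show ?thesis using R0 by (simp add: Geq)
  qed
  ultimately show ?thesis by blast
qed

section \<open>Compactness, differentiation and local inversion\<close>

text \<open>The extension by \<open>0\<close> makes \<open>cspace m\<close> a linear subspace of all functions, in the topology of pointwise
  convergence. Its norm is the \<open>L\<^sup>1\<close> norm, which \<open>nr\<close> computes for arbitrary functions, ignoring their values
  off \<open>{1..m}\<close>.\<close>

definition cspace :: "nat \<Rightarrow> (nat \<Rightarrow> complex) set"
  where "cspace m = {x. \<forall>i. i \<notin> {1..m} \<longrightarrow> x i = 0}"

definition nr :: "nat \<Rightarrow> (nat \<Rightarrow> complex) \<Rightarrow> real"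
  where "nr m x = (\<Sum>i\<in>{1..m}. cmod (x i))"

definition dst :: "nat \<Rightarrow> (nat \<Rightarrow> complex) \<Rightarrow> (nat \<Rightarrow> complex) \<Rightarrow> real"
  where "dst m x y = nr m (\<lambda>i. x i - y i)"

lemma nr_nonneg [simp]: "nr m x \<ge> 0" by (auto simp: nr_def intro: sum_nonneg)

lemma dst_nonneg [simp]: "dst m x y \<ge> 0" by (simp add: dst_def)

lemma dst_self [simp]: "dst m x x = 0" by (simp add: dst_def nr_def)

lemma dst_sym: "dst m x y = dst m y x" by (simp add: dst_def nr_def norm_minus_commute)

lemma nr_add: "nr m (\<lambda>i. x i + y i) \<le> nr m x + nr m y"
  unfolding nr_def sum.distrib[symmetric] by (intro sum_mono norm_triangle_ineq)

lemma dst_triangle: "dst m x z \<le> dst m x y + dst m y z"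
  using nr_add[of m "\<lambda>i. x i - y i" "\<lambda>i. y i - z i"] by (simp add: dst_def)

lemma nr_le_dst: "nr m x \<le> nr m y + dst m x y"
  using nr_add[of m y "\<lambda>i. x i - y i"] by (simp add: dst_def)

lemma coord_le_nr: "i \<in> {1..m} \<Longrightarrow> cmod (x i) \<le> nr m x"
  unfolding nr_def by (rule member_le_sum[where f = "\<lambda>i. cmod (x i)"]) auto

lemma nr_scale: "nr m (\<lambda>i. t * x i) = cmod t * nr m x"
  by (simp add: nr_def norm_mult sum_distrib_left)

lemma dst_0_eq: assumes "x \<in> cspace m" "y \<in> cspace m" "dst m x y = 0" shows "x = y"
proof
  fix i show "x i = y i"
  proof (cases "i \<in> {1..m}")
    case True
    then show ?thesis using coord_le_nr[of i m "\<lambda>i. x i - y i"] assms(3) by (simp add: dst_def)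
  next
    case False then show ?thesis using assms(1,2) by (simp add: cspace_def)
  qed
qed

lemma continuous_on_coord: "continuous_on S (\<lambda>x::nat \<Rightarrow> complex. x i)"
  by (rule continuous_on_subset[OF continuous_on_product_coordinates]) simp

lemma continuous_on_nr: "continuous_on S (nr m)"
  unfolding nr_def by (intro continuous_intros continuous_on_coord)

lemma continuous_on_dst: "continuous_on S (\<lambda>x. dst m x y)"
  unfolding dst_def nr_def by (intro continuous_intros continuous_on_coord)

lemma continuous_on_pfun: assumes "pfun m d f" shows "continuous_on S f"
proof -
  from assms obtain c where c: "f = (\<lambda>x. \<Sum>\<beta>\<in>mons m d. c \<beta> * monomial m \<beta> x)"
    by (auto simp: pfun_def)
  show ?thesis unfolding c monomial_def
    by (intro continuous_intros continuous_on_coord)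
qed

lemma compact_nr_ball: "compact {x \<in> cspace m. nr m x \<le> R}"
proof -
  define K where "K = (\<lambda>i. if i \<in> {1..m} then cball (0::complex) R else {0})"
  have "compactin (product_topology (\<lambda>_. euclidean) UNIV) (PiE UNIV K)"
    unfolding compactin_PiE by (auto simp: K_def)
  then have c: "compact (PiE UNIV K)"
    by (simp add: euclidean_product_topology compactin_euclidean_iff)
  have cl: "closed {x. nr m x \<le> R}"
    by (intro closed_Collect_le continuous_on_nr continuous_on_const)
  have "{x \<in> cspace m. nr m x \<le> R} = PiE UNIV K \<inter> {x. nr m x \<le> R}"
  proof (intro subset_antisym subsetI)
    fix x assume x: "x \<in> {x \<in> cspace m. nr m x \<le> R}"
    then have "x i \<in> K i" for i
      using coord_le_nr[of i m x] by (auto simp: K_def cspace_def intro: order_trans)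
    then show "x \<in> PiE UNIV K \<inter> {x. nr m x \<le> R}" using x by auto
  next
    fix x assume x: "x \<in> PiE UNIV K \<inter> {x. nr m x \<le> R}"
    then have "x i \<in> K i" for i by auto
    then have "x i \<in> (if i \<in> {1..m} then cball 0 R else {0})" for i by (simp only: K_def)
    then have "x i = 0" if "i \<notin> {1..m}" for i using that by (metis singletonD)
    then have "x \<in> cspace m" unfolding cspace_def by blast
    then show "x \<in> {x \<in> cspace m. nr m x \<le> R}" using x by auto
  qed
  then show ?thesis using compact_Int_closed[OF c cl] by simp
qed

text \<open>Pairs of points that both tend to \<open>z\<close>, as they occur in strict differentiability.\<close>

definition pair_nhds :: "nat \<Rightarrow> (nat \<Rightarrow> complex) \<Rightarrow> ((nat \<Rightarrow> complex) \<times> (nat \<Rightarrow> complex)) filter"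
  where "pair_nhds m z = filtercomap (\<lambda>p. dst m (fst p) z + dst m (snd p) z) (nhds 0)"

lemma eventually_pair_nhds:
  "eventually Q (pair_nhds m z) \<longleftrightarrow> (\<exists>\<delta>>0. \<forall>x y. dst m x z < \<delta> \<longrightarrow> dst m y z < \<delta> \<longrightarrow> Q (x, y))"
proof
  assume "eventually Q (pair_nhds m z)"
  then obtain \<delta> where d: "\<delta> > 0" "\<And>p. \<bar>dst m (fst p) z + dst m (snd p) z\<bar> < \<delta> \<Longrightarrow> Q p"
    unfolding pair_nhds_def eventually_filtercomap eventually_nhds_metric by (auto simp: dist_norm)
  show "\<exists>\<delta>>0. \<forall>x y. dst m x z < \<delta> \<longrightarrow> dst m y z < \<delta> \<longrightarrow> Q (x, y)"
  proof (intro exI[of _ "\<delta> / 2"] conjI allI impI)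
    fix x y assume "dst m x z < \<delta> / 2" "dst m y z < \<delta> / 2"
    then show "Q (x, y)" by (intro d(2)) simp
  qed (use d in simp)
next
  assume "\<exists>\<delta>>0. \<forall>x y. dst m x z < \<delta> \<longrightarrow> dst m y z < \<delta> \<longrightarrow> Q (x, y)"
  then obtain \<delta> where d: "\<delta> > 0" "\<And>x y. dst m x z < \<delta> \<Longrightarrow> dst m y z < \<delta> \<Longrightarrow> Q (x, y)" by auto
  have "Q p" if "\<bar>dst m (fst p) z + dst m (snd p) z\<bar> < \<delta>" for p
  proof -
    have "dst m (fst p) z < \<delta>" "dst m (snd p) z < \<delta>"
      using that dst_nonneg[of m "fst p" z] dst_nonneg[of m "snd p" z] by linarith+
    then show ?thesis using d(2)[of "fst p" "snd p"] by simp
  qed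
  then show "eventually Q (pair_nhds m z)"
    unfolding pair_nhds_def eventually_filtercomap eventually_nhds_metric
    by (intro exI[of _ "\<lambda>u. \<bar>u\<bar> < \<delta>"] conjI exI[of _ \<delta>]) (auto simp: d dist_norm)
qed

lemma tendsto_pair_coord:
  assumes "i \<in> {1..m}"
  shows "((\<lambda>p. fst p i) \<longlongrightarrow> z i) (pair_nhds m z)" "((\<lambda>p. snd p i) \<longlongrightarrow> z i) (pair_nhds m z)"
proof -
  have le: "dist (x i) (z i) \<le> dst m x z" for x
    using coord_le_nr[OF assms, of "\<lambda>i. x i - z i"] by (simp add: dst_def dist_norm)
  show "((\<lambda>p. fst p i) \<longlongrightarrow> z i) (pair_nhds m z)" "((\<lambda>p. snd p i) \<longlongrightarrow> z i) (pair_nhds m z)"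
    unfolding tendsto_iff eventually_pair_nhds using le by (auto intro: le_less_trans)
qed

lemma tendsto_pair_pfun:
  assumes "pfun m d f"
  shows "((\<lambda>p. f (fst p)) \<longlongrightarrow> f z) (pair_nhds m z)" "((\<lambda>p. f (snd p)) \<longlongrightarrow> f z) (pair_nhds m z)"
proof -
  from assms obtain c where c: "f = (\<lambda>x. \<Sum>\<beta>\<in>mons m d. c \<beta> * monomial m \<beta> x)"
    by (auto simp: pfun_def)
  show "((\<lambda>p. f (fst p)) \<longlongrightarrow> f z) (pair_nhds m z)" "((\<lambda>p. f (snd p)) \<longlongrightarrow> f z) (pair_nhds m z)"
    unfolding c monomial_def by (intro tendsto_intros tendsto_pair_coord; simp)+
qed

lemma pfun_continuous_dst:
  assumes "pfun m d f" "\<epsilon> > 0"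
  shows "\<exists>\<delta>>0. \<forall>x. dst m x z < \<delta> \<longrightarrow> cmod (f x - f z) < \<epsilon>"
proof -
  have "eventually (\<lambda>p. dist (f (fst p)) (f z) < \<epsilon>) (pair_nhds m z)"
    using tendsto_pair_pfun(1)[OF assms(1)] assms(2) by (rule tendstoD)
  then obtain \<delta> where "\<delta> > 0" "\<And>x y. dst m x z < \<delta> \<Longrightarrow> dst m y z < \<delta> \<Longrightarrow> dist (f x) (f z) < \<epsilon>"
    unfolding eventually_pair_nhds by auto
  then show ?thesis by (intro exI[of _ \<delta>]) (auto simp: dist_norm)
qed

text \<open>The polynomial has only finitely many zeros on the line from \<open>z\<close> to \<open>b\<close>.\<close>

lemma pfun_nonzero_dense:
  assumes "pfun m d f" "f b \<noteq> 0" "z \<in> cspace m" "\<delta> > 0"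
  shows "\<exists>x\<in>cspace m. dst m x z < \<delta> \<and> f x \<noteq> 0"
proof -
  define b' where "b' = (\<lambda>i. if i \<in> {1..m} then b i else 0)"
  have "f b' = f b" by (rule pfun_cong[OF assms(1)]) (simp add: b'_def)
  let ?l = "\<lambda>t i. z i + t * (b' i - z i)"
  have "f (?l 1) \<noteq> 0" using \<open>f b' = f b\<close> assms(2) by simp
  then have "finite {t. f (?l t) = 0}" by (rule pfun_finite_zeros_on_line[OF assms(1)])
  moreover define N where "N = nr m (\<lambda>i. b' i - z i) + 1"
  moreover define e where "e = \<delta> / (2 * N)"
  have n0: "N > 0" unfolding N_def by (meson add_nonneg_pos nr_nonneg zero_less_one)
  have e: "e > 0" using assms(4) n0 by (simp add: e_def)
  then have "infinite (of_real ` {0<..<e} :: complex set)"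
    by (subst finite_image_iff) (auto simp: inj_on_def infinite_Ioo)
  ultimately obtain t where t: "t \<in> of_real ` {0<..<e}" "t \<notin> {t. f (?l t) = 0}"
    by (meson finite_subset subsetI)
  have "dst m (?l t) z = cmod t * nr m (\<lambda>i. b' i - z i)"
    using nr_scale[of m t "\<lambda>i. b' i - z i"] by (simp add: dst_def)
  also have "\<dots> \<le> e * nr m (\<lambda>i. b' i - z i)" using t(1) by (intro mult_right_mono) auto
  also have "\<dots> \<le> e * N" using e by (intro mult_left_mono) (auto simp: N_def)
  also have "\<dots> = \<delta> / 2" using n0 by (simp add: e_def)
  also have "\<dots> < \<delta>" using assms(4) by simp
  finally show ?thesis using t(2) assms(3) by (intro bexI[of _ "?l t"]) (auto simp: cspace_def b'_def)
qed

text \<open>Hadamard's lemma: the difference of two values is a combination of the differences of the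
  coordinates, with continuous coefficients.\<close>

definition hadamard :: "nat \<Rightarrow> ((nat \<Rightarrow> complex) \<Rightarrow> complex) \<Rightarrow> (nat \<Rightarrow> (nat \<Rightarrow> complex) \<Rightarrow> (nat \<Rightarrow> complex) \<Rightarrow> complex) \<Rightarrow> bool"
  where "hadamard m f A \<longleftrightarrow>
    (\<forall>x y. f x - f y = (\<Sum>i\<in>{1..m}. A i x y * (x i - y i))) \<and>
    (\<forall>z. ((\<lambda>p. f (fst p)) \<longlongrightarrow> f z) (pair_nhds m z) \<and> ((\<lambda>p. f (snd p)) \<longlongrightarrow> f z) (pair_nhds m z)) \<and>
    (\<forall>i\<in>{1..m}. \<forall>z. ((\<lambda>p. A i (fst p) (snd p)) \<longlongrightarrow> A i z z) (pair_nhds m z))"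

lemma hadamard_const: "\<exists>A. hadamard m (\<lambda>_. c) A"
  by (rule exI[of _ "\<lambda>_ _ _. 0"]) (auto simp: hadamard_def)

lemma hadamard_coord: assumes "k \<in> {1..m}" shows "\<exists>A. hadamard m (\<lambda>x. x k) A"
proof -
  have "(\<Sum>i\<in>{1..m}. (if i = k then 1 else 0) * (x i - y i)) = x k - y k" for x y :: "nat \<Rightarrow> complex"
    using assms by (simp add: if_distrib[of "\<lambda>u. u * _"] cong: if_cong)
  then show ?thesis
    using tendsto_pair_coord[OF assms] by (intro exI[of _ "\<lambda>i _ _. if i = k then 1 else 0"]) (auto simp: hadamard_def)
qed

lemma hadamard_add:
  assumes "\<exists>A. hadamard m f A" "\<exists>B. hadamard m g B" shows "\<exists>C. hadamard m (\<lambda>x. f x + g x) C"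
proof -
  from assms obtain A B where A: "hadamard m f A" and B: "hadamard m g B" by auto
  have "f x + g x - (f y + g y) = (\<Sum>i\<in>{1..m}. (A i x y + B i x y) * (x i - y i))" for x y
  proof -
    have "f x + g x - (f y + g y) = (f x - f y) + (g x - g y)" by simp
    also have "f x - f y = (\<Sum>i\<in>{1..m}. A i x y * (x i - y i))" using A by (simp add: hadamard_def)
    also have "g x - g y = (\<Sum>i\<in>{1..m}. B i x y * (x i - y i))" using B by (simp add: hadamard_def)
    finally show ?thesis by (simp add: sum.distrib distrib_right)
  qed
  then show ?thesis using A B unfolding hadamard_def
    by (intro exI[of _ "\<lambda>i x y. A i x y + B i x y"]) (auto intro!: tendsto_add)
qed

lemma hadamard_mult:
  assumes "\<exists>A. hadamard m f A" "\<exists>B. hadamard m g B" shows "\<exists>C. hadamard m (\<lambda>x. f x * g x) C"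
proof -
  from assms obtain A B where A: "hadamard m f A" and B: "hadamard m g B" by auto
  have "f x * g x - f y * g y = (\<Sum>i\<in>{1..m}. (f x * B i x y + A i x y * g y) * (x i - y i))" for x y
  proof -
    have "f x * g x - f y * g y = f x * (g x - g y) + (f x - f y) * g y" by (simp add: algebra_simps)
    also have "f x - f y = (\<Sum>i\<in>{1..m}. A i x y * (x i - y i))" using A by (simp add: hadamard_def)
    also have "g x - g y = (\<Sum>i\<in>{1..m}. B i x y * (x i - y i))" using B by (simp add: hadamard_def)
    finally show ?thesis
      by (simp add: sum.distrib[symmetric] sum_distrib_left sum_distrib_right) (simp add: algebra_simps)
  qed
  then show ?thesis using A B unfolding hadamard_def
    by (intro exI[of _ "\<lambda>i x y. f x * B i x y + A i x y * g y"]) (auto intro!: tendsto_add tendsto_mult)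
qed

lemma hadamard_pfun: assumes "pfun m d f" shows "\<exists>A. hadamard m f A"
proof -
  from assms obtain c where c: "f = (\<lambda>x. \<Sum>\<beta>\<in>mons m d. c \<beta> * monomial m \<beta> x)"
    by (auto simp: pfun_def)
  have pow: "\<exists>A. hadamard m (\<lambda>x. x i ^ k) A" if "i \<in> {1..m}" for i k
    using that by (induction k) (auto intro!: hadamard_const hadamard_mult hadamard_coord)
  have prd: "\<exists>A. hadamard m (\<lambda>x. \<Prod>i\<in>S. x i ^ \<beta> i) A" if "S \<subseteq> {1..m}" for S \<beta>
    using finite_subset[OF that finite_atLeastAtMost] that
    by (induction S rule: finite_induct) (auto intro!: hadamard_const hadamard_mult pow)
  have "\<exists>A. hadamard m (\<lambda>x. \<Sum>\<beta>\<in>T. c \<beta> * monomial m \<beta> x) A" if "finite T" for T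
    using that unfolding monomial_def
    by (induction T rule: finite_induct) (auto intro!: hadamard_const hadamard_mult hadamard_add prd)
  then show ?thesis unfolding c by simp
qed

text \<open>An injective square matrix is surjective by counting equations, and a right inverse is then a left
  inverse. The second part says that the inverse is injective as well.\<close>

lemma injective_matrix_inverse:
  fixes A :: "nat \<Rightarrow> nat \<Rightarrow> complex"
  assumes inj: "\<And>v. (\<And>j. j \<in> {1..m} \<Longrightarrow> (\<Sum>i\<in>{1..m}. A j i * v i) = 0) \<Longrightarrow> (\<And>i. i \<in> {1..m} \<Longrightarrow> v i = 0)"
  shows "\<exists>M. (\<forall>i\<in>{1..m}. \<forall>l\<in>{1..m}. (\<Sum>j\<in>{1..m}. M i j * A j l) = (if i = l then 1 else 0)) \<and>
     (\<forall>w. (\<forall>i\<in>{1..m}. (\<Sum>j\<in>{1..m}. M i j * w j) = 0) \<longrightarrow> (\<forall>j\<in>{1..m}. w j = 0))"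
proof -
  have surj: "\<exists>v. \<forall>j\<in>{1..m}. (\<Sum>i\<in>{1..m}. A j i * v i) = w j" for w :: "nat \<Rightarrow> complex"
  proof -
    have "card {1..m} < card {1..Suc m}" by simp
    from underdetermined_system[OF _ _ this, of "\<lambda>i j. if i = Suc m then w j else A j i"]
    have "\<exists>c. (\<exists>i\<in>{1..Suc m}. c i \<noteq> 0) \<and> (\<forall>j\<in>{1..m}. (\<Sum>i\<in>{1..Suc m}. c i * (if i = Suc m then w j else A j i)) = 0)"
      by blast
    then obtain c where c: "\<exists>i\<in>{1..Suc m}. c i \<noteq> 0"
        "\<And>j. j \<in> {1..m} \<Longrightarrow> (\<Sum>i\<in>{1..Suc m}. c i * (if i = Suc m then w j else A j i)) = 0"
      by (elim exE conjE) blast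
    have eq: "(\<Sum>i\<in>{1..m}. A j i * c i) + c (Suc m) * w j = 0" if "j \<in> {1..m}" for j
    proof -
      have "(\<Sum>i\<in>{1..m}. A j i * c i) = (\<Sum>i\<in>{1..m}. c i * (if i = Suc m then w j else A j i))"
        by (intro sum.cong) auto
      then show ?thesis using c(2)[OF that] by simp
    qed
    have ns: "c (Suc m) \<noteq> 0"
    proof
      assume z: "c (Suc m) = 0"
      then have "c i = 0" if "i \<in> {1..m}" for i using inj[of c i] eq that by simp
      then show False using c(1) z by (auto simp: le_Suc_eq)
    qed
    show ?thesis
    proof (intro exI[of _ "\<lambda>i. - c i / c (Suc m)"] ballI)
      fix j assume "j \<in> {1..m}"
      have "(\<Sum>i\<in>{1..m}. A j i * (- c i / c (Suc m))) = - (\<Sum>i\<in>{1..m}. A j i * c i) / c (Suc m)"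
        by (simp add: sum_negf sum_divide_distrib)
      also have "\<dots> = w j" using eq[OF \<open>j \<in> {1..m}\<close>] ns by (simp add: field_simps add_eq_0_iff)
      finally show "(\<Sum>i\<in>{1..m}. A j i * (- c i / c (Suc m))) = w j" .
    qed
  qed
  have "\<forall>k. \<exists>v. \<forall>j\<in>{1..m}. (\<Sum>i\<in>{1..m}. A j i * v i) = (if j = k then 1 else 0)"
    by (intro allI surj)
  then obtain N where N: "\<And>k j. j \<in> {1..m} \<Longrightarrow> (\<Sum>i\<in>{1..m}. A j i * N k i) = (if j = k then 1 else 0)"
    by metis
  show ?thesis
  proof (intro exI[of _ "\<lambda>i j. N j i"] conjI ballI allI impI)
    fix i l assume il: "i \<in> {1..m}" "l \<in> {1..m}"
    define v where "v = (\<lambda>i. (\<Sum>j\<in>{1..m}. N j i * A j l) - (if i = l then 1 else 0))"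
    have "(\<Sum>i\<in>{1..m}. A k i * v i) = 0" if k: "k \<in> {1..m}" for k
    proof -
      have "(\<Sum>i\<in>{1..m}. A k i * v i) = (\<Sum>i\<in>{1..m}. \<Sum>j\<in>{1..m}. A k i * N j i * A j l) - (\<Sum>i\<in>{1..m}. A k i * (if i = l then 1 else 0))"
        by (simp add: v_def algebra_simps sum_subtractf sum_distrib_left)
      also have "(\<Sum>i\<in>{1..m}. A k i * (if i = l then 1 else 0)) = A k l"
        using il by (simp add: if_distrib[of "\<lambda>u. _ * u"] cong: if_cong)
      also have "(\<Sum>i\<in>{1..m}. \<Sum>j\<in>{1..m}. A k i * N j i * A j l) = (\<Sum>j\<in>{1..m}. (\<Sum>i\<in>{1..m}. A k i * N j i) * A j l)"
        by (subst sum.swap) (simp add: sum_distrib_right)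
      also have "\<dots> = (\<Sum>j\<in>{1..m}. (if k = j then 1 else 0) * A j l)" using N k by (intro sum.cong) auto
      also have "\<dots> = A k l" using k by (simp add: if_distrib[of "\<lambda>u. u * _"] cong: if_cong)
      finally show ?thesis by simp
    qed
    then have "v i = 0" using inj[of v i] il by blast
    then show "(\<Sum>j\<in>{1..m}. N j i * A j l) = (if i = l then 1 else 0)" by (simp add: v_def)
  next
    fix w k assume w: "\<forall>i\<in>{1..m}. (\<Sum>j\<in>{1..m}. N j i * w j) = 0" and k: "k \<in> {1..m}"
    have "0 = (\<Sum>i\<in>{1..m}. A k i * (\<Sum>j\<in>{1..m}. N j i * w j))" using w by simp
    also have "\<dots> = (\<Sum>i\<in>{1..m}. \<Sum>j\<in>{1..m}. A k i * N j i * w j)" by (simp add: sum_distrib_left mult.assoc)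
    also have "\<dots> = (\<Sum>j\<in>{1..m}. (\<Sum>i\<in>{1..m}. A k i * N j i) * w j)"
      by (subst sum.swap) (simp add: sum_distrib_right)
    also have "\<dots> = (\<Sum>j\<in>{1..m}. (if k = j then 1 else 0) * w j)" using N k by (intro sum.cong) auto
    also have "\<dots> = w k" using k by (simp add: if_distrib[of "\<lambda>u. u * _"] cong: if_cong)
    finally show "w k = 0" by simp
  qed
qed

section \<open>Fibres of homogeneous maps\<close>

lemma finite_positive_lower_bound:
  fixes f :: "'a \<Rightarrow> real"
  assumes "finite A" "\<And>a. a \<in> A \<Longrightarrow> f a > 0"
  shows "\<exists>\<eta>>0. \<forall>a\<in>A. \<eta> \<le> f a"
  using assms
proof (induction A rule: finite_induct)
  case empty then show ?case by (intro exI[of _ 1]) auto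
next
  case (insert a A)
  then obtain \<eta> where "\<eta> > 0" "\<forall>a\<in>A. \<eta> \<le> f a" by auto
  then show ?case using insert.prems[of a] by (intro exI[of _ "min \<eta> (f a)"]) auto
qed

lemma nr_matrix: "nr m (\<lambda>i. \<Sum>j\<in>{1..m}. M i j * w j) \<le> (\<Sum>i\<in>{1..m}. \<Sum>j\<in>{1..m}. cmod (M i j)) * nr m w"
  unfolding nr_def[of m "\<lambda>i. \<Sum>j\<in>{1..m}. M i j * w j"] sum_distrib_right
  by (intro sum_mono order_trans[OF norm_sum]) (auto simp: norm_mult intro!: mult_left_mono coord_le_nr)

text \<open>\<open>B0\<close> plays the part of the Jacobian determinant: a nonzero polynomial that vanishes at all points where
  the differential is singular.\<close>

locale homogeneous_map =
  fixes m n :: nat and P :: "nat \<Rightarrow> (nat \<Rightarrow> complex) \<Rightarrow> complex"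
    and e0 :: nat and B0 :: "(nat \<Rightarrow> complex) \<Rightarrow> complex"
  assumes m: "m \<ge> 1" and n: "n \<ge> 1"
    and P: "\<And>j. j \<in> {1..m} \<Longrightarrow> pfun m n (P j)"
    and homogeneous: "\<And>j t x. j \<in> {1..m} \<Longrightarrow> P j (\<lambda>i. t * x i) = t ^ n * P j x"
    and only_trivial_zero: "\<And>x. x \<in> cspace m \<Longrightarrow> (\<And>j. j \<in> {1..m} \<Longrightarrow> P j x = 0) \<Longrightarrow> x = (\<lambda>_. 0)"
    and B0: "pfun m e0 B0" "\<exists>x. B0 x \<noteq> 0"
    and differential_injective: "\<And>x v i. B0 x \<noteq> 0 \<Longrightarrow>
      (\<And>j. j \<in> {1..m} \<Longrightarrow> ((\<lambda>t. P j (\<lambda>i. x i + t * v i)) has_field_derivative 0) (at 0)) \<Longrightarrow>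
      i \<in> {1..m} \<Longrightarrow> v i = 0"
begin

definition PP :: "(nat \<Rightarrow> complex) \<Rightarrow> nat \<Rightarrow> complex"
  where "PP x = (\<lambda>j. P j x)"

definition fib :: "(nat \<Rightarrow> complex) \<Rightarrow> (nat \<Rightarrow> complex) set"
  where "fib \<rho> = {x \<in> cspace m. \<forall>j\<in>{1..m}. P j x = \<rho> j}"

lemma continuous_on_dst_PP: "continuous_on S (\<lambda>x. dst m (PP x) \<rho>)"
  unfolding dst_def nr_def PP_def by (intro continuous_intros continuous_on_pfun[OF P]) auto

lemma dst_PP_fib: "x \<in> fib \<rho> \<Longrightarrow> dst m (PP x) \<rho>' = dst m \<rho> \<rho>'"
  unfolding dst_def nr_def PP_def fib_def by (intro sum.cong) auto

lemma dst_PP_fib': "x \<in> fib \<rho> \<Longrightarrow> dst m \<rho>' (PP x) = dst m \<rho>' \<rho>"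
  using dst_PP_fib dst_sym by metis

lemma nr_PP_fib: "x \<in> fib \<rho> \<Longrightarrow> nr m (PP x) = nr m \<rho>"
  unfolding nr_def PP_def fib_def by (intro sum.cong) auto

text \<open>By homogeneity the map grows like the \<open>n\<close>-th power of the norm, as it has no zero on the
  compact unit sphere.\<close>

lemma proper: "\<exists>C>0. \<forall>x\<in>cspace m. nr m x ^ n \<le> C * nr m (PP x)"
proof -
  define S where "S = {x \<in> cspace m. nr m x \<le> 1} \<inter> {x. nr m x = 1}"
  have "closed {x. nr m x = 1}"
    by (intro closed_Collect_eq continuous_on_nr continuous_on_const)
  then have cS: "compact S" unfolding S_def by (intro compact_Int_closed compact_nr_ball)
  define u :: "nat \<Rightarrow> complex" where "u = (\<lambda>i. if i = 1 then 1 else 0)"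
  have "nr m u = (\<Sum>i\<in>{1..m}. if i = 1 then 1 else 0)" unfolding nr_def u_def by (intro sum.cong) auto
  also have "\<dots> = 1" using m by simp
  finally have "u \<in> S" using m by (auto simp: S_def u_def cspace_def)
  then have "S \<noteq> {}" by auto
  have cont: "continuous_on S (\<lambda>x. nr m (PP x))"
    using continuous_on_dst_PP[of S "\<lambda>_. 0"] by (simp add: dst_def)
  obtain s where s: "s \<in> S" "\<And>y. y \<in> S \<Longrightarrow> nr m (PP s) \<le> nr m (PP y)"
    using continuous_attains_inf[OF cS \<open>S \<noteq> {}\<close> cont] by blast
  have "nr m (PP s) \<noteq> 0"
  proof
    assume z: "nr m (PP s) = 0"
    have "P j s = 0" if "j \<in> {1..m}" for j using coord_le_nr[OF that, of "PP s"] z by (simp add: PP_def)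
    then have "s = (\<lambda>_. 0)" using s(1) by (intro only_trivial_zero) (auto simp: S_def)
    then show False using s(1) by (simp add: S_def nr_def)
  qed
  then have c: "nr m (PP s) > 0" using nr_nonneg[of m "PP s"] by linarith
  show ?thesis
  proof (intro exI[of _ "1 / nr m (PP s)"] conjI ballI)
    fix x assume x: "x \<in> cspace m"
    show "nr m x ^ n \<le> 1 / nr m (PP s) * nr m (PP x)"
    proof (cases "nr m x = 0")
      case True then show ?thesis using n c by (simp add: power_0_left)
    next
      case False
      then have r: "nr m x > 0" using nr_nonneg[of m x] by linarith
      define y where "y = (\<lambda>i. of_real (1 / nr m x) * x i)"
      have "nr m y = cmod (of_real (1 / nr m x)) * nr m x" unfolding y_def by (rule nr_scale)
      then have "nr m y = 1" using r by (simp add: norm_divide)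
      then have "y \<in> S" using x by (auto simp: S_def y_def cspace_def)
      have "nr m (PP y) = nr m (\<lambda>j. of_real (1 / nr m x) ^ n * PP x j)"
        unfolding nr_def PP_def y_def by (intro sum.cong) (simp_all only: homogeneous)
      also have "\<dots> = nr m (PP x) / nr m x ^ n"
        using r by (simp only: nr_scale) (simp add: norm_power norm_divide power_divide)
      finally have "nr m (PP s) \<le> nr m (PP x) / nr m x ^ n" using s(2)[OF \<open>y \<in> S\<close>] by simp
      then have "nr m (PP s) * nr m x ^ n \<le> nr m (PP x)"
        using pos_le_divide_eq[of "nr m x ^ n"] zero_less_power[OF r] by blast
      then have "nr m x ^ n \<le> nr m (PP x) / nr m (PP s)"
        using pos_le_divide_eq[OF c, of "nr m x ^ n" "nr m (PP x)"] by (simp only: mult.commute)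
      then show ?thesis by simp
    qed
  qed (use c in simp)
qed

text \<open>A constant for \<open>proper\<close>, fixed to keep the bounds below uniform in the point of the target.\<close>

definition growth_const :: real where "growth_const = (SOME C. C > 0 \<and> (\<forall>x\<in>cspace m. nr m x ^ n \<le> C * nr m (PP x)))"

lemma growth_const: "growth_const > 0" "x \<in> fib \<rho> \<Longrightarrow> nr m x ^ n \<le> growth_const * nr m \<rho>"
proof -
  have "growth_const > 0 \<and> (\<forall>x\<in>cspace m. nr m x ^ n \<le> growth_const * nr m (PP x))"
    unfolding growth_const_def by (rule someI_ex[OF proper])
  note C = this
  show "growth_const > 0" using C by blast
  assume x: "x \<in> fib \<rho>"
  then have "x \<in> cspace m" by (simp add: fib_def)
  then have "nr m x ^ n \<le> growth_const * nr m (PP x)" using C by blast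
  then show "nr m x ^ n \<le> growth_const * nr m \<rho>" by (simp only: nr_PP_fib[OF x])
qed

lemma fib_bounded: assumes "x \<in> fib \<rho>" shows "nr m x \<le> 1 + growth_const * nr m \<rho>"
proof (cases "nr m x \<le> 1")
  case True
  have "0 \<le> growth_const * nr m \<rho>" using growth_const(1) by simp
  then show ?thesis using True by linarith
next
  case False
  then have "nr m x ^ 1 \<le> nr m x ^ n" using n by (intro power_increasing) auto
  then show ?thesis using growth_const(2)[OF assms] by simp
qed

lemma compact_fib: "compact (fib \<rho>)"
proof -
  have "closed {x. dst m (PP x) \<rho> = 0}"
    by (intro closed_Collect_eq continuous_on_dst_PP continuous_on_const)
  moreover have "fib \<rho> = {x \<in> cspace m. nr m x \<le> 1 + growth_const * nr m \<rho>} \<inter> {x. dst m (PP x) \<rho> = 0}"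
  proof (intro subset_antisym subsetI)
    fix x assume x: "x \<in> fib \<rho>"
    then show "x \<in> {x \<in> cspace m. nr m x \<le> 1 + growth_const * nr m \<rho>} \<inter> {x. dst m (PP x) \<rho> = 0}"
      using fib_bounded[OF x] dst_PP_fib[OF x, of \<rho>] by (auto simp: fib_def)
  next
    fix x assume x: "x \<in> {x \<in> cspace m. nr m x \<le> 1 + growth_const * nr m \<rho>} \<inter> {x. dst m (PP x) \<rho> = 0}"
    have "P j x = \<rho> j" if "j \<in> {1..m}" for j
      using coord_le_nr[OF that, of "\<lambda>i. PP x i - \<rho> i"] x by (simp add: dst_def PP_def)
    then show "x \<in> fib \<rho>" using x by (auto simp: fib_def)
  qed
  ultimately show ?thesis using compact_Int_closed[OF compact_nr_ball] by simp
qed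

text \<open>\<open>M\<close> is the inverse of the differential at \<open>z\<close>. By Hadamard's lemma the difference quotients of \<open>P\<close>
  converge to the differential when both points tend to \<open>z\<close>, so \<open>M\<close> recovers \<open>x - y\<close> from the
  difference of the values up to a small relative error.\<close>

lemma strict_inverse:
  assumes "B0 z \<noteq> 0"
  shows "\<exists>M. (\<forall>w. (\<forall>i\<in>{1..m}. (\<Sum>j\<in>{1..m}. M i j * w j) = 0) \<longrightarrow> (\<forall>j\<in>{1..m}. w j = 0)) \<and>
    (\<forall>\<epsilon>>0. \<exists>\<delta>>0. \<forall>x y. dst m x z < \<delta> \<longrightarrow> dst m y z < \<delta> \<longrightarrow>
        nr m (\<lambda>i. x i - y i - (\<Sum>j\<in>{1..m}. M i j * (P j x - P j y))) \<le> \<epsilon> * dst m x y)"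
proof -
  have "\<forall>j\<in>{1..m}. \<exists>A. hadamard m (P j) A" using hadamard_pfun[OF P] by blast
  from bchoice[OF this] obtain A where A: "\<And>j. j \<in> {1..m} \<Longrightarrow> hadamard m (P j) (A j)" by blast
  have AP: "P j x - P j y = (\<Sum>i\<in>{1..m}. A j i x y * (x i - y i))" if "j \<in> {1..m}" for j x y
    using A[OF that] by (simp add: hadamard_def)
  have lim: "((\<lambda>p. A j i (fst p) (snd p)) \<longlongrightarrow> A j i z z) (pair_nhds m z)" if "j \<in> {1..m}" "i \<in> {1..m}" for j i
    using A[OF that(1)] that(2) by (auto simp: hadamard_def)
  have "\<exists>M. (\<forall>i\<in>{1..m}. \<forall>l\<in>{1..m}. (\<Sum>j\<in>{1..m}. M i j * A j l z z) = (if i = l then 1 else 0)) \<and>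
     (\<forall>w. (\<forall>i\<in>{1..m}. (\<Sum>j\<in>{1..m}. M i j * w j) = 0) \<longrightarrow> (\<forall>j\<in>{1..m}. w j = 0))"
  proof (rule injective_matrix_inverse)
    fix v i assume v: "\<And>j. j \<in> {1..m} \<Longrightarrow> (\<Sum>i\<in>{1..m}. A j i z z * v i) = 0" and i: "i \<in> {1..m}"
    show "v i = 0"
    proof (rule differential_injective[OF assms _ i])
      fix j assume j: "j \<in> {1..m}"
      have fl: "filterlim (\<lambda>t. (\<lambda>i. z i + t * v i, z)) (pair_nhds m z) (at 0)"
        unfolding filterlim_iff eventually_pair_nhds
      proof safe
        fix Q \<delta> assume d: "\<delta> > 0" and Q: "\<forall>x y. dst m x z < \<delta> \<longrightarrow> dst m y z < \<delta> \<longrightarrow> Q (x, y)"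
        have dd: "dst m (\<lambda>i. z i + t * v i) z = cmod t * nr m v" for t
          using nr_scale[of m t v] by (simp add: dst_def)
        have "((\<lambda>t. cmod t * nr m v) \<longlongrightarrow> 0 * nr m v) (at 0)"
          by (intro tendsto_mult tendsto_const tendsto_norm_zero tendsto_ident_at)
        then have "\<forall>\<^sub>F t in at 0. cmod t * nr m v < \<delta>" by (intro order_tendstoD(2)) (use d in auto)
        then show "\<forall>\<^sub>F t in at 0. Q (\<lambda>i. z i + t * v i, z)"
          by eventually_elim (use Q d dd in auto)
      qed
      have "((\<lambda>t. \<Sum>i\<in>{1..m}. A j i (\<lambda>i. z i + t * v i) z * v i) \<longlongrightarrow> (\<Sum>i\<in>{1..m}. A j i z z * v i)) (at 0)"
        by (intro tendsto_sum tendsto_mult tendsto_const)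
          (use filterlim_compose[OF lim[OF j] fl] in simp)
      moreover have "\<forall>\<^sub>F t in at 0. (\<Sum>i\<in>{1..m}. A j i (\<lambda>i. z i + t * v i) z * v i) =
           (P j (\<lambda>i. z i + t * v i) - P j z) / t"
      proof (rule eventually_at_filter[THEN iffD2], intro always_eventually allI impI)
        fix t :: complex assume "t \<noteq> 0"
        have "P j (\<lambda>i. z i + t * v i) - P j z = (\<Sum>i\<in>{1..m}. A j i (\<lambda>i. z i + t * v i) z * v i) * t"
          unfolding AP[OF j] by (simp add: sum_distrib_left mult_ac)
        then show "(\<Sum>i\<in>{1..m}. A j i (\<lambda>i. z i + t * v i) z * v i) = (P j (\<lambda>i. z i + t * v i) - P j z) / t"
          using \<open>t \<noteq> 0\<close> by simp
      qed
      ultimately have "((\<lambda>t. (P j (\<lambda>i. z i + t * v i) - P j z) / t) \<longlongrightarrow> 0) (at 0)"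
        using v[OF j] by (auto elim: Lim_transform_eventually)
      then show "((\<lambda>t. P j (\<lambda>i. z i + t * v i)) has_field_derivative 0) (at 0)"
        by (simp add: DERIV_def)
    qed
  qed
  then obtain M where M: "\<And>i l. i \<in> {1..m} \<Longrightarrow> l \<in> {1..m} \<Longrightarrow> (\<Sum>j\<in>{1..m}. M i j * A j l z z) = (if i = l then 1 else 0)"
    and Minj: "\<forall>w. (\<forall>i\<in>{1..m}. (\<Sum>j\<in>{1..m}. M i j * w j) = 0) \<longrightarrow> (\<forall>j\<in>{1..m}. w j = 0)"
    by blast
  \<comment> \<open>The deviation of \<open>M\<close> times the difference quotients from the identity matrix.\<close>
  define E where "E = (\<lambda>i l x y. (if i = l then 1 else 0) - (\<Sum>j\<in>{1..m}. M i j * A j l x y))"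
  have "((\<lambda>p. \<Sum>i\<in>{1..m}. \<Sum>l\<in>{1..m}. cmod (E i l (fst p) (snd p))) \<longlongrightarrow>
      (\<Sum>i\<in>{1..m}. \<Sum>l\<in>{1..m}. cmod (E i l z z))) (pair_nhds m z)"
    unfolding E_def by (intro tendsto_sum tendsto_norm tendsto_diff tendsto_mult tendsto_const lim)
  moreover have "(\<Sum>i\<in>{1..m}. \<Sum>l\<in>{1..m}. cmod (E i l z z)) = 0"
    unfolding E_def by (intro sum.neutral ballI) (simp only: M diff_self norm_zero)
  ultimately have E0: "((\<lambda>p. \<Sum>i\<in>{1..m}. \<Sum>l\<in>{1..m}. cmod (E i l (fst p) (snd p))) \<longlongrightarrow> 0) (pair_nhds m z)"
    by simp
  have err: "nr m (\<lambda>i. x i - y i - (\<Sum>j\<in>{1..m}. M i j * (P j x - P j y))) \<le>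
     (\<Sum>i\<in>{1..m}. \<Sum>l\<in>{1..m}. cmod (E i l x y)) * dst m x y" for x y
  proof -
    have eq: "x i - y i - (\<Sum>j\<in>{1..m}. M i j * (P j x - P j y)) = (\<Sum>l\<in>{1..m}. E i l x y * (x l - y l))" if i: "i \<in> {1..m}" for i
    proof -
      have "(\<Sum>j\<in>{1..m}. M i j * (P j x - P j y)) = (\<Sum>j\<in>{1..m}. \<Sum>l\<in>{1..m}. M i j * A j l x y * (x l - y l))"
        by (intro sum.cong refl) (simp add: AP sum_distrib_left mult.assoc)
      also have "\<dots> = (\<Sum>l\<in>{1..m}. (\<Sum>j\<in>{1..m}. M i j * A j l x y) * (x l - y l))"
        by (subst sum.swap) (simp add: sum_distrib_right)
      finally have 1: "(\<Sum>j\<in>{1..m}. M i j * (P j x - P j y)) = (\<Sum>l\<in>{1..m}. (\<Sum>j\<in>{1..m}. M i j * A j l x y) * (x l - y l))" .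
      have "(\<Sum>l\<in>{1..m}. (if i = l then 1 else 0) * (x l - y l)) = x i - y i"
        using i by (simp add: if_distrib[of "\<lambda>u. u * _"] cong: if_cong)
      then show ?thesis unfolding 1 E_def left_diff_distrib sum_subtractf by simp
    qed
    have "nr m (\<lambda>i. x i - y i - (\<Sum>j\<in>{1..m}. M i j * (P j x - P j y))) = nr m (\<lambda>i. \<Sum>l\<in>{1..m}. E i l x y * (x l - y l))"
      unfolding nr_def by (intro sum.cong refl) (simp only: eq)
    then show ?thesis unfolding dst_def using nr_matrix[of m "\<lambda>i l. E i l x y" "\<lambda>l. x l - y l"] by simp
  qed
  show ?thesis
  proof (intro exI[of _ M] conjI Minj allI impI)
    fix \<epsilon> :: real assume "\<epsilon> > 0"
    then have "\<forall>\<^sub>F p in pair_nhds m z. (\<Sum>i\<in>{1..m}. \<Sum>l\<in>{1..m}. cmod (E i l (fst p) (snd p))) < \<epsilon>"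
      using order_tendstoD(2)[OF E0] by blast
    then obtain \<delta> where d: "\<delta> > 0" "\<And>x y. dst m x z < \<delta> \<Longrightarrow> dst m y z < \<delta> \<Longrightarrow> (\<Sum>i\<in>{1..m}. \<Sum>l\<in>{1..m}. cmod (E i l x y)) < \<epsilon>"
      unfolding eventually_pair_nhds by auto
    show "\<exists>\<delta>>0. \<forall>x y. dst m x z < \<delta> \<longrightarrow> dst m y z < \<delta> \<longrightarrow>
        nr m (\<lambda>i. x i - y i - (\<Sum>j\<in>{1..m}. M i j * (P j x - P j y))) \<le> \<epsilon> * dst m x y"
    proof (intro exI[of _ \<delta>] conjI allI impI d(1))
      fix x y assume "dst m x z < \<delta>" "dst m y z < \<delta>"
      from d(2)[OF this] show "nr m (\<lambda>i. x i - y i - (\<Sum>j\<in>{1..m}. M i j * (P j x - P j y))) \<le> \<epsilon> * dst m x y"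
        using err[of x y] mult_right_mono[of _ \<epsilon> "dst m x y"] by (meson dst_nonneg less_imp_le order_trans)
    qed
  qed
qed

lemma local_injectivity:
  assumes "B0 z \<noteq> 0"
  shows "\<exists>\<delta>>0. \<exists>K\<ge>0. \<forall>x y. dst m x z < \<delta> \<longrightarrow> dst m y z < \<delta> \<longrightarrow> dst m x y \<le> K * dst m (PP x) (PP y)"
proof -
  obtain M where M: "\<And>\<epsilon>. \<epsilon> > 0 \<Longrightarrow> \<exists>\<delta>>0. \<forall>x y. dst m x z < \<delta> \<longrightarrow> dst m y z < \<delta> \<longrightarrow>
        nr m (\<lambda>i. x i - y i - (\<Sum>j\<in>{1..m}. M i j * (P j x - P j y))) \<le> \<epsilon> * dst m x y"
    using strict_inverse[OF assms] by blast
  obtain \<delta> where d: "\<delta> > 0" "\<And>x y. dst m x z < \<delta> \<Longrightarrow> dst m y z < \<delta> \<Longrightarrow>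
        nr m (\<lambda>i. x i - y i - (\<Sum>j\<in>{1..m}. M i j * (P j x - P j y))) \<le> 1/2 * dst m x y"
    using M[of "1/2"] by auto
  define K where "K = (\<Sum>i\<in>{1..m}. \<Sum>j\<in>{1..m}. cmod (M i j))"
  have K: "K \<ge> 0" unfolding K_def by (intro sum_nonneg) auto
  show ?thesis
  proof (rule exI[of _ \<delta>], rule conjI, rule d(1), rule exI[of _ "2 * K"], intro conjI allI impI)
    fix x y assume xy: "dst m x z < \<delta>" "dst m y z < \<delta>"
    have "dst m x y \<le> nr m (\<lambda>i. \<Sum>j\<in>{1..m}. M i j * (P j x - P j y)) +
      nr m (\<lambda>i. x i - y i - (\<Sum>j\<in>{1..m}. M i j * (P j x - P j y)))"
      using nr_add[of m "\<lambda>i. \<Sum>j\<in>{1..m}. M i j * (P j x - P j y)" "\<lambda>i. x i - y i - (\<Sum>j\<in>{1..m}. M i j * (P j x - P j y))"]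
      by (simp add: dst_def)
    also have "nr m (\<lambda>i. \<Sum>j\<in>{1..m}. M i j * (P j x - P j y)) \<le> K * dst m (PP x) (PP y)"
      unfolding K_def dst_def PP_def by (rule nr_matrix)
    finally show "dst m x y \<le> 2 * K * dst m (PP x) (PP y)" using d(2)[OF xy] by linarith
  qed (use K in auto)
qed

text \<open>Values near \<open>PP z\<close> are attained near \<open>z\<close>: Newton's map with fixed slope is a contraction of
  a compact ball, so that a point moved least by it is fixed.\<close>

lemma local_surjectivity:
  assumes "B0 z \<noteq> 0" "z \<in> cspace m" "\<epsilon> > 0"
  shows "\<exists>\<delta>>0. \<forall>\<rho>. dst m \<rho> (PP z) < \<delta> \<longrightarrow> (\<exists>x\<in>fib \<rho>. dst m x z < \<epsilon>)"
proof -
  obtain M where Minj: "\<forall>w. (\<forall>i\<in>{1..m}. (\<Sum>j\<in>{1..m}. M i j * w j) = 0) \<longrightarrow> (\<forall>j\<in>{1..m}. w j = 0)"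
    and M: "\<forall>\<epsilon>>0. \<exists>\<delta>>0. \<forall>x y. dst m x z < \<delta> \<longrightarrow> dst m y z < \<delta> \<longrightarrow>
        nr m (\<lambda>i. x i - y i - (\<Sum>j\<in>{1..m}. M i j * (P j x - P j y))) \<le> \<epsilon> * dst m x y"
    using strict_inverse[OF assms(1)] by (elim exE conjE)
  obtain \<delta>0 where d0: "\<delta>0 > 0" "\<And>x y. dst m x z < \<delta>0 \<Longrightarrow> dst m y z < \<delta>0 \<Longrightarrow>
        nr m (\<lambda>i. x i - y i - (\<Sum>j\<in>{1..m}. M i j * (P j x - P j y))) \<le> 1/2 * dst m x y"
    using M[rule_format, of "1/2"] by auto
  define \<eta> where "\<eta> = min \<epsilon> \<delta>0 / 2"
  have eta: "\<eta> > 0" "\<eta> < \<epsilon>" "\<eta> < \<delta>0" using assms(3) d0(1) by (auto simp: \<eta>_def)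
  define K where "K = (\<Sum>i\<in>{1..m}. \<Sum>j\<in>{1..m}. cmod (M i j)) + 1"
  have K: "K > 0" unfolding K_def by (intro add_nonneg_pos sum_nonneg) auto
  define S where "S = {x \<in> cspace m. nr m x \<le> nr m z + \<eta>} \<inter> {x. dst m x z \<le> \<eta>}"
  have S_eq: "S = {x \<in> cspace m. dst m x z \<le> \<eta>}"
  proof -
    have "nr m x \<le> nr m z + \<eta>" if "dst m x z \<le> \<eta>" for x using nr_le_dst[of m x z] that by linarith
    then show ?thesis by (auto simp: S_def)
  qed
  have "closed {x. dst m x z \<le> \<eta>}" by (intro closed_Collect_le continuous_on_dst continuous_on_const)
  then have cS: "compact S" unfolding S_def by (intro compact_Int_closed compact_nr_ball)
  have zS: "z \<in> S" using assms(2) eta by (simp add: S_eq)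
  show ?thesis
  proof (intro exI[of _ "\<eta> / (2 * K)"] conjI allI impI)
    fix \<rho> assume rho: "dst m \<rho> (PP z) < \<eta> / (2 * K)"
    \<comment> \<open>Newton's map for \<open>P x = \<rho>\<close>, with \<open>M\<close> in place of the inverse of the differential at \<open>x\<close>.\<close>
    define T where "T = (\<lambda>x i. if i \<in> {1..m} then x i - (\<Sum>j\<in>{1..m}. M i j * (P j x - \<rho> j)) else 0)"
    have contr: "dst m (T x) (T y) \<le> 1/2 * dst m x y" if "x \<in> S" "y \<in> S" for x y
    proof -
      have "dst m (T x) (T y) = nr m (\<lambda>i. x i - y i - (\<Sum>j\<in>{1..m}. M i j * (P j x - P j y)))"
        unfolding dst_def nr_def
      proof (intro sum.cong refl)
        fix i assume i: "i \<in> {1..m}"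
        have "(\<Sum>j\<in>{1..m}. M i j * (P j x - P j y)) =
            (\<Sum>j\<in>{1..m}. M i j * (P j x - \<rho> j)) - (\<Sum>j\<in>{1..m}. M i j * (P j y - \<rho> j))"
          unfolding sum_subtractf[symmetric] by (intro sum.cong refl) (simp add: algebra_simps)
        then have "T x i - T y i = x i - y i - (\<Sum>j\<in>{1..m}. M i j * (P j x - P j y))"
          using i by (simp add: T_def)
        then show "cmod (T x i - T y i) = cmod (x i - y i - (\<Sum>j\<in>{1..m}. M i j * (P j x - P j y)))"
          by (rule arg_cong)
      qed
      also have "\<dots> \<le> 1/2 * dst m x y" using that eta by (intro d0(2)) (auto simp: S_eq)
      finally show ?thesis .
    qed
    have Tz: "dst m (T z) z \<le> \<eta> / 2"
    proof -
      have "dst m (T z) z = nr m (\<lambda>i. \<Sum>j\<in>{1..m}. M i j * (P j z - \<rho> j))"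
        unfolding dst_def nr_def T_def by (intro sum.cong refl) simp
      also have "\<dots> \<le> (\<Sum>i\<in>{1..m}. \<Sum>j\<in>{1..m}. cmod (M i j)) * dst m (PP z) \<rho>"
        unfolding dst_def PP_def by (rule nr_matrix)
      also have "\<dots> \<le> K * dst m (PP z) \<rho>" by (intro mult_right_mono) (auto simp: K_def)
      also have "\<dots> \<le> K * (\<eta> / (2 * K))" using rho K by (intro mult_left_mono) (auto simp: dst_sym[of m "PP z"])
      finally show ?thesis using K by simp
    qed
    have TS: "T x \<in> S" if "x \<in> S" for x
    proof -
      have "dst m (T x) z \<le> dst m (T x) (T z) + dst m (T z) z" by (rule dst_triangle)
      also have "\<dots> \<le> 1/2 * dst m x z + \<eta> / 2" using contr[OF that zS] Tz by linarith
      also have "\<dots> \<le> \<eta>" using that by (simp add: S_eq)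
      finally show ?thesis by (auto simp: S_eq T_def cspace_def)
    qed
    have "continuous_on S (\<lambda>x. dst m (T x) x)"
    proof -
      have "(\<lambda>x. dst m (T x) x) = (\<lambda>x. \<Sum>i\<in>{1..m}. cmod (\<Sum>j\<in>{1..m}. M i j * (P j x - \<rho> j)))"
        unfolding dst_def nr_def T_def by (intro ext sum.cong refl) simp
      then show ?thesis by (simp only:) (intro continuous_intros continuous_on_pfun[OF P])
    qed
    then obtain x where x: "x \<in> S" "\<And>y. y \<in> S \<Longrightarrow> dst m (T x) x \<le> dst m (T y) y"
      using continuous_attains_inf[OF cS, of "\<lambda>x. dst m (T x) x"] zS by blast
    have "dst m (T x) x = 0"
      using contr[OF TS[OF x(1)] x(1)] x(2)[OF TS[OF x(1)]] dst_nonneg[of m "T x" x] by linarith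
    then have eq: "T x = x" using x(1) TS[OF x(1)] by (intro dst_0_eq) (auto simp: S_eq)
    have zero: "(\<Sum>j\<in>{1..m}. M i j * (P j x - \<rho> j)) = 0" if "i \<in> {1..m}" for i
      using fun_cong[OF eq, of i] that by (simp add: T_def)
    have "\<forall>j\<in>{1..m}. P j x - \<rho> j = 0"
      using spec[OF Minj, of "\<lambda>j. P j x - \<rho> j"] zero by blast
    then have "x \<in> fib \<rho>" using x(1) by (auto simp: fib_def S_eq)
    moreover have "dst m x z < \<epsilon>" using x(1) eta by (auto simp: S_eq)
    ultimately show "\<exists>x\<in>fib \<rho>. dst m x z < \<epsilon>" by blast
  qed (use eta K in simp)
qed

end

section \<open>Generic fibres and norms\<close>

text \<open>The hypersurface \<open>G = 0\<close> of the target contains the images of the ramification points.\<close>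

locale generic_homogeneous_map = homogeneous_map +
  fixes dG :: nat and G :: "(nat \<Rightarrow> complex) \<Rightarrow> complex"
  assumes G: "pfun m dG G" "\<exists>\<rho>. G \<rho> \<noteq> 0"
    and G_B0: "\<And>x. G (PP x) \<noteq> 0 \<Longrightarrow> B0 x \<noteq> 0"
begin

lemma G_fib: assumes "x \<in> fib \<rho>" shows "G (PP x) = G \<rho>"
  using assms by (intro pfun_cong[OF G(1)]) (auto simp: PP_def fib_def)

lemma B0_fib: "x \<in> fib \<rho> \<Longrightarrow> G \<rho> \<noteq> 0 \<Longrightarrow> B0 x \<noteq> 0"
  using G_fib G_B0 by metis

text \<open>A compact infinite fibre would have a limit point, where the map is locally injective.\<close>

lemma finite_fib: assumes "G \<rho> \<noteq> 0" shows "finite (fib \<rho>)"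
proof (rule ccontr)
  assume "infinite (fib \<rho>)"
  then obtain z where z: "z \<in> fib \<rho>" "z islimpt fib \<rho>"
    using Heine_Borel_imp_Bolzano_Weierstrass[OF compact_fib _ subset_refl] by blast
  obtain \<delta> K where d: "\<delta> > 0" "\<And>x y. dst m x z < \<delta> \<Longrightarrow> dst m y z < \<delta> \<Longrightarrow> dst m x y \<le> K * dst m (PP x) (PP y)"
    using local_injectivity[OF B0_fib[OF z(1) assms]] by blast
  have op: "open {x. dst m x z < \<delta>}"
    by (intro open_Collect_less continuous_on_dst continuous_on_const)
  have "z \<in> {x. dst m x z < \<delta>}" using d(1) by simp
  from z(2)[unfolded islimpt_def, rule_format, OF this op]
  obtain y where y: "y \<in> fib \<rho>" "dst m y z < \<delta>" "y \<noteq> z" by blast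
  have "dst m (PP y) (PP z) = 0" using dst_PP_fib[OF y(1)] dst_PP_fib'[OF z(1)] by simp
  then have "dst m y z \<le> 0" using d(2)[OF y(2), of z] d(1) by simp
  then have "dst m y z = 0" using dst_nonneg[of m y z] by linarith
  then have "y = z" using y(1) z(1) by (intro dst_0_eq) (auto simp: fib_def)
  then show False using y(3) by simp
qed

text \<open>Over the generic locus the fibre moves continuously, without gaining or losing points: local
  surjectivity provides a point near each point of the fibre, local injectivity makes it unique, and
  compactness excludes further points, since away from the fibre over \<open>\<rho>1\<close> the values stay away from \<open>\<rho>1\<close>.\<close>

lemma local_cover:
  assumes G1: "G \<rho>1 \<noteq> 0" and eps: "\<epsilon> > 0"
  shows "\<exists>\<delta>>0. \<forall>\<rho>. dst m \<rho> \<rho>1 < \<delta> \<longrightarrow> (\<exists>\<zeta>. bij_betw \<zeta> (fib \<rho>1) (fib \<rho>) \<and> (\<forall>z\<in>fib \<rho>1. dst m (\<zeta> z) z < \<epsilon>))"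
proof -
  define Z where "Z = fib \<rho>1"
  have Zc: "z \<in> cspace m" if "z \<in> Z" for z using that by (auto simp: Z_def fib_def)
  have fZ: "finite Z" unfolding Z_def by (rule finite_fib[OF G1])
  have BZ: "B0 z \<noteq> 0" if "z \<in> Z" for z using B0_fib[OF _ G1] that by (auto simp: Z_def)
  have "\<forall>z\<in>Z. \<exists>\<delta>. \<delta> > 0 \<and> (\<exists>K\<ge>0. \<forall>x y. dst m x z < \<delta> \<longrightarrow> dst m y z < \<delta> \<longrightarrow> dst m x y \<le> K * dst m (PP x) (PP y))"
    using local_injectivity BZ by blast
  from bchoice[OF this] obtain r where r: "\<And>z. z \<in> Z \<Longrightarrow> r z > 0"
    "\<And>z. z \<in> Z \<Longrightarrow> \<exists>K\<ge>0. \<forall>x y. dst m x z < r z \<longrightarrow> dst m y z < r z \<longrightarrow> dst m x y \<le> K * dst m (PP x) (PP y)" by blast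
  obtain \<eta>1 where e1: "\<eta>1 > 0" "\<forall>z\<in>Z. \<eta>1 \<le> r z" using finite_positive_lower_bound[of Z r, OF fZ r(1)] by blast
  have "\<exists>\<eta>>0. \<forall>p\<in>{p\<in>Z \<times> Z. fst p \<noteq> snd p}. \<eta> \<le> dst m (fst p) (snd p)"
  proof (rule finite_positive_lower_bound)
    show "finite {p\<in>Z \<times> Z. fst p \<noteq> snd p}" using fZ by simp
    fix p assume p: "p \<in> {p\<in>Z \<times> Z. fst p \<noteq> snd p}"
    then have "dst m (fst p) (snd p) \<noteq> 0" using dst_0_eq[of "fst p" m "snd p"] Zc by auto
    then show "dst m (fst p) (snd p) > 0" using dst_nonneg[of m "fst p" "snd p"] by linarith
  qed
  then obtain \<eta>2 where e2: "\<eta>2 > 0" "\<And>z z'. z \<in> Z \<Longrightarrow> z' \<in> Z \<Longrightarrow> z \<noteq> z' \<Longrightarrow> \<eta>2 \<le> dst m z z'" by force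
  define \<eta> where "\<eta> = min \<epsilon> (min \<eta>1 (\<eta>2 / 2))"
  have eta: "\<eta> > 0" "\<eta> \<le> \<epsilon>" "\<eta> \<le> \<eta>1" "2 * \<eta> \<le> \<eta>2" using eps e1 e2 by (auto simp: \<eta>_def)
  have "\<forall>z\<in>Z. \<exists>\<delta>. \<delta> > 0 \<and> (\<forall>\<rho>. dst m \<rho> (PP z) < \<delta> \<longrightarrow> (\<exists>x\<in>fib \<rho>. dst m x z < \<eta>))"
    using local_surjectivity[OF BZ Zc eta(1)] by blast
  from bchoice[OF this] obtain s where s: "\<And>z. z \<in> Z \<Longrightarrow> s z > 0"
    "\<And>z \<rho>. z \<in> Z \<Longrightarrow> dst m \<rho> (PP z) < s z \<Longrightarrow> \<exists>x\<in>fib \<rho>. dst m x z < \<eta>" by blast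
  obtain \<delta>1 where d1: "\<delta>1 > 0" "\<forall>z\<in>Z. \<delta>1 \<le> s z" using finite_positive_lower_bound[of Z s, OF fZ s(1)] by blast
  \<comment> \<open>All points of all fibres over the unit ball about \<open>\<rho>1\<close> have norm at most \<open>R\<close>; \<open>S\<close> consists of those
    points of norm at most \<open>R\<close> that are not close to \<open>Z\<close>.\<close>
  define R where "R = 1 + growth_const * (nr m \<rho>1 + 1)"
  define S where "S = {x \<in> cspace m. nr m x \<le> R} \<inter> (\<Inter>z\<in>Z. {x. \<eta> \<le> dst m x z})"
  have "closed (\<Inter>z\<in>Z. {x. \<eta> \<le> dst m x z})"
    by (intro closed_INT ballI closed_Collect_le continuous_on_dst continuous_on_const)
  then have cS: "compact S" unfolding S_def by (intro compact_Int_closed compact_nr_ball)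
  have "\<exists>\<delta>2>0. \<forall>x\<in>S. \<delta>2 \<le> dst m (PP x) \<rho>1"
  proof (cases "S = {}")
    case True then show ?thesis by (intro exI[of _ 1]) auto
  next
    case False
    obtain x where x: "x \<in> S" "\<And>y. y \<in> S \<Longrightarrow> dst m (PP x) \<rho>1 \<le> dst m (PP y) \<rho>1"
      using continuous_attains_inf[OF cS False continuous_on_dst_PP[of S \<rho>1]] by blast
    have "dst m (PP x) \<rho>1 \<noteq> 0"
    proof
      assume z: "dst m (PP x) \<rho>1 = 0"
      have "P j x = \<rho>1 j" if "j \<in> {1..m}" for j
        using coord_le_nr[OF that, of "\<lambda>i. PP x i - \<rho>1 i"] z by (simp add: dst_def PP_def)
      then have "x \<in> Z" using x(1) by (auto simp: Z_def fib_def S_def)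
      then have "\<eta> \<le> dst m x x" using x(1) unfolding S_def by blast
      then show False using eta(1) by simp
    qed
    then show ?thesis using x dst_nonneg[of m "PP x" \<rho>1]
      by (intro exI[of _ "dst m (PP x) \<rho>1"]) (auto simp: less_le)
  qed
  then obtain \<delta>2 where d2: "\<delta>2 > 0" "\<And>x. x \<in> S \<Longrightarrow> \<delta>2 \<le> dst m (PP x) \<rho>1" by blast
  show ?thesis unfolding Z_def[symmetric]
  proof (intro exI[of _ "min 1 (min \<delta>1 \<delta>2)"] conjI allI impI)
    fix \<rho> assume rho: "dst m \<rho> \<rho>1 < min 1 (min \<delta>1 \<delta>2)"
    have "\<forall>z\<in>Z. \<exists>x. x \<in> fib \<rho> \<and> dst m x z < \<eta>"
    proof
      fix z assume z: "z \<in> Z"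
      have "dst m \<rho> (PP z) = dst m \<rho> \<rho>1" using dst_PP_fib' z by (simp add: Z_def)
      moreover have "\<delta>1 \<le> s z" using d1 z by blast
      ultimately have "dst m \<rho> (PP z) < s z" using rho by simp
      from s(2)[OF z this] show "\<exists>x. x \<in> fib \<rho> \<and> dst m x z < \<eta>" by blast
    qed
    from bchoice[OF this] obtain \<zeta> where zeta: "\<And>z. z \<in> Z \<Longrightarrow> \<zeta> z \<in> fib \<rho>" "\<And>z. z \<in> Z \<Longrightarrow> dst m (\<zeta> z) z < \<eta>" by blast
    have "inj_on \<zeta> Z"
    proof (rule inj_onI, rule ccontr)
      fix z z' assume zz: "z \<in> Z" "z' \<in> Z" "\<zeta> z = \<zeta> z'" "z \<noteq> z'"
      have "dst m z z' \<le> dst m z (\<zeta> z) + dst m (\<zeta> z') z'" using dst_triangle[of m z z' "\<zeta> z"] zz(3) by simp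
      also have "\<dots> < 2 * \<eta>" using zeta(2)[OF zz(1)] zeta(2)[OF zz(2)] by (simp add: dst_sym[of m z])
      finally show False using e2(2)[OF zz(1,2,4)] eta(4) by linarith
    qed
    moreover have "fib \<rho> \<subseteq> \<zeta> ` Z"
    proof
      fix x assume x: "x \<in> fib \<rho>"
      have "nr m \<rho> \<le> nr m \<rho>1 + 1" using nr_le_dst[of m \<rho> \<rho>1] rho by linarith
      then have "growth_const * nr m \<rho> \<le> growth_const * (nr m \<rho>1 + 1)" using growth_const(1) by (intro mult_left_mono) auto
      then have "nr m x \<le> R" using fib_bounded[OF x] by (simp only: R_def)
      have "x \<notin> S"
      proof
        assume "x \<in> S"
        from d2(2)[OF this] show False using rho dst_PP_fib[OF x, of \<rho>1] by simp
      qed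
      then obtain z where z: "z \<in> Z" "dst m x z < \<eta>" using \<open>nr m x \<le> R\<close> x by (auto simp: S_def fib_def not_le)
      have "\<eta> \<le> r z" using eta(3) e1(2) z(1) by force
      obtain K where K: "\<And>x y. dst m x z < r z \<Longrightarrow> dst m y z < r z \<Longrightarrow> dst m x y \<le> K * dst m (PP x) (PP y)"
        using r(2)[OF z(1)] by blast
      have "dst m x (\<zeta> z) \<le> K * dst m (PP x) (PP (\<zeta> z))"
        using z zeta(2)[OF z(1)] \<open>\<eta> \<le> r z\<close> by (intro K) auto
      also have "dst m (PP x) (PP (\<zeta> z)) = 0" using dst_PP_fib[OF x] dst_PP_fib'[OF zeta(1)[OF z(1)]] by simp
      finally have "dst m x (\<zeta> z) = 0" using dst_nonneg[of m x "\<zeta> z"] by linarith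
      then have "x = \<zeta> z" using x zeta(1)[OF z(1)] by (intro dst_0_eq) (auto simp: fib_def)
      then show "x \<in> \<zeta> ` Z" using z(1) by blast
    qed
    ultimately have "bij_betw \<zeta> Z (fib \<rho>)" using zeta(1) by (auto simp: bij_betw_def)
    moreover have "\<forall>z\<in>Z. dst m (\<zeta> z) z < \<epsilon>" using zeta(2) eta(2) by force
    ultimately show "\<exists>\<zeta>. bij_betw \<zeta> Z (fib \<rho>) \<and> (\<forall>z\<in>Z. dst m (\<zeta> z) z < \<epsilon>)" by blast
  qed (use d1 d2 in auto)
qed

lemma local_cover_lipschitz:
  assumes "G \<rho>1 \<noteq> 0"
  shows "\<exists>K\<ge>0. \<exists>\<delta>>0. \<forall>\<rho>. dst m \<rho> \<rho>1 < \<delta> \<longrightarrow>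
    (\<exists>\<zeta>. bij_betw \<zeta> (fib \<rho>1) (fib \<rho>) \<and> (\<forall>z\<in>fib \<rho>1. dst m (\<zeta> z) z \<le> K * dst m \<rho> \<rho>1))"
proof -
  define Z where "Z = fib \<rho>1"
  have fZ: "finite Z" unfolding Z_def by (rule finite_fib[OF assms])
  have BZ: "B0 z \<noteq> 0" if "z \<in> Z" for z using B0_fib[OF _ assms] that by (auto simp: Z_def)
  have "\<forall>z\<in>Z. \<exists>\<delta>. \<delta> > 0 \<and> (\<exists>K\<ge>0. \<forall>x y. dst m x z < \<delta> \<longrightarrow> dst m y z < \<delta> \<longrightarrow> dst m x y \<le> K * dst m (PP x) (PP y))"
    using local_injectivity BZ by blast
  from bchoice[OF this] obtain r where r: "\<And>z. z \<in> Z \<Longrightarrow> r z > 0"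
    "\<forall>z\<in>Z. \<exists>K\<ge>0. \<forall>x y. dst m x z < r z \<longrightarrow> dst m y z < r z \<longrightarrow> dst m x y \<le> K * dst m (PP x) (PP y)" by blast
  from bchoice[OF r(2)[unfolded Bex_def]] obtain L where L: "\<And>z. z \<in> Z \<Longrightarrow> L z \<ge> 0"
    "\<And>z x y. z \<in> Z \<Longrightarrow> dst m x z < r z \<Longrightarrow> dst m y z < r z \<Longrightarrow> dst m x y \<le> L z * dst m (PP x) (PP y)" by blast
  obtain \<eta> where eta: "\<eta> > 0" "\<And>z. z \<in> Z \<Longrightarrow> \<eta> \<le> r z" using finite_positive_lower_bound[of Z r, OF fZ r(1)] by blast
  obtain \<delta> where d: "\<delta> > 0" "\<And>\<rho>. dst m \<rho> \<rho>1 < \<delta> \<Longrightarrow>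
      \<exists>\<zeta>. bij_betw \<zeta> Z (fib \<rho>) \<and> (\<forall>z\<in>Z. dst m (\<zeta> z) z < \<eta>)"
    using local_cover[OF assms eta(1)] unfolding Z_def by blast
  have "\<exists>\<zeta>. bij_betw \<zeta> Z (fib \<rho>) \<and> (\<forall>z\<in>Z. dst m (\<zeta> z) z \<le> (\<Sum>z\<in>Z. L z) * dst m \<rho> \<rho>1)" if near: "dst m \<rho> \<rho>1 < \<delta>" for \<rho>
  proof -
    obtain \<zeta> where zeta: "bij_betw \<zeta> Z (fib \<rho>)" "\<And>z. z \<in> Z \<Longrightarrow> dst m (\<zeta> z) z < \<eta>" using d(2)[OF near] by blast
    have "dst m (\<zeta> z) z \<le> (\<Sum>z\<in>Z. L z) * dst m \<rho> \<rho>1" if z: "z \<in> Z" for z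
    proof -
      have "\<zeta> z \<in> fib \<rho>" using zeta(1) z by (auto simp: bij_betw_def)
      have "dst m (\<zeta> z) z \<le> L z * dst m (PP (\<zeta> z)) (PP z)"
        using zeta(2)[OF z] eta(2)[OF z] r(1)[OF z] by (intro L(2) z) auto
      also have "dst m (PP (\<zeta> z)) (PP z) = dst m \<rho> \<rho>1"
        using dst_PP_fib[OF \<open>\<zeta> z \<in> fib \<rho>\<close>] dst_PP_fib'[of z \<rho>1] z by (simp add: Z_def)
      also have "L z * dst m \<rho> \<rho>1 \<le> (\<Sum>z\<in>Z. L z) * dst m \<rho> \<rho>1"
        using z fZ L(1) by (intro mult_right_mono member_le_sum) auto
      finally show ?thesis .
    qed
    then show ?thesis using zeta(1) by blast
  qed
  moreover have "(\<Sum>z\<in>Z. L z) \<ge> 0" using L(1) by (rule sum_nonneg)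
  ultimately show ?thesis using d(1) unfolding Z_def by blast
qed

definition line :: "(nat \<Rightarrow> complex) \<Rightarrow> (nat \<Rightarrow> complex) \<Rightarrow> complex \<Rightarrow> nat \<Rightarrow> complex"
  where "line a v t = (\<lambda>i. a i + t * v i)"

definition bad :: "(nat \<Rightarrow> complex) \<Rightarrow> (nat \<Rightarrow> complex) \<Rightarrow> complex set"
  where "bad a v = {t. G (line a v t) = 0}"

lemma line_0 [simp]: "line a v 0 = a" by (simp add: line_def)

lemma dst_line: "dst m (line a v s) (line a v t) = cmod (s - t) * nr m v"
  using nr_scale[of m "s - t" v] by (simp add: dst_def line_def algebra_simps)

lemma finite_bad: "G a \<noteq> 0 \<Longrightarrow> finite (bad a v)"
  unfolding bad_def line_def by (rule pfun_finite_zeros_on_line[OF G(1), of _ 0]) simp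

lemma eventually_line:
  assumes "\<delta> > 0" shows "\<forall>\<^sub>F t in nhds t0. dst m (line a v t) (line a v t0) < \<delta>"
proof -
  have "((\<lambda>t. cmod (t - t0) * nr m v) \<longlongrightarrow> cmod (t0 - t0) * nr m v) (nhds t0)"
    by (intro tendsto_intros filterlim_ident)
  then show ?thesis unfolding dst_line using assms by (intro order_tendstoD(2)) auto
qed

text \<open>A complex line minus finitely many points is connected, and the number is locally constant.\<close>

lemma card_fib_constant:
  assumes "G \<rho>1 \<noteq> 0" "G \<rho>2 \<noteq> 0" shows "card (fib \<rho>1) = card (fib \<rho>2)"
proof -
  let ?v = "\<lambda>i. \<rho>2 i - \<rho>1 i"
  define S where "S = UNIV - bad \<rho>1 ?v"
  have "connected S" unfolding S_def
    by (rule connected_open_delete_finite) (auto simp: finite_bad assms)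
  moreover have l1: "line \<rho>1 ?v 1 = \<rho>2" by (simp add: line_def)
  then have "0 \<in> S" "1 \<in> S" using assms by (auto simp: S_def bad_def)
  moreover have "\<forall>t\<in>S. \<forall>\<^sub>F s in at t within S. card (fib (line \<rho>1 ?v t)) = card (fib (line \<rho>1 ?v s))"
  proof
    fix t assume "t \<in> S"
    then have "G (line \<rho>1 ?v t) \<noteq> 0" by (simp add: S_def bad_def)
    from local_cover[OF this, of 1] obtain \<delta> where d: "\<delta> > 0"
      "\<And>\<rho>. dst m \<rho> (line \<rho>1 ?v t) < \<delta> \<Longrightarrow> \<exists>\<zeta>. bij_betw \<zeta> (fib (line \<rho>1 ?v t)) (fib \<rho>)" by force
    have "\<forall>\<^sub>F s in nhds t. dst m (line \<rho>1 ?v s) (line \<rho>1 ?v t) < \<delta>" by (rule eventually_line[OF d(1)])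
    then have "\<forall>\<^sub>F s in nhds t. card (fib (line \<rho>1 ?v t)) = card (fib (line \<rho>1 ?v s))"
      by eventually_elim (use d(2) bij_betw_same_card in blast)
    then show "\<forall>\<^sub>F s in at t within S. card (fib (line \<rho>1 ?v t)) = card (fib (line \<rho>1 ?v s))"
      by (simp add: eventually_at_filter eventually_mono)
  qed
  ultimately have "card (fib (line \<rho>1 ?v 0)) = card (fib (line \<rho>1 ?v 1))"
    using connected_local_const[of S 0 1 "\<lambda>t. card (fib (line \<rho>1 ?v t))"] by blast
  then show ?thesis by (simp add: l1)
qed

text \<open>The norm of \<open>f\<close>, as for a finite extension of function fields.\<close>

definition norm_fib :: "((nat \<Rightarrow> complex) \<Rightarrow> complex) \<Rightarrow> (nat \<Rightarrow> complex) \<Rightarrow> complex"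
  where "norm_fib f \<rho> = (\<Prod>z\<in>fib \<rho>. f z)"

text \<open>Near \<open>t0\<close> the norm is the product of the values of \<open>f\<close> at points that move with \<open>t\<close>; by
  \<open>strict_inverse\<close> each of them has the velocity \<open>M v\<close> at \<open>t0\<close>.\<close>

lemma norm_fib_differentiable:
  assumes f: "pfun m d f" and t0: "G (line a v t0) \<noteq> 0"
  shows "(\<lambda>t. norm_fib f (line a v t)) field_differentiable (at t0)"
proof -
  let ?\<rho> = "line a v"
  define Z where "Z = fib (?\<rho> t0)"
  have Zc: "z \<in> cspace m" if "z \<in> Z" for z using that by (auto simp: Z_def fib_def)
  have fZ: "finite Z" unfolding Z_def by (rule finite_fib[OF t0])
  have BZ: "B0 z \<noteq> 0" if "z \<in> Z" for z using B0_fib[OF _ t0] that by (auto simp: Z_def)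
  obtain K \<delta> where K: "K \<ge> 0" and d: "\<delta> > 0" "\<And>\<rho>. dst m \<rho> (?\<rho> t0) < \<delta> \<Longrightarrow>
      \<exists>\<zeta>. bij_betw \<zeta> Z (fib \<rho>) \<and> (\<forall>z\<in>Z. dst m (\<zeta> z) z \<le> K * dst m \<rho> (?\<rho> t0))"
    using local_cover_lipschitz[OF t0] unfolding Z_def by blast
  have "\<forall>t. \<exists>\<zeta>. dst m (?\<rho> t) (?\<rho> t0) < \<delta> \<longrightarrow> bij_betw \<zeta> Z (fib (?\<rho> t)) \<and> (\<forall>z\<in>Z. dst m (\<zeta> z) z \<le> K * dst m (?\<rho> t) (?\<rho> t0))"
    using d(2) by blast
  from choice[OF this] obtain \<zeta> where zeta: "\<And>t. dst m (?\<rho> t) (?\<rho> t0) < \<delta> \<Longrightarrow> bij_betw (\<zeta> t) Z (fib (?\<rho> t))"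
    "\<And>t z. dst m (?\<rho> t) (?\<rho> t0) < \<delta> \<Longrightarrow> z \<in> Z \<Longrightarrow> dst m (\<zeta> t z) z \<le> K * dst m (?\<rho> t) (?\<rho> t0)" by blast
  have near: "\<forall>\<^sub>F t in nhds t0. dst m (?\<rho> t) (?\<rho> t0) < \<delta>" by (rule eventually_line[OF d(1)])
  have fibz: "\<zeta> t z \<in> fib (?\<rho> t)" if "dst m (?\<rho> t) (?\<rho> t0) < \<delta>" "z \<in> Z" for t z
    using zeta(1)[OF that(1)] that(2) by (auto simp: bij_betw_def)
  have diff: "(\<lambda>t. f (\<zeta> t z)) field_differentiable (at t0)" if z: "z \<in> Z" for z
  proof -
    have lip: "dst m (\<zeta> t z) z \<le> K * nr m v * cmod (t - t0)" if "dst m (?\<rho> t) (?\<rho> t0) < \<delta>" for t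
      using zeta(2)[OF that z] by (simp add: dst_line mult_ac)
    have z0: "\<zeta> t0 z = z"
    proof -
      have 0: "dst m (?\<rho> t0) (?\<rho> t0) < \<delta>" using d(1) by simp
      from lip[OF 0] have "dst m (\<zeta> t0 z) z = 0" using dst_nonneg[of m "\<zeta> t0 z" z] by simp
      then show ?thesis using fibz[OF 0 z] Zc[OF z] by (intro dst_0_eq) (auto simp: fib_def)
    qed
    obtain M where M: "\<forall>\<epsilon>>0. \<exists>\<delta>>0. \<forall>x y. dst m x z < \<delta> \<longrightarrow> dst m y z < \<delta> \<longrightarrow>
        nr m (\<lambda>i. x i - y i - (\<Sum>j\<in>{1..m}. M i j * (P j x - P j y))) \<le> \<epsilon> * dst m x y"
      using strict_inverse[OF BZ[OF z]] by (elim exE conjE)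
    \<comment> \<open>The velocity of the point of the fibre that is \<open>z\<close> at \<open>t0\<close>.\<close>
    define u where "u = (\<lambda>i. \<Sum>j\<in>{1..m}. M i j * v j)"
    have dz: "((\<lambda>t. dst m (\<zeta> t z) z) \<longlongrightarrow> 0) (at t0)"
    proof (rule Lim_null_comparison)
      have "\<forall>\<^sub>F t in nhds t0. norm (dst m (\<zeta> t z) z) \<le> K * nr m v * cmod (t - t0)"
        using near by eventually_elim (use lip in auto)
      then show "\<forall>\<^sub>F t in at t0. norm (dst m (\<zeta> t z) z) \<le> K * nr m v * cmod (t - t0)"
        by (simp add: eventually_at_filter eventually_mono)
      have "((\<lambda>t. K * nr m v * cmod (t - t0)) \<longlongrightarrow> K * nr m v * cmod (t0 - t0)) (at t0)"
        by (intro tendsto_intros)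
      then show "((\<lambda>t. K * nr m v * cmod (t - t0)) \<longlongrightarrow> 0) (at t0)" by simp
    qed
    have coord: "((\<lambda>t. (\<zeta> t z i - z i) / (t - t0)) \<longlongrightarrow> u i) (at t0)" if i: "i \<in> {1..m}" for i
    proof (rule tendstoI)
      fix e :: real assume e: "e > 0"
      define \<epsilon> where "\<epsilon> = e / (2 * (K * nr m v + 1))"
      have Kv: "K * nr m v + 1 > 0" using K by (simp add: add_nonneg_pos)
      have ep: "\<epsilon> > 0" using e Kv by (simp add: \<epsilon>_def)
      obtain \<delta>' where d': "\<delta>' > 0" "\<And>x y. dst m x z < \<delta>' \<Longrightarrow> dst m y z < \<delta>' \<Longrightarrow>
        nr m (\<lambda>i. x i - y i - (\<Sum>j\<in>{1..m}. M i j * (P j x - P j y))) \<le> \<epsilon> * dst m x y"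
        using M[rule_format, OF ep] by blast
      have "\<forall>\<^sub>F t in at t0. dst m (\<zeta> t z) z < \<delta>'" using order_tendstoD(2)[OF dz] d'(1) by blast
      moreover have "\<forall>\<^sub>F t in at t0. dst m (?\<rho> t) (?\<rho> t0) < \<delta>" using near by (simp add: eventually_at_filter eventually_mono)
      moreover have "\<forall>\<^sub>F t in at t0. t \<noteq> t0" by (simp add: eventually_at_filter)
      ultimately show "\<forall>\<^sub>F t in at t0. dist ((\<zeta> t z i - z i) / (t - t0)) (u i) < e"
      proof eventually_elim
        case (elim t)
        have "(\<Sum>j\<in>{1..m}. M i j * (P j (\<zeta> t z) - P j z)) = (\<Sum>j\<in>{1..m}. M i j * ((t - t0) * v j))"
        proof (intro sum.cong refl)
          fix j assume j: "j \<in> {1..m}"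
          have "P j (\<zeta> t z) = ?\<rho> t j" "P j z = ?\<rho> t0 j"
            using fibz[OF elim(2) z] z j by (auto simp: fib_def Z_def)
          then show "M i j * (P j (\<zeta> t z) - P j z) = M i j * ((t - t0) * v j)"
            by (simp add: line_def algebra_simps)
        qed
        then have eq: "(\<Sum>j\<in>{1..m}. M i j * (P j (\<zeta> t z) - P j z)) = (t - t0) * u i"
          by (simp add: u_def sum_distrib_left mult_ac)
        have "cmod (\<zeta> t z i - z i - (t - t0) * u i) \<le> nr m (\<lambda>i. \<zeta> t z i - z i - (\<Sum>j\<in>{1..m}. M i j * (P j (\<zeta> t z) - P j z)))"
          unfolding eq[symmetric] by (rule coord_le_nr[OF i])
        also have "\<dots> \<le> \<epsilon> * dst m (\<zeta> t z) z" using d'(1) by (intro d'(2) elim(1)) simp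
        also have "\<dots> \<le> \<epsilon> * (K * nr m v * cmod (t - t0))" using ep lip[OF elim(2)] by (intro mult_left_mono) auto
        also have "\<dots> \<le> \<epsilon> * ((K * nr m v + 1) * cmod (t - t0))" using ep by (intro mult_left_mono mult_right_mono) auto
        also have "\<dots> = e / 2 * cmod (t - t0)" unfolding \<epsilon>_def using Kv by (simp add: divide_simps)
        finally have le: "cmod (\<zeta> t z i - z i - (t - t0) * u i) \<le> e / 2 * cmod (t - t0)" .
        have "(\<zeta> t z i - z i) / (t - t0) - u i = (\<zeta> t z i - z i - (t - t0) * u i) / (t - t0)"
          using elim(3) by (simp add: field_simps)
        then have "dist ((\<zeta> t z i - z i) / (t - t0)) (u i) = cmod (\<zeta> t z i - z i - (t - t0) * u i) / cmod (t - t0)"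
          by (simp add: dist_norm norm_divide)
        also have "\<dots> \<le> e / 2" using le elim(3) by (simp add: divide_le_eq)
        finally show ?case using e by linarith
      qed
    qed
    obtain A where A: "hadamard m f A" using hadamard_pfun[OF f] by blast
    have fl: "filterlim (\<lambda>t. (\<zeta> t z, z)) (pair_nhds m z) (at t0)"
      unfolding filterlim_iff eventually_pair_nhds
    proof safe
      fix Q \<delta> assume "\<delta> > 0" and Q: "\<forall>x y. dst m x z < \<delta> \<longrightarrow> dst m y z < \<delta> \<longrightarrow> Q (x, y)"
      then have "\<forall>\<^sub>F t in at t0. dst m (\<zeta> t z) z < \<delta>" using order_tendstoD(2)[OF dz] by blast
      then show "\<forall>\<^sub>F t in at t0. Q (\<zeta> t z, z)"
        by eventually_elim (use Q \<open>\<delta> > 0\<close> in auto)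
    qed
    have Alim: "((\<lambda>t. A i (\<zeta> t z) z) \<longlongrightarrow> A i z z) (at t0)" if i: "i \<in> {1..m}" for i
    proof -
      have "((\<lambda>p. A i (fst p) (snd p)) \<longlongrightarrow> A i z z) (pair_nhds m z)" using A i by (auto simp: hadamard_def)
      from filterlim_compose[OF this fl] show ?thesis by simp
    qed
    have "((\<lambda>t. \<Sum>i\<in>{1..m}. A i (\<zeta> t z) z * ((\<zeta> t z i - z i) / (t - t0))) \<longlongrightarrow> (\<Sum>i\<in>{1..m}. A i z z * u i)) (at t0)"
      by (intro tendsto_sum tendsto_mult Alim coord)
    moreover have "(\<Sum>i\<in>{1..m}. A i (\<zeta> t z) z * ((\<zeta> t z i - z i) / (t - t0))) = (f (\<zeta> t z) - f (\<zeta> t0 z)) / (t - t0)" for t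
    proof -
      have "f (\<zeta> t z) - f z = (\<Sum>i\<in>{1..m}. A i (\<zeta> t z) z * (\<zeta> t z i - z i))" using A by (simp add: hadamard_def)
      then show ?thesis by (simp add: z0 sum_divide_distrib)
    qed
    ultimately have "((\<lambda>t. (f (\<zeta> t z) - f (\<zeta> t0 z)) / (t - t0)) \<longlongrightarrow> (\<Sum>i\<in>{1..m}. A i z z * u i)) (at t0)"
      by simp
    then have "((\<lambda>t. f (\<zeta> t z)) has_field_derivative (\<Sum>i\<in>{1..m}. A i z z * u i)) (at t0)"
      by (simp add: has_field_derivative_iff)
    then show ?thesis by (auto simp: field_differentiable_def)
  qed
  have "(\<lambda>t. \<Prod>z\<in>Y. f (\<zeta> t z)) field_differentiable (at t0)" if "Y \<subseteq> Z" for Y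
    using finite_subset[OF that fZ] that
    by (induction Y rule: finite_induct) (auto intro!: field_differentiable_mult diff)
  then obtain D where D: "((\<lambda>t. \<Prod>z\<in>Z. f (\<zeta> t z)) has_field_derivative D) (at t0)"
    by (auto simp: field_differentiable_def)
  have "\<forall>\<^sub>F t in nhds t0. (\<Prod>z\<in>Z. f (\<zeta> t z)) = norm_fib f (?\<rho> t)"
    using near
  proof eventually_elim
    case (elim t)
    show ?case unfolding norm_fib_def by (rule prod.reindex_bij_betw[OF zeta(1)[OF elim]])
  qed
  then have "((\<lambda>t. norm_fib f (?\<rho> t)) has_field_derivative D) (at t0)"
    using D DERIV_cong_ev[OF refl _ refl, of "\<lambda>t. \<Prod>z\<in>Z. f (\<zeta> t z)" "\<lambda>t. norm_fib f (?\<rho> t)" t0 D] by simp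
  then show ?thesis by (auto simp: field_differentiable_def)
qed

end

section \<open>The number of points of a fibre\<close>

lemma pfun_growth:
  assumes "pfun m D f"
  shows "\<exists>C\<ge>0. \<forall>x. cmod (f x) \<le> C * (1 + nr m x) ^ D"
proof -
  from assms obtain c where c: "f = (\<lambda>x. \<Sum>\<beta>\<in>mons m D. c \<beta> * monomial m \<beta> x)"
    by (auto simp: pfun_def)
  have mon: "cmod (monomial m \<beta> x) \<le> (1 + nr m x) ^ D" if b: "\<beta> \<in> mons m D" for \<beta> x
  proof -
    have "cmod (monomial m \<beta> x) = (\<Prod>i\<in>{1..m}. cmod (x i) ^ \<beta> i)"
      by (simp add: monomial_def prod_norm[symmetric] norm_power)
    also have "\<dots> \<le> (\<Prod>i\<in>{1..m}. (1 + nr m x) ^ \<beta> i)"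
    proof (intro prod_mono conjI power_mono)
      fix i assume i: "i \<in> {1..m}"
      show "cmod (x i) \<le> 1 + nr m x" using coord_le_nr[OF i, of x] by linarith
    qed auto
    also have "\<dots> = (1 + nr m x) ^ (\<Sum>i\<in>{1..m}. \<beta> i)" by (simp add: power_sum)
    also have "\<dots> \<le> (1 + nr m x) ^ D" using b by (intro power_increasing) (auto simp: mons_def)
    finally show ?thesis .
  qed
  show ?thesis
  proof (intro exI[of _ "\<Sum>\<beta>\<in>mons m D. cmod (c \<beta>)"] conjI allI)
    fix x
    have "cmod (f x) \<le> (\<Sum>\<beta>\<in>mons m D. cmod (c \<beta> * monomial m \<beta> x))" unfolding c by (rule norm_sum)
    also have "\<dots> \<le> (\<Sum>\<beta>\<in>mons m D. cmod (c \<beta>) * (1 + nr m x) ^ D)"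
      unfolding norm_mult by (intro sum_mono mult_left_mono mon) auto
    finally show "cmod (f x) \<le> (\<Sum>\<beta>\<in>mons m D. cmod (c \<beta>)) * (1 + nr m x) ^ D"
      by (simp add: sum_distrib_right)
  qed (auto intro: sum_nonneg)
qed

text \<open>A generic power vector is a linear form that separates finitely many given points.\<close>

lemma separating_linear_form:
  assumes "finite T" "T \<subseteq> cspace m"
  shows "\<exists>\<theta>. pfun m 1 \<theta> \<and> inj_on \<theta> T"
proof -
  define p where "p = (\<lambda>x::nat\<Rightarrow>complex. \<Sum>i\<in>{1..m}. monom (x i) i)"
  have co: "coeff (p x) i = x i" if "i \<in> {1..m}" for x i
    using that by (simp add: p_def coeff_sum)
  have "finite (\<Union>q\<in>{q\<in>T \<times> T. fst q \<noteq> snd q}. {t. poly (p (fst q) - p (snd q)) t = 0})"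
  proof (intro finite_UN_I)
    show "finite {q\<in>T \<times> T. fst q \<noteq> snd q}" using assms(1) by simp
    fix q assume q: "q \<in> {q\<in>T \<times> T. fst q \<noteq> snd q}"
    have "p (fst q) \<noteq> p (snd q)"
    proof
      assume e: "p (fst q) = p (snd q)"
      have "fst q i = snd q i" for i
      proof (cases "i \<in> {1..m}")
        case True then show ?thesis using co e by metis
      next
        case False
        have "fst q \<in> cspace m" "snd q \<in> cspace m" using q assms(2) by auto
        then show ?thesis using False by (simp add: cspace_def)
      qed
      then have "fst q = snd q" by (rule ext)
      then show False using q by simp
    qed
    then show "finite {t. poly (p (fst q) - p (snd q)) t = 0}" by (intro poly_roots_finite) simp
  qed
  then obtain t where t: "t \<notin> (\<Union>q\<in>{q\<in>T \<times> T. fst q \<noteq> snd q}. {t. poly (p (fst q) - p (snd q)) t = 0})"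
    using ex_new_if_finite[OF infinite_UNIV_char_0] by blast
  show ?thesis
  proof (intro exI conjI)
    show "pfun m 1 (\<lambda>x. \<Sum>i\<in>{1..m}. t ^ i * x i)"
      by (intro pfun_sum pfun_cmult pfun_coord) auto
    have eq: "poly (p x) t = (\<Sum>i\<in>{1..m}. t ^ i * x i)" for x
      by (simp add: p_def poly_sum poly_monom mult.commute)
    show "inj_on (\<lambda>x. \<Sum>i\<in>{1..m}. t ^ i * x i) T"
    proof (rule inj_onI, rule ccontr)
      fix x y assume xy: "x \<in> T" "y \<in> T" "(\<Sum>i\<in>{1..m}. t ^ i * x i) = (\<Sum>i\<in>{1..m}. t ^ i * y i)" "x \<noteq> y"
      have "(x, y) \<in> {q\<in>T \<times> T. fst q \<noteq> snd q}" using xy by simp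
      moreover have "t \<in> {t. poly (p (fst (x, y)) - p (snd (x, y))) t = 0}" using xy(3) by (simp add: eq)
      ultimately show False using t by blast
    qed
  qed
qed

text \<open>By Liouville \<open>h\<close> is a polynomial of degree at most \<open>N\<close>, and by Cauchy's inequality its coefficients
  up to degree \<open>N\<close> vanish.\<close>

lemma entire_eq_0_if_growth_below_vanishing:
  assumes h: "h holomorphic_on UNIV" and B: "\<And>t. cmod (h t) \<le> B * (1 + cmod t) ^ N"
    and d: "\<delta> > 0" and C: "\<And>t. cmod t < \<delta> \<Longrightarrow> cmod (h t) \<le> C * cmod t ^ Suc N"
  shows "h t = 0"
proof -
  have "h t = (\<Sum>k\<le>N. (deriv ^^ k) h 0 / fact k * t ^ k)"
  proof (rule Liouville_polynomial[OF h])
    fix z :: complex assume z: "1 \<le> cmod z"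
    have "0 \<le> B * (1 + cmod 0) ^ N" using B[of 0] norm_ge_zero[of "h 0"] by linarith
    then have "B \<ge> 0" by simp
    have "cmod (h z) \<le> B * (1 + cmod z) ^ N" by (rule B)
    also have "\<dots> \<le> B * (2 * cmod z) ^ N" using z \<open>B \<ge> 0\<close> by (intro mult_left_mono power_mono) auto
    finally show "cmod (h z) \<le> B * 2 ^ N * cmod z ^ N" by (simp add: power_mult_distrib)
  qed
  moreover have "(deriv ^^ k) h 0 = 0" if k: "k \<le> N" for k
  proof -
    define C' where "C' = max C 0"
    have le: "cmod ((deriv ^^ k) h 0) \<le> fact k * C' * r" if r: "0 < r" "r < min \<delta> 1" for r
    proof -
      have "cmod ((deriv ^^ k) h 0) \<le> fact k * (C' * r ^ Suc N) / r ^ k"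
      proof (rule Cauchy_inequality)
        show "h holomorphic_on ball 0 r" using h holomorphic_on_subset by blast
        show "continuous_on (cball 0 r) h" using h holomorphic_on_imp_continuous_on continuous_on_subset by blast
        fix x :: complex assume x: "cmod (0 - x) = r"
        then have "cmod (h x) \<le> C * cmod x ^ Suc N" using r by (intro C) simp
        also have "\<dots> \<le> C' * cmod x ^ Suc N" by (intro mult_right_mono) (auto simp: C'_def)
        finally show "cmod (h x) \<le> C' * r ^ Suc N" using x by simp
      qed (use r in auto)
      also have "r ^ Suc N = r ^ k * r ^ (Suc N - k)" using k by (simp add: power_add[symmetric])
      also have "fact k * (C' * (r ^ k * r ^ (Suc N - k))) / r ^ k = fact k * C' * r ^ (Suc N - k)" using r by simp
      also have "\<dots> \<le> fact k * C' * r ^ 1"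
        using r k by (intro mult_left_mono power_decreasing) (auto simp: C'_def)
      finally show ?thesis by simp
    qed
    have "((\<lambda>r. fact k * C' * r) \<longlongrightarrow> fact k * C' * 0) (at_right 0)"
      by (intro tendsto_mult tendsto_const tendsto_ident_at)
    moreover have "\<forall>\<^sub>F r in at_right 0. cmod ((deriv ^^ k) h 0) \<le> fact k * C' * r"
      unfolding eventually_at_right_field using le d by (intro exI[of _ "min \<delta> 1"]) auto
    ultimately have "cmod ((deriv ^^ k) h 0) \<le> fact k * C' * 0"
      by (intro tendsto_lowerbound[where F = "at_right (0::real)"]) auto
    then show ?thesis by simp
  qed
  ultimately show ?thesis by simp
qed

context homogeneous_map
begin

lemma PP_continuous:
  assumes "\<epsilon> > 0" shows "\<exists>\<delta>>0. \<forall>x. dst m x z < \<delta> \<longrightarrow> dst m (PP x) (PP z) < \<epsilon>"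
proof -
  have "((\<lambda>p. \<Sum>j\<in>{1..m}. cmod (P j (fst p) - P j z)) \<longlongrightarrow> (\<Sum>j\<in>{1..m}. cmod (P j z - P j z))) (pair_nhds m z)"
    by (intro tendsto_sum tendsto_norm tendsto_diff tendsto_const tendsto_pair_pfun(1)[OF P])
  then have "\<forall>\<^sub>F p in pair_nhds m z. (\<Sum>j\<in>{1..m}. cmod (P j (fst p) - P j z)) < \<epsilon>"
    using assms by (intro order_tendstoD(2)) auto
  then obtain \<delta> where d: "\<delta> > 0" "\<And>x y. dst m x z < \<delta> \<Longrightarrow> dst m y z < \<delta> \<Longrightarrow> (\<Sum>j\<in>{1..m}. cmod (P j x - P j z)) < \<epsilon>"
    unfolding eventually_pair_nhds by auto
  show ?thesis
  proof (intro exI[of _ \<delta>] conjI allI impI d(1))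
    fix x assume "dst m x z < \<delta>"
    from d(2)[OF this this] show "dst m (PP x) (PP z) < \<epsilon>" by (simp add: dst_def nr_def PP_def)
  qed
qed

lemma pfun_comp_PP: "pfun m d g \<Longrightarrow> pfun m (d * n) (\<lambda>x. g (PP x))"
  unfolding PP_def by (rule pfun_comp[OF _ P])

text \<open>The image has interior points, hence lies in no hypersurface.\<close>

lemma nonzero_comp_PP:
  assumes "pfun m d g" "g b \<noteq> 0" shows "\<exists>x\<in>cspace m. g (PP x) \<noteq> 0"
proof -
  obtain x0 where "B0 x0 \<noteq> 0" using B0 by blast
  then obtain z where z: "z \<in> cspace m" "B0 z \<noteq> 0"
    using pfun_nonzero_dense[OF B0(1), of x0 "\<lambda>_. 0" 1] by (auto simp: cspace_def)
  obtain \<delta> where d: "\<delta> > 0" "\<And>\<rho>. dst m \<rho> (PP z) < \<delta> \<Longrightarrow> \<exists>x\<in>fib \<rho>. dst m x z < 1"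
    using local_surjectivity[OF z(2,1), of 1] by auto
  define \<rho>0 where "\<rho>0 = (\<lambda>j. if j \<in> {1..m} then PP z j else 0)"
  have eq: "dst m \<rho> \<rho>0 = dst m \<rho> (PP z)" for \<rho>
    unfolding dst_def nr_def by (intro sum.cong) (auto simp: \<rho>0_def)
  have "\<rho>0 \<in> cspace m" by (simp add: cspace_def \<rho>0_def)
  then obtain \<rho> where rho: "dst m \<rho> \<rho>0 < \<delta>" "g \<rho> \<noteq> 0"
    using pfun_nonzero_dense[OF assms _ d(1)] by blast
  then obtain x where x: "x \<in> fib \<rho>" using d(2)[of \<rho>] eq by auto
  have "g (PP x) = g \<rho>" using x by (intro pfun_cong[OF assms(1)]) (auto simp: PP_def fib_def)
  then have "g (PP x) \<noteq> 0" using rho(2) by simp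
  then show ?thesis using x unfolding fib_def by blast
qed

text \<open>As \<open>\<rho>\<close> grows like the \<open>n\<close>-th power of the points of its fibre, degree \<open>n * d\<close> in the points means
  degree \<open>d\<close> in \<open>\<rho>\<close>.\<close>

lemma fib_growth:
  assumes "pfun m (n * d) f"
  shows "\<exists>C\<ge>1. \<forall>\<rho>. \<forall>z\<in>fib \<rho>. cmod (f z) \<le> C * (1 + nr m \<rho>) ^ d"
proof -
  obtain C0 where C0: "C0 \<ge> 0" "\<And>x. cmod (f x) \<le> C0 * (1 + nr m x) ^ (n * d)"
    using pfun_growth[OF assms] by blast
  define C1 where "C1 = 2 ^ n * (1 + growth_const)"
  have C1: "C1 \<ge> 0" using growth_const(1) by (simp add: C1_def)
  have main: "cmod (f z) \<le> C0 * C1 ^ d * (1 + nr m \<rho>) ^ d" if z: "z \<in> fib \<rho>" for \<rho> z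
  proof -
    have "(1 + nr m z) ^ n \<le> (2 * max 1 (nr m z)) ^ n" by (intro power_mono) auto
    also have "\<dots> = 2 ^ n * max 1 (nr m z) ^ n" by (simp add: power_mult_distrib)
    also have "max 1 (nr m z) ^ n \<le> 1 + nr m z ^ n" by (auto simp: max_def)
    also have "nr m z ^ n \<le> growth_const * nr m \<rho>" by (rule growth_const(2)[OF z])
    also have "1 + growth_const * nr m \<rho> \<le> (1 + growth_const) * (1 + nr m \<rho>)" using growth_const(1) nr_nonneg[of m \<rho>] by (simp add: algebra_simps)
    finally have "(1 + nr m z) ^ n \<le> C1 * (1 + nr m \<rho>)" by (simp add: C1_def mult.assoc)
    then have "((1 + nr m z) ^ n) ^ d \<le> (C1 * (1 + nr m \<rho>)) ^ d" by (intro power_mono) auto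
    then have "(1 + nr m z) ^ (n * d) \<le> C1 ^ d * (1 + nr m \<rho>) ^ d" by (simp add: power_mult power_mult_distrib)
    then have "C0 * (1 + nr m z) ^ (n * d) \<le> C0 * (C1 ^ d * (1 + nr m \<rho>) ^ d)" using C0(1) by (rule mult_left_mono)
    then show ?thesis using C0(2)[of z] by (simp add: mult.assoc)
  qed
  show ?thesis
  proof (intro exI[of _ "max 1 (C0 * C1 ^ d)"] conjI allI ballI)
    fix \<rho> z assume z: "z \<in> fib \<rho>"
    have "C0 * C1 ^ d * (1 + nr m \<rho>) ^ d \<le> max 1 (C0 * C1 ^ d) * (1 + nr m \<rho>) ^ d"
      by (intro mult_right_mono) auto
    then show "cmod (f z) \<le> max 1 (C0 * C1 ^ d) * (1 + nr m \<rho>) ^ d" using main[OF z] by linarith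
  qed simp
qed

end

context generic_homogeneous_map
begin

definition generic_card :: nat where "generic_card = card (fib (SOME \<rho>. G \<rho> \<noteq> 0))"

lemma card_fib_generic: "G \<rho> \<noteq> 0 \<Longrightarrow> card (fib \<rho>) = generic_card"
  unfolding generic_card_def using someI_ex[OF G(2)] by (intro card_fib_constant)

lemma generic_card_pos: "generic_card > 0"
proof -
  obtain \<rho>0 where "G \<rho>0 \<noteq> 0" using G(2) by blast
  from nonzero_comp_PP[OF G(1) this] obtain x where x: "x \<in> cspace m" "G (PP x) \<noteq> 0" by blast
  then have "x \<in> fib (PP x)" by (simp add: fib_def PP_def)
  then have "card (fib (PP x)) > 0" using finite_fib[OF x(2)] card_gt_0_iff by blast
  then show ?thesis using card_fib_generic[OF x(2)] by simp
qed

lemma norm_fib_bound: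
  assumes "C \<ge> 1" "\<And>\<rho> z. z \<in> fib \<rho> \<Longrightarrow> cmod (f z) \<le> C * (1 + nr m \<rho>) ^ d" "G \<rho> \<noteq> 0"
  shows "cmod (norm_fib f \<rho>) \<le> C ^ generic_card * (1 + nr m \<rho>) ^ (d * generic_card)"
proof -
  have "cmod (norm_fib f \<rho>) = (\<Prod>z\<in>fib \<rho>. cmod (f z))" by (simp add: norm_fib_def prod_norm[symmetric])
  also have "\<dots> \<le> (\<Prod>z\<in>fib \<rho>. C * (1 + nr m \<rho>) ^ d)" using assms(2) by (intro prod_mono) auto
  also have "\<dots> = C ^ generic_card * (1 + nr m \<rho>) ^ (d * generic_card)" using card_fib_generic[OF assms(3)] by (simp add: power_mult_distrib power_mult)
  finally show ?thesis .
qed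

text \<open>The norm is locally bounded, so that its finitely many singularities on a line are
  removable. The bound extends to them by continuity.\<close>

lemma norm_fib_line:
  assumes f: "pfun m D f" and C: "C \<ge> 1" "\<And>\<rho> z. z \<in> fib \<rho> \<Longrightarrow> cmod (f z) \<le> C * (1 + nr m \<rho>) ^ d"
    and a: "G a \<noteq> 0"
  shows "\<exists>h. h holomorphic_on UNIV \<and> (\<forall>t. G (line a v t) \<noteq> 0 \<longrightarrow> h t = norm_fib f (line a v t)) \<and>
    (\<forall>t. cmod (h t) \<le> C ^ generic_card * (1 + nr m (line a v t)) ^ (d * generic_card))"
proof -
  let ?N = "\<lambda>t. norm_fib f (line a v t)"
  let ?b = "\<lambda>t. C ^ generic_card * (1 + nr m (line a v t)) ^ (d * generic_card)"
  have fb: "finite (bad a v)" by (rule finite_bad[OF a])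
  have "\<exists>h. h holomorphic_on UNIV \<and> (\<forall>t\<in>UNIV - bad a v. h t = ?N t)"
  proof (rule removable_singularities[OF fb])
    show "?N holomorphic_on UNIV - bad a v"
      unfolding holomorphic_on_def
      using norm_fib_differentiable[OF f] by (auto simp: bad_def intro: field_differentiable_at_within)
    fix z assume "z \<in> bad a v"
    have "\<forall>\<^sub>F t in nhds z. t \<in> - (bad a v - {z})"
      using fb by (intro eventually_nhds_in_open open_Compl finite_imp_closed) auto
    then have "\<forall>\<^sub>F t in at z. t \<notin> bad a v"
      unfolding eventually_at_filter by eventually_elim auto
    moreover have "\<forall>\<^sub>F t in at z. dst m (line a v t) (line a v z) < 1"
      using eventually_line[of 1 a v z] by (simp add: eventually_at_filter eventually_mono)
    ultimately have "\<forall>\<^sub>F t in at z. cmod (?N t) \<le> C ^ generic_card * (2 + nr m (line a v z)) ^ (d * generic_card) * norm (1::complex)"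
    proof eventually_elim
      case (elim t)
      have "cmod (?N t) \<le> ?b t" using elim(1) by (intro norm_fib_bound[OF C]) (simp_all add: bad_def)
      also have "\<dots> \<le> C ^ generic_card * (2 + nr m (line a v z)) ^ (d * generic_card)"
        using nr_le_dst[of m "line a v t" "line a v z"] elim(2) C(1) by (intro mult_left_mono power_mono) auto
      finally show ?case by simp
    qed
    then show "?N \<in> O[at z](\<lambda>_. 1)" by (rule bigoI)
  qed auto
  then obtain h where h: "h holomorphic_on UNIV" "\<And>t. t \<notin> bad a v \<Longrightarrow> h t = ?N t" by blast
  have "- bad a v \<subseteq> {t. cmod (h t) \<le> ?b t}"
    using h(2) norm_fib_bound[OF C] by (auto simp: bad_def)
  moreover have "closed {t. cmod (h t) \<le> ?b t}"
  proof (rule closed_Collect_le)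
    show "continuous_on UNIV (\<lambda>t. cmod (h t))" using h(1) by (intro continuous_on_norm holomorphic_on_imp_continuous_on)
    show "continuous_on UNIV ?b" unfolding nr_def line_def by (intro continuous_intros)
  qed
  ultimately have "closure (- bad a v) \<subseteq> {t. cmod (h t) \<le> ?b t}" by (rule closure_minimal)
  moreover have "closure (- bad a v) = UNIV" using fb by (simp add: closure_complement empty_interior_finite)
  ultimately have "cmod (h t) \<le> ?b t" for t by blast
  then show ?thesis using h by (intro exI[of _ h]) (auto simp: bad_def)
qed

text \<open>The norm is bounded on bounded sets. On the line through two generic points at distance of order
  \<open>\<delta>\<close>, parametrized such that they correspond to \<open>0\<close> and \<open>1\<close>, the bound \<open>B\<close> holds on a disc of radius
  \<open>1 / \<delta>\<close>, so by Cauchy's inequality the derivative between them is of order \<open>B * \<delta>\<close>.\<close>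

lemma norm_fib_Cauchy:
  assumes f: "pfun m D f" and eps: "\<epsilon> > 0"
  shows "\<exists>\<delta>>0. \<forall>a b. G a \<noteq> 0 \<longrightarrow> G b \<noteq> 0 \<longrightarrow> dst m a \<rho>0 < \<delta> \<longrightarrow> dst m b \<rho>0 < \<delta> \<longrightarrow>
    cmod (norm_fib f a - norm_fib f b) < \<epsilon>"
proof -
  have "D \<le> n * D" using n by simp
  then have "pfun m (n * D) f" using f pfun_mono by blast
  from fib_growth[OF this] obtain C where C: "C \<ge> 1" "\<And>\<rho> z. z \<in> fib \<rho> \<Longrightarrow> cmod (f z) \<le> C * (1 + nr m \<rho>) ^ D" by blast
  define B where "B = C ^ generic_card * (4 + nr m \<rho>0) ^ (D * generic_card)"
  have B: "B > 0" using C(1) nr_nonneg[of m \<rho>0] by (simp add: B_def add_pos_nonneg)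
  define \<delta> where "\<delta> = min (1/2) (\<epsilon> / (4 * B))"
  have d: "\<delta> > 0" "\<delta> \<le> 1/2" "4 * B * \<delta> \<le> \<epsilon>"
  proof -
    show "\<delta> > 0" "\<delta> \<le> 1/2" using eps B by (auto simp: \<delta>_def)
    have "4 * B * \<delta> \<le> 4 * B * (\<epsilon> / (4 * B))" using B by (intro mult_left_mono) (auto simp: \<delta>_def)
    also have "\<dots> = \<epsilon>" using B by simp
    finally show "4 * B * \<delta> \<le> \<epsilon>" .
  qed
  define r where "r = 1 / \<delta> - 1"
  have r: "r > 0" "1 / r \<le> 2 * \<delta>" using d by (auto simp: r_def field_simps)
  have "cmod (norm_fib f a - norm_fib f b) < \<epsilon>"
    if a: "G a \<noteq> 0" and b: "G b \<noteq> 0" and ad: "dst m a \<rho>0 < \<delta>" and bd: "dst m b \<rho>0 < \<delta>" for a b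
  proof -
    define v where "v = (\<lambda>i. b i - a i)"
    have l1: "line a v 1 = b" by (simp add: line_def v_def)
    obtain h where h: "h holomorphic_on UNIV" "\<And>t. G (line a v t) \<noteq> 0 \<Longrightarrow> h t = norm_fib f (line a v t)"
      "\<And>t. cmod (h t) \<le> C ^ generic_card * (1 + nr m (line a v t)) ^ (D * generic_card)"
      using norm_fib_line[OF f C a, of v] by blast
    have nv: "nr m v \<le> 2 * \<delta>"
    proof -
      have "nr m v = dst m b a" by (simp add: dst_def v_def)
      also have "\<dots> \<le> dst m b \<rho>0 + dst m a \<rho>0" using dst_triangle[of m b a \<rho>0] by (simp add: dst_sym[of m \<rho>0 a])
      finally show ?thesis using ad bd by linarith
    qed
    have hB: "cmod (h t) \<le> B" if t: "cmod t \<le> 1 / \<delta>" for t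
    proof -
      have "dst m (line a v t) a = cmod t * nr m v" using dst_line[of a v t 0] by simp
      also have "\<dots> \<le> 1 / \<delta> * (2 * \<delta>)" using t nv d by (intro mult_mono) auto
      also have "\<dots> = 2" using d by simp
      finally have "nr m (line a v t) \<le> nr m \<rho>0 + 3"
        using nr_le_dst[of m "line a v t" a] nr_le_dst[of m a \<rho>0] ad d(2) by linarith
      then have "C ^ generic_card * (1 + nr m (line a v t)) ^ (D * generic_card) \<le> B"
        unfolding B_def using C(1) by (intro mult_left_mono power_mono) auto
      then show ?thesis using h(3)[of t] by linarith
    qed
    have der: "cmod (deriv h t) \<le> 2 * B * \<delta>" if t: "cmod t \<le> 1" for t
    proof -
      have "cmod ((deriv ^^ 1) h t) \<le> fact 1 * B / r ^ 1"
      proof (rule Cauchy_inequality)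
        show "h holomorphic_on ball t r" using h holomorphic_on_subset by blast
        show "continuous_on (cball t r) h" using h holomorphic_on_imp_continuous_on continuous_on_subset by blast
        fix x assume "cmod (t - x) = r"
        moreover have "cmod x \<le> cmod t + cmod (t - x)" by (metis norm_minus_commute norm_triangle_sub)
        ultimately have "cmod x \<le> 1 / \<delta>" using t by (simp add: r_def)
        then show "cmod (h x) \<le> B" by (rule hB)
      qed (use r in auto)
      also have "fact 1 * B / r ^ 1 = B * (1 / r)" by simp
      also have "\<dots> \<le> B * (2 * \<delta>)" using r B by (intro mult_left_mono) auto
      finally show ?thesis by (simp add: mult_ac)
    qed
    have "cmod (h 0 - h 1) \<le> 2 * B * \<delta> * cmod (0 - 1)"
    proof (rule field_differentiable_bound[where S = "cball 0 1" and f' = "deriv h"])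
      show "(h has_field_derivative deriv h z) (at z within cball 0 1)" if "z \<in> cball 0 1" for z
        using h(1) by (metis UNIV_I has_field_derivative_at_within holomorphic_derivI open_UNIV)
      show "cmod (deriv h z) \<le> 2 * B * \<delta>" if "z \<in> cball 0 1" for z using der that by simp
    qed auto
    moreover have "h 0 = norm_fib f a" using h(2)[of 0] a by simp
    moreover have "h 1 = norm_fib f b" using h(2)[of 1] b l1 by simp
    ultimately have "cmod (norm_fib f a - norm_fib f b) \<le> 2 * B * \<delta>" by simp
    also have "\<dots> < \<epsilon>"
    proof -
      have "0 < 2 * B * \<delta>" using B d(1) by simp
      then show ?thesis using d(3) by linarith
    qed
    finally show ?thesis .
  qed
  then show ?thesis using d(1) by blast
qed

text \<open>There are generic points \<open>x\<close> arbitrarily close to \<open>z\<close>. There \<open>f\<close> is small, hence so is its norm at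
  \<open>PP x\<close>, and the norms at all generic points near \<open>\<rho>0\<close> are close to each other.\<close>

lemma norm_fib_tendsto_0:
  assumes f: "pfun m D f" and z: "z \<in> fib \<rho>0" "f z = 0" and eps: "\<epsilon> > 0"
  shows "\<exists>\<delta>>0. \<forall>\<rho>. G \<rho> \<noteq> 0 \<longrightarrow> dst m \<rho> \<rho>0 < \<delta> \<longrightarrow> cmod (norm_fib f \<rho>) < \<epsilon>"
proof -
  obtain \<delta> where d: "\<delta> > 0" "\<And>a b. G a \<noteq> 0 \<Longrightarrow> G b \<noteq> 0 \<Longrightarrow> dst m a \<rho>0 < \<delta> \<Longrightarrow> dst m b \<rho>0 < \<delta> \<Longrightarrow>
    cmod (norm_fib f a - norm_fib f b) < \<epsilon> / 2"
    using norm_fib_Cauchy[OF f, of "\<epsilon> / 2" \<rho>0] eps by auto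
  have "D \<le> n * D" using n by simp
  then have "pfun m (n * D) f" using f pfun_mono by blast
  from fib_growth[OF this] obtain C where C: "C \<ge> 1" "\<And>\<rho> z. z \<in> fib \<rho> \<Longrightarrow> cmod (f z) \<le> C * (1 + nr m \<rho>) ^ D" by blast
  define L where "L = C * (1 + (nr m \<rho>0 + \<delta>)) ^ D"
  have "1 * 1 \<le> C * (1 + (nr m \<rho>0 + \<delta>)) ^ D" using C(1) d(1) by (intro mult_mono one_le_power) auto
  then have L: "L \<ge> 1" by (simp add: L_def)
  define e where "e = \<epsilon> / 2 / L ^ generic_card"
  have e: "e > 0" using eps L by (simp add: e_def)
  obtain \<delta>1 where d1: "\<delta>1 > 0" "\<And>x. dst m x z < \<delta>1 \<Longrightarrow> cmod (f x - f z) < e"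
    using pfun_continuous_dst[OF f e] by blast
  obtain \<delta>2 where d2: "\<delta>2 > 0" "\<And>x. dst m x z < \<delta>2 \<Longrightarrow> dst m (PP x) (PP z) < \<delta>"
    using PP_continuous[OF d(1)] by blast
  obtain b where "G b \<noteq> 0" using G(2) by blast
  from nonzero_comp_PP[OF G(1) this] obtain b' where b': "G (PP b') \<noteq> 0" by blast
  have zc: "z \<in> cspace m" using z(1) by (simp add: fib_def)
  have "min \<delta>1 \<delta>2 > 0" using d1 d2 by simp
  from pfun_nonzero_dense[OF pfun_comp_PP[OF G(1)] b' zc this]
  obtain x where x: "x \<in> cspace m" "dst m x z < min \<delta>1 \<delta>2" "G (PP x) \<noteq> 0" by blast
  have xf: "x \<in> fib (PP x)" using x(1) by (simp add: fib_def PP_def)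
  have px: "dst m (PP x) \<rho>0 < \<delta>" using d2(2)[of x] x(2) dst_PP_fib'[OF z(1)] by simp
  have small: "cmod (norm_fib f (PP x)) < \<epsilon> / 2"
  proof -
    have fin: "finite (fib (PP x))" by (rule finite_fib[OF x(3)])
    have "cmod (norm_fib f (PP x)) = cmod (f x) * (\<Prod>w\<in>fib (PP x) - {x}. cmod (f w))"
      unfolding norm_fib_def prod_norm[symmetric] using fin xf by (rule prod.remove)
    also have "(\<Prod>w\<in>fib (PP x) - {x}. cmod (f w)) \<le> (\<Prod>w\<in>fib (PP x) - {x}. L)"
    proof (intro prod_mono conjI)
      fix w assume w: "w \<in> fib (PP x) - {x}"
      then have "cmod (f w) \<le> C * (1 + nr m (PP x)) ^ D" by (intro C(2)) simp
      also have "\<dots> \<le> L" unfolding L_def using C(1) nr_le_dst[of m "PP x" \<rho>0] px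
        by (intro mult_left_mono power_mono) auto
      finally show "cmod (f w) \<le> L" .
    qed auto
    also have "\<dots> = L ^ (generic_card - 1)" using fin xf card_fib_generic[OF x(3)] by simp
    also have "\<dots> \<le> L ^ generic_card" using L by (intro power_increasing) auto
    finally have "cmod (norm_fib f (PP x)) \<le> cmod (f x) * L ^ generic_card" by (simp add: mult_left_mono)
    also have "\<dots> < e * L ^ generic_card" using d1(2)[of x] x(2) z(2) L by (intro mult_strict_right_mono) auto
    also have "\<dots> = \<epsilon> / 2" using L by (simp add: e_def)
    finally show ?thesis .
  qed
  show ?thesis
  proof (intro exI[of _ \<delta>] conjI allI impI d(1))
    fix \<rho> assume "G \<rho> \<noteq> 0" "dst m \<rho> \<rho>0 < \<delta>"
    then have "cmod (norm_fib f \<rho> - norm_fib f (PP x)) < \<epsilon> / 2" using d(2) x(3) px by blast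
    then show "cmod (norm_fib f \<rho>) < \<epsilon>" using small norm_triangle_sub[of "norm_fib f \<rho>" "norm_fib f (PP x)"] by linarith
  qed
qed

text \<open>For a linear form \<open>\<theta>\<close> that separates the points of \<open>T\<close>, the norm of \<open>\<theta> - \<theta> z\<close> is small at a nearby generic
  point for all \<open>z \<in> T\<close>. So each \<open>z\<close> has a point of the nearby generic fibre with almost the same value of \<open>\<theta>\<close>,
  and different points \<open>z\<close> have different ones.\<close>

lemma card_subset_fib_le: assumes T: "finite T" "T \<subseteq> fib \<rho>0" shows "card T \<le> generic_card"
proof -
  have Tc: "T \<subseteq> cspace m" using T(2) by (auto simp: fib_def)
  obtain \<theta> where th: "pfun m 1 \<theta>" "inj_on \<theta> T" using separating_linear_form[OF T(1) Tc] by blast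
  have "\<exists>\<eta>>0. \<forall>p\<in>{p\<in>T \<times> T. fst p \<noteq> snd p}. \<eta> \<le> cmod (\<theta> (fst p) - \<theta> (snd p))"
  proof (rule finite_positive_lower_bound)
    show "finite {p\<in>T \<times> T. fst p \<noteq> snd p}" using T(1) by simp
    fix p assume p: "p \<in> {p\<in>T \<times> T. fst p \<noteq> snd p}"
    then have "\<theta> (fst p) \<noteq> \<theta> (snd p)" using inj_onD[OF th(2), of "fst p" "snd p"] by auto
    then show "0 < cmod (\<theta> (fst p) - \<theta> (snd p))" by simp
  qed
  then obtain \<eta> where eta: "\<eta> > 0" "\<And>z z'. z \<in> T \<Longrightarrow> z' \<in> T \<Longrightarrow> z \<noteq> z' \<Longrightarrow> \<eta> \<le> cmod (\<theta> z - \<theta> z')" by fastforce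
  define f where "f = (\<lambda>z x. \<theta> x - \<theta> z)"
  have pf: "pfun m 1 (f z)" for z unfolding f_def by (intro pfun_diff th pfun_const)
  \<comment> \<open>A product of \<open>generic_card\<close> factors is smaller than \<open>\<epsilon>\<close> only if one of them is smaller than \<open>\<eta> / 2\<close>.\<close>
  define \<epsilon> where "\<epsilon> = (\<eta> / 2) ^ generic_card"
  have eps: "\<epsilon> > 0" using eta by (simp add: \<epsilon>_def)
  have "\<forall>z\<in>T. \<exists>\<delta>. \<delta> > 0 \<and> (\<forall>\<rho>. G \<rho> \<noteq> 0 \<longrightarrow> dst m \<rho> \<rho>0 < \<delta> \<longrightarrow> cmod (norm_fib (f z) \<rho>) < \<epsilon>)"
    using norm_fib_tendsto_0[OF pf _ _ eps] T(2) by (auto simp: f_def)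
  from bchoice[OF this] obtain s where s: "\<And>z. z \<in> T \<Longrightarrow> s z > 0"
    "\<And>z \<rho>. z \<in> T \<Longrightarrow> G \<rho> \<noteq> 0 \<Longrightarrow> dst m \<rho> \<rho>0 < s z \<Longrightarrow> cmod (norm_fib (f z) \<rho>) < \<epsilon>" by blast
  obtain \<delta> where d: "\<delta> > 0" "\<And>z. z \<in> T \<Longrightarrow> \<delta> \<le> s z"
    using finite_positive_lower_bound[of T s, OF T(1) s(1)] by blast
  define \<rho>1 where "\<rho>1 = (\<lambda>j. if j \<in> {1..m} then \<rho>0 j else 0)"
  have eq: "dst m \<rho> \<rho>1 = dst m \<rho> \<rho>0" for \<rho>
    unfolding dst_def nr_def by (intro sum.cong) (auto simp: \<rho>1_def)
  have "\<rho>1 \<in> cspace m" by (simp add: cspace_def \<rho>1_def)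
  moreover obtain b where "G b \<noteq> 0" using G(2) by blast
  ultimately obtain \<rho> where rho1: "G \<rho> \<noteq> 0" "dst m \<rho> \<rho>1 < \<delta>"
    using pfun_nonzero_dense[OF G(1) _ _ d(1)] by blast
  have rho: "G \<rho> \<noteq> 0" "dst m \<rho> \<rho>0 < \<delta>" using rho1 eq[of \<rho>] by simp_all
  have "\<forall>z\<in>T. \<exists>w. w \<in> fib \<rho> \<and> cmod (f z w) < \<eta> / 2"
  proof (rule ballI, rule ccontr)
    fix z assume z: "z \<in> T" and no: "\<not> (\<exists>w. w \<in> fib \<rho> \<and> cmod (f z w) < \<eta> / 2)"
    have "\<epsilon> = (\<Prod>w\<in>fib \<rho>. \<eta> / 2)" by (simp add: \<epsilon>_def card_fib_generic[OF rho(1)])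
    also have "\<dots> \<le> (\<Prod>w\<in>fib \<rho>. cmod (f z w))" using no eta(1) by (intro prod_mono) (auto simp: not_less)
    also have "\<dots> = cmod (norm_fib (f z) \<rho>)" by (simp add: norm_fib_def prod_norm[symmetric])
    also have "\<dots> < \<epsilon>" using s(2)[OF z rho(1)] rho(2) d(2)[OF z] by simp
    finally show False by simp
  qed
  from bchoice[OF this] obtain w where w: "\<And>z. z \<in> T \<Longrightarrow> w z \<in> fib \<rho>" "\<And>z. z \<in> T \<Longrightarrow> cmod (f z (w z)) < \<eta> / 2" by blast
  have "inj_on w T"
  proof (rule inj_onI, rule ccontr)
    fix z z' assume zz: "z \<in> T" "z' \<in> T" "w z = w z'" "z \<noteq> z'"
    have "cmod (\<theta> z - \<theta> z') = cmod (f z' (w z') - f z (w z))" using zz(3) by (simp add: f_def)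
    also have "\<dots> \<le> cmod (f z' (w z')) + cmod (f z (w z))" by (rule norm_triangle_ineq4)
    also have "\<dots> < \<eta>" using w(2)[OF zz(1)] w(2)[OF zz(2)] by linarith
    finally show False using eta(2)[OF zz(1,2,4)] by linarith
  qed
  then have "card T \<le> card (fib \<rho>)" using w(1) finite_fib[OF rho(1)] by (intro card_inj_on_le) auto
  then show ?thesis by (simp add: card_fib_generic[OF rho(1)])
qed

lemma fib_finite_card_le: "finite (fib \<rho>) \<and> card (fib \<rho>) \<le> generic_card"
proof -
  have "finite (fib \<rho>)"
  proof (rule ccontr)
    assume "infinite (fib \<rho>)"
    then obtain T where "finite T" "card T = Suc generic_card" "T \<subseteq> fib \<rho>"
      using infinite_arbitrarily_large by blast
    then show False using card_subset_fib_le[of T \<rho>] by simp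
  qed
  then show ?thesis using card_subset_fib_le by blast
qed

end

lemma (in homogeneous_map) elimination_PP:
  assumes "pfun m e B" "B x0 \<noteq> 0"
  shows "\<exists>d F. pfun m d F \<and> (\<exists>y. F y \<noteq> 0) \<and> (\<forall>x. B x = 0 \<longrightarrow> F (PP x) = 0)"
  unfolding PP_def by (rule elimination[OF P assms])

context generic_homogeneous_map
begin

text \<open>If the generic fibre had fewer than \<open>n ^ m\<close> points, some nonzero polynomial of degree at most
  \<open>n * d\<close> would vanish to order greater than \<open>d\<close> at all of them. Its norm grows along lines with
  exponent \<open>d * generic_card\<close> at most but vanishes to higher order at the base point, so it is zero, and
  the polynomial vanishes somewhere on every generic fibre, which contradicts elimination.\<close>

lemma generic_card_ge: "n ^ m \<le> generic_card"
proof (rule ccontr)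
  assume "\<not> n ^ m \<le> generic_card"
  then obtain d where d: "generic_card * ((d + m) choose m) < (n * d + m) choose m"
    using choose_growth_lower[OF n, of generic_card m] by auto
  obtain \<rho>0 where g0: "G \<rho>0 \<noteq> 0" using G(2) by blast
  define Z where "Z = fib \<rho>0"
  have fZ: "finite Z" "card Z = generic_card" unfolding Z_def using finite_fib[OF g0] card_fib_generic[OF g0] by auto
  define A where "A = mons m (n * d)"
  have "pfun m (n * d) (\<lambda>w. monomial m \<gamma> (\<lambda>i. z i + w i))" if "\<gamma> \<in> A" for \<gamma> z
  proof -
    have "pfun m (n * d * 1) (\<lambda>w. monomial m \<gamma> (\<lambda>j. (\<lambda>j w. z j + w j) j w))"
      using that by (intro pfun_comp_mon pfun_add pfun_const pfun_coord) (auto simp: A_def)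
    then show ?thesis by simp
  qed
  then have ex: "\<exists>c. (\<lambda>w. monomial m \<gamma> (\<lambda>i. z i + w i)) = (\<lambda>w. \<Sum>\<beta>\<in>A. c \<beta> * monomial m \<beta> w)" if "\<gamma> \<in> A" for \<gamma> z
    using that unfolding pfun_def A_def by blast
  \<comment> \<open>\<open>M \<gamma> z\<close> are the coefficients of the Taylor expansion at \<open>z\<close> of the monomial with exponents \<open>\<gamma>\<close>.\<close>
  define M where "M = (\<lambda>\<gamma> z. SOME c. (\<lambda>w. monomial m \<gamma> (\<lambda>i. z i + w i)) = (\<lambda>w. \<Sum>\<beta>\<in>A. c \<beta> * monomial m \<beta> w))"
  have M: "monomial m \<gamma> (\<lambda>i. z i + w i) = (\<Sum>\<beta>\<in>A. M \<gamma> z \<beta> * monomial m \<beta> w)" if "\<gamma> \<in> A" for \<gamma> z w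
    using fun_cong[OF someI_ex[OF ex[OF that, of z]], of w] unfolding M_def .
  have "card (Z \<times> mons m d) < card A"
    using d fZ by (simp add: A_def card_mons card_cartesian_product)
  then have "\<exists>c. (\<exists>\<gamma>\<in>A. c \<gamma> \<noteq> 0) \<and> (\<forall>q\<in>Z \<times> mons m d. (\<Sum>\<gamma>\<in>A. c \<gamma> * M \<gamma> (fst q) (snd q)) = 0)"
    by (intro underdetermined_system) (simp_all add: A_def fZ)
  then obtain c where c: "\<exists>\<gamma>\<in>A. c \<gamma> \<noteq> 0"
    "\<forall>q\<in>Z \<times> mons m d. (\<Sum>\<gamma>\<in>A. c \<gamma> * M \<gamma> (fst q) (snd q)) = 0"
    by (elim exE conjE)
  define f where "f = (\<lambda>x. \<Sum>\<gamma>\<in>A. c \<gamma> * monomial m \<gamma> x)"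
  have pf: "pfun m (n * d) f" unfolding f_def A_def by (rule pfunI[OF refl])
  obtain \<gamma>0 where "\<gamma>0 \<in> A" "c \<gamma>0 \<noteq> 0" using c(1) by blast
  then obtain x0 where x0: "f x0 \<noteq> 0" unfolding f_def A_def using nonzero_coeff_imp_nonzero_fun by blast
  define e where "e = (\<lambda>z \<beta>. \<Sum>\<gamma>\<in>A. c \<gamma> * M \<gamma> z \<beta>)"
  have exp: "f (\<lambda>i. z i + w i) = (\<Sum>\<beta>\<in>A. e z \<beta> * monomial m \<beta> w)" for z w
  proof -
    have "f (\<lambda>i. z i + w i) = (\<Sum>\<gamma>\<in>A. \<Sum>\<beta>\<in>A. c \<gamma> * M \<gamma> z \<beta> * monomial m \<beta> w)"
      unfolding f_def by (intro sum.cong refl) (simp only: M sum_distrib_left mult.assoc)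
    also have "\<dots> = (\<Sum>\<beta>\<in>A. e z \<beta> * monomial m \<beta> w)"
      unfolding e_def by (subst sum.swap) (simp add: sum_distrib_right)
    finally show ?thesis .
  qed
  have vanish: "cmod (f x) \<le> (\<Sum>\<beta>\<in>A. cmod (e z \<beta>)) * dst m x z ^ Suc d" if z: "z \<in> Z" and x: "dst m x z \<le> 1" for z x
  proof -
    define w where "w = (\<lambda>i. x i - z i)"
    have nw: "nr m w = dst m x z" by (simp add: w_def dst_def)
    have each_term: "cmod (e z \<beta> * monomial m \<beta> w) \<le> cmod (e z \<beta>) * nr m w ^ Suc d" if b: "\<beta> \<in> A" for \<beta>
    proof (cases "\<beta> \<in> mons m d")
      case True
      then have "e z \<beta> = 0" using c(2) z by (auto simp: e_def)
      then show ?thesis by simp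
    next
      case False
      then have sb: "Suc d \<le> (\<Sum>i\<in>{1..m}. \<beta> i)" using b by (auto simp: A_def mons_def)
      have "cmod (monomial m \<beta> w) = (\<Prod>i\<in>{1..m}. cmod (w i) ^ \<beta> i)"
        by (simp add: monomial_def prod_norm[symmetric] norm_power)
      also have "\<dots> \<le> (\<Prod>i\<in>{1..m}. nr m w ^ \<beta> i)"
        by (intro prod_mono conjI power_mono coord_le_nr) auto
      also have "\<dots> = nr m w ^ (\<Sum>i\<in>{1..m}. \<beta> i)" by (simp add: power_sum)
      also have "\<dots> \<le> nr m w ^ Suc d" using sb x nw by (intro power_decreasing) auto
      finally show ?thesis by (simp add: norm_mult mult_left_mono)
    qed
    have "f x = (\<Sum>\<beta>\<in>A. e z \<beta> * monomial m \<beta> w)" using exp[of z w] by (simp add: w_def)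
    then have "cmod (f x) \<le> (\<Sum>\<beta>\<in>A. cmod (e z \<beta> * monomial m \<beta> w))" using norm_sum by simp
    also have "\<dots> \<le> (\<Sum>\<beta>\<in>A. cmod (e z \<beta>) * nr m w ^ Suc d)" by (rule sum_mono[OF each_term])
    finally show ?thesis by (simp add: nw sum_distrib_right)
  qed
  define C1 where "C1 = (\<Sum>z\<in>Z. \<Sum>\<beta>\<in>A. cmod (e z \<beta>))"
  have C1: "C1 \<ge> 0" unfolding C1_def by (intro sum_nonneg) auto
  have vanish': "cmod (f x) \<le> C1 * dst m x z ^ Suc d" if z: "z \<in> Z" and x: "dst m x z \<le> 1" for z x
  proof -
    have "(\<Sum>\<beta>\<in>A. cmod (e z \<beta>)) \<le> C1" unfolding C1_def
      using z fZ by (intro member_le_sum[of z Z "\<lambda>z. \<Sum>\<beta>\<in>A. cmod (e z \<beta>)"]) (auto intro: sum_nonneg)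
    then have "(\<Sum>\<beta>\<in>A. cmod (e z \<beta>)) * dst m x z ^ Suc d \<le> C1 * dst m x z ^ Suc d" by (intro mult_right_mono) auto
    then show ?thesis using vanish[OF z x] by linarith
  qed
  obtain K \<delta> where K: "K \<ge> 0" and dl: "\<delta> > 0" "\<And>\<rho>. dst m \<rho> \<rho>0 < \<delta> \<Longrightarrow>
      \<exists>\<zeta>. bij_betw \<zeta> Z (fib \<rho>) \<and> (\<forall>z\<in>Z. dst m (\<zeta> z) z \<le> K * dst m \<rho> \<rho>0)"
    using local_cover_lipschitz[OF g0] unfolding Z_def by blast
  obtain C where C: "C \<ge> 1" "\<And>\<rho> z. z \<in> fib \<rho> \<Longrightarrow> cmod (f z) \<le> C * (1 + nr m \<rho>) ^ d"
    using fib_growth[OF pf] by blast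
  have zero: "norm_fib f b = 0" if gb: "G b \<noteq> 0" for b
  proof -
    define v where "v = (\<lambda>i. b i - \<rho>0 i)"
    have l1: "line \<rho>0 v 1 = b" by (simp add: line_def v_def)
    have l0: "dst m (line \<rho>0 v t) \<rho>0 = cmod t * nr m v" for t using dst_line[of \<rho>0 v t 0] by simp
    obtain h where h: "h holomorphic_on UNIV" "\<And>t. G (line \<rho>0 v t) \<noteq> 0 \<Longrightarrow> h t = norm_fib f (line \<rho>0 v t)"
      "\<And>t. cmod (h t) \<le> C ^ generic_card * (1 + nr m (line \<rho>0 v t)) ^ (d * generic_card)"
      using norm_fib_line[OF pf C g0, of v] by blast
    define B where "B = 1 + nr m \<rho>0 + nr m v"
    have B: "B \<ge> 1" by (simp add: B_def)
    have growth: "cmod (h t) \<le> C ^ generic_card * B ^ (d * generic_card) * (1 + cmod t) ^ (d * generic_card)" for t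
    proof -
      have "1 + nr m (line \<rho>0 v t) \<le> 1 + nr m \<rho>0 + cmod t * nr m v"
        using nr_le_dst[of m "line \<rho>0 v t" \<rho>0] l0[of t] by simp
      also have "\<dots> \<le> B * (1 + cmod t)" by (simp add: B_def algebra_simps)
      finally have "C ^ generic_card * (1 + nr m (line \<rho>0 v t)) ^ (d * generic_card) \<le> C ^ generic_card * (B * (1 + cmod t)) ^ (d * generic_card)"
        using C(1) by (intro mult_left_mono power_mono) auto
      then show ?thesis using h(3)[of t] by (simp add: power_mult_distrib mult.assoc)
    qed
    obtain U where U: "finite U" "U = bad \<rho>0 v" using finite_bad[OF g0] by blast
    have "0 \<notin> U" using g0 by (simp add: U bad_def)
    have "open (- U)" using U(1) by (intro open_Compl finite_imp_closed)
    then obtain s where s: "s > 0" "ball 0 s \<subseteq> - U" using \<open>0 \<notin> U\<close> open_contains_ball by blast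
    define V where "V = nr m v + 1"
    have V: "V > 0" unfolding V_def by (simp add: add_nonneg_pos)
    define K' where "K' = K + 1"
    have K': "K' > 0" using K by (simp add: K'_def)
    define s' where "s' = min 1 (min s (min (\<delta> / V) (1 / (K' * V))))"
    have s': "s' > 0" using s dl V K' by (simp add: s'_def)
    have near: "cmod (h t) \<le> (C1 * (K' * V) ^ Suc d) ^ generic_card * cmod t ^ Suc (d * generic_card)" if t: "cmod t < s'" for t
    proof -
      have good: "G (line \<rho>0 v t) \<noteq> 0" using s(2) t U(2) by (auto simp: s'_def bad_def subset_iff)
      have "cmod t * nr m v \<le> cmod t * V" by (intro mult_left_mono) (auto simp: V_def)
      moreover have "cmod t * V < \<delta>" using t V by (simp add: s'_def pos_less_divide_eq)
      ultimately have "dst m (line \<rho>0 v t) \<rho>0 < \<delta>" using l0[of t] by simp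
      from dl(2)[OF this] obtain \<zeta> where zeta: "bij_betw \<zeta> Z (fib (line \<rho>0 v t))"
        "\<And>z. z \<in> Z \<Longrightarrow> dst m (\<zeta> z) z \<le> K * dst m (line \<rho>0 v t) \<rho>0" by blast
      have each: "cmod (f (\<zeta> z)) \<le> C1 * (K' * V) ^ Suc d * cmod t ^ Suc d" if z: "z \<in> Z" for z
      proof -
        have "dst m (\<zeta> z) z \<le> K * (cmod t * nr m v)" using zeta(2)[OF z] by (simp only: l0)
        also have "\<dots> \<le> K' * (cmod t * V)" using K by (intro mult_mono) (auto simp: K'_def V_def)
        finally have le: "dst m (\<zeta> z) z \<le> K' * V * cmod t" by (simp add: mult_ac)
        have "cmod t < 1 / (K' * V)" using t by (simp add: s'_def)
        then have "K' * V * cmod t < 1" using K' V by (simp add: field_simps)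
        then have "dst m (\<zeta> z) z \<le> 1" using le by linarith
        then have "cmod (f (\<zeta> z)) \<le> C1 * dst m (\<zeta> z) z ^ Suc d" by (rule vanish'[OF z])
        also have "\<dots> \<le> C1 * (K' * V * cmod t) ^ Suc d" using le C1 by (intro mult_left_mono power_mono) auto
        finally show ?thesis by (simp only: power_mult_distrib mult.assoc)
      qed
      have "h t = norm_fib f (line \<rho>0 v t)" by (rule h(2)[OF good])
      also have "\<dots> = (\<Prod>z\<in>Z. f (\<zeta> z))" unfolding norm_fib_def using prod.reindex_bij_betw[OF zeta(1)] by metis
      finally have "cmod (h t) = (\<Prod>z\<in>Z. cmod (f (\<zeta> z)))" by (simp add: prod_norm[symmetric])
      also have "\<dots> \<le> (\<Prod>z\<in>Z. C1 * (K' * V) ^ Suc d * cmod t ^ Suc d)" by (intro prod_mono conjI each) auto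
      also have "\<dots> = (C1 * (K' * V) ^ Suc d) ^ generic_card * cmod t ^ (Suc d * generic_card)"
        by (simp only: prod_constant fZ power_mult_distrib power_mult)
      also have "\<dots> \<le> (C1 * (K' * V) ^ Suc d) ^ generic_card * cmod t ^ Suc (d * generic_card)"
        using C1 K' V t generic_card_pos by (intro mult_left_mono power_decreasing) (auto simp: s'_def)
      finally show ?thesis .
    qed
    have "h 1 = 0" by (rule entire_eq_0_if_growth_below_vanishing[OF h(1) growth s' near])
    then show ?thesis using h(2)[of 1] gb l1 by simp
  qed
  \<comment> \<open>The zeros of \<open>f\<close> lie over a hypersurface, but every generic fibre contains one.\<close>
  obtain dF F where F: "pfun m dF F" "\<exists>y. F y \<noteq> 0" "\<forall>x. f x = 0 \<longrightarrow> F (PP x) = 0"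
    using elimination_PP[OF pf x0] by blast
  obtain y b where yb: "G y \<noteq> 0" "F b \<noteq> 0" using G(2) F(2) by blast
  from pfun_nonzero_mult[OF G(1) F(1) this] obtain \<rho> where rho: "G \<rho> \<noteq> 0" "F \<rho> \<noteq> 0" by auto
  obtain x where x: "x \<in> fib \<rho>" "f x = 0"
    using zero[OF rho(1)] finite_fib[OF rho(1)] by (auto simp: norm_fib_def)
  have "F (PP x) = F \<rho>" using x(1) by (intro pfun_cong[OF F(1)]) (auto simp: PP_def fib_def)
  then show False using F(3) x(2) rho(2) by simp
qed

text \<open>Polynomials \<open>f z\<close> that are dual to the points of a generic fibre are linearly independent over
  the polynomials in \<open>P\<close>, since their values at the points of a nearby fibre form an almost
  diagonal matrix. Counting dimensions bounds their number.\<close>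

lemma generic_card_le: "generic_card \<le> n ^ m"
proof -
  obtain \<rho>0 where g0: "G \<rho>0 \<noteq> 0" using G(2) by blast
  define Z where "Z = fib \<rho>0"
  have fZ: "finite Z" "card Z = generic_card" unfolding Z_def using finite_fib[OF g0] card_fib_generic[OF g0] by auto
  have Zc: "Z \<subseteq> cspace m" by (auto simp: Z_def fib_def)
  obtain \<theta> where th: "pfun m 1 \<theta>" "inj_on \<theta> Z" using separating_linear_form[OF fZ(1) Zc] by blast
  \<comment> \<open>Lagrange interpolation along \<open>\<theta>\<close>.\<close>
  define f where "f = (\<lambda>z x. \<Prod>y\<in>Z - {z}. (\<theta> x - \<theta> y) * (1 / (\<theta> z - \<theta> y)))"
  have pf: "pfun m generic_card (f z)" for z
  proof -
    have "pfun m (\<Sum>y\<in>Z - {z}. 1 + 0) (f z)" unfolding f_def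
      by (intro pfun_prod pfun_mult pfun_diff th pfun_const)
    moreover have "(\<Sum>y\<in>Z - {z}. 1 + 0) \<le> generic_card" using card_mono[of Z "Z - {z}"] fZ by simp
    ultimately show ?thesis by (rule pfun_mono)
  qed
  have dual: "f z z' = (if z = z' then 1 else 0)" if "z \<in> Z" "z' \<in> Z" for z z'
  proof (cases "z = z'")
    case True
    have "\<theta> z - \<theta> y \<noteq> 0" if "y \<in> Z - {z}" for y using inj_onD[OF th(2)] that \<open>z \<in> Z\<close> by fastforce
    then show ?thesis using True by (simp add: f_def)
  next
    case False
    then have "\<exists>y\<in>Z - {z}. (\<theta> z' - \<theta> y) * (1 / (\<theta> z - \<theta> y)) = 0" using that by (intro bexI[of _ z']) auto
    then show ?thesis using False fZ(1) unfolding f_def by (simp only: prod_zero finite_Diff if_False)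
  qed
  show ?thesis
  proof (rule choose_growth_upper[OF n, of generic_card m generic_card], rule ccontr)
    fix d assume "\<not> generic_card * ((d + m) choose m) \<le> (n * d + generic_card + m) choose m"
    then have big: "(n * d + generic_card + m) choose m < generic_card * ((d + m) choose m)" by simp
    define A where "A = Z \<times> mons m d"
    define S where "S = mons m (d * n + generic_card)"
    have fA: "finite A" using fZ by (simp add: A_def)
    have "card S < card A" using big fZ by (simp add: A_def S_def card_mons card_cartesian_product mult.commute)
    have "\<forall>q\<in>A. \<exists>c. (\<lambda>x. monomial m (snd q) (PP x) * f (fst q) x) = (\<lambda>x. \<Sum>\<beta>\<in>S. c \<beta> * monomial m \<beta> x)"
    proof
      fix q assume "q \<in> A"
      then have "pfun m (d * n + generic_card) (\<lambda>x. monomial m (snd q) (PP x) * f (fst q) x)"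
        unfolding PP_def by (intro pfun_mult pf pfun_comp_mon P) (auto simp: A_def)
      then show "\<exists>c. (\<lambda>x. monomial m (snd q) (PP x) * f (fst q) x) = (\<lambda>x. \<Sum>\<beta>\<in>S. c \<beta> * monomial m \<beta> x)"
        unfolding pfun_def S_def .
    qed
    from bchoice[OF this] obtain M where M': "\<forall>q\<in>A. (\<lambda>x. monomial m (snd q) (PP x) * f (fst q) x) = (\<lambda>x. \<Sum>\<beta>\<in>S. M q \<beta> * monomial m \<beta> x)"
      by blast
    have M: "monomial m (snd q) (PP x) * f (fst q) x = (\<Sum>\<beta>\<in>S. M q \<beta> * monomial m \<beta> x)" if "q \<in> A" for q x
      using fun_cong[OF bspec[OF M' that], of x] .
    have "\<exists>c. (\<exists>q\<in>A. c q \<noteq> 0) \<and> (\<forall>\<beta>\<in>S. (\<Sum>q\<in>A. c q * M q \<beta>) = 0)"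
      by (rule underdetermined_system[OF _ fA \<open>card S < card A\<close>]) (simp add: S_def)
    then obtain c where c: "\<exists>q\<in>A. c q \<noteq> 0" "\<forall>\<beta>\<in>S. (\<Sum>q\<in>A. c q * M q \<beta>) = 0"
      by (elim exE conjE)
    define a where "a = (\<lambda>z \<rho>. \<Sum>\<beta>\<in>mons m d. c (z, \<beta>) * monomial m \<beta> \<rho>)"
    have pa: "pfun m d (a z)" for z unfolding a_def by (rule pfunI[OF refl])
    have rel: "(\<Sum>z\<in>Z. a z (PP x) * f z x) = 0" for x
    proof -
      have "(\<Sum>z\<in>Z. a z (PP x) * f z x) = (\<Sum>q\<in>A. c q * (monomial m (snd q) (PP x) * f (fst q) x))"
        unfolding A_def a_def sum_distrib_right by (simp add: sum.cartesian_product case_prod_beta mult.assoc)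
      also have "\<dots> = (\<Sum>q\<in>A. \<Sum>\<beta>\<in>S. c q * M q \<beta> * monomial m \<beta> x)"
        by (intro sum.cong refl) (simp only: M sum_distrib_left mult.assoc)
      also have "\<dots> = (\<Sum>\<beta>\<in>S. (\<Sum>q\<in>A. c q * M q \<beta>) * monomial m \<beta> x)"
        by (subst sum.swap) (simp add: sum_distrib_right)
      also have "\<dots> = 0" by (simp add: c(2))
      finally show ?thesis .
    qed
    \<comment> \<open>Bounds the deviation of each entry of the matrix of values from the identity matrix.\<close>
    define e where "e = 1 / (2 * real generic_card)"
    have e: "e > 0" "real generic_card * e = 1/2" using generic_card_pos by (simp_all add: e_def)
    have "\<forall>q\<in>Z \<times> Z. \<exists>\<delta>. \<delta> > 0 \<and> (\<forall>x. dst m x (snd q) < \<delta> \<longrightarrow> cmod (f (fst q) x - f (fst q) (snd q)) < e)"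
      using pfun_continuous_dst[OF pf e(1)] by blast
    from bchoice[OF this] obtain s where S:
      "\<forall>q\<in>Z \<times> Z. s q > 0 \<and> (\<forall>x. dst m x (snd q) < s q \<longrightarrow> cmod (f (fst q) x - f (fst q) (snd q)) < e)" by (elim exE)
    have s: "s q > 0" "dst m x (snd q) < s q \<Longrightarrow> cmod (f (fst q) x - f (fst q) (snd q)) < e" if "q \<in> Z \<times> Z" for q x
      using bspec[OF S that] by simp_all
    have "finite (Z \<times> Z)" using fZ by simp
    from finite_positive_lower_bound[of "Z \<times> Z" s, OF this s(1)]
    obtain \<eta> where eta: "\<eta> > 0" "\<And>q. q \<in> Z \<times> Z \<Longrightarrow> \<eta> \<le> s q" by blast
    obtain \<delta> where dl: "\<delta> > 0" "\<And>\<rho>. dst m \<rho> \<rho>0 < \<delta> \<Longrightarrow>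
        \<exists>\<zeta>. bij_betw \<zeta> Z (fib \<rho>) \<and> (\<forall>z\<in>Z. dst m (\<zeta> z) z < \<eta>)"
      using local_cover[OF g0 eta(1)] unfolding Z_def by blast
    have near: "a z \<rho> = 0" if z: "z \<in> Z" and rho: "dst m \<rho> \<rho>0 < \<delta>" for z \<rho>
    proof -
      obtain \<zeta> where zeta: "bij_betw \<zeta> Z (fib \<rho>)" "\<And>z. z \<in> Z \<Longrightarrow> dst m (\<zeta> z) z < \<eta>" using dl(2)[OF rho] by blast
      \<comment> \<open>At the point of the fibre over \<open>\<rho>\<close> near \<open>z1\<close>, the relation reads \<open>a z1 \<rho> = small\<close>, with an error of at
        most half of the largest coefficient \<open>mx\<close>.\<close>
      define mx where "mx = Max ((\<lambda>z. cmod (a z \<rho>)) ` Z)"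
      have ne: "(\<lambda>z. cmod (a z \<rho>)) ` Z \<noteq> {}" using z by auto
      have "mx \<in> (\<lambda>z. cmod (a z \<rho>)) ` Z" unfolding mx_def using fZ(1) ne by (intro Max_in) auto
      then obtain z1 where z1: "z1 \<in> Z" "mx = cmod (a z1 \<rho>)" by blast
      have le: "cmod (a y \<rho>) \<le> mx" if "y \<in> Z" for y unfolding mx_def using fZ(1) that by (intro Max_ge) auto
      have w: "\<zeta> z1 \<in> fib \<rho>" using zeta(1) z1(1) by (auto simp: bij_betw_def)
      have aw: "a y (PP (\<zeta> z1)) = a y \<rho>" for y
        using w by (intro pfun_cong[OF pa]) (auto simp: PP_def fib_def)
      have "(\<Sum>y\<in>Z. a y \<rho> * (f y (\<zeta> z1) - f y z1)) = - (\<Sum>y\<in>Z. a y \<rho> * f y z1)"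
        using rel[of "\<zeta> z1"] by (simp add: aw algebra_simps sum_subtractf)
      also have "(\<Sum>y\<in>Z. a y \<rho> * f y z1) = (\<Sum>y\<in>Z. if y = z1 then a y \<rho> else 0)"
        using dual z1(1) by (intro sum.cong) auto
      also have "\<dots> = a z1 \<rho>" using fZ(1) z1(1) by simp
      finally have "mx = cmod (\<Sum>y\<in>Z. a y \<rho> * (f y (\<zeta> z1) - f y z1))" using z1(2) by simp
      also have "\<dots> \<le> (\<Sum>y\<in>Z. cmod (a y \<rho> * (f y (\<zeta> z1) - f y z1)))" by (rule norm_sum)
      also have "\<dots> \<le> (\<Sum>y\<in>Z. mx * e)" unfolding norm_mult
      proof (intro sum_mono mult_mono le)
        fix y assume y: "y \<in> Z"
        have "dst m (\<zeta> z1) z1 < s (y, z1)" using zeta(2)[OF z1(1)] eta(2)[of "(y, z1)"] y z1(1) by simp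
        then have "cmod (f (fst (y, z1)) (\<zeta> z1) - f (fst (y, z1)) (snd (y, z1))) < e"
          using y z1(1) by (intro s(2)) auto
        then show "cmod (f y (\<zeta> z1) - f y z1) \<le> e" by simp
      qed (use z1(2) in auto)
      also have "\<dots> = mx * (real generic_card * e)" by (simp add: fZ)
      also have "\<dots> = mx / 2" by (simp add: e)
      finally have "mx \<le> 0" by simp
      then show ?thesis using le[OF z] norm_ge_zero[of "a z \<rho>"] by (metis norm_le_zero_iff order_trans)
    qed
    obtain z \<beta> where zb: "z \<in> Z" "\<beta> \<in> mons m d" "c (z, \<beta>) \<noteq> 0" using c(1) by (auto simp: A_def)
    then obtain b where b: "a z b \<noteq> 0"
      using nonzero_coeff_imp_nonzero_fun[of \<beta> m d "\<lambda>\<beta>. c (z, \<beta>)"] unfolding a_def by blast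
    define \<rho>1 where "\<rho>1 = (\<lambda>j. if j \<in> {1..m} then \<rho>0 j else 0)"
    have eq: "dst m \<rho> \<rho>1 = dst m \<rho> \<rho>0" for \<rho>
      unfolding dst_def nr_def by (intro sum.cong) (auto simp: \<rho>1_def)
    have "\<rho>1 \<in> cspace m" by (simp add: cspace_def \<rho>1_def)
    then obtain \<rho> where "dst m \<rho> \<rho>1 < \<delta>" "a z \<rho> \<noteq> 0" using pfun_nonzero_dense[OF pa b _ dl(1)] by blast
    then show False using near[OF zb(1), of \<rho>] eq[of \<rho>] by simp
  qed
qed

lemma generic_card_eq: "generic_card = n ^ m" using generic_card_le generic_card_ge by simp

end

text \<open>Bezout's theorem for a homogeneous map: \<open>n ^ m\<close> bounds the number of points of every fibre,
  and it is attained outside a hypersurface.\<close>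

context homogeneous_map
begin

text \<open>Elimination maps the ramification points into a hypersurface.\<close>

lemma generic_locus:
  shows "\<exists>dG G. generic_homogeneous_map m n P e0 B0 dG G"
proof -
  obtain x0 where x0: "B0 x0 \<noteq> 0" using B0(2) by blast
  obtain dG G where "pfun m dG G" "\<exists>y. G y \<noteq> 0" "\<forall>x. B0 x = 0 \<longrightarrow> G (PP x) = 0"
    using elimination_PP[OF B0(1) x0] by blast
  then show ?thesis
    by (intro exI[of _ dG] exI[of _ G] generic_homogeneous_map.intro generic_homogeneous_map_axioms.intro
        homogeneous_map_axioms) auto
qed

theorem bezout_bound: "finite (fib \<rho>) \<and> card (fib \<rho>) \<le> n ^ m"
proof -
  obtain dG G where "generic_homogeneous_map m n P e0 B0 dG G" using generic_locus by blast
  then interpret g: generic_homogeneous_map m n P e0 B0 dG G .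
  show ?thesis using g.fib_finite_card_le[of \<rho>] by (simp add: g.generic_card_eq)
qed

theorem bezout_generic:
  assumes B: "pfun m e B" "B x0 \<noteq> 0"
  shows "\<exists>d G. pfun m d G \<and> (\<exists>x\<in>cspace m. G (PP x) \<noteq> 0) \<and>
    (\<forall>\<rho>. G \<rho> \<noteq> 0 \<longrightarrow> card (fib \<rho>) = n ^ m \<and> (\<forall>x\<in>fib \<rho>. B x \<noteq> 0))"
proof -
  obtain dG G where "generic_homogeneous_map m n P e0 B0 dG G" using generic_locus by blast
  then interpret g: generic_homogeneous_map m n P e0 B0 dG G .
  obtain dF F where F: "pfun m dF F" "\<exists>y. F y \<noteq> 0" "\<forall>x. B x = 0 \<longrightarrow> F (PP x) = 0"
    using elimination_PP[OF B] by blast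
  obtain y b where yb: "G y \<noteq> 0" "F b \<noteq> 0" using g.G(2) F(2) by blast
  obtain \<rho>1 where r1: "G \<rho>1 * F \<rho>1 \<noteq> 0" using pfun_nonzero_mult[OF g.G(1) F(1) yb] by blast
  have p: "pfun m (dG + dF) (\<lambda>\<rho>. G \<rho> * F \<rho>)" by (intro pfun_mult g.G F)
  have "\<exists>x\<in>cspace m. G (PP x) * F (PP x) \<noteq> 0" using nonzero_comp_PP[OF p r1] .
  moreover have "card (fib \<rho>) = n ^ m \<and> (\<forall>x\<in>fib \<rho>. B x \<noteq> 0)" if "G \<rho> * F \<rho> \<noteq> 0" for \<rho>
  proof
    show "card (fib \<rho>) = n ^ m" using g.card_fib_generic[of \<rho>] that by (simp add: g.generic_card_eq)
    show "\<forall>x\<in>fib \<rho>. B x \<noteq> 0"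
    proof
      fix x assume x: "x \<in> fib \<rho>"
      have "F (PP x) = F \<rho>" using x by (intro pfun_cong[OF F(1)]) (auto simp: PP_def fib_def)
      then show "B x \<noteq> 0" using F(3) that by auto
    qed
  qed
  ultimately show ?thesis using p by blast
qed

end

section \<open>Polynomials with given critical points\<close>

lemma esym_0 [simp]: "esym N 0 x = 1"
proof -
  have "{S. S \<subseteq> {1..N} \<and> card S = 0} = {{}}"
    by (auto simp: card_eq_0_iff dest: finite_subset[OF _ finite_atLeastAtMost])
  then show ?thesis by (simp add: esym_def)
qed

lemma esym_full: "esym N N x = (\<Prod>i\<in>{1..N}. x i)"
proof -
  have "{S. S \<subseteq> {1..N} \<and> card S = N} = {{1..N}}"
    using card_subset_eq[of "{1..N}"] by auto
  then show ?thesis by (simp add: esym_def)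
qed

lemma esym_1: "esym N 1 x = (\<Sum>i\<in>{1..N}. x i)"
proof -
  have "{S. S \<subseteq> {1..N} \<and> card S = 1} = (\<lambda>i. {i}) ` {1..N}" by (auto simp: card_1_singleton_iff)
  then show ?thesis by (simp add: esym_def sum.reindex)
qed

lemma esym_cong: "(\<And>i. i \<in> {1..N} \<Longrightarrow> x i = y i) \<Longrightarrow> esym N k x = esym N k y"
  unfolding esym_def by (intro sum.cong prod.cong) auto

lemma esym_scale: "esym N k (\<lambda>i. u * x i) = u ^ k * esym N k x"
  unfolding esym_def by (simp add: sum_distrib_left prod.distrib)

lemma pfun_esym:
  assumes "\<And>i. i \<in> {1..N} \<Longrightarrow> pfun m 1 (\<lambda>x. g x i)"
  shows "pfun m k (\<lambda>x. esym N k (g x))"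
  unfolding esym_def
proof (rule pfun_sum)
  fix S assume S: "S \<in> {S. S \<subseteq> {1..N} \<and> card S = k}"
  have "pfun m (\<Sum>i\<in>S. 1) (\<lambda>x. \<Prod>i\<in>S. g x i)" by (intro pfun_prod assms) (use S in auto)
  then show "pfun m k (\<lambda>x. \<Prod>i\<in>S. g x i)" using S by simp
qed

lemma poly_Qpoly: "poly (Qpoly N a) t = (\<Prod>j\<in>{1..N}. (t - a j))"
  by (simp add: Qpoly_def poly_prod)

lemma Qpoly_nonzero [simp]: "Qpoly N a \<noteq> 0"
  by (simp add: Qpoly_def)

lemma degree_Qpoly [simp]: "degree (Qpoly N a) = N"
proof -
  have "degree (Qpoly N a) = (\<Sum>j\<in>{1..N}. degree [:- a j, 1:])"
    unfolding Qpoly_def by (rule degree_prod_eq_sum_degree) auto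
  then show ?thesis by simp
qed

lemma Qpoly_expand: "Qpoly N a = (\<Sum>k\<in>{0..N}. monom ((-1) ^ k * esym N k a) (N - k))"
proof -
  have "poly (Qpoly N a) = poly (\<Sum>k\<in>{0..N}. monom ((-1) ^ k * esym N k a) (N - k))"
    by (rule ext) (simp only: poly_Qpoly prod_diff_esym poly_sum poly_monom)
  then show ?thesis by (simp add: poly_eq_poly_eq_iff)
qed

lemma coeff_descending_sum:
  fixes c :: "nat \<Rightarrow> complex"
  assumes "l \<le> N" "M \<le> N"
  shows "coeff (\<Sum>k\<in>{0..M}. monom (c k) (N - k)) (N - l) = (if l \<le> M then c l else 0)"
proof -
  have "coeff (\<Sum>k\<in>{0..M}. monom (c k) (N - k)) (N - l) = (\<Sum>k\<in>{0..M}. if k = l then c k else 0)"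
    unfolding coeff_sum using assms by (intro sum.cong) auto
  then show ?thesis by simp
qed

lemma coeff_Qpoly: "l \<le> N \<Longrightarrow> coeff (Qpoly N a) (N - l) = (-1) ^ l * esym N l a"
  unfolding Qpoly_expand by (subst coeff_descending_sum) auto

lemma order_Qpoly: "order x (Qpoly N a) = card {j\<in>{1..N}. a j = x}"
proof (induction N)
  case 0 then show ?case by (simp add: Qpoly_def)
next
  case (Suc N)
  have "Qpoly (Suc N) a = Qpoly N a * [:- a (Suc N), 1:]" by (simp add: Qpoly_def mult.commute)
  moreover have "order x [:- a (Suc N), 1:] = (if a (Suc N) = x then 1 else 0)"
    using order_power_n_n[of x 1] order_0I[of "[:- a (Suc N), 1:]" x] by auto
  ultimately have "order x (Qpoly (Suc N) a) = card {j\<in>{1..N}. a j = x} + (if a (Suc N) = x then 1 else 0)"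
    using order_mult[of "Qpoly N a" "[:- a (Suc N), 1:]" x] Suc by (simp only: Qpoly_nonzero mult_eq_0_iff) simp
  moreover have "{j\<in>{1..Suc N}. a j = x} = (if a (Suc N) = x then insert (Suc N) {j\<in>{1..N}. a j = x} else {j\<in>{1..N}. a j = x})"
    by (auto simp: le_Suc_eq)
  ultimately show ?case by simp
qed

text \<open>The multiplicities of the roots agree.\<close>

lemma Qpoly_eq_imp_permuted:
  assumes "Qpoly N a = Qpoly N b"
  shows "\<exists>\<pi>. \<pi> permutes {1..N} \<and> (\<forall>j\<in>{1..N}. b j = a (\<pi> j))"
proof -
  have "image_mset b (mset_set {1..N}) = image_mset a (mset_set {1..N})"
  proof (rule multiset_eqI)
    fix x
    have "order x (Qpoly N a) = order x (Qpoly N b)" by (simp add: assms)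
    then show "count (image_mset b (mset_set {1..N})) x = count (image_mset a (mset_set {1..N})) x"
      by (simp add: count_image_mset_eq_card_vimage order_Qpoly)
  qed
  from image_mset_eq_implies_permutes[OF finite_atLeastAtMost this]
  obtain \<pi> where "\<pi> permutes {1..N}" "\<forall>x\<in>{1..N}. b x = a (\<pi> x)" .
  then show ?thesis by blast
qed

lemma Qpoly_permuted: assumes "\<pi> permutes {1..N}" shows "Qpoly N (a \<circ> \<pi>) = Qpoly N a"
  unfolding Qpoly_def o_def by (rule prod.permute[OF assms, symmetric, unfolded o_def])

lemma monic_poly_splits:
  fixes p :: "complex poly"
  assumes "degree p = N" "lead_coeff p = 1"
  shows "\<exists>a\<in>cvec N. Qpoly N a = p"
proof -
  have "p \<noteq> 0" using assms(2) by auto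
  then obtain A where A: "size A = N" "p = (\<Prod>x\<in>#A. [:-x, 1:])"
    using alg_closed_imp_factorization[of p] assms by auto
  obtain xs where xs: "mset xs = A" using ex_mset by blast
  define a where "a = (\<lambda>i\<in>{1..N}. xs ! (i - 1))"
  have len: "length xs = N" using A(1) xs by auto
  have "Qpoly N a = (\<Prod>j\<in>{..<N}. [:- (xs ! j), 1:])"
    unfolding Qpoly_def a_def
    by (rule prod.reindex_bij_witness[of _ Suc "\<lambda>i. i - 1"]) auto
  also have "\<dots> = prod_list (map (\<lambda>x. [:- x, 1:]) xs)"
    by (simp add: prod.list_conv_set_nth len atLeast0LessThan)
  also have "\<dots> = p" unfolding A(2) xs[symmetric] by (simp add: prod_mset_prod_list[symmetric])
  finally show ?thesis by (intro bexI[of _ a]) (simp_all add: cvec_def a_def)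
qed

lemma pderiv_sum: "pderiv (\<Sum>i\<in>A. f i) = (\<Sum>i\<in>A. pderiv (f i))"
  by (induction A rule: infinite_finite_induct) (simp_all add: pderiv_add)

text \<open>The antiderivative, vanishing at \<open>0\<close>, of \<open>n\<close> times the monic polynomial with roots
  \<open>\<kappa> 1, \<dots>, \<kappa> (n - 1)\<close>.\<close>

definition crit_poly :: "nat \<Rightarrow> (nat \<Rightarrow> complex) \<Rightarrow> complex poly"
  where "crit_poly n \<kappa> = (\<Sum>l\<in>{0..n - 1}. monom ((-1) ^ l * (of_nat n / of_nat (n - l)) * esym (n - 1) l \<kappa>) (n - l))"

lemma poly_crit_poly:
  "poly (crit_poly n \<kappa>) t = (\<Sum>l\<in>{0..n - 1}. (-1) ^ l * (of_nat n / of_nat (n - l)) * esym (n - 1) l \<kappa> * t ^ (n - l))"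
  by (simp only: crit_poly_def poly_sum poly_monom)

lemma pderiv_crit_poly: assumes "n \<ge> 1" shows "pderiv (crit_poly n \<kappa>) = smult (of_nat n) (Qpoly (n - 1) \<kappa>)"
proof -
  have "pderiv (crit_poly n \<kappa>) = (\<Sum>l\<in>{0..n - 1}. smult (of_nat n) (monom ((-1) ^ l * esym (n - 1) l \<kappa>) (n - 1 - l)))"
    unfolding crit_poly_def pderiv_sum
  proof (intro sum.cong refl)
    fix l assume l: "l \<in> {0..n - 1}"
    then have "n - l > 0" using assms by auto
    then show "pderiv (monom ((-1) ^ l * (of_nat n / of_nat (n - l)) * esym (n - 1) l \<kappa>) (n - l)) =
        smult (of_nat n) (monom ((-1) ^ l * esym (n - 1) l \<kappa>) (n - 1 - l))"
      by (simp add: pderiv_monom smult_monom mult_ac)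
  qed
  also have "\<dots> = smult (of_nat n) (\<Sum>l\<in>{0..n - 1}. monom ((-1) ^ l * esym (n - 1) l \<kappa>) (n - 1 - l))"
    by (rule poly_ext) (simp only: poly_sum poly_smult sum_distrib_left)
  finally show ?thesis by (simp only: Qpoly_expand)
qed

lemma poly_crit_poly_0: "n \<ge> 1 \<Longrightarrow> poly (crit_poly n \<kappa>) 0 = 0"
  unfolding poly_crit_poly by (intro sum.neutral) auto

lemma coeff_crit_poly: "l \<le> n - 1 \<Longrightarrow> coeff (crit_poly n \<kappa>) (n - l) = (-1) ^ l * (of_nat n / of_nat (n - l)) * esym (n - 1) l \<kappa>"
  unfolding crit_poly_def by (subst coeff_descending_sum) auto

lemma lead_coeff_crit_poly: assumes "n \<ge> 1"
  shows "degree (crit_poly n \<kappa>) = n" "lead_coeff (crit_poly n \<kappa>) = 1"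
proof -
  have c: "coeff (crit_poly n \<kappa>) n = 1" using coeff_crit_poly[of 0 n \<kappa>] assms by simp
  have "degree (crit_poly n \<kappa>) \<le> n" unfolding crit_poly_def
    by (intro degree_sum_le) (auto intro: order_trans[OF degree_monom_le])
  then show d: "degree (crit_poly n \<kappa>) = n" using le_degree[of "crit_poly n \<kappa>" n] c by simp
  then show "lead_coeff (crit_poly n \<kappa>) = 1" using c by simp
qed

lemma poly_eq_if_pderiv_eq:
  fixes p q :: "complex poly"
  assumes "pderiv p = pderiv q" "poly p t = poly q t" shows "p = q"
proof -
  have "pderiv (p - q) = 0" using assms(1) by (simp add: pderiv_diff)
  then have "degree (p - q) = 0" by (simp add: pderiv_eq_0_iff)
  then obtain c where c: "p - q = [:c:]" by (rule degree_eq_zeroE)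
  then have "poly (p - q) t = c" by simp
  then have "c = 0" using assms(2) by (simp add: poly_diff)
  then show ?thesis using c by simp
qed

lemma eq_crit_poly:
  assumes "n \<ge> 1" "pderiv p = smult (of_nat n) (Qpoly (n - 1) \<kappa>)"
  shows "p = crit_poly n \<kappa> + [:poly p 0:]"
  by (rule poly_eq_if_pderiv_eq[of _ _ 0])
     (simp_all add: assms(2) pderiv_add pderiv_crit_poly[OF assms(1)] poly_crit_poly_0[OF assms(1)] pderiv_pCons)

lemma crit_poly_cong: "(\<And>i. i \<in> {1..n - 1} \<Longrightarrow> x i = y i) \<Longrightarrow> crit_poly n x = crit_poly n y"
  unfolding crit_poly_def using esym_cong[of "n - 1" x y] by simp

lemma crit_poly_permuted: assumes "\<pi> permutes {1..n - 1}" "n \<ge> 1" shows "crit_poly n (\<kappa> \<circ> \<pi>) = crit_poly n \<kappa>"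
  by (rule poly_eq_if_pderiv_eq[of _ _ 0])
     (simp_all only: pderiv_crit_poly[OF assms(2)] poly_crit_poly_0[OF assms(2)] Qpoly_permuted[OF assms(1)])

lemma poly_crit_poly_scale:
  assumes "n \<ge> 1"
  shows "poly (crit_poly n (\<lambda>i. u * \<kappa> i)) (u * t) = u ^ n * poly (crit_poly n \<kappa>) t"
  unfolding poly_crit_poly sum_distrib_left esym_scale
proof (intro sum.cong refl)
  fix l assume "l \<in> {0..n - 1}"
  then have un: "u ^ n = u ^ l * u ^ (n - l)" using assms by (auto simp flip: power_add)
  show "(- 1) ^ l * (of_nat n / of_nat (n - l)) * (u ^ l * esym (n - 1) l \<kappa>) * (u * t) ^ (n - l) =
      u ^ n * ((- 1) ^ l * (of_nat n / of_nat (n - l)) * esym (n - 1) l \<kappa> * t ^ (n - l))"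
    unfolding un power_mult_distrib by (simp only: mult_ac)
qed

text \<open>The roots of a centred polynomial vanishing at \<open>0\<close> and at \<open>n - 2\<close> of its critical points:
  the critical points that are roots number \<open>n\<close> minus the number of distinct roots, so there are at
  most two distinct roots, and the centring excludes a nonzero one.\<close>

lemma critical_roots_imp_zero:
  assumes n: "n \<ge> 2" and sum: "(\<Sum>j\<in>{1..n - 1}. \<kappa> j) = 0"
    and z: "\<And>j. j \<in> {1..n - 2} \<Longrightarrow> poly (crit_poly n \<kappa>) (\<kappa> j) = 0"
    and j: "j \<in> {1..n - 1}"
  shows "\<kappa> j = 0"
proof -
  let ?R = "crit_poly n \<kappa>"
  have n1: "n \<ge> 1" using n by simp
  obtain a where a: "Qpoly n a = ?R" using monic_poly_splits[of ?R n] lead_coeff_crit_poly[OF n1] by blast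
  define X where "X = a ` {1..n}"
  have fX: "finite X" by (simp add: X_def)
  have rX: "poly ?R x = 0 \<longleftrightarrow> x \<in> X" for x by (auto simp: a[symmetric] poly_Qpoly X_def)
  have R0: "?R \<noteq> 0" using a Qpoly_nonzero by metis
  have "(\<Sum>x\<in>X. order x ?R) = (\<Sum>x\<in>X. card {j\<in>{1..n}. a j = x})" by (simp add: a[symmetric] order_Qpoly)
  also have "\<dots> = card (\<Union>x\<in>X. {j\<in>{1..n}. a j = x})" by (intro card_UN_disjoint[symmetric]) (auto simp: fX)
  also have "(\<Union>x\<in>X. {j\<in>{1..n}. a j = x}) = {1..n}" by (auto simp: X_def)
  finally have s1: "(\<Sum>x\<in>X. order x ?R) = n" by simp
  have "order x ?R = Suc (card {j\<in>{1..n - 1}. \<kappa> j = x})" if "x \<in> X" for x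
  proof -
    have "order x ?R = Suc (order x (pderiv ?R))" using that R0 rX by (intro order_pderiv) auto
    also have "order x (pderiv ?R) = order x (Qpoly (n - 1) \<kappa>)"
      unfolding pderiv_crit_poly[OF n1] using n by (intro order_smult) simp
    finally show ?thesis by (simp only: order_Qpoly)
  qed
  then have "n = (\<Sum>x\<in>X. Suc (card {j\<in>{1..n - 1}. \<kappa> j = x}))" using s1 by simp
  also have "\<dots> = card X + (\<Sum>x\<in>X. card {j\<in>{1..n - 1}. \<kappa> j = x})" by (simp add: sum.distrib flip: One_nat_def plus_1_eq_Suc)
  also have "(\<Sum>x\<in>X. card {j\<in>{1..n - 1}. \<kappa> j = x}) = card (\<Union>x\<in>X. {j\<in>{1..n - 1}. \<kappa> j = x})"
    by (intro card_UN_disjoint[symmetric]) (auto simp: fX)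
  finally have "n = card X + card (\<Union>x\<in>X. {j\<in>{1..n - 1}. \<kappa> j = x})" .
  moreover have "card {1..n - 2} \<le> card (\<Union>x\<in>X. {j\<in>{1..n - 1}. \<kappa> j = x})"
    using z fX by (intro card_mono) (auto simp: rX)
  ultimately have cX: "card X \<le> 2" using n by simp
  have "0 \<in> X" using rX poly_crit_poly_0[OF n1] by blast
  have "X = {0}"
  proof (rule ccontr)
    assume "X \<noteq> {0}"
    then obtain b where b: "b \<in> X" "b \<noteq> 0" using \<open>0 \<in> X\<close> by blast
    have "X = {0, b}"
      using card_seteq[OF fX, of "{0, b}"] cX b \<open>0 \<in> X\<close> by auto
    then have "(\<Sum>j\<in>{1..n}. a j) = (\<Sum>j\<in>{1..n}. if a j = b then b else 0)"
      by (intro sum.cong) (auto simp: X_def)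
    also have "\<dots> = of_nat (card {j\<in>{1..n}. a j = b}) * b" by (simp add: sum.If_cases Int_def)
    finally have "(\<Sum>j\<in>{1..n}. a j) = of_nat (card {j\<in>{1..n}. a j = b}) * b" .
    moreover have "(\<Sum>j\<in>{1..n}. a j) = 0"
    proof -
      have "(-1) ^ 1 * esym n 1 a = (-1) ^ 1 * (of_nat n / of_nat (n - 1)) * esym (n - 1) 1 \<kappa>"
        using coeff_Qpoly[of 1 n a] coeff_crit_poly[of 1 n \<kappa>] n a by simp
      then show ?thesis using sum by (simp only: esym_1 mult_zero_right) simp
    qed
    ultimately have "card {j\<in>{1..n}. a j = b} = 0" using b(2) by simp
    then have "b \<notin> X" by (auto simp: X_def)
    then show False using b(1) by simp
  qed
  then have zero: "\<kappa> j = 0" if "j \<in> {1..n - 2}" for j using z[OF that] rX by auto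
  have "{1..n - 1} = insert (n - 1) {1..n - 2}" using n by auto
  moreover have "n - 1 \<notin> {1..n - 2}" using n by auto
  ultimately have "(\<Sum>j\<in>{1..n - 1}. \<kappa> j) = \<kappa> (n - 1) + (\<Sum>j\<in>{1..n - 2}. \<kappa> j)"
    by (metis sum.insert finite_atLeastAtMost)
  then have "\<kappa> (n - 1) = 0" using sum zero by simp
  then show ?thesis using j zero n by (cases "j = n - 1") auto
qed

text \<open>A tangent vector killed by the differentials of the first \<open>n - 2\<close> critical values is zero when
  these critical points are distinct and nonzero: it deforms the polynomial by a polynomial of degree
  at most \<open>n - 2\<close> that vanishes at these critical points and at \<open>0\<close>.\<close>

lemma critical_values_differential_injective:
  assumes n: "n \<ge> 3" and sum: "(\<Sum>i\<in>{1..n - 1}. w i) = 0"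
    and inj: "inj_on \<kappa> {1..n - 1}" and nz: "\<And>j. j \<in> {1..n - 2} \<Longrightarrow> \<kappa> j \<noteq> 0"
    and D: "\<And>j. j \<in> {1..n - 2} \<Longrightarrow>
      ((\<lambda>t. poly (crit_poly n (\<lambda>i. \<kappa> i + t * w i)) (\<kappa> j + t * w j)) has_field_derivative 0) (at 0)"
    and j: "j \<in> {1..n - 1}"
  shows "w j = 0"
proof -
  define c where "c = (\<lambda>l. (-1) ^ l * (of_nat n / of_nat (n - l)) :: complex)"
  define e where "e = (\<lambda>l t. esym (n - 1) l (\<lambda>i. \<kappa> i + t * w i))"
  have "\<exists>p. \<forall>t. e l t = poly p t" for l
  proof -
    have "pfun (n - 1) l (\<lambda>x. esym (n - 1) l x)" by (rule pfun_esym) (auto intro: pfun_coord)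
    from pfun_line[OF this, of \<kappa> w] show ?thesis by (simp add: e_def)
  qed
  then obtain p where p: "\<And>l t. e l t = poly (p l) t" by metis
  define e' where "e' = (\<lambda>l. poly (pderiv (p l)) 0)"
  have De: "(e l has_field_derivative e' l) (at 0)" for l
    using poly_DERIV[of "p l" 0] p unfolding e'_def by (simp add: p[abs_def] ext)
  \<comment> \<open>The derivative of the polynomial in the direction \<open>w\<close>. Its coefficient in degree \<open>n\<close> is \<open>0\<close> as the
    polynomials are monic, the one in degree \<open>n - 1\<close> as they are centred.\<close>
  define S where "S = (\<Sum>l\<in>{0..n - 1}. monom (c l * e' l) (n - l))"
  have e0: "e' 0 = 0"
    using DERIV_unique[OF De[of 0], of 0] by (simp add: e_def[abs_def])
  have e1: "e' 1 = 0"
  proof -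
    have "e 1 = (\<lambda>t. \<Sum>i\<in>{1..n - 1}. \<kappa> i)"
      unfolding e_def esym_1 using sum by (simp add: sum.distrib flip: sum_distrib_left)
    then show ?thesis using DERIV_unique[OF De[of 1], of 0] by simp
  qed
  have crit: "poly (crit_poly n (\<lambda>i. \<kappa> i + t * w i)) u = (\<Sum>l\<in>{0..n - 1}. c l * e l t * u ^ (n - l))" for t u
    by (simp add: poly_crit_poly c_def e_def mult.assoc)
  have Sj: "poly S (\<kappa> j) = 0" if j: "j \<in> {1..n - 2}" for j
  proof -
    have "((\<lambda>t. \<Sum>l\<in>{0..n - 1}. c l * e l t * (\<kappa> j + t * w j) ^ (n - l)) has_field_derivative
        (\<Sum>l\<in>{0..n - 1}. c l * e' l * (\<kappa> j + 0 * w j) ^ (n - l) + c l * e l 0 * (of_nat (n - l) * (\<kappa> j + 0 * w j) ^ (n - l - 1) * w j))) (at 0)"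
      by (rule derivative_eq_intros refl De | simp add: algebra_simps)+
    moreover have "(\<Sum>l\<in>{0..n - 1}. c l * e' l * (\<kappa> j + 0 * w j) ^ (n - l) + c l * e l 0 * (of_nat (n - l) * (\<kappa> j + 0 * w j) ^ (n - l - 1) * w j))
       = poly S (\<kappa> j) + w j * poly (pderiv (crit_poly n \<kappa>)) (\<kappa> j)"
    proof -
      have "poly (pderiv (crit_poly n \<kappa>)) (\<kappa> j) = (\<Sum>l\<in>{0..n - 1}. of_nat (n - l) * (c l * e l 0) * \<kappa> j ^ (n - l - 1))"
        unfolding crit_poly_def pderiv_sum pderiv_monom poly_sum poly_monom by (simp add: c_def e_def mult.assoc)
      then show ?thesis unfolding S_def poly_sum poly_monom
        by (simp add: sum.distrib sum_distrib_left mult_ac)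
    qed
    moreover have "poly (pderiv (crit_poly n \<kappa>)) (\<kappa> j) = 0"
    proof -
      have "j \<in> {1..n - 1}" using that by auto
      then have "(\<Prod>i\<in>{1..n - 1}. \<kappa> j - \<kappa> i) = 0" by (intro prod_zero) auto
      then show ?thesis using n by (simp add: pderiv_crit_poly poly_Qpoly)
    qed
    ultimately show ?thesis using DERIV_unique[OF D[OF that, unfolded crit]] by auto
  qed
  have "S = 0"
  proof (rule ccontr)
    assume S0: "S \<noteq> 0"
    have "degree S \<le> n - 2" unfolding S_def
    proof (rule degree_sum_le)
      fix l assume "l \<in> {0..n - 1}"
      show "degree (monom (c l * e' l) (n - l)) \<le> n - 2"
      proof (cases "l = 0 \<or> l = 1")
        case True then show ?thesis using e0 e1 by auto
      next
        case False then show ?thesis using degree_monom_le[of "c l * e' l" "n - l"] by linarith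
      qed
    qed simp
    moreover have "insert 0 (\<kappa> ` {1..n - 2}) \<subseteq> {x. poly S x = 0}"
    proof -
      have "poly S 0 = 0" unfolding S_def poly_sum poly_monom using n by (intro sum.neutral) auto
      then show ?thesis using Sj by auto
    qed
    then have "card (insert 0 (\<kappa> ` {1..n - 2})) \<le> card {x. poly S x = 0}"
      using poly_roots_finite[OF S0] by (intro card_mono)
    then have "card (insert 0 (\<kappa> ` {1..n - 2})) \<le> degree S" using card_poly_roots_bound[OF S0] by linarith
    moreover have "card (insert 0 (\<kappa> ` {1..n - 2})) = n - 1"
    proof -
      have "inj_on \<kappa> {1..n - 2}" using inj by (rule inj_on_subset) auto
      moreover have "0 \<notin> \<kappa> ` {1..n - 2}" using nz by force
      ultimately show ?thesis using n by (simp add: card_image)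
    qed
    ultimately show False using n by linarith
  qed
  have el: "e' l = 0" if "l \<in> {0..n - 1}" for l
  proof -
    have "coeff S (n - l) = c l * e' l" unfolding S_def using that by (subst coeff_descending_sum) auto
    moreover have "c l \<noteq> 0" using that n by (auto simp: c_def)
    ultimately show ?thesis using \<open>S = 0\<close> by simp
  qed
  \<comment> \<open>So the elementary symmetric polynomials of the critical points have derivative \<open>0\<close>. Evaluating the
    monic polynomial with these roots at \<open>\<kappa> j\<close> yields that the simple root \<open>\<kappa> j\<close> does not move.\<close>
  define g where "g = (\<lambda>t. \<Prod>i\<in>{1..n - 1} - {j}. \<kappa> j - \<kappa> i - t * w i)"
  have prod_eq: "(\<Prod>i\<in>{1..n - 1}. \<kappa> j - (\<kappa> i + t * w i)) = - (t * w j) * g t" for t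
    unfolding g_def using prod.remove[OF _ j, of "\<lambda>i. \<kappa> j - (\<kappa> i + t * w i)"] by (simp add: diff_diff_eq)
  have "((\<lambda>t. \<Sum>k\<in>{0..n - 1}. (-1) ^ k * e k t * \<kappa> j ^ (n - 1 - k)) has_field_derivative
     (\<Sum>k\<in>{0..n - 1}. (-1) ^ k * e' k * \<kappa> j ^ (n - 1 - k))) (at 0)"
    by (intro DERIV_sum DERIV_cmult_right DERIV_cmult De)
  then have "((\<lambda>t. \<Prod>i\<in>{1..n - 1}. \<kappa> j - (\<kappa> i + t * w i)) has_field_derivative 0) (at 0)"
    unfolding prod_diff_esym e_def by (rule DERIV_cong) (simp add: el)
  then have "((\<lambda>t. - (t * w j) * g t / t) \<longlongrightarrow> 0) (at 0)"
    unfolding prod_eq by (simp add: DERIV_def)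
  moreover have "\<forall>\<^sub>F t in at 0. - (t * w j) * g t / t = - w j * g t"
    by (simp add: eventually_at_filter)
  ultimately have "((\<lambda>t. - w j * g t) \<longlongrightarrow> 0) (at 0)" by (rule Lim_transform_eventually)
  moreover have "((\<lambda>t. - w j * g t) \<longlongrightarrow> - w j * g 0) (at 0)"
    unfolding g_def by (intro tendsto_intros)
  ultimately have "- w j * g 0 = 0" using tendsto_unique[OF _ _ ] by (metis at_neq_bot)
  moreover have "g 0 \<noteq> 0" unfolding g_def using inj_onD[OF inj] j by fastforce
  ultimately show ?thesis by simp
qed

section \<open>Analytic equivalence of the normalized functions\<close>

lemma biholomorphic_germ_shear:
  assumes "c \<noteq> 0" "d \<noteq> 0" "q \<ge> 1"
  shows "biholomorphic_germ (\<lambda>(x, y). (c * x, d * y + \<mu> * x ^ q))"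
proof -
  have hol: "holomorphic2_on (\<lambda>(x, y). (c * x, d * y + \<mu> * x ^ q)) UNIV" for c d \<mu> :: complex
    unfolding holomorphic2_on_def
  proof (intro ballI exI conjI)
    fix z :: "complex \<times> complex"
    show "((\<lambda>(x, y). (c * x, d * y + \<mu> * x ^ q)) has_derivative
        (\<lambda>h. (c * fst h, d * snd h + \<mu> * (of_nat q * fst h * fst z ^ (q - 1))))) (at z)"
      unfolding case_prod_beta by (auto intro!: derivative_eq_intros)
    show "\<forall>k u v. (c * fst (k * u, k * v), d * snd (k * u, k * v) + \<mu> * (of_nat q * fst (k * u, k * v) * fst z ^ (q - 1))) =
      (k * fst (c * fst (u, v), d * snd (u, v) + \<mu> * (of_nat q * fst (u, v) * fst z ^ (q - 1))),
       k * snd (c * fst (u, v), d * snd (u, v) + \<mu> * (of_nat q * fst (u, v) * fst z ^ (q - 1))))"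
      by (simp add: algebra_simps)
  qed
  let ?P = "\<lambda>(x, y). (c * x, d * y + \<mu> * x ^ q)"
  let ?R = "\<lambda>(x, y). (inverse c * x, inverse d * y + (- \<mu> / (d * c ^ q)) * x ^ q)"
  have 1: "?R (?P z) = z" for z using assms by (cases z) (simp add: field_simps power_mult_distrib)
  have 2: "?P (?R z) = z" for z
    using assms by (cases z) (simp add: field_simps power_mult_distrib power_inverse)
  have s1: "?P ` UNIV = UNIV" by (rule surjI) (rule 2)
  have s2: "?R ` UNIV = UNIV" by (rule surjI) (rule 1)
  show ?thesis unfolding biholomorphic_germ_def
  proof (intro conjI exI[of _ UNIV] exI[of _ ?R])
    show "?P 0 = 0" using assms by (simp add: zero_prod_def power_0_left)
    show "holomorphic2_on ?P UNIV" "holomorphic2_on ?R UNIV" by (rule hol)+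
  qed (use 1 2 s1 s2 in auto)
qed

lemma holomorphic2_on_imp_continuous_on: "holomorphic2_on \<Phi> S \<Longrightarrow> continuous_on S \<Phi>"
  unfolding holomorphic2_on_def continuous_on_eq_continuous_within
  by (meson continuous_at_imp_continuous_at_within has_derivative_continuous)

lemma holomorphic2_on_subset: "holomorphic2_on \<Phi> S \<Longrightarrow> T \<subseteq> S \<Longrightarrow> holomorphic2_on \<Phi> T"
  unfolding holomorphic2_on_def by blast

lemma holomorphic2_on_compose:
  assumes "holomorphic2_on \<Phi> S" "holomorphic2_on \<Theta> T" "\<Phi> ` S \<subseteq> T"
  shows "holomorphic2_on (\<Theta> \<circ> \<Phi>) S"
  unfolding holomorphic2_on_def
proof
  fix z assume z: "z \<in> S"
  obtain D where D: "(\<Phi> has_derivative D) (at z)"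
    "\<And>c u v. D (c * u, c * v) = (c * fst (D (u, v)), c * snd (D (u, v)))"
    using assms(1) z unfolding holomorphic2_on_def by blast
  obtain E where E: "(\<Theta> has_derivative E) (at (\<Phi> z))"
    "\<And>c u v. E (c * u, c * v) = (c * fst (E (u, v)), c * snd (E (u, v)))"
    using assms(2,3) z unfolding holomorphic2_on_def by blast
  have "((\<Theta> \<circ> \<Phi>) has_derivative (E \<circ> D)) (at z)" by (rule diff_chain_at[OF D(1) E(1)])
  moreover have "(E \<circ> D) (c * u, c * v) = (c * fst ((E \<circ> D) (u, v)), c * snd ((E \<circ> D) (u, v)))" for c u v
    using E(2)[of c "fst (D (u, v))" "snd (D (u, v))"] by (simp add: D(2))
  ultimately show "\<exists>D. ((\<Theta> \<circ> \<Phi>) has_derivative D) (at z) \<and>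
      (\<forall>c u v. D (c * u, c * v) = (c * fst (D (u, v)), c * snd (D (u, v))))" by blast
qed

lemma biholomorphic_germ_tendsto:
  assumes "biholomorphic_germ \<Phi>" shows "(\<Phi> \<longlongrightarrow> 0) (nhds 0)"
proof -
  obtain U where U: "open U" "0 \<in> U" "holomorphic2_on \<Phi> U" "\<Phi> 0 = 0"
    using assms unfolding biholomorphic_germ_def by blast
  then have "isCont \<Phi> 0" using holomorphic2_on_imp_continuous_on continuous_on_eq_continuous_at by blast
  then show ?thesis using U(4) by (metis isCont_def tendsto_at_iff_tendsto_nhds)
qed

lemma analytic_equiv_refl: "analytic_equiv f f"
proof -
  have "biholomorphic_germ (\<lambda>(x, y). (1 * x, 1 * y + 0 * x ^ 1))" by (rule biholomorphic_germ_shear) auto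
  then show ?thesis unfolding analytic_equiv_def
    by (intro exI[of _ "\<lambda>(x, y). (1 * x, 1 * y + 0 * x ^ 1)"]) simp
qed

lemma analytic_equiv_sym:
  assumes "analytic_equiv f g" shows "analytic_equiv g f"
proof -
  obtain \<Phi> where P: "biholomorphic_germ \<Phi>" "\<forall>\<^sub>F z in nhds 0. g z = f (\<Phi> z)"
    using assms unfolding analytic_equiv_def by blast
  obtain U V \<Psi> where U: "open U" "open V" "0 \<in> U" "0 \<in> V" "\<Phi> ` U = V" "\<Psi> ` V = U" "\<forall>z\<in>U. \<Psi> (\<Phi> z) = z"
    "\<forall>w\<in>V. \<Phi> (\<Psi> w) = w" "holomorphic2_on \<Phi> U" "holomorphic2_on \<Psi> V" and P0: "\<Phi> 0 = 0"
    using P(1) unfolding biholomorphic_germ_def by blast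
  have "\<Psi> 0 = 0" using U(3,7) P0 by metis
  then have R: "biholomorphic_germ \<Psi>" unfolding biholomorphic_germ_def using U by blast
  have "\<forall>\<^sub>F w in nhds 0. g (\<Psi> w) = f (\<Phi> (\<Psi> w))"
    using biholomorphic_germ_tendsto[OF R] P(2) unfolding filterlim_iff by blast
  moreover have "\<forall>\<^sub>F w in nhds 0. w \<in> V" using U(2,4) by (rule eventually_nhds_in_open)
  ultimately have "\<forall>\<^sub>F w in nhds 0. f w = g (\<Psi> w)"
    by eventually_elim (use U(8) in auto)
  then show ?thesis unfolding analytic_equiv_def using R by blast
qed

lemma biholomorphic_germ_compose:
  assumes "biholomorphic_germ \<Phi>" "biholomorphic_germ \<Theta>" shows "biholomorphic_germ (\<Theta> \<circ> \<Phi>)"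
proof -
  obtain U V \<Psi> where U: "open U" "open V" "0 \<in> U" "0 \<in> V" "\<Phi> ` U = V" "\<Psi> ` V = U" "\<forall>z\<in>U. \<Psi> (\<Phi> z) = z"
    "\<forall>w\<in>V. \<Phi> (\<Psi> w) = w" "holomorphic2_on \<Phi> U" "holomorphic2_on \<Psi> V" and P0: "\<Phi> 0 = 0"
    using assms(1) unfolding biholomorphic_germ_def by blast
  obtain U' V' \<Psi>' where U': "open U'" "open V'" "0 \<in> U'" "0 \<in> V'" "\<Theta> ` U' = V'" "\<Psi>' ` V' = U'" "\<forall>z\<in>U'. \<Psi>' (\<Theta> z) = z"
    "\<forall>w\<in>V'. \<Theta> (\<Psi>' w) = w" "holomorphic2_on \<Theta> U'" "holomorphic2_on \<Psi>' V'" and P0': "\<Theta> 0 = 0"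
    using assms(2) unfolding biholomorphic_germ_def by blast
  define A where "A = {z\<in>U. \<Phi> z \<in> U'}"
  define B where "B = {w\<in>V'. \<Psi>' w \<in> V}"
  have oA: "open A"
    using continuous_open_preimage[OF holomorphic2_on_imp_continuous_on[OF U(9)] U(1) U'(1)]
    by (simp add: A_def vimage_def Int_def)
  have oB: "open B"
    using continuous_open_preimage[OF holomorphic2_on_imp_continuous_on[OF U'(10)] U'(2) U(2)]
    by (simp add: B_def vimage_def Int_def)
  have a: "z \<in> A \<Longrightarrow> (\<Theta> \<circ> \<Phi>) z \<in> B \<and> (\<Psi> \<circ> \<Psi>') ((\<Theta> \<circ> \<Phi>) z) = z" for z
    using U U' by (auto simp: A_def B_def)
  have b: "w \<in> B \<Longrightarrow> (\<Psi> \<circ> \<Psi>') w \<in> A \<and> (\<Theta> \<circ> \<Phi>) ((\<Psi> \<circ> \<Psi>') w) = w" for w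
    using U U' by (auto simp: A_def B_def)
  have zero: "(\<Theta> \<circ> \<Phi>) 0 = 0" by (simp add: P0 P0')
  have zA: "0 \<in> A" using P0 U(3) U'(3) by (simp add: A_def)
  show ?thesis unfolding biholomorphic_germ_def
  proof (rule conjI[OF zero], rule exI[of _ A], rule exI[of _ B], rule exI[of _ "\<Psi> \<circ> \<Psi>'"], intro conjI)
    show "0 \<in> A" by (rule zA)
    show "0 \<in> B" using a[OF zA] zero by simp
    show "(\<Theta> \<circ> \<Phi>) ` A = B"
    proof (intro subset_antisym image_subsetI subsetI)
      fix w assume "w \<in> B"
      from b[OF this] show "w \<in> (\<Theta> \<circ> \<Phi>) ` A" by (intro image_eqI[of w _ "(\<Psi> \<circ> \<Psi>') w"]) simp_all
    qed (use a in blast)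
    show "(\<Psi> \<circ> \<Psi>') ` B = A"
    proof (intro subset_antisym image_subsetI subsetI)
      fix w assume "w \<in> A"
      from a[OF this] show "w \<in> (\<Psi> \<circ> \<Psi>') ` B" by (intro image_eqI[of w _ "(\<Theta> \<circ> \<Phi>) w"]) simp_all
    qed (use b in blast)
    show "\<forall>z\<in>A. (\<Psi> \<circ> \<Psi>') ((\<Theta> \<circ> \<Phi>) z) = z" "\<forall>w\<in>B. (\<Theta> \<circ> \<Phi>) ((\<Psi> \<circ> \<Psi>') w) = w" using a b by blast+
    show "holomorphic2_on (\<Theta> \<circ> \<Phi>) A"
      by (rule holomorphic2_on_compose[OF holomorphic2_on_subset[OF U(9)] U'(9)]) (auto simp: A_def)
    show "holomorphic2_on (\<Psi> \<circ> \<Psi>') B"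
      by (rule holomorphic2_on_compose[OF holomorphic2_on_subset[OF U'(10)] U(10)]) (auto simp: B_def)
  qed (use oA oB in auto)
qed

lemma analytic_equiv_trans:
  assumes "analytic_equiv f g" "analytic_equiv g h" shows "analytic_equiv f h"
proof -
  obtain \<Phi> where P: "biholomorphic_germ \<Phi>" "\<forall>\<^sub>F z in nhds 0. g z = f (\<Phi> z)"
    using assms(1) unfolding analytic_equiv_def by blast
  obtain \<Theta> where T: "biholomorphic_germ \<Theta>" "\<forall>\<^sub>F z in nhds 0. h z = g (\<Theta> z)"
    using assms(2) unfolding analytic_equiv_def by blast
  have "\<forall>\<^sub>F z in nhds 0. g (\<Theta> z) = f (\<Phi> (\<Theta> z))"
    using biholomorphic_germ_tendsto[OF T(1)] P(2) unfolding filterlim_iff by blast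
  with T(2) have "\<forall>\<^sub>F z in nhds 0. h z = f ((\<Phi> \<circ> \<Theta>) z)" by eventually_elim simp
  then show ?thesis unfolding analytic_equiv_def
    using biholomorphic_germ_compose[OF T(1) P(1)] by blast
qed

lemma analytic_type_eq_iff: "analytic_type f = analytic_type g \<longleftrightarrow> analytic_equiv f g"
proof
  assume "analytic_type f = analytic_type g"
  then show "analytic_equiv f g" using analytic_equiv_refl[of g] by (auto simp: analytic_type_def)
next
  assume "analytic_equiv f g"
  then show "analytic_type f = analytic_type g"
    unfolding analytic_type_def using analytic_equiv_sym analytic_equiv_trans by blast
qed

text \<open>A holomorphic map of two variables is strictly differentiable in the second variable, uniformly
  in the first: by Cauchy's inequality, the derivatives in the second variable converge uniformly when
  the first variable tends to \<open>0\<close>.\<close>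

lemma strict_derivative_second_variable:
  fixes g :: "complex \<times> complex \<Rightarrow> complex"
  assumes U: "open U" "0 \<in> U" and cont: "continuous_on U g"
    and hol: "\<And>x y. (x, y) \<in> U \<Longrightarrow> (\<lambda>y. g (x, y)) field_differentiable (at y)"
    and e: "((\<lambda>y. g (0, y)) has_field_derivative e) (at 0)" and eps: "\<epsilon> > 0"
  shows "\<exists>\<delta>>0. \<forall>x y y'. cmod x < \<delta> \<longrightarrow> cmod y < \<delta> \<longrightarrow> cmod y' < \<delta> \<longrightarrow>
    cmod (g (x, y) - g (x, y') - e * (y - y')) \<le> \<epsilon> * cmod (y - y')"
proof -
  have "(0, 0) \<in> U" using U(2) by (simp add: zero_prod_def)
  from open_prod_elim[OF U(1) this] obtain A B where AB: "open A" "open B" "0 \<in> A" "0 \<in> B" "A \<times> B \<subseteq> U"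
    by (metis mem_Sigma_iff)
  obtain r1 where r1: "r1 > 0" "cball 0 r1 \<subseteq> A" using AB open_contains_cball by blast
  obtain r2 where r2: "r2 > 0" "cball 0 r2 \<subseteq> B" using AB open_contains_cball by blast
  define r where "r = min r1 r2"
  have "cball 0 r \<subseteq> A" "cball 0 r \<subseteq> B" using r1(2) r2(2) by (auto simp: r_def)
  then have r: "r > 0" "cball 0 r \<times> cball 0 r \<subseteq> U" using r1 r2 AB(5) by (auto simp: r_def)
  have "compact (cball 0 r \<times> cball (0::complex) r :: (complex \<times> complex) set)" by (intro compact_Times) auto
  then have uc: "uniformly_continuous_on (cball 0 r \<times> cball 0 r) g"
    using cont r(2) continuous_on_subset compact_uniformly_continuous by blast
  have holx: "(\<lambda>y. g (x, y)) holomorphic_on S" if "cmod x \<le> r" "S \<subseteq> cball 0 r" for x S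
    unfolding holomorphic_on_def
  proof
    fix y assume "y \<in> S"
    then have "(x, y) \<in> U" using that r(2) by auto
    then show "(\<lambda>y. g (x, y)) field_differentiable at y within S"
      using hol field_differentiable_at_within by blast
  qed
  define \<eta> where "\<eta> = \<epsilon> * r / 4"
  have eta: "\<eta> > 0" using eps r by (simp add: \<eta>_def)
  obtain \<delta>1 where d1: "\<delta>1 > 0" "\<And>p p'. p \<in> cball 0 r \<times> cball 0 r \<Longrightarrow> p' \<in> cball 0 r \<times> cball 0 r \<Longrightarrow> dist p' p < \<delta>1 \<Longrightarrow> dist (g p') (g p) < \<eta>"
    using uc eta unfolding uniformly_continuous_on_def by metis
  define h where "h = (\<lambda>y. g (0, y))"
  have h: "h holomorphic_on ball 0 r" unfolding h_def by (rule holx) (use r in auto)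
  have dh: "deriv h 0 = e" unfolding h_def using e by (rule DERIV_imp_deriv)
  have "isCont (deriv h) 0"
    using holomorphic_deriv[OF h open_ball] r(1)
    by (metis centre_in_ball continuous_on_eq_continuous_at holomorphic_on_imp_continuous_on open_ball)
  then have "\<exists>\<delta>2>0. \<forall>y. dist y 0 < \<delta>2 \<longrightarrow> dist (deriv h y) (deriv h 0) < \<epsilon> / 2"
    unfolding continuous_at_eps_delta using half_gt_zero[OF eps] by blast
  then obtain \<delta>2 where d2: "\<delta>2 > 0" "\<And>y. cmod y < \<delta>2 \<Longrightarrow> cmod (deriv h y - e) < \<epsilon> / 2"
    by (auto simp: dist_norm dh)
  define \<delta> where "\<delta> = min (min \<delta>1 \<delta>2) (r / 2)"
  have d: "\<delta> > 0" "\<delta> \<le> \<delta>1" "\<delta> \<le> \<delta>2" "\<delta> \<le> r / 2" using d1 d2 r by (auto simp: \<delta>_def)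
  have "cmod (g (x, y) - g (x, y') - e * (y - y')) \<le> \<epsilon> * cmod (y - y')"
    if xy: "cmod x < \<delta>" "cmod y < \<delta>" "cmod y' < \<delta>" for x y y'
  proof -
    \<comment> \<open>The difference of the slices over \<open>x\<close> and over \<open>0\<close> is uniformly small, hence so is its derivative.\<close>
    define k where "k = (\<lambda>y. g (x, y) - h y)"
    have xr: "cmod x \<le> r" using xy(1) d(4) r(1) by linarith
    have ks: "k holomorphic_on S" if "S \<subseteq> cball 0 r" for S
      unfolding k_def h_def using that xr r by (intro holomorphic_on_diff holx) auto
    have kb: "cmod (k y) \<le> \<eta>" if "cmod y \<le> r" for y
    proof -
      have "dist (x, y) (0, y) < \<delta>1" using xy(1) d(2) by (simp add: dist_Pair_Pair)
      then have "dist (g (x, y)) (g (0, y)) < \<eta>" using that xr r(1) by (intro d1(2)) auto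
      then show ?thesis by (simp add: k_def h_def dist_norm)
    qed
    have kd: "cmod (deriv k w) \<le> \<epsilon> / 2" if w: "cmod w < \<delta>" for w
    proof -
      have sub: "cball w (r / 2) \<subseteq> cball 0 r" using w d(4) by (auto simp: cball_subset_cball_iff)
      have "cmod ((deriv ^^ 1) k w) \<le> fact 1 * \<eta> / (r / 2) ^ 1"
      proof (rule Cauchy_inequality)
        show "k holomorphic_on ball w (r / 2)" using sub ball_subset_cball by (intro ks) blast
        show "continuous_on (cball w (r / 2)) k" using ks[OF sub] by (rule holomorphic_on_imp_continuous_on)
        fix v assume "cmod (w - v) = r / 2"
        then have "v \<in> cball w (r / 2)" by (simp add: dist_norm)
        then show "cmod (k v) \<le> \<eta>" using sub by (intro kb) auto
      qed (use r in auto)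
      also have "fact 1 * \<eta> / (r / 2) ^ 1 = \<epsilon> / 2" using r by (simp add: \<eta>_def)
      finally show ?thesis by simp
    qed
    have sub: "ball 0 \<delta> \<subseteq> cball (0::complex) r" "ball 0 \<delta> \<subseteq> ball (0::complex) r" using d(4) r(1) by auto
    have "cmod ((k y + (h y - e * y)) - (k y' + (h y' - e * y'))) \<le> \<epsilon> * cmod (y - y')"
    proof (rule field_differentiable_bound[where S = "ball 0 \<delta>" and f' = "\<lambda>w. deriv k w + (deriv h w - e)"])
      fix w :: complex assume w: "w \<in> ball 0 \<delta>"
      have dk: "(k has_field_derivative deriv k w) (at w)"
        by (rule holomorphic_derivI[OF ks[OF sub(1)] open_ball w])
      have dh: "(h has_field_derivative deriv h w) (at w)"
        using w sub(2) by (intro holomorphic_derivI[OF h open_ball]) blast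
      show "((\<lambda>y. k y + (h y - e * y)) has_field_derivative deriv k w + (deriv h w - e)) (at w within ball 0 \<delta>)"
        by (rule has_field_derivative_at_within[OF DERIV_add[OF dk DERIV_diff[OF dh DERIV_cmult_Id]]])
      have "cmod (deriv k w + (deriv h w - e)) \<le> cmod (deriv k w) + cmod (deriv h w - e)" by (rule norm_triangle_ineq)
      also have "\<dots> \<le> \<epsilon>" using kd[of w] d2(2)[of w] w d(3) by (simp add: dist_norm)
      finally show "cmod (deriv k w + (deriv h w - e)) \<le> \<epsilon>" .
    qed (use xy in auto)
    moreover have "(k y + (h y - e * y)) - (k y' + (h y' - e * y')) = g (x, y) - g (x, y') - e * (y - y')"
      unfolding k_def right_diff_distrib by simp
    ultimately show ?thesis by (simp only:)
  qed
  then show ?thesis using d(1) by blast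
qed

text \<open>\<open>(a, c)\<close> and \<open>(_, e)\<close> are the columns of the Jacobian matrix at \<open>0\<close>. To order \<open>q\<close> only differences
  between two arcs have a limit in the second component, which may contain powers of \<open>x\<close> with exponents
  less than \<open>q\<close>.\<close>

lemma biholomorphic_germ_along_arcs:
  assumes Phi: "biholomorphic_germ \<Phi>" and q: "q \<ge> 2"
  shows "\<exists>a c e. (\<forall>t. ((\<lambda>s. fst (\<Phi> (s, t * s ^ q)) / s) \<longlongrightarrow> a) (at 0)) \<and>
    (\<forall>t. ((\<lambda>s. snd (\<Phi> (s, t * s ^ q)) / s) \<longlongrightarrow> c) (at 0)) \<and>
    (\<forall>t t'. ((\<lambda>s. (snd (\<Phi> (s, t * s ^ q)) - snd (\<Phi> (s, t' * s ^ q))) / s ^ q) \<longlongrightarrow> e * (t - t')) (at 0)) \<and>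
    (c = 0 \<longrightarrow> a \<noteq> 0 \<and> e \<noteq> 0)"
proof -
  obtain U V \<Psi> where U: "open U" "open V" "0 \<in> U" "0 \<in> V" "\<Phi> ` U = V" "\<Psi> ` V = U" "\<forall>z\<in>U. \<Psi> (\<Phi> z) = z"
    "\<forall>w\<in>V. \<Phi> (\<Psi> w) = w" "holomorphic2_on \<Phi> U" "holomorphic2_on \<Psi> V" and P0: "\<Phi> 0 = 0"
    using Phi unfolding biholomorphic_germ_def by blast
  obtain D where D: "(\<Phi> has_derivative D) (at 0)"
    and Dc: "\<And>c u v. D (c * u, c * v) = (c * fst (D (u, v)), c * snd (D (u, v)))"
    using U(3,9) unfolding holomorphic2_on_def by blast
  obtain E where E: "(\<Psi> has_derivative E) (at 0)"
    using U(4,10) unfolding holomorphic2_on_def by blast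
  have lin: "linear D" using D has_derivative_linear by blast
  have ED: "E (D z) = z" for z
  proof -
    have "((\<Psi> \<circ> \<Phi>) has_derivative (E \<circ> D)) (at 0)" using diff_chain_at[OF D] E P0 by simp
    moreover have "((\<Psi> \<circ> \<Phi>) has_derivative (\<lambda>x. x)) (at 0)"
      by (rule has_derivative_transform_within_open[OF has_derivative_ident U(1,3)]) (use U(7) in auto)
    ultimately have "E \<circ> D = (\<lambda>x. x)" by (rule has_derivative_unique)
    then show ?thesis by (metis comp_apply)
  qed
  define a b c e where "a = fst (D (1, 0))" and "b = fst (D (0, 1))" and "c = snd (D (1, 0))" and "e = snd (D (0, 1))"
  have Du: "D (u, 0) = (u * a, u * c)" for u using Dc[of u 1 0] by (simp add: a_def c_def)
  have Dv: "D (0, v) = (v * b, v * e)" for v using Dc[of v 0 1] by (simp add: b_def e_def)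
  have curve: "((\<lambda>s. \<Phi> (s, t * s ^ q)) has_derivative (\<lambda>h. (h * a, h * c))) (at 0)" for t
  proof -
    have "((\<lambda>s. (s, t * s ^ q)) has_derivative (\<lambda>h. (h, 0))) (at 0)"
      using q by (auto intro!: derivative_eq_intros simp: power_0_left)
    moreover have "(0, t * 0 ^ q) = (0 :: complex \<times> complex)" using q by (simp add: zero_prod_def power_0_left)
    ultimately have "(\<Phi> \<circ> (\<lambda>s. (s, t * s ^ q)) has_derivative (D \<circ> (\<lambda>h. (h, 0)))) (at 0)"
      using D by (intro diff_chain_at) auto
    then show ?thesis by (simp add: o_def Du)
  qed
  have z0: "\<Phi> (0, t * 0 ^ q) = 0" for t using P0 q by (simp add: zero_prod_def power_0_left)
  have f1: "((\<lambda>s. fst (\<Phi> (s, t * s ^ q)) / s) \<longlongrightarrow> a) (at 0)" for t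
  proof -
    have "((\<lambda>s. fst (\<Phi> (s, t * s ^ q))) has_derivative (\<lambda>h. h * a)) (at 0)"
      using has_derivative_fst[OF curve[of t]] by simp
    then have "((\<lambda>s. fst (\<Phi> (s, t * s ^ q))) has_field_derivative a) (at 0)"
      by (simp add: has_field_derivative_def mult_commute_abs)
    then show ?thesis using z0[of t] by (simp add: DERIV_def)
  qed
  have f2: "((\<lambda>s. snd (\<Phi> (s, t * s ^ q)) / s) \<longlongrightarrow> c) (at 0)" for t
  proof -
    have "((\<lambda>s. snd (\<Phi> (s, t * s ^ q))) has_derivative (\<lambda>h. h * c)) (at 0)"
      using has_derivative_snd[OF curve[of t]] by simp
    then have "((\<lambda>s. snd (\<Phi> (s, t * s ^ q))) has_field_derivative c) (at 0)"
      by (simp add: has_field_derivative_def mult_commute_abs)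
    then show ?thesis using z0[of t] by (simp add: DERIV_def)
  qed
  have dy: "\<exists>d. ((\<lambda>y. snd (\<Phi> (x, y))) has_field_derivative d) (at y) \<and> (\<forall>D. (\<Phi> has_derivative D) (at (x, y)) \<longrightarrow> d = snd (D (0, 1)))"
    if xy: "(x, y) \<in> U" for x y
  proof -
    obtain D where D: "(\<Phi> has_derivative D) (at (x, y))"
      and Dc: "\<And>c u v. D (c * u, c * v) = (c * fst (D (u, v)), c * snd (D (u, v)))"
      using U(9) xy unfolding holomorphic2_on_def by blast
    have "((\<lambda>y. (x, y)) has_derivative (\<lambda>h. (0, h))) (at y)" by (auto intro!: derivative_eq_intros)
    then have "(\<Phi> \<circ> (\<lambda>y. (x, y)) has_derivative (D \<circ> (\<lambda>h. (0, h)))) (at y)" using D by (intro diff_chain_at) auto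
    from has_derivative_snd[OF this]
    have "((\<lambda>y. snd (\<Phi> (x, y))) has_derivative (\<lambda>h. snd (D (0, h)))) (at y)" by (simp add: o_def)
    moreover have "(\<lambda>h. snd (D (0, h))) = (*) (snd (D (0, 1)))"
    proof
      fix h show "snd (D (0, h)) = snd (D (0, 1)) * h" using Dc[of h 0 1] by simp
    qed
    ultimately have "((\<lambda>y. snd (\<Phi> (x, y))) has_field_derivative snd (D (0, 1))) (at y)"
      by (simp only: has_field_derivative_def)
    moreover have "D' = D" if "(\<Phi> has_derivative D') (at (x, y))" for D'
      using has_derivative_unique[OF that D] .
    ultimately show ?thesis by (intro exI[of _ "snd (D (0, 1))"]) auto
  qed
  have f3: "((\<lambda>s. (snd (\<Phi> (s, t * s ^ q)) - snd (\<Phi> (s, t' * s ^ q))) / s ^ q) \<longlongrightarrow> e * (t - t')) (at 0)" for t t'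
  proof (rule tendstoI)
    fix \<epsilon> :: real assume eps: "\<epsilon> > 0"
    define \<epsilon>' where "\<epsilon>' = \<epsilon> / (2 * (cmod (t - t') + 1))"
    have tt: "cmod (t - t') + 1 > 0" by (simp add: add_nonneg_pos)
    have eps': "\<epsilon>' > 0" using eps tt by (simp add: \<epsilon>'_def)
    have "\<exists>\<delta>>0. \<forall>x y y'. cmod x < \<delta> \<longrightarrow> cmod y < \<delta> \<longrightarrow> cmod y' < \<delta> \<longrightarrow>
      cmod (snd (\<Phi> (x, y)) - snd (\<Phi> (x, y')) - e * (y - y')) \<le> \<epsilon>' * cmod (y - y')"
    proof (rule strict_derivative_second_variable[OF U(1,3) _ _ _ eps'])
      show "continuous_on U (\<lambda>z. snd (\<Phi> z))"
        using holomorphic2_on_imp_continuous_on[OF U(9)] by (rule continuous_on_snd)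
      show "(\<lambda>y. snd (\<Phi> (x, y))) field_differentiable at y" if "(x, y) \<in> U" for x y
        using dy[OF that] unfolding field_differentiable_def by blast
      have "(0, 0) \<in> U" using U(3) by (simp add: zero_prod_def)
      from dy[OF this] show "((\<lambda>y. snd (\<Phi> (0, y))) has_field_derivative e) (at 0)"
      proof (elim exE conjE)
        fix d assume d: "((\<lambda>y. snd (\<Phi> (0, y))) has_field_derivative d) (at 0)"
          "\<forall>D. (\<Phi> has_derivative D) (at (0, 0)) \<longrightarrow> d = snd (D (0, 1))"
        have "d = e" using d(2) D unfolding zero_prod_def e_def by blast
        then show ?thesis using d(1) by simp
      qed
    qed
    then obtain \<delta> where d: "\<delta> > 0" "\<And>x y y'. cmod x < \<delta> \<Longrightarrow> cmod y < \<delta> \<Longrightarrow> cmod y' < \<delta> \<Longrightarrow>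
      cmod (snd (\<Phi> (x, y)) - snd (\<Phi> (x, y')) - e * (y - y')) \<le> \<epsilon>' * cmod (y - y')" by blast
    have small: "\<forall>\<^sub>F s in at 0. cmod (t * s ^ q) < \<delta>" for t :: complex
    proof -
      have "((\<lambda>s. cmod (t * s ^ q)) \<longlongrightarrow> cmod (t * 0 ^ q)) (at 0)" by (intro tendsto_intros)
      then show ?thesis using d(1) q by (intro order_tendstoD(2)) (auto simp: power_0_left)
    qed
    have "((\<lambda>s::complex. cmod s) \<longlongrightarrow> cmod 0) (at 0)" by (intro tendsto_intros)
    then have "\<forall>\<^sub>F s::complex in at 0. cmod s < \<delta>" using d(1) by (intro order_tendstoD(2)) auto
    moreover have "\<forall>\<^sub>F s::complex in at 0. s \<noteq> 0" by (simp add: eventually_at_filter)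
    ultimately show "\<forall>\<^sub>F s in at 0. dist ((snd (\<Phi> (s, t * s ^ q)) - snd (\<Phi> (s, t' * s ^ q))) / s ^ q) (e * (t - t')) < \<epsilon>"
      using small[of t] small[of t']
    proof eventually_elim
      case (elim s)
      have s: "cmod (s ^ q) > 0" using elim(2) by simp
      let ?w = "snd (\<Phi> (s, t * s ^ q)) - snd (\<Phi> (s, t' * s ^ q)) - e * (t * s ^ q - t' * s ^ q)"
      have "?w / s ^ q = (snd (\<Phi> (s, t * s ^ q)) - snd (\<Phi> (s, t' * s ^ q))) / s ^ q - e * (t - t')"
        using elim(2) by (simp add: field_simps)
      then have "dist ((snd (\<Phi> (s, t * s ^ q)) - snd (\<Phi> (s, t' * s ^ q))) / s ^ q) (e * (t - t')) = cmod ?w / cmod (s ^ q)"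
        by (simp add: dist_norm flip: norm_divide)
      also have "\<dots> \<le> \<epsilon>' * cmod (t * s ^ q - t' * s ^ q) / cmod (s ^ q)"
        using d(2)[OF elim(1) elim(3,4)] by (intro divide_right_mono) auto
      also have "cmod (t * s ^ q - t' * s ^ q) = cmod (t - t') * cmod (s ^ q)"
        by (simp only: norm_mult[symmetric] left_diff_distrib)
      also have "\<epsilon>' * (cmod (t - t') * cmod (s ^ q)) / cmod (s ^ q) = \<epsilon>' * cmod (t - t')"
          using s by (metis mult.assoc nonzero_mult_div_cancel_right less_irrefl)
      also have "\<dots> \<le> \<epsilon>' * (cmod (t - t') + 1)" using eps' by (intro mult_left_mono) auto
      also have "\<dots> = \<epsilon> / 2" unfolding \<epsilon>'_def using tt by (simp add: divide_simps)
      also have "\<dots> < \<epsilon>" using eps by simp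
      finally show ?case .
    qed
  qed
  have f4: "a \<noteq> 0 \<and> e \<noteq> 0" if "c = 0"
  proof -
    have E0: "E 0 = 0" using E has_derivative_linear linear_0 by blast
    have a: "a \<noteq> 0"
    proof
      assume "a = 0"
      then have "D (1, 0) = 0" using Du[of 1] \<open>c = 0\<close> by (simp add: zero_prod_def)
      then have "(1, 0) = (0 :: complex \<times> complex)" using ED[of "(1, 0)"] E0 by simp
      then show False by (simp add: zero_prod_def)
    qed
    have "e \<noteq> 0"
    proof
      assume "e = 0"
      then have "D (0, 1) = D (b / a, 0)" using Dv[of 1] Du[of "b / a"] \<open>c = 0\<close> a by simp
      then have "(0, 1) = (b / a, 0 :: complex)" using ED by metis
      then show False by simp
    qed
    then show ?thesis using a by simp
  qed
  show ?thesis using f1 f2 f3 f4 by blast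
qed

text \<open>One of the zeros \<open>y = lam' 1 * x ^ q\<close> is mapped to zeros, hence, along a sequence of points tending
  to \<open>0\<close>, to a single branch \<open>y = lam i * x ^ q\<close>. The filter \<open>F\<close> stands for this sequence. This excludes lower powers of
  \<open>x\<close> in the second component of \<open>\<Phi>\<close>, and the differences between arcs then determine the images of all arcs.

  The change of coordinates maps an arc \<open>y = t * x ^ q\<close> to one of the form
  \<open>y = (e / a ^ q) * t * x ^ q\<close> up to higher order. The leading coefficients of the functions
  along these arcs are the values of the polynomials, which are therefore related by a rotation.\<close>

lemma arcs_of_equivalence:
  assumes Phi: "biholomorphic_germ \<Phi>" and q: "q \<ge> 2" and n: "n \<ge> 1"
    and eq: "\<forall>\<^sub>F z in nhds 0. qh 1 q n lam' z = qh 1 q n lam (\<Phi> z)"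
    and sum: "(\<Sum>j\<in>{1..n}. lam j) = 0" "(\<Sum>j\<in>{1..n}. lam' j) = 0"
    and prod: "(\<Prod>j\<in>{1..n}. lam j) = 1" "(\<Prod>j\<in>{1..n}. lam' j) = 1"
  shows "\<exists>a e F. a \<noteq> 0 \<and> (e / a ^ q) ^ n = 1 \<and>
    (\<forall>t. poly (Qpoly n lam') t = poly (Qpoly n lam) (e / a ^ q * t)) \<and>
    F \<noteq> bot \<and> F \<le> at 0 \<and>
    (\<forall>t. ((\<lambda>s. fst (\<Phi> (s, t * s ^ q)) / s) \<longlongrightarrow> a) F) \<and>
    (\<forall>t. ((\<lambda>s. snd (\<Phi> (s, t * s ^ q)) / s ^ q) \<longlongrightarrow> e * t) F)"
proof -
  obtain a c e where a: "\<And>t. ((\<lambda>s. fst (\<Phi> (s, t * s ^ q)) / s) \<longlongrightarrow> a) (at 0)"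
    and c: "\<And>t. ((\<lambda>s. snd (\<Phi> (s, t * s ^ q)) / s) \<longlongrightarrow> c) (at 0)"
    and e: "\<And>t t'. ((\<lambda>s. (snd (\<Phi> (s, t * s ^ q)) - snd (\<Phi> (s, t' * s ^ q))) / s ^ q) \<longlongrightarrow> e * (t - t')) (at 0)"
    and ae: "c = 0 \<Longrightarrow> a \<noteq> 0 \<and> e \<noteq> 0"
    using biholomorphic_germ_along_arcs[OF Phi q] by blast
  have eq': "\<forall>\<^sub>F s in at 0. qh 1 q n lam' (s, t * s ^ q) = qh 1 q n lam (\<Phi> (s, t * s ^ q))" for t
  proof -
    have "((\<lambda>s. (s, t * s ^ q)) \<longlongrightarrow> (0, t * 0 ^ q)) (at 0)" by (intro tendsto_intros)
    then have "((\<lambda>s. (s, t * s ^ q)) \<longlongrightarrow> 0) (at 0)" using q by (simp add: zero_prod_def power_0_left)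
    then show ?thesis using eq unfolding filterlim_iff by blast
  qed
  \<comment> \<open>The arc of zeros that singles out the filter \<open>F\<close>.\<close>
  define t0 where "t0 = lam' 1"
  have zero: "\<forall>\<^sub>F s in at 0. \<exists>i\<in>{1..n}. snd (\<Phi> (s, t0 * s ^ q)) = lam i * fst (\<Phi> (s, t0 * s ^ q)) ^ q"
    using eq'[of t0]
  proof eventually_elim
    case (elim s)
    have "qh 1 q n lam' (s, t0 * s ^ q) = 0"
      unfolding qh_def t0_def using n by (auto intro!: prod_zero bexI[of _ 1])
    then have "qh 1 q n lam (\<Phi> (s, t0 * s ^ q)) = 0" using elim by simp
    then show ?case by (auto simp: qh_def case_prod_beta)
  qed
  have "\<exists>\<^sub>F s in at (0::complex). \<exists>i\<in>{1..n}. snd (\<Phi> (s, t0 * s ^ q)) = lam i * fst (\<Phi> (s, t0 * s ^ q)) ^ q"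
    by (rule eventually_frequently[OF _ zero]) simp
  from frequently_bex_finite[OF finite_atLeastAtMost this]
  obtain i where i: "\<exists>\<^sub>F s in at 0. snd (\<Phi> (s, t0 * s ^ q)) = lam i * fst (\<Phi> (s, t0 * s ^ q)) ^ q"
    by blast
  define S where "S = {s. snd (\<Phi> (s, t0 * s ^ q)) = lam i * fst (\<Phi> (s, t0 * s ^ q)) ^ q}"
  define F where "F = at 0 within S"
  have F: "F \<noteq> bot" "F \<le> at 0"
  proof -
    show "F \<le> at 0" unfolding F_def by (simp add: at_le)
    show "F \<noteq> bot"
    proof
      assume "F = bot"
      then have "eventually (\<lambda>_. False) F" by simp
      then have "\<forall>\<^sub>F s in nhds 0. s \<noteq> 0 \<longrightarrow> s \<notin> S" by (simp add: F_def eventually_at_filter)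
      then have "\<forall>\<^sub>F s in at 0. s \<notin> S" by (simp add: eventually_at_filter)
      then show False using i by (simp add: frequently_def S_def)
    qed
  qed
  have aF: "((\<lambda>s. fst (\<Phi> (s, t * s ^ q)) / s) \<longlongrightarrow> a) F" for t using a F(2) tendsto_mono by blast
  define \<beta> where "\<beta> = lam i * a ^ q"
  have t0F: "((\<lambda>s. snd (\<Phi> (s, t0 * s ^ q)) / s ^ q) \<longlongrightarrow> \<beta>) F"
  proof -
    have "((\<lambda>s. lam i * (fst (\<Phi> (s, t0 * s ^ q)) / s) ^ q) \<longlongrightarrow> \<beta>) F"
      unfolding \<beta>_def by (intro tendsto_intros aF)
    moreover have "\<forall>\<^sub>F s in F. lam i * (fst (\<Phi> (s, t0 * s ^ q)) / s) ^ q = snd (\<Phi> (s, t0 * s ^ q)) / s ^ q"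
      unfolding F_def eventually_at_filter by (intro always_eventually) (auto simp: S_def power_divide)
    ultimately show ?thesis by (rule Lim_transform_eventually)
  qed
  have "c = 0"
  proof -
    have "((\<lambda>s. snd (\<Phi> (s, t0 * s ^ q)) / s ^ q * s ^ (q - 1)) \<longlongrightarrow> \<beta> * 0 ^ (q - 1)) F"
      by (intro tendsto_mult t0F tendsto_power tendsto_mono[OF F(2) tendsto_ident_at])
    moreover have "\<forall>\<^sub>F s in F. snd (\<Phi> (s, t0 * s ^ q)) / s ^ q * s ^ (q - 1) = snd (\<Phi> (s, t0 * s ^ q)) / s"
    proof -
      have "s ^ q = s * s ^ (q - 1)" for s :: complex using q by (cases q) auto
      then show ?thesis unfolding F_def eventually_at_filter by (intro always_eventually) auto
    qed
    ultimately have "((\<lambda>s. snd (\<Phi> (s, t0 * s ^ q)) / s) \<longlongrightarrow> \<beta> * 0 ^ (q - 1)) F" by (rule Lim_transform_eventually)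
    moreover have "((\<lambda>s. snd (\<Phi> (s, t0 * s ^ q)) / s) \<longlongrightarrow> c) F" using c F(2) tendsto_mono by blast
    ultimately have "c = \<beta> * 0 ^ (q - 1)" using tendsto_unique[OF F(1)] by blast
    then show ?thesis using q by (simp add: power_0_left)
  qed
  then have a0: "a \<noteq> 0" and e0: "e \<noteq> 0" using ae by auto
  \<comment> \<open>The arc with coefficient \<open>t\<close> is mapped to one with second component \<open>(\<beta>' + e * t) * s ^ q\<close>.\<close>
  define \<beta>' where "\<beta>' = \<beta> - e * t0"
  have tF: "((\<lambda>s. snd (\<Phi> (s, t * s ^ q)) / s ^ q) \<longlongrightarrow> \<beta>' + e * t) F" for t
  proof -
    have "((\<lambda>s. snd (\<Phi> (s, t0 * s ^ q)) / s ^ q + (snd (\<Phi> (s, t * s ^ q)) - snd (\<Phi> (s, t0 * s ^ q))) / s ^ q) \<longlongrightarrow> \<beta> + e * (t - t0)) F"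
      using tendsto_mono[OF F(2) e] by (intro tendsto_add t0F)
    then show ?thesis by (simp add: \<beta>'_def algebra_simps flip: add_divide_distrib)
  qed
  have val: "poly (Qpoly n lam') t = (\<Prod>j\<in>{1..n}. \<beta>' + e * t - lam j * a ^ q)" for t
  proof -
    have "((\<lambda>s. \<Prod>j\<in>{1..n}. snd (\<Phi> (s, t * s ^ q)) / s ^ q - lam j * (fst (\<Phi> (s, t * s ^ q)) / s) ^ q) \<longlongrightarrow>
        (\<Prod>j\<in>{1..n}. \<beta>' + e * t - lam j * a ^ q)) F"
      by (intro tendsto_intros tF aF)
    moreover have "\<forall>\<^sub>F s in F. (\<Prod>j\<in>{1..n}. snd (\<Phi> (s, t * s ^ q)) / s ^ q - lam j * (fst (\<Phi> (s, t * s ^ q)) / s) ^ q)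
        = poly (Qpoly n lam') t"
    proof -
      have ne: "\<forall>\<^sub>F s in F. s \<noteq> 0" by (simp add: F_def eventually_at_filter)
      have "\<forall>\<^sub>F s in F. qh 1 q n lam' (s, t * s ^ q) = qh 1 q n lam (\<Phi> (s, t * s ^ q))"
        using eq'[of t] F(2) by (simp add: le_filter_def)
      then show ?thesis using ne
      proof eventually_elim
        case (elim s)
        have "(\<Prod>j\<in>{1..n}. snd (\<Phi> (s, t * s ^ q)) / s ^ q - lam j * (fst (\<Phi> (s, t * s ^ q)) / s) ^ q)
          = (\<Prod>j\<in>{1..n}. (snd (\<Phi> (s, t * s ^ q)) - lam j * fst (\<Phi> (s, t * s ^ q)) ^ q) / s ^ q)"
          by (intro prod.cong refl) (simp add: power_divide diff_divide_distrib)
        also have "\<dots> = qh 1 q n lam (\<Phi> (s, t * s ^ q)) / (s ^ q) ^ n"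
          by (simp add: prod_dividef qh_def case_prod_beta)
        also have "\<dots> = qh 1 q n lam' (s, t * s ^ q) / (s ^ q) ^ n" using elim(1) by simp
        also have "\<dots> = (\<Prod>j\<in>{1..n}. (t * s ^ q - lam' j * s ^ q) / s ^ q)"
          by (simp add: prod_dividef qh_def)
        also have "\<dots> = (\<Prod>j\<in>{1..n}. t - lam' j)"
          using elim(2) by (intro prod.cong refl) (simp flip: left_diff_distrib)
        finally show ?case by (simp add: poly_Qpoly)
      qed
    qed
    ultimately have "((\<lambda>s. poly (Qpoly n lam') t) \<longlongrightarrow> (\<Prod>j\<in>{1..n}. \<beta>' + e * t - lam j * a ^ q)) F"
      by (rule Lim_transform_eventually)
    then show ?thesis using tendsto_unique[OF F(1) _ tendsto_const] by metis
  qed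
  define \<mu> where "\<mu> = (\<lambda>j. (lam j * a ^ q - \<beta>') / e)"
  have "Qpoly n lam' = smult (e ^ n) (Qpoly n \<mu>)"
  proof (rule poly_ext)
    fix t
    have "(\<Prod>j\<in>{1..n}. \<beta>' + e * t - lam j * a ^ q) = (\<Prod>j\<in>{1..n}. e * (t - \<mu> j))"
      using e0 by (intro prod.cong refl) (simp add: \<mu>_def field_simps)
    then show "poly (Qpoly n lam') t = poly (smult (e ^ n) (Qpoly n \<mu>)) t"
      unfolding val by (simp add: poly_Qpoly prod.distrib)
  qed
  moreover have lead: "coeff (Qpoly n x) n = 1" for x using coeff_Qpoly[of 0 n x] by simp
  ultimately have en: "e ^ n = 1" using lead[of lam'] lead[of \<mu>] by simp
  then have Q: "Qpoly n lam' = Qpoly n \<mu>" using \<open>Qpoly n lam' = smult (e ^ n) (Qpoly n \<mu>)\<close> by simp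
  \<comment> \<open>Both polynomials are centred.\<close>
  have "\<beta>' = 0"
  proof -
    have "esym n 1 lam' = esym n 1 \<mu>" using coeff_Qpoly[of 1 n lam'] coeff_Qpoly[of 1 n \<mu>] n Q by simp
    then have "(\<Sum>j\<in>{1..n}. lam j * a ^ q - \<beta>') = 0"
      using sum(2) e0 by (simp only: esym_1 \<mu>_def sum_divide_distrib[symmetric]) simp
    then have "(\<Sum>j\<in>{1..n}. lam j) * a ^ q = of_nat n * \<beta>'" by (simp add: sum_subtractf sum_distrib_right)
    then show ?thesis using sum(1) n by simp
  qed
  \<comment> \<open>Both polynomials have the same constant term.\<close>
  have an: "(a ^ q) ^ n = 1"
  proof -
    have "(\<Prod>j\<in>{1..n}. - lam' j) = (\<Prod>j\<in>{1..n}. - lam j * a ^ q)"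
      using val[of 0] \<open>\<beta>' = 0\<close> by (simp add: poly_Qpoly)
    then have "(-1) ^ n * (\<Prod>j\<in>{1..n}. lam' j) = (-1) ^ n * (\<Prod>j\<in>{1..n}. lam j) * (a ^ q) ^ n"
      by (simp only: prod.distrib prod_constant card_atLeastAtMost) (simp add: prod_uminus)
    then show ?thesis using prod by simp
  qed
  have "poly (Qpoly n lam') t = poly (Qpoly n lam) (e / a ^ q * t)" for t
  proof -
    have "poly (Qpoly n lam') t = (\<Prod>j\<in>{1..n}. a ^ q * (e / a ^ q * t - lam j))"
      unfolding val using a0 \<open>\<beta>' = 0\<close> by (intro prod.cong refl) (simp add: field_simps)
    then show ?thesis by (simp add: prod.distrib an poly_Qpoly)
  qed
  moreover have "(e / a ^ q) ^ n = 1" using en an by (simp add: power_divide)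
  moreover have "((\<lambda>s. snd (\<Phi> (s, t * s ^ q)) / s ^ q) \<longlongrightarrow> e * t) F" for t using tF[of t] \<open>\<beta>' = 0\<close> by simp
  ultimately show ?thesis using a0 F aF by blast
qed

section \<open>Normalized parameters and their functions\<close>

text \<open>\<open>roots_of\<close> prescribes the elementary symmetric polynomials of the roots, that is the coefficients of a
  polynomial with the critical points \<open>\<kappa>\<close>.\<close>

lemma roots_of_iff:
  assumes n: "n \<ge> 2" and k: "\<kappa> \<in> W0 n"
  shows "roots_of n \<kappa> lam \<longleftrightarrow> lam \<in> cvec n \<and> Qpoly n lam = crit_poly n \<kappa> + [:(-1) ^ n:]"
proof (intro iffI conjI)
  assume r: "roots_of n \<kappa> lam"
  then show "lam \<in> cvec n" by (simp add: roots_of_def)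
  show "Qpoly n lam = crit_poly n \<kappa> + [:(-1) ^ n:]"
  proof (rule poly_ext)
    fix t
    have ins: "{0..n} = insert n {0..n - 1}" "n \<notin> {0..n - 1}" using n by auto
    have "poly (Qpoly n lam) t = (\<Sum>k\<in>{0..n}. (-1) ^ k * esym n k lam * t ^ (n - k))"
      by (simp only: poly_Qpoly prod_diff_esym)
    also have "\<dots> = (-1) ^ n * esym n n lam + (\<Sum>k\<in>{0..n - 1}. (-1) ^ k * esym n k lam * t ^ (n - k))"
      unfolding ins(1) using ins(2) by (subst sum.insert) auto
    also have "esym n n lam = 1" using r by (simp add: esym_full roots_of_def)
    also have "(\<Sum>k\<in>{0..n - 1}. (-1) ^ k * esym n k lam * t ^ (n - k)) = poly (crit_poly n \<kappa>) t"
      unfolding poly_crit_poly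
    proof (intro sum.cong refl)
      fix l assume l: "l \<in> {0..n - 1}"
      have "esym n l lam = of_nat n / of_nat (n - l) * esym (n - 1) l \<kappa>"
      proof (cases "l = 0")
        case True then show ?thesis using n by simp
      next
        case False then show ?thesis using r l by (simp add: roots_of_def)
      qed
      then show "(-1) ^ l * esym n l lam * t ^ (n - l) =
          (-1) ^ l * (of_nat n / of_nat (n - l)) * esym (n - 1) l \<kappa> * t ^ (n - l)" by (simp only: mult.assoc)
    qed
    finally show "poly (Qpoly n lam) t = poly (crit_poly n \<kappa> + [:(-1) ^ n:]) t" by (simp add: add.commute)
  qed
next
  assume a: "lam \<in> cvec n \<and> Qpoly n lam = crit_poly n \<kappa> + [:(-1) ^ n:]"
  have e: "esym n l lam = of_nat n / of_nat (n - l) * esym (n - 1) l \<kappa>" if l: "l \<in> {1..n - 1}" for l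
  proof -
    have "coeff [:(-1) ^ n :: complex:] (n - l) = 0" using l by (cases "n - l") auto
    then have "coeff (Qpoly n lam) (n - l) = coeff (crit_poly n \<kappa>) (n - l)" using a by (simp only: coeff_add add_0_right)
    moreover have "l \<le> n" "l \<le> n - 1" using l by auto
    ultimately have "(-1) ^ l * esym n l lam = (-1) ^ l * (of_nat n / of_nat (n - l)) * esym (n - 1) l \<kappa>"
      by (simp only: coeff_Qpoly coeff_crit_poly)
    then have "(-1) ^ l * esym n l lam = (-1) ^ l * (of_nat n / of_nat (n - l) * esym (n - 1) l \<kappa>)"
      by (simp only: mult.assoc)
    moreover have "(-1 :: complex) ^ l \<noteq> 0" by simp
    ultimately show ?thesis using mult_left_cancel by blast
  qed
  have "poly (Qpoly n lam) 0 = (-1) ^ n" using a poly_crit_poly_0[of n \<kappa>] n by simp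
  then have "(\<Prod>j\<in>{1..n}. lam j) = 1" by (simp add: poly_Qpoly prod_uminus)
  moreover have "(\<Sum>j\<in>{1..n}. lam j) = 0" using e[of 1] n k by (simp only: esym_1) (simp add: W0_def esym_1[unfolded One_nat_def])
  ultimately show "roots_of n \<kappa> lam" using a e by (simp add: roots_of_def)
qed

lemma roots_of_exists:
  assumes n: "n \<ge> 2" and k: "\<kappa> \<in> W0 n" shows "\<exists>lam. roots_of n \<kappa> lam"
proof -
  let ?p = "crit_poly n \<kappa> + [:(-1) ^ n:]"
  have n1: "n \<ge> 1" using n by simp
  have "degree [:(-1) ^ n :: complex:] < degree (crit_poly n \<kappa>)" using n lead_coeff_crit_poly[OF n1] by simp
  then have d: "degree ?p = n" by (simp only: degree_add_eq_left lead_coeff_crit_poly(1)[OF n1])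
  have "coeff [:(-1) ^ n :: complex:] n = 0" using n by (cases n) auto
  then have "lead_coeff ?p = 1" using lead_coeff_crit_poly[OF n1, of \<kappa>] d by simp
  then obtain lam where "lam \<in> cvec n" "Qpoly n lam = ?p" using monic_poly_splits[OF d] by blast
  then show ?thesis using roots_of_iff[OF n k] by blast
qed

lemma W0_sum_roots_of:
  assumes "roots_of n \<kappa> lam"
  shows "(\<Sum>j\<in>{1..n}. lam j) = 0" "(\<Prod>j\<in>{1..n}. lam j) = 1"
  using assms by (auto simp: roots_of_def)

lemma qh_eq_if_Qpoly_eq:
  assumes "Qpoly n a = Qpoly n b" shows "qh 1 q n a = qh 1 q n b"
proof
  fix z :: "complex \<times> complex"
  obtain \<pi> where p: "\<pi> permutes {1..n}" "\<forall>j\<in>{1..n}. b j = a (\<pi> j)" using Qpoly_eq_imp_permuted[OF assms] by blast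
  have "(\<Prod>j\<in>{1..n}. snd z - a j * fst z ^ q) = (\<Prod>j\<in>{1..n}. snd z - a (\<pi> j) * fst z ^ q)"
    using prod.permute[OF p(1), of "\<lambda>j. snd z - a j * fst z ^ q"] by (simp add: o_def)
  then show "qh 1 q n a z = qh 1 q n b z" using p(2) by (simp add: qh_def case_prod_beta)
qed

text \<open>Spelled as a special case of the maps in \<open>biholomorphic_germ_shear\<close>.\<close>

definition rotate_y :: "complex \<Rightarrow> complex \<times> complex \<Rightarrow> complex \<times> complex"
  where "rotate_y \<zeta> = (\<lambda>(x, y). (1 * x, inverse \<zeta> * y + 0 * x ^ 1))"

lemma biholomorphic_germ_rotate_y: "\<zeta> \<noteq> 0 \<Longrightarrow> biholomorphic_germ (rotate_y \<zeta>)"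
  unfolding rotate_y_def by (rule biholomorphic_germ_shear) auto

lemma root_of_unity_nonzero: "\<zeta> ^ n = 1 \<Longrightarrow> n \<ge> 1 \<Longrightarrow> (\<zeta>::complex) \<noteq> 0"
  by (auto simp: power_0_left)

lemma crit_poly_rotated:
  assumes n: "n \<ge> 1" and p: "\<pi> permutes {1..n - 1}" and z: "\<zeta> ^ n = 1"
    and k: "\<And>j. j \<in> {1..n - 1} \<Longrightarrow> \<kappa>' j = \<zeta> * \<kappa> (\<pi> j)"
  shows "poly (crit_poly n \<kappa>') (\<zeta> * t) = poly (crit_poly n \<kappa>) t"
proof -
  have "crit_poly n \<kappa>' = crit_poly n (\<lambda>i. \<zeta> * (\<kappa> \<circ> \<pi>) i)" by (rule crit_poly_cong) (simp add: k)
  then show ?thesis using poly_crit_poly_scale[OF n, of \<zeta> "\<kappa> \<circ> \<pi>" t] crit_poly_permuted[OF p n, of \<kappa>] z by simp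
qed

lemma qh_rotated:
  assumes n: "n \<ge> 2" and k: "\<kappa> \<in> W0 n" "\<kappa>' \<in> W0 n" and r: "roots_of n \<kappa> lam" "roots_of n \<kappa>' lam'"
    and p: "\<pi> permutes {1..n - 1}" and z: "\<zeta> ^ n = 1"
    and kk: "\<And>j. j \<in> {1..n - 1} \<Longrightarrow> \<kappa>' j = \<zeta> * \<kappa> (\<pi> j)"
  shows "qh 1 q n lam' v = qh 1 q n lam (rotate_y \<zeta> v)"
proof -
  have n1: "n \<ge> 1" using n by simp
  have z0: "\<zeta> \<noteq> 0" by (rule root_of_unity_nonzero[OF z n1])
  have Q: "Qpoly n lam = crit_poly n \<kappa> + [:(-1) ^ n:]" "Qpoly n lam' = crit_poly n \<kappa>' + [:(-1) ^ n:]"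
    using roots_of_iff[OF n] k r by auto
  have "Qpoly n lam' = Qpoly n (\<lambda>j. \<zeta> * lam j)"
  proof (rule poly_ext)
    fix t
    have "poly (Qpoly n (\<lambda>j. \<zeta> * lam j)) t = (\<Prod>j\<in>{1..n}. \<zeta> * (inverse \<zeta> * t - lam j))"
      unfolding poly_Qpoly using z0 by (intro prod.cong refl) (simp add: field_simps)
    also have "\<dots> = \<zeta> ^ n * poly (Qpoly n lam) (inverse \<zeta> * t)" by (simp add: poly_Qpoly prod.distrib)
    also have "\<dots> = poly (crit_poly n \<kappa>) (inverse \<zeta> * t) + (-1) ^ n" using z by (simp add: Q)
    also have "poly (crit_poly n \<kappa>) (inverse \<zeta> * t) = poly (crit_poly n \<kappa>') (\<zeta> * (inverse \<zeta> * t))"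
      using crit_poly_rotated[of n \<pi> \<zeta> \<kappa>' \<kappa>, OF n1 p z kk] by metis
    also have "\<zeta> * (inverse \<zeta> * t) = t" using z0 by simp
    finally show "poly (Qpoly n lam') t = poly (Qpoly n (\<lambda>j. \<zeta> * lam j)) t" by (simp add: Q)
  qed
  then have "qh 1 q n lam' = qh 1 q n (\<lambda>j. \<zeta> * lam j)" by (rule qh_eq_if_Qpoly_eq)
  moreover have "qh 1 q n (\<lambda>j. \<zeta> * lam j) v = qh 1 q n lam (rotate_y \<zeta> v)"
  proof -
    have "qh 1 q n (\<lambda>j. \<zeta> * lam j) v = (\<Prod>j\<in>{1..n}. \<zeta> * (inverse \<zeta> * snd v - lam j * fst v ^ q))"
      unfolding qh_def case_prod_beta using z0 by (intro prod.cong refl) (simp add: field_simps)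
    also have "\<dots> = (\<Prod>j\<in>{1..n}. inverse \<zeta> * snd v - lam j * fst v ^ q)" by (simp only: prod.distrib) (simp add: z)
    finally show ?thesis by (simp add: qh_def rotate_y_def case_prod_beta)
  qed
  ultimately show ?thesis by simp
qed

lemma W0_cvec: "\<kappa> \<in> W0 n \<Longrightarrow> \<kappa> \<in> cvec (n - 1)" by (simp add: W0_def)

lemma cvec_eqI: "x \<in> cvec N \<Longrightarrow> y \<in> cvec N \<Longrightarrow> (\<And>i. i \<in> {1..N} \<Longrightarrow> x i = y i) \<Longrightarrow> x = y"
  unfolding cvec_def by (rule PiE_ext)

lemma Zn_orbit_iff:
  assumes "\<kappa>' \<in> cvec (n - 1)"
  shows "\<kappa>' \<in> Zn_orbit n \<kappa> \<longleftrightarrow> (\<exists>\<zeta>. \<zeta> ^ n = 1 \<and> (\<forall>j\<in>{1..n - 1}. \<kappa>' j = \<zeta> * \<kappa> j))"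
proof
  assume "\<kappa>' \<in> Zn_orbit n \<kappa>"
  then show "\<exists>\<zeta>. \<zeta> ^ n = 1 \<and> (\<forall>j\<in>{1..n - 1}. \<kappa>' j = \<zeta> * \<kappa> j)" by (auto simp: Zn_orbit_def)
next
  assume "\<exists>\<zeta>. \<zeta> ^ n = 1 \<and> (\<forall>j\<in>{1..n - 1}. \<kappa>' j = \<zeta> * \<kappa> j)"
  then obtain \<zeta> where z: "\<zeta> ^ n = 1" "\<forall>j\<in>{1..n - 1}. \<kappa>' j = \<zeta> * \<kappa> j" by blast
  have "\<kappa>' = (\<lambda>j\<in>{1..n - 1}. \<zeta> * \<kappa> j)"
    by (rule cvec_eqI[OF assms]) (auto simp: cvec_def z)
  then show "\<kappa>' \<in> Zn_orbit n \<kappa>" unfolding Zn_orbit_def using z(1) by blast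
qed

text \<open>The rotation of the polynomials given by an equivalence preserves the set of critical points with
  multiplicities, but not their numbering.\<close>

lemma analytic_equiv_iff_permuted_orbit:
  assumes n: "n \<ge> 2" and q: "q \<ge> 2" and k: "\<kappa> \<in> W0 n" "\<kappa>' \<in> W0 n"
    and f: "represents n q \<kappa> f" "represents n q \<kappa>' f'"
  shows "analytic_equiv f f' \<longleftrightarrow> (\<exists>\<pi>. \<pi> permutes {1..n - 1} \<and> \<kappa>' \<in> Zn_orbit n (\<kappa> \<circ> \<pi>))"
proof -
  obtain lam lam' where r: "roots_of n \<kappa> lam" "f = qh 1 q n lam" "roots_of n \<kappa>' lam'" "f' = qh 1 q n lam'"
    using f by (auto simp: represents_def)
  have n1: "n \<ge> 1" using n by simp
  show ?thesis
  proof
    assume "analytic_equiv f f'"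
    then obtain \<Phi> where P: "biholomorphic_germ \<Phi>" "\<forall>\<^sub>F z in nhds 0. qh 1 q n lam' z = qh 1 q n lam (\<Phi> z)"
      by (auto simp: analytic_equiv_def r)
    from arcs_of_equivalence[OF P(1) q n1 P(2) W0_sum_roots_of(1)[OF r(1)] W0_sum_roots_of(1)[OF r(3)]
        W0_sum_roots_of(2)[OF r(1)] W0_sum_roots_of(2)[OF r(3)]]
    obtain \<zeta> where z: "\<zeta> ^ n = 1" "\<And>t. poly (Qpoly n lam') t = poly (Qpoly n lam) (\<zeta> * t)" by blast
    have z0: "\<zeta> \<noteq> 0" by (rule root_of_unity_nonzero[OF z(1) n1])
    have Q: "Qpoly n lam = crit_poly n \<kappa> + [:(-1) ^ n:]" "Qpoly n lam' = crit_poly n \<kappa>' + [:(-1) ^ n:]"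
      using roots_of_iff[OF n] k r by auto
    have "crit_poly n \<kappa>' = crit_poly n (\<lambda>i. inverse \<zeta> * \<kappa> i)"
    proof (rule poly_ext)
      fix t
      have "poly (crit_poly n (\<lambda>i. inverse \<zeta> * \<kappa> i)) (inverse \<zeta> * (\<zeta> * t)) = inverse \<zeta> ^ n * poly (crit_poly n \<kappa>) (\<zeta> * t)"
        by (rule poly_crit_poly_scale[OF n1])
      also have "inverse \<zeta> * (\<zeta> * t) = t" using z0 by simp
      also have "inverse \<zeta> ^ n = 1" using z(1) by (simp add: power_inverse)
      finally show "poly (crit_poly n \<kappa>') t = poly (crit_poly n (\<lambda>i. inverse \<zeta> * \<kappa> i)) t"
        using z(2)[of t] by (simp add: Q)
    qed
    then have "smult (of_nat n) (Qpoly (n - 1) \<kappa>') = smult (of_nat n) (Qpoly (n - 1) (\<lambda>i. inverse \<zeta> * \<kappa> i))"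
      using pderiv_crit_poly[OF n1] by metis
    then have sm: "poly (smult (of_nat n) (Qpoly (n - 1) \<kappa>')) t = poly (smult (of_nat n) (Qpoly (n - 1) (\<lambda>i. inverse \<zeta> * \<kappa> i))) t" for t
      by (simp only:)
    have "Qpoly (n - 1) (\<lambda>i. inverse \<zeta> * \<kappa> i) = Qpoly (n - 1) \<kappa>'"
      by (rule poly_ext) (use sm n in simp)
    then obtain \<pi> where p: "\<pi> permutes {1..n - 1}" "\<forall>j\<in>{1..n - 1}. \<kappa>' j = inverse \<zeta> * \<kappa> (\<pi> j)"
      using Qpoly_eq_imp_permuted by blast
    moreover have "inverse \<zeta> ^ n = 1" using z(1) by (simp add: power_inverse)
    ultimately have "\<kappa>' \<in> Zn_orbit n (\<kappa> \<circ> \<pi>)" unfolding Zn_orbit_iff[OF W0_cvec[OF k(2)]] by auto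
    then show "\<exists>\<pi>. \<pi> permutes {1..n - 1} \<and> \<kappa>' \<in> Zn_orbit n (\<kappa> \<circ> \<pi>)" using p(1) by blast
  next
    assume "\<exists>\<pi>. \<pi> permutes {1..n - 1} \<and> \<kappa>' \<in> Zn_orbit n (\<kappa> \<circ> \<pi>)"
    then obtain \<pi> \<zeta> where p: "\<pi> permutes {1..n - 1}" "\<zeta> ^ n = 1" "\<And>j. j \<in> {1..n - 1} \<Longrightarrow> \<kappa>' j = \<zeta> * \<kappa> (\<pi> j)"
      using Zn_orbit_iff[OF W0_cvec[OF k(2)]] by auto
    have "biholomorphic_germ (rotate_y \<zeta>)" by (intro biholomorphic_germ_rotate_y root_of_unity_nonzero[OF p(2) n1])
    moreover have "\<forall>\<^sub>F v in nhds 0. f' v = f (rotate_y \<zeta> v)"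
      unfolding r by (intro always_eventually allI qh_rotated[OF n k r(1,3) p])
    ultimately show "analytic_equiv f f'" unfolding analytic_equiv_def by blast
  qed
qed

text \<open>An equivalence acts on the arcs by the same rotation as on the polynomials. As it respects the numbering
  of the polar arcs, so does the rotation.\<close>

lemma labelled_equiv_iff_orbit:
  assumes n: "n \<ge> 2" and q: "q \<ge> 2" and k: "\<kappa> \<in> W0 n" "\<kappa>' \<in> W0 n"
    and f: "represents n q \<kappa> f" "represents n q \<kappa>' f'"
  shows "labelled_equiv n q (f, \<kappa>) (f', \<kappa>') \<longleftrightarrow> \<kappa>' \<in> Zn_orbit n \<kappa>"
proof -
  obtain lam lam' where r: "roots_of n \<kappa> lam" "f = qh 1 q n lam" "roots_of n \<kappa>' lam'" "f' = qh 1 q n lam'"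
    using f by (auto simp: represents_def)
  have n1: "n \<ge> 1" using n by simp
  show ?thesis
  proof
    assume "labelled_equiv n q (f, \<kappa>) (f', \<kappa>')"
    then obtain \<Phi> where P: "biholomorphic_germ \<Phi>" "\<forall>\<^sub>F z in nhds 0. qh 1 q n lam' z = qh 1 q n lam (\<Phi> z)"
      and lim: "\<And>l. l \<in> {1..n - 1} \<Longrightarrow> ((\<lambda>s. (snd (\<Phi> (s, \<kappa>' l * s ^ q)) - \<kappa> l * fst (\<Phi> (s, \<kappa>' l * s ^ q)) ^ q) / s ^ q) \<longlongrightarrow> 0) (at 0)"
      by (auto simp: labelled_equiv_def r)
    from arcs_of_equivalence[OF P(1) q n1 P(2) W0_sum_roots_of(1)[OF r(1)] W0_sum_roots_of(1)[OF r(3)]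
        W0_sum_roots_of(2)[OF r(1)] W0_sum_roots_of(2)[OF r(3)]]
    obtain a e F where a: "a \<noteq> 0" and z: "(e / a ^ q) ^ n = 1" and F: "F \<noteq> bot" "F \<le> at 0"
      and X: "\<And>t. ((\<lambda>s. fst (\<Phi> (s, t * s ^ q)) / s) \<longlongrightarrow> a) F"
      and Y: "\<And>t. ((\<lambda>s. snd (\<Phi> (s, t * s ^ q)) / s ^ q) \<longlongrightarrow> e * t) F" by blast
    have e: "e \<noteq> 0" using root_of_unity_nonzero[OF z n1] by auto
    have "\<kappa>' l = inverse (e / a ^ q) * \<kappa> l" if l: "l \<in> {1..n - 1}" for l
    proof -
      have "((\<lambda>s. snd (\<Phi> (s, \<kappa>' l * s ^ q)) / s ^ q - \<kappa> l * (fst (\<Phi> (s, \<kappa>' l * s ^ q)) / s) ^ q) \<longlongrightarrow> e * \<kappa>' l - \<kappa> l * a ^ q) F"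
        by (intro tendsto_intros X Y)
      moreover have "((\<lambda>s. snd (\<Phi> (s, \<kappa>' l * s ^ q)) / s ^ q - \<kappa> l * (fst (\<Phi> (s, \<kappa>' l * s ^ q)) / s) ^ q) \<longlongrightarrow> 0) F"
        using tendsto_mono[OF F(2) lim[OF l]] by (simp add: diff_divide_distrib power_divide)
      ultimately have "e * \<kappa>' l - \<kappa> l * a ^ q = 0" using tendsto_unique[OF F(1)] by blast
      then show ?thesis using e a by (simp add: field_simps)
    qed
    moreover have "inverse (e / a ^ q) ^ n = 1" by (simp only: power_inverse z inverse_1)
    ultimately show "\<kappa>' \<in> Zn_orbit n \<kappa>" unfolding Zn_orbit_iff[OF W0_cvec[OF k(2)]] by blast
  next
    assume "\<kappa>' \<in> Zn_orbit n \<kappa>"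
    then obtain \<zeta> where p: "\<zeta> ^ n = 1" "\<And>j. j \<in> {1..n - 1} \<Longrightarrow> \<kappa>' j = \<zeta> * \<kappa> (id j)"
      using Zn_orbit_iff[OF W0_cvec[OF k(2)]] by auto
    have z0: "\<zeta> \<noteq> 0" by (rule root_of_unity_nonzero[OF p(1) n1])
    have "biholomorphic_germ (rotate_y \<zeta>)" by (rule biholomorphic_germ_rotate_y[OF z0])
    moreover have "\<forall>\<^sub>F v in nhds 0. f' v = f (rotate_y \<zeta> v)"
      unfolding r by (intro always_eventually allI qh_rotated[OF n k r(1,3) permutes_id p])
    moreover have "(\<lambda>s. (snd (rotate_y \<zeta> (s, \<kappa>' l * s ^ q)) - \<kappa> l * fst (rotate_y \<zeta> (s, \<kappa>' l * s ^ q)) ^ q) / s ^ q) = (\<lambda>s. 0)"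
      if "l \<in> {1..n - 1}" for l
      using z0 by (simp add: rotate_y_def p(2)[OF that] mult.assoc[symmetric])
    ultimately show "labelled_equiv n q (f, \<kappa>) (f', \<kappa>')" unfolding labelled_equiv_def prod.case
      by (intro exI[of _ "rotate_y \<zeta>"] conjI ballI) (assumption | simp)+
  qed
qed

lemma Zn_orbit_self: assumes "\<kappa> \<in> cvec (n - 1)" shows "\<kappa> \<in> Zn_orbit n \<kappa>"
  unfolding Zn_orbit_iff[OF assms] by (intro exI[of _ 1]) simp

lemma Zn_orbit_subset_cvec: "\<kappa>' \<in> Zn_orbit n \<kappa> \<Longrightarrow> \<kappa>' \<in> cvec (n - 1)"
  by (auto simp: Zn_orbit_def cvec_def)

lemma Zn_orbit_sym:
  assumes n: "n \<ge> 1" and "\<kappa> \<in> cvec (n - 1)" "\<kappa>' \<in> Zn_orbit n \<kappa>" shows "\<kappa> \<in> Zn_orbit n \<kappa>'"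
proof -
  obtain \<zeta> where z: "\<zeta> ^ n = 1" "\<forall>j\<in>{1..n - 1}. \<kappa>' j = \<zeta> * \<kappa> j"
    using assms(3) Zn_orbit_iff[OF Zn_orbit_subset_cvec[OF assms(3)]] by blast
  then show ?thesis unfolding Zn_orbit_iff[OF assms(2)] using root_of_unity_nonzero[OF z(1) n]
    by (intro exI[of _ "inverse \<zeta>"]) (simp add: power_inverse)
qed

lemma Zn_orbit_trans:
  assumes "\<kappa>' \<in> Zn_orbit n \<kappa>" "\<kappa>'' \<in> Zn_orbit n \<kappa>'" shows "\<kappa>'' \<in> Zn_orbit n \<kappa>"
proof -
  obtain \<zeta> where z: "\<zeta> ^ n = 1" "\<forall>j\<in>{1..n - 1}. \<kappa>' j = \<zeta> * \<kappa> j"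
    using assms(1) Zn_orbit_iff[OF Zn_orbit_subset_cvec[OF assms(1)]] by blast
  obtain \<xi> where x: "\<xi> ^ n = 1" "\<forall>j\<in>{1..n - 1}. \<kappa>'' j = \<xi> * \<kappa>' j"
    using assms(2) Zn_orbit_iff[OF Zn_orbit_subset_cvec[OF assms(2)]] by blast
  show ?thesis unfolding Zn_orbit_iff[OF Zn_orbit_subset_cvec[OF assms(2)]]
    by (intro exI[of _ "\<xi> * \<zeta>"]) (simp add: power_mult_distrib z x)
qed

lemma Zn_orbit_eq_iff:
  assumes "n \<ge> 1" "\<kappa> \<in> cvec (n - 1)" "\<kappa>' \<in> cvec (n - 1)"
  shows "Zn_orbit n \<kappa> = Zn_orbit n \<kappa>' \<longleftrightarrow> \<kappa>' \<in> Zn_orbit n \<kappa>"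
  using Zn_orbit_self[OF assms(3)] Zn_orbit_sym[OF assms(1,2)] Zn_orbit_trans by blast

lemma labelled_type_eq_iff_orbit:
  assumes n: "n \<ge> 2" and q: "q \<ge> 2" and k: "\<kappa> \<in> W0 n" "\<kappa>' \<in> W0 n"
    and f: "represents n q \<kappa> f" "represents n q \<kappa>' f'"
  shows "labelled_type n q (f, \<kappa>) = labelled_type n q (f', \<kappa>') \<longleftrightarrow> \<kappa>' \<in> Zn_orbit n \<kappa>"
proof
  assume eq: "labelled_type n q (f, \<kappa>) = labelled_type n q (f', \<kappa>')"
  have "labelled_equiv n q (f', \<kappa>') (f', \<kappa>')"
    unfolding labelled_equiv_iff_orbit[OF n q k(2,2) f(2,2)] by (rule Zn_orbit_self[OF W0_cvec[OF k(2)]])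
  then have "(f', \<kappa>') \<in> labelled_type n q (f', \<kappa>')" using W0_cvec[OF k(2)] by (simp add: labelled_type_def)
  then have "labelled_equiv n q (f, \<kappa>) (f', \<kappa>')" unfolding eq[symmetric] by (simp add: labelled_type_def)
  then show "\<kappa>' \<in> Zn_orbit n \<kappa>" unfolding labelled_equiv_iff_orbit[OF n q k f] .
next
  have sub: "labelled_type n q (f', \<kappa>') \<subseteq> labelled_type n q (f, \<kappa>)"
    if k: "\<kappa> \<in> W0 n" "\<kappa>' \<in> W0 n" and f: "represents n q \<kappa> f" "represents n q \<kappa>' f'"
      and o: "\<kappa>' \<in> Zn_orbit n \<kappa>" for \<kappa> \<kappa>' f f'
  proof
    fix X assume X: "X \<in> labelled_type n q (f', \<kappa>')"
    obtain g d where gd: "X = (g, d)" by (cases X)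
    obtain lam lam' where r: "roots_of n \<kappa> lam" "f = qh 1 q n lam" "roots_of n \<kappa>' lam'" "f' = qh 1 q n lam'"
      using f by (auto simp: represents_def)
    obtain \<zeta> where p: "\<zeta> ^ n = 1" "\<And>j. j \<in> {1..n - 1} \<Longrightarrow> \<kappa>' j = \<zeta> * \<kappa> (id j)"
      using Zn_orbit_iff[OF W0_cvec[OF k(2)]] o by auto
    have z0: "\<zeta> \<noteq> 0" using root_of_unity_nonzero[OF p(1)] n by simp
    from X obtain \<Phi> where d: "d \<in> cvec (n - 1)" and P: "biholomorphic_germ \<Phi>" "\<forall>\<^sub>F z in nhds 0. g z = f' (\<Phi> z)"
      and lim: "\<And>l. l \<in> {1..n - 1} \<Longrightarrow> ((\<lambda>s. (snd (\<Phi> (s, d l * s ^ q)) - \<kappa>' l * fst (\<Phi> (s, d l * s ^ q)) ^ q) / s ^ q) \<longlongrightarrow> 0) (at 0)"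
      by (auto simp: labelled_type_def labelled_equiv_def gd)
    have "biholomorphic_germ (rotate_y \<zeta> \<circ> \<Phi>)"
      by (rule biholomorphic_germ_compose[OF P(1) biholomorphic_germ_rotate_y[OF z0]])
    moreover have "\<forall>\<^sub>F z in nhds 0. g z = f ((rotate_y \<zeta> \<circ> \<Phi>) z)"
      using P(2) by eventually_elim (simp only: r qh_rotated[OF n k r(1,3) permutes_id p] o_apply)
    moreover have "((\<lambda>s. (snd ((rotate_y \<zeta> \<circ> \<Phi>) (s, d l * s ^ q)) - \<kappa> l * fst ((rotate_y \<zeta> \<circ> \<Phi>) (s, d l * s ^ q)) ^ q) / s ^ q) \<longlongrightarrow> 0) (at 0)"
      if l: "l \<in> {1..n - 1}" for l
    proof -
      have "((\<lambda>s. inverse \<zeta> * ((snd (\<Phi> (s, d l * s ^ q)) - \<kappa>' l * fst (\<Phi> (s, d l * s ^ q)) ^ q) / s ^ q)) \<longlongrightarrow> inverse \<zeta> * 0) (at 0)"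
        by (intro tendsto_mult tendsto_const lim l)
      moreover have "inverse \<zeta> * ((snd (\<Phi> (s, d l * s ^ q)) - \<kappa>' l * fst (\<Phi> (s, d l * s ^ q)) ^ q) / s ^ q)
        = (snd ((rotate_y \<zeta> \<circ> \<Phi>) (s, d l * s ^ q)) - \<kappa> l * fst ((rotate_y \<zeta> \<circ> \<Phi>) (s, d l * s ^ q)) ^ q) / s ^ q" for s
      proof -
        have "inverse \<zeta> * (y - \<kappa>' l * x ^ q) = inverse \<zeta> * y - \<kappa> l * x ^ q" for x y
          using z0 by (simp add: p(2)[OF l] right_diff_distrib)
        then show ?thesis by (simp add: rotate_y_def case_prod_beta)
      qed
      ultimately show ?thesis by (simp only: mult_zero_right)
    qed
    ultimately show "X \<in> labelled_type n q (f, \<kappa>)"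
      unfolding gd labelled_type_def labelled_equiv_def using d by blast
  qed
  assume o: "\<kappa>' \<in> Zn_orbit n \<kappa>"
  have "\<kappa> \<in> Zn_orbit n \<kappa>'" using Zn_orbit_sym[OF _ W0_cvec[OF k(1)] o] n by simp
  then show "labelled_type n q (f, \<kappa>) = labelled_type n q (f', \<kappa>')"
    using sub[OF k f o] sub[OF k(2,1) f(2,1)] by blast
qed

section \<open>The fibres of the map to the critical values\<close>

lemma Upsilon_eq: "j \<in> {1..n - 2} \<Longrightarrow> Upsilon n \<kappa> j = poly (crit_poly n \<kappa>) (\<kappa> j) + (-1) ^ n"
proof -
  assume j: "j \<in> {1..n - 2}"
  have ins: "{0..n - 1} = insert 0 {1..n - 1}" by auto
  have "poly (crit_poly n \<kappa>) (\<kappa> j) = \<kappa> j ^ n + (\<Sum>l\<in>{1..n - 1}. (-1) ^ l * (of_nat n / of_nat (n - l)) * esym (n - 1) l \<kappa> * \<kappa> j ^ (n - l))"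
    unfolding poly_crit_poly ins using j by (subst sum.insert) auto
  then show ?thesis using j by (simp add: Upsilon_def)
qed

text \<open>The normalized critical points as functions of the first \<open>n - 2\<close> of them.\<close>

definition kap :: "nat \<Rightarrow> (nat \<Rightarrow> complex) \<Rightarrow> nat \<Rightarrow> complex"
  where "kap n x = (\<lambda>i\<in>{1..n - 1}. if i = n - 1 then - (\<Sum>j\<in>{1..n - 2}. x j) else x i)"

definition critical_value :: "nat \<Rightarrow> nat \<Rightarrow> (nat \<Rightarrow> complex) \<Rightarrow> complex"
  where "critical_value n i x = poly (crit_poly n (kap n x)) (kap n x i)"

text \<open>Indexes the factors of discriminants.\<close>

definition index_pairs :: "nat \<Rightarrow> (nat \<times> nat) set"
  where "index_pairs n = {p \<in> {1..n - 1} \<times> {1..n - 1}. fst p < snd p}"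

lemma finite_index_pairs [simp]: "finite (index_pairs n)" by (simp add: index_pairs_def)

lemma inj_on_if_pairs: "(\<And>p. p \<in> index_pairs n \<Longrightarrow> f (fst p) \<noteq> f (snd p)) \<Longrightarrow> inj_on f {1..n - 1}"
proof (rule inj_onI, rule ccontr)
  fix i j assume h: "\<And>p. p \<in> index_pairs n \<Longrightarrow> f (fst p) \<noteq> f (snd p)"
    and ij: "i \<in> {1..n - 1}" "j \<in> {1..n - 1}" "f i = f j" "i \<noteq> j"
  show False
  proof (cases "i < j")
    case True then show ?thesis using h[of "(i, j)"] ij by (simp add: index_pairs_def)
  next
    case False then show ?thesis using h[of "(j, i)"] ij by (simp add: index_pairs_def)
  qed
qed

lemma atLeastAtMost_pred_insert: "(n::nat) \<ge> 3 \<Longrightarrow> {1..n - 1} = insert (n - 1) {1..n - 2} \<and> n - 1 \<notin> {1..n - 2}"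
  by auto

lemma kap_simps:
  "j \<in> {1..n - 2} \<Longrightarrow> kap n x j = x j" "n \<ge> 3 \<Longrightarrow> kap n x (n - 1) = - (\<Sum>j\<in>{1..n - 2}. x j)"
  by (auto simp: kap_def)

lemma sum_kap: assumes "n \<ge> 3" shows "(\<Sum>i\<in>{1..n - 1}. kap n x i) = 0"
proof -
  have "(\<Sum>i\<in>{1..n - 1}. kap n x i) = kap n x (n - 1) + (\<Sum>i\<in>{1..n - 2}. kap n x i)"
    using atLeastAtMost_pred_insert[OF assms] by (metis finite_atLeastAtMost sum.insert)
  also have "(\<Sum>i\<in>{1..n - 2}. kap n x i) = (\<Sum>i\<in>{1..n - 2}. x i)" by (intro sum.cong refl kap_simps)
  finally show ?thesis using kap_simps(2)[OF assms] by simp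
qed

lemma kap_W0: assumes "n \<ge> 3" shows "kap n x \<in> W0 n"
  unfolding W0_def using sum_kap[OF assms] by (simp add: cvec_def kap_def)

lemma kap_surj: assumes n: "n \<ge> 3" and k: "\<kappa> \<in> W0 n"
  shows "\<exists>x\<in>cspace (n - 2). \<kappa> = kap n x"
proof (intro bexI)
  let ?x = "\<lambda>i. if i \<in> {1..n - 2} then \<kappa> i else 0"
  show "?x \<in> cspace (n - 2)" by (simp add: cspace_def)
  have "(\<Sum>i\<in>{1..n - 1}. \<kappa> i) = \<kappa> (n - 1) + (\<Sum>i\<in>{1..n - 2}. \<kappa> i)"
    using atLeastAtMost_pred_insert[OF n] by (metis finite_atLeastAtMost sum.insert)
  then have last: "\<kappa> (n - 1) = - (\<Sum>i\<in>{1..n - 2}. \<kappa> i)" using k by (simp add: W0_def add_eq_0_iff)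
  show "\<kappa> = kap n ?x"
  proof (rule cvec_eqI[OF W0_cvec[OF k] W0_cvec[OF kap_W0[OF n]]])
    fix i assume i: "i \<in> {1..n - 1}"
    show "\<kappa> i = kap n ?x i"
    proof (cases "i = n - 1")
      case True
      have "(\<Sum>j\<in>{1..n - 2}. ?x j) = (\<Sum>j\<in>{1..n - 2}. \<kappa> j)" by (intro sum.cong) auto
      then show ?thesis using last True kap_simps(2)[OF n, of ?x] by simp
    next
      case False
      then have "i \<in> {1..n - 2}" using i by auto
      then show ?thesis using kap_simps(1)[of i n ?x] by simp
    qed
  qed
qed

lemma kap_inj: assumes "x \<in> cspace (n - 2)" "y \<in> cspace (n - 2)" "kap n x = kap n y" shows "x = y"
proof
  fix i show "x i = y i"
  proof (cases "i \<in> {1..n - 2}")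
    case True then show ?thesis using kap_simps(1)[OF True, of x] kap_simps(1)[OF True, of y] assms(3) by simp
  next
    case False then show ?thesis using assms(1,2) by (simp add: cspace_def)
  qed
qed

lemma pfun_kap: assumes "n \<ge> 3" "i \<in> {1..n - 1}" shows "pfun (n - 2) 1 (\<lambda>x. kap n x i)"
proof (cases "i = n - 1")
  case True
  have "pfun (n - 2) 1 (\<lambda>x. - (\<Sum>j\<in>{1..n - 2}. x j))"
    by (intro pfun_uminus pfun_sum pfun_coord) auto
  then show ?thesis using True kap_simps(2)[OF assms(1)] by simp
next
  case False
  then have "i \<in> {1..n - 2}" using assms(2) by auto
  then show ?thesis using pfun_coord[of i "n - 2" 1] kap_simps(1)[of i n] by simp
qed

lemma pfun_poly_crit_poly:
  assumes "n \<ge> 1" "\<And>i. i \<in> {1..n - 1} \<Longrightarrow> pfun m 1 (\<lambda>x. \<kappa> x i)" "pfun m 1 g"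
  shows "pfun m n (\<lambda>x. poly (crit_poly n (\<kappa> x)) (g x))"
  unfolding poly_crit_poly
proof (rule pfun_sum)
  fix l assume l: "l \<in> {0..n - 1}"
  have "pfun m (0 + l + (n - l) * 1) (\<lambda>x. (-1) ^ l * (of_nat n / of_nat (n - l)) * esym (n - 1) l (\<kappa> x) * g x ^ (n - l))"
    by (intro pfun_mult pfun_power pfun_const pfun_esym assms)
  moreover have "0 + l + (n - l) * 1 = n" using l assms(1) by auto
  ultimately show "pfun m n (\<lambda>x. (-1) ^ l * (of_nat n / of_nat (n - l)) * esym (n - 1) l (\<kappa> x) * g x ^ (n - l))" by metis
qed

lemma pfun_critical_value: "n \<ge> 3 \<Longrightarrow> i \<in> {1..n - 1} \<Longrightarrow> pfun (n - 2) n (critical_value n i)"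
  unfolding critical_value_def[abs_def] by (intro pfun_poly_crit_poly pfun_kap) auto

lemma kap_scale: "i \<in> {1..n - 1} \<Longrightarrow> kap n (\<lambda>i. t * x i) i = t * kap n x i"
  by (auto simp: kap_def sum_distrib_left)

lemma kap_line: "i \<in> {1..n - 1} \<Longrightarrow> kap n (\<lambda>i. x i + t * v i) i = kap n x i + t * kap n v i"
  by (auto simp: kap_def sum_distrib_left sum.distrib)

text \<open>Outside the zeros of this polynomial \<open>critical_values_differential_injective\<close> applies.\<close>

definition ramification_bound :: "nat \<Rightarrow> (nat \<Rightarrow> complex) \<Rightarrow> complex"
  where "ramification_bound n x = (\<Prod>j\<in>{1..n - 2}. x j) * (\<Prod>p\<in>index_pairs n. kap n x (fst p) - kap n x (snd p))"

lemma pfun_ramification_bound: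
  assumes n: "n \<ge> 3"
  shows "\<exists>e. pfun (n - 2) e (ramification_bound n)"
proof -
  have "pfun (n - 2) ((\<Sum>j\<in>{1..n - 2}. 1) + (\<Sum>p\<in>index_pairs n. 1)) (ramification_bound n)"
    unfolding ramification_bound_def[abs_def]
    by (intro pfun_mult pfun_prod pfun_diff pfun_kap[OF n] pfun_coord) (auto simp: index_pairs_def)
  then show ?thesis by blast
qed

lemma ramification_bound_nonzero: assumes n: "n \<ge> 3" shows "\<exists>x. ramification_bound n x \<noteq> 0"
proof
  let ?x = "\<lambda>i::nat. of_nat i :: complex"
  have neg: "kap n ?x (n - 1) = - of_nat (\<Sum>j\<in>{1..n - 2}. j)" using kap_simps(2)[OF n, of ?x] by simp
  have pos: "(\<Sum>j\<in>{1..n - 2}. j) > 0" using n by (intro sum_pos) auto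
  have "kap n ?x (fst p) \<noteq> kap n ?x (snd p)" if "p \<in> index_pairs n" for p
  proof -
    have p: "fst p \<in> {1..n - 2}" "snd p \<in> {1..n - 1}" "fst p < snd p" using that by (auto simp: index_pairs_def)
    show ?thesis
    proof (cases "snd p = n - 1")
      case True
      have "kap n ?x (fst p) + of_nat (\<Sum>j\<in>{1..n - 2}. j) \<noteq> 0"
        using kap_simps(1)[OF p(1), of ?x] pos by (metis of_nat_add of_nat_eq_0_iff add_is_0 less_irrefl)
      then show ?thesis using True neg by (metis add.left_inverse add.commute)
    next
      case False
      then have "snd p \<in> {1..n - 2}" using p(2) by auto
      then show ?thesis using kap_simps(1)[OF p(1), of ?x] kap_simps(1)[of "snd p" n ?x] p(3) by simp
    qed
  qed
  then show "ramification_bound n ?x \<noteq> 0" unfolding ramification_bound_def by simp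
qed

lemma critical_values_homogeneous_map:
  assumes n: "n \<ge> 3"
  shows "\<exists>e. homogeneous_map (n - 2) n (critical_value n) e (ramification_bound n)"
proof -
  obtain e where e: "pfun (n - 2) e (ramification_bound n)" using pfun_ramification_bound[OF n] by blast
  have n1: "n \<ge> 1" using n by simp
  have "homogeneous_map (n - 2) n (critical_value n) e (ramification_bound n)"
  proof
    show "1 \<le> n - 2" "1 \<le> n" using n by auto
    show "pfun (n - 2) n (critical_value n j)" if "j \<in> {1..n - 2}" for j
      using that by (intro pfun_critical_value[OF n]) auto
    show "critical_value n j (\<lambda>i. t * x i) = t ^ n * critical_value n j x" if "j \<in> {1..n - 2}" for j t x
    proof -
      have j: "j \<in> {1..n - 1}" using that by auto
      have "crit_poly n (kap n (\<lambda>i. t * x i)) = crit_poly n (\<lambda>i. t * kap n x i)" by (rule crit_poly_cong) (rule kap_scale)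
      then show ?thesis unfolding critical_value_def kap_scale[OF j] using poly_crit_poly_scale[OF n1] by simp
    qed
    show "x = (\<lambda>_. 0)" if x: "x \<in> cspace (n - 2)" and z: "\<And>j. j \<in> {1..n - 2} \<Longrightarrow> critical_value n j x = 0" for x
    proof
      fix i show "x i = 0"
      proof (cases "i \<in> {1..n - 2}")
        case True
        have "kap n x i = 0"
          by (rule critical_roots_imp_zero[OF _ sum_kap[OF n]]) (use n z True in \<open>auto simp: critical_value_def\<close>)
        then show ?thesis using kap_simps(1)[OF True, of x] by simp
      next
        case False then show ?thesis using x by (simp add: cspace_def)
      qed
    qed
    show "pfun (n - 2) e (ramification_bound n)" "\<exists>x. ramification_bound n x \<noteq> 0"
      using e ramification_bound_nonzero[OF n] by auto
    show "v i = 0" if r: "ramification_bound n x \<noteq> 0"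
      and D: "\<And>j. j \<in> {1..n - 2} \<Longrightarrow> ((\<lambda>t. critical_value n j (\<lambda>i. x i + t * v i)) has_field_derivative 0) (at 0)"
      and i: "i \<in> {1..n - 2}" for x v i
    proof -
      have "kap n v i = 0"
      proof (rule critical_values_differential_injective[OF n sum_kap[OF n]])
        show "inj_on (kap n x) {1..n - 1}"
          using r by (intro inj_on_if_pairs) (auto simp: ramification_bound_def)
        show "kap n x j \<noteq> 0" if "j \<in> {1..n - 2}" for j
          using r that kap_simps(1)[OF that, of x] by (auto simp: ramification_bound_def)
        show "((\<lambda>t. poly (crit_poly n (\<lambda>i. kap n x i + t * kap n v i)) (kap n x j + t * kap n v j)) has_field_derivative 0) (at 0)"
          if j: "j \<in> {1..n - 2}" for j
        proof -
          have "j \<in> {1..n - 1}" using j by auto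
          have "crit_poly n (kap n (\<lambda>i. x i + t * v i)) = crit_poly n (\<lambda>i. kap n x i + t * kap n v i)" for t
            by (rule crit_poly_cong) (rule kap_line)
          then show ?thesis using D[OF j] unfolding critical_value_def kap_line[OF \<open>j \<in> {1..n - 1}\<close>] by simp
        qed
        show "i \<in> {1..n - 1}" using i by auto
      qed
      then show ?thesis using kap_simps(1)[OF i, of v] by simp
    qed
  qed
  then show ?thesis by blast
qed

text \<open>\<open>homogeneous_map.fib\<close> for the critical values.\<close>

definition crit_fib :: "nat \<Rightarrow> (nat \<Rightarrow> complex) \<Rightarrow> (nat \<Rightarrow> complex) set"
  where "crit_fib n \<rho> = {x \<in> cspace (n - 2). \<forall>j\<in>{1..n - 2}. critical_value n j x = \<rho> j}"

lemma fiber_bij: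
  assumes n: "n \<ge> 3" and r: "\<rho> \<in> HP_II n"
  shows "bij_betw (kap n) (crit_fib n (\<lambda>j. \<rho> j - (-1) ^ n)) (fiber n \<rho>)"
  unfolding bij_betw_def
proof
  show "inj_on (kap n) (crit_fib n (\<lambda>j. \<rho> j - (-1) ^ n))"
    by (rule inj_onI) (auto simp: crit_fib_def intro: kap_inj)
  have ext: "\<rho> \<in> {1..n - 2} \<rightarrow>\<^sub>E UNIV" using r by (auto simp: HP_II_def Upsilon_def)
  have U: "Upsilon n \<kappa> = \<rho> \<longleftrightarrow> (\<forall>j\<in>{1..n - 2}. poly (crit_poly n \<kappa>) (\<kappa> j) + (-1) ^ n = \<rho> j)" for \<kappa>
  proof
    assume "Upsilon n \<kappa> = \<rho>" then show "\<forall>j\<in>{1..n - 2}. poly (crit_poly n \<kappa>) (\<kappa> j) + (-1) ^ n = \<rho> j"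
      using Upsilon_eq[of _ n \<kappa>] by auto
  next
    assume a: "\<forall>j\<in>{1..n - 2}. poly (crit_poly n \<kappa>) (\<kappa> j) + (-1) ^ n = \<rho> j"
    have "Upsilon n \<kappa> \<in> {1..n - 2} \<rightarrow>\<^sub>E UNIV" by (auto simp: Upsilon_def)
    then show "Upsilon n \<kappa> = \<rho>" using ext by (rule PiE_ext) (use a Upsilon_eq[of _ n \<kappa>] in auto)
  qed
  show "kap n ` crit_fib n (\<lambda>j. \<rho> j - (-1) ^ n) = fiber n \<rho>"
  proof (intro subset_antisym subsetI)
    fix \<kappa> assume "\<kappa> \<in> kap n ` crit_fib n (\<lambda>j. \<rho> j - (-1) ^ n)"
    then show "\<kappa> \<in> fiber n \<rho>" by (auto simp: fiber_def kap_W0[OF n] U crit_fib_def critical_value_def)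
  next
    fix \<kappa> assume k: "\<kappa> \<in> fiber n \<rho>"
    then obtain x where x: "x \<in> cspace (n - 2)" "\<kappa> = kap n x" using kap_surj[OF n] by (auto simp: fiber_def)
    then have "x \<in> crit_fib n (\<lambda>j. \<rho> j - (-1) ^ n)"
      using k by (simp add: fiber_def U crit_fib_def critical_value_def eq_diff_eq)
    then show "\<kappa> \<in> kap n ` crit_fib n (\<lambda>j. \<rho> j - (-1) ^ n)" unfolding x(2) by (rule imageI)
  qed
qed

lemma fiber_finite_card_le:
  assumes n: "n \<ge> 3" and r: "\<rho> \<in> HP_II n"
  shows "finite (fiber n \<rho>) \<and> card (fiber n \<rho>) \<le> n ^ (n - 2)"
proof -
  obtain e where "homogeneous_map (n - 2) n (critical_value n) e (ramification_bound n)"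
    using critical_values_homogeneous_map[OF n] by blast
  then interpret h: homogeneous_map "n - 2" n "critical_value n" e "ramification_bound n" .
  have "crit_fib n \<rho>' = h.fib \<rho>'" for \<rho>' unfolding crit_fib_def h.fib_def ..
  then show ?thesis using h.bezout_bound fiber_bij[OF n r] bij_betw_finite bij_betw_same_card by metis
qed

lemma Zn_orbit_fiber:
  assumes n: "n \<ge> 3" and k: "\<kappa> \<in> fiber n \<rho>" shows "Zn_orbit n \<kappa> \<subseteq> fiber n \<rho>"
proof
  fix \<kappa>' assume o: "\<kappa>' \<in> Zn_orbit n \<kappa>"
  have n1: "n \<ge> 1" using n by simp
  have c: "\<kappa>' \<in> cvec (n - 1)" by (rule Zn_orbit_subset_cvec[OF o])
  obtain \<zeta> where z: "\<zeta> ^ n = 1" "\<And>j. j \<in> {1..n - 1} \<Longrightarrow> \<kappa>' j = \<zeta> * \<kappa> (id j)"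
    using o Zn_orbit_iff[OF c] by auto
  have "(\<Sum>j\<in>{1..n - 1}. \<kappa>' j) = \<zeta> * (\<Sum>j\<in>{1..n - 1}. \<kappa> j)" unfolding sum_distrib_left by (intro sum.cong) (auto simp: z)
  then have "\<kappa>' \<in> W0 n" using k c by (simp add: W0_def fiber_def)
  moreover have "Upsilon n \<kappa>' = Upsilon n \<kappa>"
  proof (rule PiE_ext[of _ "{1..n - 2}" "\<lambda>_. UNIV"])
    fix j assume j: "j \<in> {1..n - 2}"
    then have "j \<in> {1..n - 1}" by auto
    then have "\<kappa>' j = \<zeta> * \<kappa> j" using z(2)[of j] by (simp only: id_apply)
    then show "Upsilon n \<kappa>' j = Upsilon n \<kappa> j"
      using crit_poly_rotated[of n id \<zeta> \<kappa>' \<kappa>, OF n1 permutes_id z] by (simp add: Upsilon_eq[OF j])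
  qed (auto simp: Upsilon_def)
  ultimately show "\<kappa>' \<in> fiber n \<rho>" using k by (simp add: fiber_def)
qed

lemma card_Zn_orbit:
  assumes n: "n \<ge> 1" and j: "j \<in> {1..n - 1}" "\<kappa> j \<noteq> 0" shows "card (Zn_orbit n \<kappa>) = n"
proof -
  have "Zn_orbit n \<kappa> = (\<lambda>\<zeta>. \<lambda>j\<in>{1..n - 1}. \<zeta> * \<kappa> j) ` {\<zeta>. \<zeta> ^ n = 1}" by (auto simp: Zn_orbit_def)
  moreover have "inj_on (\<lambda>\<zeta>. \<lambda>j\<in>{1..n - 1}. \<zeta> * \<kappa> j) {\<zeta>. \<zeta> ^ n = 1}"
  proof (rule inj_onI)
    fix \<zeta> \<xi> assume "(\<lambda>j\<in>{1..n - 1}. \<zeta> * \<kappa> j) = (\<lambda>j\<in>{1..n - 1}. \<xi> * \<kappa> j)"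
    from fun_cong[OF this, of j] show "\<zeta> = \<xi>" using j by simp
  qed
  ultimately show ?thesis using card_roots_unity_eq[of n] n by (simp add: card_image)
qed

lemma card_fiber_orbits:
  assumes n: "n \<ge> 3" and fin: "finite (fiber n \<rho>)"
    and nz: "\<And>\<kappa>. \<kappa> \<in> fiber n \<rho> \<Longrightarrow> \<exists>j\<in>{1..n - 1}. \<kappa> j \<noteq> 0"
  shows "n * card (fiber_orbits n \<rho>) = card (fiber n \<rho>)"
proof -
  have n1: "n \<ge> 1" using n by simp
  have cv: "\<kappa> \<in> cvec (n - 1)" if "\<kappa> \<in> fiber n \<rho>" for \<kappa> using that by (auto simp: fiber_def W0_def)
  have U: "\<Union> (fiber_orbits n \<rho>) = fiber n \<rho>"
    unfolding fiber_orbits_def using Zn_orbit_fiber[OF n] Zn_orbit_self[OF cv] by blast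
  have "n * card (fiber_orbits n \<rho>) = card (\<Union> (fiber_orbits n \<rho>))"
  proof (rule card_partition)
    show "finite (fiber_orbits n \<rho>)" using fin by (simp add: fiber_orbits_def)
    show "finite (\<Union> (fiber_orbits n \<rho>))" using fin U by simp
    show "card c = n" if c: "c \<in> fiber_orbits n \<rho>" for c
    proof -
      obtain \<kappa> where k: "\<kappa> \<in> fiber n \<rho>" "c = Zn_orbit n \<kappa>" using c unfolding fiber_orbits_def by blast
      obtain j where "j \<in> {1..n - 1}" "\<kappa> j \<noteq> 0" using nz[OF k(1)] by blast
      from card_Zn_orbit[of n j \<kappa>, OF n1 this] show ?thesis by (simp only: k(2))
    qed
    show "c1 \<inter> c2 = {}" if c: "c1 \<in> fiber_orbits n \<rho>" "c2 \<in> fiber_orbits n \<rho>" "c1 \<noteq> c2" for c1 c2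
    proof (rule ccontr)
      assume "c1 \<inter> c2 \<noteq> {}"
      then obtain \<kappa> where k: "\<kappa> \<in> c1" "\<kappa> \<in> c2" by blast
      obtain \<kappa>1 \<kappa>2 where kk: "\<kappa>1 \<in> fiber n \<rho>" "c1 = Zn_orbit n \<kappa>1" "\<kappa>2 \<in> fiber n \<rho>" "c2 = Zn_orbit n \<kappa>2"
        using c by (auto simp: fiber_orbits_def)
      have kc: "\<kappa> \<in> cvec (n - 1)" using k kk Zn_orbit_subset_cvec by blast
      have "c1 = Zn_orbit n \<kappa>" "c2 = Zn_orbit n \<kappa>"
        using Zn_orbit_eq_iff[OF n1 cv kc] k kk by blast+
      then show False using c(3) by simp
    qed
  qed
  then show ?thesis by (simp only: U)
qed

text \<open>All orbits have \<open>n\<close> points, except for the orbit of \<open>0\<close>. If the fibre contains \<open>0\<close>, its other points have the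
  critical values of \<open>0\<close> as well, so there are none.\<close>

lemma card_fiber_orbits_le:
  assumes n: "n \<ge> 3" and r: "\<rho> \<in> HP_II n"
  shows "finite (fiber_orbits n \<rho>) \<and> card (fiber_orbits n \<rho>) \<le> n ^ (n - 3)"
proof
  have fin: "finite (fiber n \<rho>)" "card (fiber n \<rho>) \<le> n ^ (n - 2)" using fiber_finite_card_le[OF n r] by auto
  show "finite (fiber_orbits n \<rho>)" using fin by (simp add: fiber_orbits_def)
  show "card (fiber_orbits n \<rho>) \<le> n ^ (n - 3)"
  proof (cases "\<forall>\<kappa>\<in>fiber n \<rho>. \<exists>j\<in>{1..n - 1}. \<kappa> j \<noteq> 0")
    case True
    then have "n * card (fiber_orbits n \<rho>) \<le> n ^ (n - 2)" using card_fiber_orbits[OF n fin(1)] fin(2) by simp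
    also have "n ^ (n - 2) = n * n ^ (n - 3)" using n by (simp add: Suc_diff_le numeral_3_eq_3 numeral_2_eq_2 flip: power_Suc)
    finally show ?thesis using n by simp
  next
    case False
    then obtain \<kappa>0 where k0: "\<kappa>0 \<in> fiber n \<rho>" "\<And>j. j \<in> {1..n - 1} \<Longrightarrow> \<kappa>0 j = 0" by auto
    have rho: "\<rho> j = (-1) ^ n" if j: "j \<in> {1..n - 2}" for j
    proof -
      have "\<rho> j = poly (crit_poly n \<kappa>0) 0 + (-1) ^ n"
        using k0 Upsilon_eq[OF j, of \<kappa>0] j by (auto simp: fiber_def)
      then show ?thesis using poly_crit_poly_0[of n] n by simp
    qed
    have "\<kappa> = \<kappa>0" if k: "\<kappa> \<in> fiber n \<rho>" for \<kappa>
    proof (rule cvec_eqI[of _ "n - 1"])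
      fix i assume i: "i \<in> {1..n - 1}"
      have "\<kappa> i = 0"
      proof (rule critical_roots_imp_zero[OF _ _ _ i])
        show "poly (crit_poly n \<kappa>) (\<kappa> j) = 0" if j: "j \<in> {1..n - 2}" for j
          using k Upsilon_eq[OF j, of \<kappa>] rho[OF j] by (auto simp: fiber_def)
      qed (use n k in \<open>auto simp: fiber_def W0_def\<close>)
      then show "\<kappa> i = \<kappa>0 i" using k0(2)[OF i] by simp
    qed (use k k0 in \<open>auto simp: fiber_def W0_def\<close>)
    then have "fiber n \<rho> = {\<kappa>0}" using k0(1) by blast
    then have "card (fiber_orbits n \<rho>) = 1" by (simp add: fiber_orbits_def)
    then show ?thesis using n by simp
  qed
qed

lemma card_image_eq_if_same_kernel:
  assumes "\<And>x y. x \<in> S \<Longrightarrow> y \<in> S \<Longrightarrow> f x = f y \<longleftrightarrow> g x = g y"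
  shows "card (f ` S) = card (g ` S)"
proof (rule bij_betw_same_card[of "\<lambda>a. g (inv_into S f a)"])
  have i: "inv_into S f (f x) \<in> S" "f (inv_into S f (f x)) = f x" if "x \<in> S" for x
    using that inv_into_into[of "f x" f S] f_inv_into_f[of "f x" f S] by auto
  have gi: "g (inv_into S f (f x)) = g x" if "x \<in> S" for x using assms i that by metis
  show "bij_betw (\<lambda>a. g (inv_into S f a)) (f ` S) (g ` S)"
    unfolding bij_betw_def inj_on_def using gi assms by (auto simp: image_image)
qed

text \<open>Reduces the classes of all functions that represent a point of a fibre to those of one chosen
  function per point.\<close>

lemma classes_eq_image_of_choice:
  assumes "\<And>x f. x \<in> S \<Longrightarrow> R x f \<Longrightarrow> T f x = T (F x) x" "\<And>x. x \<in> S \<Longrightarrow> R x (F x)"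
  shows "{T f x | f x. x \<in> S \<and> R x f} = (\<lambda>x. T (F x) x) ` S"
proof (intro subset_antisym subsetI)
  fix y assume "y \<in> {T f x | f x. x \<in> S \<and> R x f}"
  then obtain f x where x: "x \<in> S" "R x f" "y = T f x" by blast
  then have "y = T (F x) x" using assms(1) by simp
  then show "y \<in> (\<lambda>x. T (F x) x) ` S" using x(1) by (rule image_eqI)
next
  fix y assume "y \<in> (\<lambda>x. T (F x) x) ` S"
  then show "y \<in> {T f x | f x. x \<in> S \<and> R x f}" using assms(2) by blast
qed

lemma fiber_represents:
  assumes n: "n \<ge> 2" and k: "\<kappa> \<in> W0 n" shows "\<exists>f. represents n q \<kappa> f"
  using roots_of_exists[OF n k] by (auto simp: represents_def)

lemma card_labelled_types:
  assumes n: "n \<ge> 3" and q: "q \<ge> 2"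
  shows "card (labelled_types n q \<rho>) = card (fiber_orbits n \<rho>)"
proof -
  have n2: "n \<ge> 2" using n by simp
  define F where "F = (\<lambda>\<kappa>. SOME f. represents n q \<kappa> f)"
  have W: "\<kappa> \<in> W0 n" if "\<kappa> \<in> fiber n \<rho>" for \<kappa> using that by (simp add: fiber_def)
  have F: "represents n q \<kappa> (F \<kappa>)" if "\<kappa> \<in> fiber n \<rho>" for \<kappa>
    unfolding F_def using fiber_represents[OF n2 W[OF that]] by (rule someI_ex)
  have "labelled_type n q (f, \<kappa>) = labelled_type n q (F \<kappa>, \<kappa>)" if "\<kappa> \<in> fiber n \<rho>" "represents n q \<kappa> f" for f \<kappa>
    using labelled_type_eq_iff_orbit[OF n2 q W[OF that(1)] W[OF that(1)] that(2) F[OF that(1)]]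
      Zn_orbit_self[OF W0_cvec[OF W[OF that(1)]]] by blast
  then have "labelled_types n q \<rho> = (\<lambda>\<kappa>. labelled_type n q (F \<kappa>, \<kappa>)) ` fiber n \<rho>"
    unfolding labelled_types_def
    by (intro classes_eq_image_of_choice[where T = "\<lambda>f \<kappa>. labelled_type n q (f, \<kappa>)"] F)
  also have "card \<dots> = card (Zn_orbit n ` fiber n \<rho>)"
  proof (rule card_image_eq_if_same_kernel)
    fix \<kappa> \<kappa>' assume k: "\<kappa> \<in> fiber n \<rho>" "\<kappa>' \<in> fiber n \<rho>"
    show "labelled_type n q (F \<kappa>, \<kappa>) = labelled_type n q (F \<kappa>', \<kappa>') \<longleftrightarrow> Zn_orbit n \<kappa> = Zn_orbit n \<kappa>'"
      unfolding labelled_type_eq_iff_orbit[OF n2 q W[OF k(1)] W[OF k(2)] F[OF k(1)] F[OF k(2)]]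
      using Zn_orbit_eq_iff[OF _ W0_cvec[OF W[OF k(1)]] W0_cvec[OF W[OF k(2)]]] n by simp
  qed
  finally show ?thesis by (simp add: fiber_orbits_def)
qed

text \<open>Two points of a fibre have the same first \<open>n - 2\<close> critical values. If the critical values are distinct, a
  renumbering that keeps these is trivial.\<close>

lemma permuted_orbit_trivial:
  assumes n: "n \<ge> 3" and k: "\<kappa> \<in> fiber n \<rho>" "\<kappa>' \<in> fiber n \<rho>"
    and inj: "inj_on (\<lambda>i. poly (crit_poly n \<kappa>) (\<kappa> i)) {1..n - 1}"
    and p: "\<pi> permutes {1..n - 1}" "\<kappa>' \<in> Zn_orbit n (\<kappa> \<circ> \<pi>)"
  shows "\<kappa>' \<in> Zn_orbit n \<kappa>"
proof -
  have n1: "n \<ge> 1" using n by simp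
  have c: "\<kappa>' \<in> cvec (n - 1)" using k by (auto simp: fiber_def W0_def)
  obtain \<zeta> where z: "\<zeta> ^ n = 1" "\<And>j. j \<in> {1..n - 1} \<Longrightarrow> \<kappa>' j = \<zeta> * \<kappa> (\<pi> j)"
    using p(2) Zn_orbit_iff[OF c] by auto
  have fix1: "\<pi> j = j" if j: "j \<in> {1..n - 2}" for j
  proof -
    have j1: "j \<in> {1..n - 1}" using j by auto
    have "poly (crit_poly n \<kappa>') (\<kappa>' j) = poly (crit_poly n \<kappa>) (\<kappa> j)"
      using k Upsilon_eq[OF j, of \<kappa>] Upsilon_eq[OF j, of \<kappa>'] by (simp add: fiber_def)
    moreover have "poly (crit_poly n \<kappa>') (\<kappa>' j) = poly (crit_poly n \<kappa>) (\<kappa> (\<pi> j))"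
      using crit_poly_rotated[of n \<pi> \<zeta> \<kappa>' \<kappa>, OF n1 p(1) z] z(2)[OF j1] by simp
    ultimately have "poly (crit_poly n \<kappa>) (\<kappa> (\<pi> j)) = poly (crit_poly n \<kappa>) (\<kappa> j)" by simp
    moreover have "\<pi> j \<in> {1..n - 1}" using p(1) j1 permutes_in_image by metis
    ultimately show ?thesis using inj_onD[OF inj] j1 by blast
  qed
  have "\<pi> (n - 1) = n - 1"
  proof (rule ccontr)
    assume a: "\<pi> (n - 1) \<noteq> n - 1"
    have "n - 1 \<in> {1..n - 1}" using n by auto
    then have "\<pi> (n - 1) \<in> {1..n - 1}" using p(1) permutes_in_image by metis
    then have "\<pi> (n - 1) \<in> {1..n - 2}" using a by auto
    from fix1[OF this] have "\<pi> (n - 1) = n - 1" using permutes_inj[OF p(1)] by (simp add: inj_eq)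
    then show False using a by simp
  qed
  then have "\<pi> j = j" if "j \<in> {1..n - 1}" for j using fix1[of j] that n by (cases "j = n - 1") auto
  then show ?thesis unfolding Zn_orbit_iff[OF c] using z by auto
qed

lemma card_analytic_types:
  assumes n: "n \<ge> 3" and q: "q \<ge> 2"
    and inj: "\<And>\<kappa>. \<kappa> \<in> fiber n \<rho> \<Longrightarrow> inj_on (\<lambda>i. poly (crit_poly n \<kappa>) (\<kappa> i)) {1..n - 1}"
  shows "card (analytic_types n q \<rho>) = card (fiber_orbits n \<rho>)"
proof -
  have n2: "n \<ge> 2" using n by simp
  define F where "F = (\<lambda>\<kappa>. SOME f. represents n q \<kappa> f)"
  have W: "\<kappa> \<in> W0 n" if "\<kappa> \<in> fiber n \<rho>" for \<kappa> using that by (simp add: fiber_def)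
  have F: "represents n q \<kappa> (F \<kappa>)" if "\<kappa> \<in> fiber n \<rho>" for \<kappa>
    unfolding F_def using fiber_represents[OF n2 W[OF that]] by (rule someI_ex)
  have iff: "analytic_type f = analytic_type f' \<longleftrightarrow> \<kappa>' \<in> Zn_orbit n \<kappa>"
    if k: "\<kappa> \<in> fiber n \<rho>" "\<kappa>' \<in> fiber n \<rho>" and f: "represents n q \<kappa> f" "represents n q \<kappa>' f'" for \<kappa> \<kappa>' f f'
    unfolding analytic_type_eq_iff analytic_equiv_iff_permuted_orbit[OF n2 q W[OF k(1)] W[OF k(2)] f]
  proof
    show "\<exists>\<pi>. \<pi> permutes {1..n - 1} \<and> \<kappa>' \<in> Zn_orbit n (\<kappa> \<circ> \<pi>) \<Longrightarrow> \<kappa>' \<in> Zn_orbit n \<kappa>"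
      using permuted_orbit_trivial[OF n k inj[OF k(1)]] by blast
    show "\<kappa>' \<in> Zn_orbit n \<kappa> \<Longrightarrow> \<exists>\<pi>. \<pi> permutes {1..n - 1} \<and> \<kappa>' \<in> Zn_orbit n (\<kappa> \<circ> \<pi>)"
      by (intro exI[of _ id]) (simp add: permutes_id)
  qed
  have "analytic_type f = analytic_type (F \<kappa>)" if "\<kappa> \<in> fiber n \<rho>" "represents n q \<kappa> f" for f \<kappa>
    using iff[OF that(1) that(1) that(2) F[OF that(1)]] Zn_orbit_self[OF W0_cvec[OF W[OF that(1)]]] by blast
  then have "analytic_types n q \<rho> = (\<lambda>\<kappa>. analytic_type (F \<kappa>)) ` fiber n \<rho>"
    unfolding analytic_types_def
    by (intro classes_eq_image_of_choice[where T = "\<lambda>f \<kappa>. analytic_type f"] F)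
  also have "card \<dots> = card (Zn_orbit n ` fiber n \<rho>)"
  proof (rule card_image_eq_if_same_kernel)
    fix \<kappa> \<kappa>' assume k: "\<kappa> \<in> fiber n \<rho>" "\<kappa>' \<in> fiber n \<rho>"
    show "analytic_type (F \<kappa>) = analytic_type (F \<kappa>') \<longleftrightarrow> Zn_orbit n \<kappa> = Zn_orbit n \<kappa>'"
      unfolding iff[OF k F[OF k(1)] F[OF k(2)]]
      using Zn_orbit_eq_iff[OF _ W0_cvec[OF W[OF k(1)]] W0_cvec[OF W[OF k(2)]]] n by simp
  qed
  finally show ?thesis by (simp add: fiber_orbits_def)
qed

lemma Z_roots_imp_inj_critical_values:
  assumes n: "n \<ge> 3" and k: "\<kappa> \<in> W0 n" and r: "roots_of n \<kappa> lam" and Z: "lam \<in> Z_roots n"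
  shows "inj_on (\<lambda>i. poly (crit_poly n \<kappa>) (\<kappa> i)) {1..n - 1}"
proof -
  have n2: "n \<ge> 2" and n1: "n \<ge> 1" using n by auto
  have Q: "Qpoly n lam = crit_poly n \<kappa> + [:(-1) ^ n:]" using roots_of_iff[OF n2 k] r by blast
  have "pderiv (Qpoly n lam) = smult (of_nat n) (Qpoly (n - 1) \<kappa>)"
    by (simp add: Q pderiv_add pderiv_crit_poly[OF n1] pderiv_pCons)
  then have crit: "{t. poly (pderiv (Qpoly n lam)) t = 0} = \<kappa> ` {1..n - 1}"
    using n by (auto simp: poly_Qpoly)
  have "card (\<kappa> ` {1..n - 1}) = n - 1" "inj_on (poly (Qpoly n lam)) (\<kappa> ` {1..n - 1})"
    using Z unfolding Z_roots_def crit[symmetric] by auto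
  then have "inj_on \<kappa> {1..n - 1}" "inj_on (poly (Qpoly n lam)) (\<kappa> ` {1..n - 1})"
    by (simp_all add: eq_card_imp_inj_on)
  then have "inj_on (poly (Qpoly n lam) \<circ> \<kappa>) {1..n - 1}" by (rule comp_inj_on)
  then show ?thesis by (simp add: Q inj_on_def)
qed

section \<open>Generic critical values\<close>

lemma prod_index_pairs_nonzero:
  "(\<Prod>p\<in>index_pairs n. f (fst p) - f (snd p)) \<noteq> (0::complex) \<Longrightarrow> inj_on f {1..n - 1}"
  by (rule inj_on_if_pairs) auto

text \<open>Take \<open>n - 2\<close> as the \<open>i\<close>-th critical point and \<open>-1\<close> as all the other ones, so that their sum is \<open>0\<close>. The
  polynomial is then \<open>(t + 1) ^ n - n * (t + 1) ^ (n - 1)\<close> up to a constant, with the critical values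
  \<open>- (n - 1) ^ (n - 1)\<close> and \<open>0\<close>.\<close>

lemma critical_values_differ:
  assumes n: "n \<ge> 3" and i: "i \<in> {1..n - 1}" and j: "j \<in> {1..n - 1}" "i \<noteq> j"
  shows "\<exists>x. critical_value n i x - critical_value n j x \<noteq> 0"
proof -
  define \<kappa> where "\<kappa> = (\<lambda>k\<in>{1..n - 1}. if k = i then of_nat (n - 2) else (-1::complex))"
  have rem: "(\<Sum>k\<in>{1..n - 1}. \<kappa> k) = \<kappa> i + (\<Sum>k\<in>{1..n - 1} - {i}. \<kappa> k)"
    using i by (intro sum.remove) auto
  have "(\<Sum>k\<in>{1..n - 1} - {i}. \<kappa> k) = (\<Sum>k\<in>{1..n - 1} - {i}. -1)" by (intro sum.cong) (auto simp: \<kappa>_def)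
  also have "\<dots> = - of_nat (n - 2)" using i by simp
  finally have W: "\<kappa> \<in> W0 n" using rem i by (simp add: W0_def cvec_def \<kappa>_def)
  then obtain x where x: "\<kappa> = kap n x" using kap_surj[OF n] by blast
  have n1: "n \<ge> 1" using n by simp
  define q :: "complex poly" where "q = [:1, 1:] ^ n - smult (of_nat n) ([:1, 1:] ^ (n - 1))"
  obtain k where k: "n = Suc (Suc k)" using n by (metis numeral_3_eq_3 Suc_le_D Suc_le_mono)
  have ki: "\<kappa> i = of_nat (n - 2)" "\<kappa> j = -1" using i j by (auto simp: \<kappa>_def)
  have Q: "Qpoly (n - 1) \<kappa> = [:- of_nat (n - 2), 1:] * [:1, 1:] ^ (n - 2)"
  proof -
    have "Qpoly (n - 1) \<kappa> = [:- \<kappa> i, 1:] * (\<Prod>k\<in>{1..n - 1} - {i}. [:- \<kappa> k, 1:])"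
      unfolding Qpoly_def using i by (intro prod.remove) auto
    also have "(\<Prod>k\<in>{1..n - 1} - {i}. [:- \<kappa> k, 1:]) = (\<Prod>k\<in>{1..n - 1} - {i}. [:1, 1:])"
      by (intro prod.cong) (auto simp: \<kappa>_def)
    also have "\<dots> = [:1, 1:] ^ (n - 2)" using i by (simp add: numeral_2_eq_2)
    finally show ?thesis by (simp only: ki)
  qed
  have "pderiv q = smult (of_nat n) (Qpoly (n - 1) \<kappa>)"
  proof (rule poly_ext)
    fix t
    have d1: "pderiv [:1, 1::complex:] = 1" by (simp add: pderiv_pCons)
    have "poly (pderiv q) t = of_nat n * (1 + t) ^ (n - 1) - of_nat n * (of_nat (n - 1) * (1 + t) ^ (n - 2))"
      unfolding q_def pderiv_diff pderiv_smult k by (simp add: pderiv_power_Suc d1 del: power_Suc of_nat_Suc)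
    also have "\<dots> = of_nat n * ((t - of_nat (n - 2)) * (1 + t) ^ (n - 2))"
      unfolding k by (simp add: algebra_simps)
    finally show "poly (pderiv q) t = poly (smult (of_nat n) (Qpoly (n - 1) \<kappa>)) t"
      unfolding Q poly_smult poly_mult poly_power by simp
  qed
  from eq_crit_poly[OF n1 this] have qc: "poly q t = poly (crit_poly n \<kappa>) t + poly q 0" for t
    by (metis poly_add poly_pCons poly_0 add_0_right mult_zero_right)
  have "poly q (of_nat (n - 2)) = - (of_nat (n - 1) ^ (n - 1))"
    unfolding q_def k by (simp add: algebra_simps)
  moreover have "poly q (-1) = 0" unfolding q_def k by simp
  ultimately have "poly (crit_poly n \<kappa>) (\<kappa> i) - poly (crit_poly n \<kappa>) (\<kappa> j) = - (of_nat (n - 1) ^ (n - 1))"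
    using qc[of "\<kappa> i"] qc[of "\<kappa> j"] unfolding ki by (metis add_diff_cancel_right diff_zero)
  moreover have "(of_nat (n - 1) :: complex) ^ (n - 1) \<noteq> 0" using n by simp
  ultimately show ?thesis unfolding critical_value_def x[symmetric] by (intro exI[of _ x]) (simp add: x[symmetric])
qed

text \<open>The last factor is the product of the values \<open>\<rho>\<close> at all critical points, the last one included: it does not
  vanish iff the function has distinct roots.\<close>

definition nondegeneracy :: "nat \<Rightarrow> (nat \<Rightarrow> complex) \<Rightarrow> complex"
  where "nondegeneracy n x = ramification_bound n x *
    (\<Prod>p\<in>index_pairs n. critical_value n (fst p) x - critical_value n (snd p) x) *
    (\<Prod>i\<in>{1..n - 1}. critical_value n i x + (-1) ^ n)"

lemma nondegeneracy_pfun_nonzero: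
  assumes n: "n \<ge> 3"
  shows "\<exists>e x. pfun (n - 2) e (nondegeneracy n) \<and> nondegeneracy n x \<noteq> 0"
proof -
  obtain e where e: "pfun (n - 2) e (ramification_bound n)" using pfun_ramification_bound[OF n] by blast
  obtain x1 where x1: "ramification_bound n x1 \<noteq> 0" using ramification_bound_nonzero[OF n] by blast
  let ?f = "\<lambda>x. \<Prod>p\<in>index_pairs n. critical_value n (fst p) x - critical_value n (snd p) x"
  let ?g = "\<lambda>x. \<Prod>i\<in>{1..n - 1}. critical_value n i x + (-1) ^ n"
  have pv: "pfun (n - 2) n (\<lambda>x. critical_value n (fst p) x - critical_value n (snd p) x)" if "p \<in> index_pairs n" for p
    using that by (intro pfun_diff pfun_critical_value[OF n]) (auto simp: index_pairs_def)
  have pf: "pfun (n - 2) (\<Sum>p\<in>index_pairs n. n) ?f" by (intro pfun_prod pv)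
  have pw: "pfun (n - 2) n (\<lambda>x. critical_value n i x + (-1) ^ n)" if "i \<in> {1..n - 1}" for i
    using that by (intro pfun_add pfun_critical_value[OF n] pfun_const)
  have pg: "pfun (n - 2) (\<Sum>i\<in>{1..n - 1}. n) ?g" by (intro pfun_prod pw)
  have "\<exists>x. ?f x \<noteq> 0"
  proof (rule pfun_nonzero_prod[OF finite_index_pairs pv])
    fix p assume "p \<in> index_pairs n"
    then show "\<exists>x. critical_value n (fst p) x - critical_value n (snd p) x \<noteq> 0"
      by (intro critical_values_differ[OF n]) (auto simp: index_pairs_def)
  qed
  then obtain x2 where x2: "?f x2 \<noteq> 0" by blast
  have n1: "n \<ge> 1" using n by simp
  have "?g (\<lambda>_. 0) \<noteq> 0"
  proof -
    have "critical_value n i (\<lambda>_. 0) = 0" if "i \<in> {1..n - 1}" for i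
      using that by (simp add: critical_value_def kap_def poly_crit_poly_0[OF n1])
    then show ?thesis by simp
  qed
  then obtain x3 where x3: "?g x3 \<noteq> 0" by blast
  obtain x4 where x4: "ramification_bound n x4 * ?f x4 \<noteq> 0"
    using pfun_nonzero_mult[OF e pf x1 x2] by blast
  obtain x where "ramification_bound n x * ?f x * ?g x \<noteq> 0"
    using pfun_nonzero_mult[OF pfun_mult[OF e pf] pg x4 x3] by blast
  moreover have "pfun (n - 2) (e + (\<Sum>p\<in>index_pairs n. n) + (\<Sum>i\<in>{1..n - 1}. n)) (nondegeneracy n)"
    unfolding nondegeneracy_def[abs_def] by (intro pfun_mult[OF pfun_mult[OF e pf] pg])
  ultimately show ?thesis unfolding nondegeneracy_def by blast
qed

definition good_parameter :: "nat \<Rightarrow> (nat \<Rightarrow> complex) \<Rightarrow> bool"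
  where "good_parameter n \<kappa> \<longleftrightarrow> inj_on \<kappa> {1..n - 1} \<and>
    inj_on (\<lambda>i. poly (crit_poly n \<kappa>) (\<kappa> i)) {1..n - 1} \<and>
    (\<forall>i\<in>{1..n - 1}. poly (crit_poly n \<kappa>) (\<kappa> i) + (-1) ^ n \<noteq> 0)"

lemma good_parameter_if_nondegeneracy:
  assumes "nondegeneracy n x \<noteq> 0" shows "good_parameter n (kap n x)"
  unfolding good_parameter_def
proof (intro conjI ballI)
  show "inj_on (kap n x) {1..n - 1}"
    using assms by (intro prod_index_pairs_nonzero) (auto simp: nondegeneracy_def ramification_bound_def)
  show "inj_on (\<lambda>i. poly (crit_poly n (kap n x)) (kap n x i)) {1..n - 1}"
    using assms unfolding nondegeneracy_def critical_value_def
    by (intro prod_index_pairs_nonzero) auto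
  show "poly (crit_poly n (kap n x)) (kap n x i) + (-1) ^ n \<noteq> 0" if "i \<in> {1..n - 1}" for i
    using assms that unfolding nondegeneracy_def critical_value_def by auto
qed

text \<open>The point in the second component shows that the condition \<open>G \<noteq> 0\<close> is met by a normalized function, and
  hence later that a certain polynomial on the family is nonzero.\<close>

lemma generic_critical_values:
  assumes n: "n \<ge> 3"
  shows "\<exists>d G. pfun (n - 2) d G \<and> (\<exists>\<kappa>\<in>W0 n. G (\<lambda>j. poly (crit_poly n \<kappa>) (\<kappa> j)) \<noteq> 0 \<and> good_parameter n \<kappa>) \<and>
    (\<forall>\<kappa>\<in>W0 n. G (\<lambda>j. poly (crit_poly n \<kappa>) (\<kappa> j)) \<noteq> 0 \<longrightarrow>
       card (fiber n (Upsilon n \<kappa>)) = n ^ (n - 2) \<and> (\<forall>\<kappa>'\<in>fiber n (Upsilon n \<kappa>). good_parameter n \<kappa>'))"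
proof -
  obtain e where "homogeneous_map (n - 2) n (critical_value n) e (ramification_bound n)"
    using critical_values_homogeneous_map[OF n] by blast
  then interpret h: homogeneous_map "n - 2" n "critical_value n" e "ramification_bound n" .
  have fib: "crit_fib n \<rho>' = h.fib \<rho>'" for \<rho>' unfolding crit_fib_def h.fib_def ..
  obtain e' x0 where "pfun (n - 2) e' (nondegeneracy n)" "nondegeneracy n x0 \<noteq> 0"
    using nondegeneracy_pfun_nonzero[OF n] by blast
  from h.bezout_generic[OF this] obtain d G where G: "pfun (n - 2) d G" "\<exists>x\<in>cspace (n - 2). G (h.PP x) \<noteq> 0"
    "\<forall>\<rho>. G \<rho> \<noteq> 0 \<longrightarrow> card (h.fib \<rho>) = n ^ (n - 2) \<and> (\<forall>x\<in>h.fib \<rho>. nondegeneracy n x \<noteq> 0)" by blast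
  have main: "card (fiber n (Upsilon n \<kappa>)) = n ^ (n - 2) \<and> (\<forall>\<kappa>'\<in>fiber n (Upsilon n \<kappa>). good_parameter n \<kappa>')"
    if k: "\<kappa> \<in> W0 n" and g: "G (\<lambda>j. poly (crit_poly n \<kappa>) (\<kappa> j)) \<noteq> 0" for \<kappa>
  proof -
    let ?\<rho> = "\<lambda>j. Upsilon n \<kappa> j - (-1) ^ n"
    have "G ?\<rho> = G (\<lambda>j. poly (crit_poly n \<kappa>) (\<kappa> j))"
      by (rule pfun_cong[OF G(1)]) (simp add: Upsilon_eq)
    then have "G ?\<rho> \<noteq> 0" using g by simp
    then have gr: "card (crit_fib n ?\<rho>) = n ^ (n - 2)" "\<forall>x\<in>crit_fib n ?\<rho>. nondegeneracy n x \<noteq> 0"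
      using G(3) unfolding fib by blast+
    have bij: "bij_betw (kap n) (crit_fib n ?\<rho>) (fiber n (Upsilon n \<kappa>))"
      using k by (intro fiber_bij[OF n]) (auto simp: HP_II_def)
    have "good_parameter n \<kappa>'" if k': "\<kappa>' \<in> fiber n (Upsilon n \<kappa>)" for \<kappa>'
    proof -
      have "\<kappa>' \<in> kap n ` crit_fib n ?\<rho>" using k' bij_betw_imp_surj_on[OF bij] by simp
      then obtain x where "x \<in> crit_fib n ?\<rho>" "\<kappa>' = kap n x" by (rule imageE)
      then show ?thesis using gr(2) good_parameter_if_nondegeneracy by simp
    qed
    then show ?thesis using gr(1) bij_betw_same_card[OF bij] by simp
  qed
  obtain x where x: "G (h.PP x) \<noteq> 0" using G(2) by blast
  have k: "kap n x \<in> W0 n" by (rule kap_W0[OF n])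
  have g: "G (\<lambda>j. poly (crit_poly n (kap n x)) (kap n x j)) \<noteq> 0"
    using x unfolding h.PP_def critical_value_def .
  have "kap n x \<in> fiber n (Upsilon n (kap n x))" using k by (simp add: fiber_def)
  then have "good_parameter n (kap n x)" using main[OF k g] by blast
  then show ?thesis using G(1) main k g by blast
qed

lemma generic_fiber_counts:
  assumes n: "n \<ge> 3" and q: "q \<ge> 2" and k: "\<kappa> \<in> W0 n"
    and card: "card (fiber n (Upsilon n \<kappa>)) = n ^ (n - 2)"
    and good: "\<forall>\<kappa>'\<in>fiber n (Upsilon n \<kappa>). good_parameter n \<kappa>'"
  shows "card (fiber_orbits n (Upsilon n \<kappa>)) = n ^ (n - 3) \<and> card (analytic_types n q (Upsilon n \<kappa>)) = n ^ (n - 3)"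
proof -
  have H: "Upsilon n \<kappa> \<in> HP_II n" using k by (auto simp: HP_II_def)
  have fin: "finite (fiber n (Upsilon n \<kappa>))" using fiber_finite_card_le[OF n H] by simp
  have "\<exists>j\<in>{1..n - 1}. \<kappa>' j \<noteq> 0" if "\<kappa>' \<in> fiber n (Upsilon n \<kappa>)" for \<kappa>'
  proof (rule ccontr)
    assume z: "\<not> (\<exists>j\<in>{1..n - 1}. \<kappa>' j \<noteq> 0)"
    have "inj_on \<kappa>' {1..n - 1}" using good that by (simp add: good_parameter_def)
    moreover have "1 \<in> {1..n - 1}" "2 \<in> {1..n - 1}" using n by auto
    ultimately have "\<kappa>' 1 \<noteq> \<kappa>' 2" by (metis inj_onD one_eq_numeral_iff semiring_norm(85) num.distinct(1))
    then show False using z \<open>1 \<in> {1..n - 1}\<close> \<open>2 \<in> {1..n - 1}\<close> by metis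
  qed
  from card_fiber_orbits[OF n fin this] have "n * card (fiber_orbits n (Upsilon n \<kappa>)) = n ^ (n - 2)" using card by simp
  also have "n ^ (n - 2) = n * n ^ (n - 3)" using n by (simp add: Suc_diff_le numeral_3_eq_3 numeral_2_eq_2 flip: power_Suc)
  finally have "card (fiber_orbits n (Upsilon n \<kappa>)) = n ^ (n - 3)" using n by simp
  moreover have "card (analytic_types n q (Upsilon n \<kappa>)) = card (fiber_orbits n (Upsilon n \<kappa>))"
    using good by (intro card_analytic_types[OF n q]) (simp add: good_parameter_def)
  ultimately show ?thesis by simp
qed

section \<open>Critical points as coordinates on the family\<close>

text \<open>A monic polynomial of degree \<open>n\<close> is given by its critical points \<open>x 1, \<dots>, x (n - 1)\<close> and the product
  \<open>x n\<close> of its roots.\<close>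

definition full_poly :: "nat \<Rightarrow> (nat \<Rightarrow> complex) \<Rightarrow> complex poly"
  where "full_poly n x = crit_poly n x + [:(-1) ^ n * x n:]"

definition sigma_of_critical :: "nat \<Rightarrow> nat \<Rightarrow> (nat \<Rightarrow> complex) \<Rightarrow> complex"
  where "sigma_of_critical n l x = (if l = n then x n else of_nat n / of_nat (n - l) * esym (n - 1) l x)"

lemma esym_eq_sigma_of_critical:
  assumes n: "n \<ge> 1" and Q: "Qpoly n lam = full_poly n x" and l: "l \<in> {1..n}"
  shows "esym n l lam = sigma_of_critical n l x"
proof (cases "l = n")
  case True
  have "poly (Qpoly n lam) 0 = (-1) ^ n * x n" unfolding Q full_poly_def using poly_crit_poly_0[OF n] by simp
  then have "(\<Prod>j\<in>{1..n}. lam j) = x n" by (simp add: poly_Qpoly prod_uminus)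
  then show ?thesis using True by (simp add: sigma_of_critical_def esym_full)
next
  case False
  then have l': "l \<le> n - 1" "l \<le> n" "n - l \<noteq> 0" using l by auto
  have z: "coeff [:(-1) ^ n * x n:] (n - l) = 0" using l'(3) by (cases "n - l") auto
  have "(-1) ^ l * esym n l lam = coeff (Qpoly n lam) (n - l)" using coeff_Qpoly[OF l'(2)] by simp
  also have "\<dots> = coeff (crit_poly n x) (n - l)" unfolding Q full_poly_def by (simp only: coeff_add z add_0_right)
  also have "\<dots> = (-1) ^ l * (of_nat n / of_nat (n - l) * esym (n - 1) l x)"
    by (simp only: coeff_crit_poly[OF l'(1)] mult.assoc)
  finally have "(-1) ^ l * esym n l lam = (-1) ^ l * (of_nat n / of_nat (n - l) * esym (n - 1) l x)" .
  moreover have "(-1 :: complex) ^ l \<noteq> 0" by simp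
  ultimately show ?thesis using mult_left_cancel False unfolding sigma_of_critical_def by metis
qed

lemma full_poly_exists:
  assumes n: "n \<ge> 2" shows "\<exists>x. Qpoly n lam = full_poly n x"
proof -
  have n1: "n \<ge> 1" using n by simp
  let ?p = "smult (1 / of_nat n) (pderiv (Qpoly n lam))"
  have dg: "degree ?p = n - 1" using n by (simp add: degree_pderiv)
  have "coeff (Qpoly n lam) n = 1" using coeff_Qpoly[of 0 n lam] by simp
  then have "coeff ?p (n - 1) = 1" using n by (simp add: coeff_pderiv)
  then obtain k where k: "Qpoly (n - 1) k = ?p" using monic_poly_splits[of ?p "n - 1"] dg by auto
  have der: "pderiv (Qpoly n lam) = smult (of_nat n) (Qpoly (n - 1) k)" unfolding k using n by simp
  define x where "x = (\<lambda>i. if i = n then (-1) ^ n * poly (Qpoly n lam) 0 else k i)"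
  have "crit_poly n k = crit_poly n x" using n by (intro crit_poly_cong) (auto simp: x_def)
  moreover have "(-1) ^ n * x n = poly (Qpoly n lam) 0"
    by (simp add: x_def mult.assoc[symmetric] power_mult_distrib[symmetric])
  ultimately have "Qpoly n lam = full_poly n x" using eq_crit_poly[OF n1 der] unfolding full_poly_def by simp
  then show ?thesis by blast
qed

text \<open>Multiple roots are critical points with critical value \<open>0\<close>.\<close>

lemma Z_rootsI:
  assumes n: "n \<ge> 2" and c: "lam \<in> cvec n" and Q: "Qpoly n lam = full_poly n x" and x0: "x n \<noteq> 0"
    and inj: "inj_on x {1..n - 1}" "inj_on (\<lambda>i. poly (full_poly n x) (x i)) {1..n - 1}"
    and nz: "\<And>i. i \<in> {1..n - 1} \<Longrightarrow> poly (full_poly n x) (x i) \<noteq> 0"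
  shows "lam \<in> Z_roots n"
proof -
  have n1: "n \<ge> 1" using n by simp
  have der: "pderiv (Qpoly n lam) = smult (of_nat n) (Qpoly (n - 1) x)"
    by (simp add: Q full_poly_def pderiv_add pderiv_crit_poly[OF n1] pderiv_pCons)
  have crit: "{t. poly (pderiv (Qpoly n lam)) t = 0} = x ` {1..n - 1}"
    using n by (auto simp: der poly_Qpoly)
  have "(\<Prod>j\<in>{1..n}. lam j) = x n"
    using esym_eq_sigma_of_critical[OF n1 Q, of n] n by (simp add: sigma_of_critical_def esym_full)
  then have "\<forall>j\<in>{1..n}. lam j \<noteq> 0" using x0 by (metis finite_atLeastAtMost prod_zero)
  moreover have "inj_on lam {1..n}"
  proof (rule inj_onI, rule ccontr)
    fix i j assume ij: "i \<in> {1..n}" "j \<in> {1..n}" "lam i = lam j" "i \<noteq> j"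
    have root: "poly (Qpoly n lam) (lam i) = 0" using ij(1) by (auto simp: poly_Qpoly)
    have "card {i, j} \<le> card {k\<in>{1..n}. lam k = lam i}" using ij by (intro card_mono) auto
    then have "order (lam i) (Qpoly n lam) \<ge> 2" using ij(4) by (simp add: order_Qpoly)
    moreover have "order (lam i) (Qpoly n lam) = Suc (order (lam i) (pderiv (Qpoly n lam)))"
      by (rule order_pderiv[OF Qpoly_nonzero root])
    ultimately have "order (lam i) (pderiv (Qpoly n lam)) \<noteq> 0" by simp
    then have "poly (pderiv (Qpoly n lam)) (lam i) = 0" using order_root by blast
    then have "lam i \<in> x ` {1..n - 1}" using crit by blast
    then show False using nz root unfolding Q by auto
  qed
  moreover have "card (x ` {1..n - 1}) = n - 1" using inj(1) by (simp add: card_image)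
  moreover have "inj_on (poly (Qpoly n lam)) (x ` {1..n - 1})"
    using inj(2) unfolding Q by (auto simp: inj_on_def)
  ultimately show ?thesis using c by (simp add: Z_roots_def H_roots_def crit)
qed

text \<open>The homogenization of a polynomial, as a polynomial in the numerators and the common denominator
  of its arguments.\<close>

lemma pfun_clear_denominators:
  assumes G: "pfun m d G" and y: "\<And>j. j \<in> {1..m} \<Longrightarrow> pfun r e (y j)" and w: "pfun r e w"
  shows "\<exists>D H. pfun r D H \<and> (\<forall>x. w x \<noteq> 0 \<longrightarrow> H x = w x ^ d * G (\<lambda>j. y j x / w x))"
proof -
  from G obtain c where c: "G = (\<lambda>x. \<Sum>\<beta>\<in>mons m d. c \<beta> * monomial m \<beta> x)" by (auto simp: pfun_def)
  let ?s = "\<lambda>\<beta>. \<Sum>i\<in>{1..m}. \<beta> i :: nat"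
  define H where "H = (\<lambda>x. \<Sum>\<beta>\<in>mons m d. c \<beta> * (w x ^ (d - ?s \<beta>) * monomial m \<beta> (\<lambda>j. y j x)))"
  have "pfun r (d * e + d * e) H" unfolding H_def
  proof (intro pfun_sum pfun_cmult pfun_mult)
    fix \<beta> assume b: "\<beta> \<in> mons m d"
    show "pfun r (d * e) (\<lambda>x. monomial m \<beta> (\<lambda>j. y j x))" by (rule pfun_comp_mon[OF y b])
    have "pfun r ((d - ?s \<beta>) * e) (\<lambda>x. w x ^ (d - ?s \<beta>))" by (rule pfun_power[OF w])
    then show "pfun r (d * e) (\<lambda>x. w x ^ (d - ?s \<beta>))" by (rule pfun_mono) simp
  qed
  moreover have "H x = w x ^ d * G (\<lambda>j. y j x / w x)" if w0: "w x \<noteq> 0" for x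
    unfolding H_def c sum_distrib_left
  proof (intro sum.cong refl)
    fix \<beta> assume b: "\<beta> \<in> mons m d"
    have "monomial m \<beta> (\<lambda>j. y j x / w x) = monomial m \<beta> (\<lambda>j. y j x) / w x ^ ?s \<beta>"
      by (simp add: monomial_def power_divide prod_dividef power_sum)
    moreover have "w x ^ d = w x ^ (d - ?s \<beta>) * w x ^ ?s \<beta>" using b by (simp add: mons_def flip: power_add)
    ultimately show "c \<beta> * (w x ^ (d - ?s \<beta>) * monomial m \<beta> (\<lambda>j. y j x)) = w x ^ d * (c \<beta> * monomial m \<beta> (\<lambda>j. y j x / w x))"
      using w0 by simp
  qed
  ultimately show ?thesis by blast
qed

definition crit_mean :: "nat \<Rightarrow> (nat \<Rightarrow> complex) \<Rightarrow> complex"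
  where "crit_mean n x = (1 / of_nat (n - 1)) * (\<Sum>i\<in>{1..n - 1}. x i)"

text \<open>The product of the roots after the translation that centres them.\<close>

definition mean_value :: "nat \<Rightarrow> (nat \<Rightarrow> complex) \<Rightarrow> complex"
  where "mean_value n x = (-1) ^ n * poly (full_poly n x) (crit_mean n x)"

text \<open>Nonzero iff the function satisfies the conditions of \<open>Z_rootsI\<close> and can be normalized.\<close>

definition regularity :: "nat \<Rightarrow> (nat \<Rightarrow> complex) \<Rightarrow> complex"
  where "regularity n x = x n * mean_value n x * (\<Prod>p\<in>index_pairs n. x (fst p) - x (snd p)) *
    (\<Prod>p\<in>index_pairs n. poly (full_poly n x) (x (fst p)) - poly (full_poly n x) (x (snd p))) *
    (\<Prod>i\<in>{1..n - 1}. poly (full_poly n x) (x i))"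

lemma pfun_crit_mean: assumes "n \<ge> 1" shows "pfun n 1 (crit_mean n)"
  unfolding crit_mean_def[abs_def] using assms by (intro pfun_cmult pfun_sum pfun_coord) auto

lemma pfun_full_poly: assumes n: "n \<ge> 1" and g: "pfun n 1 g" shows "pfun n n (\<lambda>x. poly (full_poly n x) (g x))"
proof -
  have "pfun n n (\<lambda>x. poly (crit_poly n x) (g x))"
    using n by (intro pfun_poly_crit_poly g pfun_coord) auto
  moreover have "pfun n n (\<lambda>x. (-1) ^ n * x n)" using n by (intro pfun_cmult pfun_coord) auto
  ultimately have "pfun n n (\<lambda>x. poly (crit_poly n x) (g x) + (-1) ^ n * x n)" by (rule pfun_add)
  then show ?thesis by (simp add: full_poly_def)
qed

lemma pfun_mean_value: "n \<ge> 1 \<Longrightarrow> pfun n n (mean_value n)"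
  unfolding mean_value_def[abs_def] by (intro pfun_cmult pfun_full_poly pfun_crit_mean)

lemma pfun_regularity: assumes n: "n \<ge> 1" shows "\<exists>e. pfun n e (regularity n)"
proof -
  have c: "pfun n 1 (\<lambda>x. x i)" if "i \<in> {1..n - 1}" for i using that by (intro pfun_coord) auto
  have x: "pfun n 1 (\<lambda>x. x n)" using n by (intro pfun_coord) auto
  have p1: "pfun n (\<Sum>p\<in>index_pairs n. 1) (\<lambda>x. \<Prod>p\<in>index_pairs n. x (fst p) - x (snd p))"
    by (intro pfun_prod pfun_diff c) (auto simp: index_pairs_def)
  have p2: "pfun n (\<Sum>p\<in>index_pairs n. n) (\<lambda>x. \<Prod>p\<in>index_pairs n. poly (full_poly n x) (x (fst p)) - poly (full_poly n x) (x (snd p)))"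
    by (intro pfun_prod pfun_diff pfun_full_poly n c) (auto simp: index_pairs_def)
  have p3: "pfun n (\<Sum>i\<in>{1..n - 1}. n) (\<lambda>x. \<Prod>i\<in>{1..n - 1}. poly (full_poly n x) (x i))"
    by (intro pfun_prod pfun_full_poly n c)
  show ?thesis unfolding regularity_def[abs_def]
    using pfun_mult[OF pfun_mult[OF pfun_mult[OF pfun_mult[OF x pfun_mean_value[OF n]] p1] p2] p3] by blast
qed

lemma regular_roots_in_Z_roots:
  assumes n: "n \<ge> 2" and c: "lam \<in> cvec n" and Q: "Qpoly n lam = full_poly n x" and r: "regularity n x \<noteq> 0"
  shows "lam \<in> Z_roots n"
proof (rule Z_rootsI[OF n c Q])
  show "x n \<noteq> 0" using r by (auto simp: regularity_def)
  show "inj_on x {1..n - 1}" "inj_on (\<lambda>i. poly (full_poly n x) (x i)) {1..n - 1}"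
    using r unfolding regularity_def by (intro prod_index_pairs_nonzero; auto)+
  show "poly (full_poly n x) (x i) \<noteq> 0" if "i \<in> {1..n - 1}" for i
    using r that unfolding regularity_def by auto
qed

lemma pfun_sigma_of_critical:
  assumes n: "n \<ge> 1" and l: "l \<in> {1..n}" shows "pfun n n (sigma_of_critical n l)"
proof (cases "l = n")
  case True
  then show ?thesis unfolding sigma_of_critical_def[abs_def] using n by (auto intro!: pfun_coord)
next
  case False
  have "pfun n l (\<lambda>x. esym (n - 1) l x)" by (rule pfun_esym) (auto intro!: pfun_coord)
  then have "pfun n n (\<lambda>x. esym (n - 1) l x)" using pfun_mono[of n l _ n] l by auto
  then show ?thesis unfolding sigma_of_critical_def[abs_def]
    using False pfun_cmult[of n n _ "of_nat n / of_nat (n - l)"] by simp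
qed

text \<open>The translation of \<open>y\<close> by \<open>m * x ^ q\<close>, where \<open>m\<close> is the barycentre of the roots and also of the critical
  points, and a dilatation of \<open>x\<close> normalize a function of the family. They act on the polynomial by an affine
  change of variable, so the critical values relative to the value at \<open>m\<close> are only rescaled.\<close>

lemma normalization:
  assumes n: "n \<ge> 3" and q: "q \<ge> 2" and Q: "Qpoly n lam = full_poly n x" and w: "mean_value n x \<noteq> 0"
  shows "\<exists>u \<kappa> f. u ^ n = 1 / mean_value n x \<and> \<kappa> \<in> W0 n \<and>
    (\<forall>i\<in>{1..n - 1}. \<kappa> i = u * (x i - crit_mean n x)) \<and>
    (\<forall>t. poly (crit_poly n \<kappa>) (u * (t - crit_mean n x)) =
       (poly (full_poly n x) t - poly (full_poly n x) (crit_mean n x)) / mean_value n x) \<and>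
    represents n q \<kappa> f \<and> analytic_equiv f (qh 1 q n lam)"
proof -
  have n1: "n \<ge> 1" and n2: "n \<ge> 2" using n by auto
  let ?w = "mean_value n x" and ?m = "crit_mean n x"
  have "n \<noteq> 0" "q \<noteq> 0" using n q by auto
  then obtain u where u: "u ^ n = 1 / ?w" by (metis exists_complex_root)
  have u0: "u \<noteq> 0" using u w n1 by (auto simp: power_0_left)
  obtain c where c: "c ^ q = 1 / u" using \<open>q \<noteq> 0\<close> by (metis exists_complex_root)
  have c0: "c \<noteq> 0" using c u0 q by (auto simp: power_0_left)
  define \<kappa> where "\<kappa> = (\<lambda>i\<in>{1..n - 1}. u * (x i - ?m))"
  have ki: "\<kappa> i = u * (x i - ?m)" if "i \<in> {1..n - 1}" for i using that by (simp add: \<kappa>_def)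
  have "(\<Sum>i\<in>{1..n - 1}. \<kappa> i) = u * ((\<Sum>i\<in>{1..n - 1}. x i) - of_nat (n - 1) * ?m)"
    by (simp add: ki sum_distrib_left[symmetric] sum_subtractf)
  also have "\<dots> = 0" using n by (simp add: crit_mean_def)
  finally have kW: "\<kappa> \<in> W0 n" by (simp add: W0_def cvec_def \<kappa>_def)
  define lam0 where "lam0 = (\<lambda>j\<in>{1..n}. u * (lam j - ?m))"
  have P: "poly (Qpoly n lam0) (u * (t - ?m)) = u ^ n * poly (full_poly n x) t" for t
  proof -
    have "poly (Qpoly n lam0) (u * (t - ?m)) = (\<Prod>j\<in>{1..n}. u * (t - lam j))"
      unfolding poly_Qpoly by (intro prod.cong refl) (simp add: lam0_def algebra_simps)
    then show ?thesis by (simp add: prod.distrib poly_Qpoly flip: Q)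
  qed
  have PC: "pcompose (Qpoly n lam0) [:- u * ?m, u:] = smult (u ^ n) (full_poly n x)"
  proof (rule poly_ext)
    fix t
    have "poly [:- u * ?m, u:] t = u * (t - ?m)" by (simp add: algebra_simps)
    then show "poly (pcompose (Qpoly n lam0) [:- u * ?m, u:]) t = poly (smult (u ^ n) (full_poly n x)) t"
      by (simp only: poly_pcompose P poly_smult)
  qed
  have "pderiv (Qpoly n lam0) = smult (of_nat n) (Qpoly (n - 1) \<kappa>)"
  proof (rule poly_ext)
    fix s
    define t where "t = s / u + ?m"
    have s: "s = u * (t - ?m)" using u0 by (simp add: t_def)
    have "pderiv (pcompose (Qpoly n lam0) [:- u * ?m, u:]) = pcompose (pderiv (Qpoly n lam0)) [:- u * ?m, u:] * [:u:]"
      by (simp add: pderiv_pcompose pderiv_pCons)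
    then have a: "poly (pderiv (smult (u ^ n) (full_poly n x))) t = poly (pderiv (Qpoly n lam0)) (poly [:- u * ?m, u:] t) * u"
      unfolding PC by (simp only: poly_mult poly_pcompose) simp
    have b: "poly [:- u * ?m, u:] t = s" by (simp add: s algebra_simps)
    have c: "poly (pderiv (smult (u ^ n) (full_poly n x))) t = u ^ n * (of_nat n * (\<Prod>i\<in>{1..n - 1}. t - x i))"
      by (simp add: pderiv_smult full_poly_def pderiv_add pderiv_crit_poly[OF n1] pderiv_pCons poly_Qpoly)
    have d: "(\<Prod>i\<in>{1..n - 1}. s - \<kappa> i) = u ^ (n - 1) * (\<Prod>i\<in>{1..n - 1}. t - x i)"
    proof -
      have "(\<Prod>i\<in>{1..n - 1}. s - \<kappa> i) = (\<Prod>i\<in>{1..n - 1}. u * (t - x i))"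
        by (intro prod.cong refl) (simp add: ki s algebra_simps)
      then show ?thesis by (simp add: prod.distrib)
    qed
    have e: "u ^ n = u ^ (n - 1) * u" using n1 by (cases n) auto
    have "poly (pderiv (Qpoly n lam0)) s * u = u ^ n * (of_nat n * (\<Prod>i\<in>{1..n - 1}. t - x i))"
      using a unfolding b c by (rule sym)
    also have "\<dots> = (of_nat n * (\<Prod>i\<in>{1..n - 1}. s - \<kappa> i)) * u" unfolding d e by (simp only: mult_ac)
    finally have "poly (pderiv (Qpoly n lam0)) s * u = (of_nat n * (\<Prod>i\<in>{1..n - 1}. s - \<kappa> i)) * u" .
    then show "poly (pderiv (Qpoly n lam0)) s = poly (smult (of_nat n) (Qpoly (n - 1) \<kappa>)) s"
      using u0 by (simp add: poly_Qpoly)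
  qed
  moreover have fm: "poly (full_poly n x) ?m = (-1) ^ n * ?w"
    unfolding mean_value_def by (simp add: mult.assoc[symmetric] power_mult_distrib[symmetric])
  moreover have "poly (Qpoly n lam0) 0 = (-1) ^ n" using P[of ?m] u w by (simp add: fm)
  ultimately have Q0: "Qpoly n lam0 = crit_poly n \<kappa> + [:(-1) ^ n:]" using eq_crit_poly[OF n1] by metis
  then have r: "roots_of n \<kappa> lam0" unfolding roots_of_iff[OF n2 kW] by (simp add: lam0_def cvec_def)
  have val: "poly (crit_poly n \<kappa>) (u * (t - ?m)) = (poly (full_poly n x) t - poly (full_poly n x) ?m) / ?w" for t
    using P[of t] w by (simp add: Q0 u fm field_simps)
  have "biholomorphic_germ (\<lambda>(x, y). (c * x, 1 * y + (- ?m) * x ^ q))"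
    using c0 q by (intro biholomorphic_germ_shear) auto
  moreover have "qh 1 q n lam z = qh 1 q n lam0 ((\<lambda>(x, y). (c * x, 1 * y + (- ?m) * x ^ q)) z)" for z
  proof -
    have "(\<Prod>j\<in>{1..n}. snd z ^ 1 - lam j * fst z ^ q)
        = (\<Prod>j\<in>{1..n}. (1 * snd z + (- ?m) * fst z ^ q) ^ 1 - lam0 j * (c * fst z) ^ q)"
    proof (intro prod.cong refl)
      fix j assume "j \<in> {1..n}"
      then have "lam0 j * c ^ q = lam j - ?m" using u0 by (simp add: lam0_def c)
      then have "lam0 j * (c * fst z) ^ q = (lam j - ?m) * fst z ^ q" by (simp add: power_mult_distrib flip: mult.assoc)
      then show "snd z ^ 1 - lam j * fst z ^ q = (1 * snd z + (- ?m) * fst z ^ q) ^ 1 - lam0 j * (c * fst z) ^ q"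
        by (simp add: algebra_simps)
    qed
    then show ?thesis by (simp add: qh_def case_prod_beta)
  qed
  ultimately have eq: "analytic_equiv (qh 1 q n lam0) (qh 1 q n lam)"
    unfolding analytic_equiv_def by (intro exI conjI always_eventually allI)
  have "represents n q \<kappa> (qh 1 q n lam0)" using r by (auto simp: represents_def)
  with u kW ki val eq show ?thesis by blast
qed

lemma zariski_open_nonvanishing:
  assumes "pfun n d g" shows "zariski_open n {a \<in> cvec n. g a \<noteq> 0}"
proof -
  from assms obtain c where "g = (\<lambda>x. \<Sum>\<beta>\<in>mons n d. c \<beta> * monomial n \<beta> x)" by (auto simp: pfun_def)
  then have "poly_fun n g" unfolding poly_fun_def monomial_def by (intro exI[of _ "mons n d"] exI[of _ c]) simp
  then show ?thesis unfolding zariski_open_def by (intro exI[of _ "{g}"]) auto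
qed

lemma roots_with_given_sigma_coords:
  assumes a: "a \<in> cvec n" shows "\<exists>lam\<in>cvec n. sigma_coords n lam = a"
proof -
  let ?p = "\<Sum>k\<in>{0..n}. monom (if k = 0 then 1 else (-1) ^ k * a k) (n - k)"
  have co: "coeff ?p (n - l) = (if l = 0 then 1 else (-1) ^ l * a l)" if "l \<le> n" for l
    using coeff_descending_sum[OF that order_refl, of "\<lambda>k. if k = 0 then 1 else (-1) ^ k * a k"] that by simp
  have "coeff ?p n = 1" using co[of 0] by simp
  moreover have "degree ?p \<le> n" by (intro degree_sum_le) (auto intro: order_trans[OF degree_monom_le])
  ultimately have "degree ?p = n" using le_degree[of ?p n] by simp
  then obtain lam where lam: "lam \<in> cvec n" "Qpoly n lam = ?p" using monic_poly_splits[of ?p n] \<open>coeff ?p n = 1\<close> by auto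
  have "sigma_coords n lam = a"
  proof (rule cvec_eqI[OF _ a])
    show "sigma_coords n lam \<in> cvec n" by (simp add: sigma_coords_def cvec_def)
    fix l assume l: "l \<in> {1..n}"
    then have "(-1) ^ l * esym n l lam = (-1) ^ l * a l" using coeff_Qpoly[of l n lam] co[of l] lam(2) by simp
    moreover have "(-1 :: complex) ^ l \<noteq> 0" by simp
    ultimately show "sigma_coords n lam l = a l" using l mult_left_cancel by (metis sigma_coords_def restrict_apply')
  qed
  then show ?thesis using lam(1) by blast
qed

text \<open>The parameters at which a polynomial in the critical points and the constant term vanishes are
  mapped into a hypersurface by elimination. Since the coefficients of a polynomial do not depend on the
  numbering of its critical points, this polynomial is nonzero for all numberings outside of it.\<close>

lemma generic_family_members:
  assumes n: "n \<ge> 3" and q: "q \<ge> 2"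
  shows "\<exists>U. zariski_open n U \<and> U \<noteq> {} \<and> U \<subseteq> Z_set n \<and>
        (\<forall>lam\<in>H_roots n. sigma_coords n lam \<in> U \<longrightarrow>
           (\<exists>\<rho>. has_HP_invariant n q (qh 1 q n lam) \<rho>) \<and>
           (\<forall>\<rho>. has_HP_invariant n q (qh 1 q n lam) \<rho> \<longrightarrow>
              card (fiber_orbits n \<rho>) = n ^ (n - 3) \<and>
              card (analytic_types n q \<rho>) = n ^ (n - 3)))"
proof -
  have n1: "n \<ge> 1" and n2: "n \<ge> 2" using n by auto
  obtain d G \<kappa>0 where G: "pfun (n - 2) d G" and k0: "\<kappa>0 \<in> W0 n" "G (\<lambda>j. poly (crit_poly n \<kappa>0) (\<kappa>0 j)) \<noteq> 0" "good_parameter n \<kappa>0"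
    and Gfib: "\<forall>\<kappa>\<in>W0 n. G (\<lambda>j. poly (crit_poly n \<kappa>) (\<kappa> j)) \<noteq> 0 \<longrightarrow>
       card (fiber n (Upsilon n \<kappa>)) = n ^ (n - 2) \<and> (\<forall>\<kappa>'\<in>fiber n (Upsilon n \<kappa>). good_parameter n \<kappa>')"
    using generic_critical_values[OF n] by blast
  \<comment> \<open>Divided by \<open>mean_value n x\<close>, these are the critical values of the normalized function, by
    \<open>normalization\<close>.\<close>
  define y where "y = (\<lambda>j x. poly (full_poly n x) (x j) - poly (full_poly n x) (crit_mean n x))"
  have py: "pfun n n (y j)" if "j \<in> {1..n - 2}" for j
    unfolding y_def using that n by (intro pfun_diff pfun_full_poly[OF n1] pfun_crit_mean[OF n1] pfun_coord) auto
  have "\<exists>D H. pfun n D H \<and> (\<forall>x. mean_value n x \<noteq> 0 \<longrightarrow> H x = mean_value n x ^ d * G (\<lambda>j. y j x / mean_value n x))"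
    by (rule pfun_clear_denominators[OF G py pfun_mean_value[OF n1]])
  then obtain D H where H: "pfun n D H"
    and H_eq: "\<forall>x. mean_value n x \<noteq> 0 \<longrightarrow> H x = mean_value n x ^ d * G (\<lambda>j. y j x / mean_value n x)" by blast
  have Hx: "H x = mean_value n x ^ d * G (\<lambda>j. y j x / mean_value n x)" if "mean_value n x \<noteq> 0" for x
    using H_eq that by blast
  obtain e where e: "pfun n e (regularity n)" using pfun_regularity[OF n1] by blast
  define B where "B = (\<lambda>x. regularity n x * H x)"
  have pB: "pfun n (e + D) B" unfolding B_def by (rule pfun_mult[OF e H])
  \<comment> \<open>The function of \<open>\<kappa>0\<close>, which is its own normalization.\<close>
  define x0 where "x0 = (\<lambda>i. if i = n then 1 else \<kappa>0 i)"
  have B0: "B x0 \<noteq> 0"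
  proof -
    have xk: "x0 i = \<kappa>0 i" if "i \<in> {1..n - 1}" for i using that by (auto simp: x0_def)
    have cp: "crit_poly n x0 = crit_poly n \<kappa>0" by (rule crit_poly_cong) (rule xk)
    have xn: "x0 n = 1" by (simp add: x0_def)
    have F: "poly (full_poly n x0) t = poly (crit_poly n \<kappa>0) t + (-1) ^ n" for t by (simp add: full_poly_def cp xn)
    have "(\<Sum>i\<in>{1..n - 1}. x0 i) = (\<Sum>i\<in>{1..n - 1}. \<kappa>0 i)" by (intro sum.cong refl xk)
    then have cm: "crit_mean n x0 = 0" using k0(1) by (simp add: crit_mean_def W0_def)
    have F0: "poly (full_poly n x0) 0 = (-1) ^ n" using poly_crit_poly_0[OF n1] by (simp add: F)
    have mv: "mean_value n x0 = 1" by (simp add: mean_value_def cm F0 flip: power_mult_distrib)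
    have "G (\<lambda>j. y j x0 / mean_value n x0) = G (\<lambda>j. poly (crit_poly n \<kappa>0) (\<kappa>0 j))"
    proof (rule pfun_cong[OF G])
      fix j assume "j \<in> {1..n - 2}"
      then have "x0 j = \<kappa>0 j" by (intro xk) auto
      then show "y j x0 / mean_value n x0 = poly (crit_poly n \<kappa>0) (\<kappa>0 j)" by (simp add: y_def mv cm F0 F poly_crit_poly_0[OF n1])
    qed
    then have "H x0 \<noteq> 0" using Hx[of x0] k0(2) by (simp add: mv)
    moreover have "regularity n x0 \<noteq> 0"
    proof -
      have inj: "inj_on x0 {1..n - 1}" "inj_on (\<lambda>i. poly (full_poly n x0) (x0 i)) {1..n - 1}"
        using k0(3) unfolding good_parameter_def inj_on_def by (simp_all add: xk F)
      have pr: "fst p \<in> {1..n - 1}" "snd p \<in> {1..n - 1}" "fst p \<noteq> snd p" if "p \<in> index_pairs n" for p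
        using that by (auto simp: index_pairs_def)
      have "x0 (fst p) - x0 (snd p) \<noteq> 0" if "p \<in> index_pairs n" for p
        using inj_onD[OF inj(1), of "fst p" "snd p"] pr[OF that] by auto
      moreover have "poly (full_poly n x0) (x0 (fst p)) - poly (full_poly n x0) (x0 (snd p)) \<noteq> 0" if "p \<in> index_pairs n" for p
        using inj_onD[OF inj(2), of "fst p" "snd p"] pr[OF that] by auto
      moreover have "poly (full_poly n x0) (x0 i) \<noteq> 0" if "i \<in> {1..n - 1}" for i
        using k0(3) that unfolding good_parameter_def by (simp add: xk F)
      moreover have "x0 n \<noteq> 0" by (simp add: x0_def)
      ultimately show ?thesis by (simp add: regularity_def mv)
    qed
    ultimately show ?thesis by (simp add: B_def)
  qed
  have "\<exists>d g. pfun n d g \<and> (\<exists>y. g y \<noteq> 0) \<and> (\<forall>x. B x = 0 \<longrightarrow> g (\<lambda>l. sigma_of_critical n l x) = 0)"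
    by (rule elimination[OF pfun_sigma_of_critical[OF n1] pB B0])
  then obtain dg g where g: "pfun n dg g" "\<exists>y. g y \<noteq> 0" "\<forall>x. B x = 0 \<longrightarrow> g (\<lambda>l. sigma_of_critical n l x) = 0" by blast
  define U where "U = {a \<in> cvec n. g a \<noteq> 0}"
  have Bx: "B x \<noteq> 0" if "sigma_coords n lam \<in> U" "Qpoly n lam = full_poly n x" for lam x
  proof -
    have "g (sigma_coords n lam) = g (\<lambda>l. sigma_of_critical n l x)"
      by (rule pfun_cong[OF g(1)]) (simp add: sigma_coords_def esym_eq_sigma_of_critical[OF n1 that(2)])
    then show ?thesis using that(1) g(3) by (auto simp: U_def)
  qed
  have "zariski_open n U" unfolding U_def by (rule zariski_open_nonvanishing[OF g(1)])
  moreover have "U \<noteq> {}"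
  proof -
    obtain v where v: "g v \<noteq> 0" using g(2) by blast
    have "g (\<lambda>i\<in>{1..n}. v i) = g v" by (rule pfun_cong[OF g(1)]) simp
    then have "(\<lambda>i\<in>{1..n}. v i) \<in> U" using v by (simp add: U_def cvec_def)
    then show ?thesis by blast
  qed
  moreover have "U \<subseteq> Z_set n"
  proof
    fix a assume a: "a \<in> U"
    then obtain lam where lam: "lam \<in> cvec n" "sigma_coords n lam = a"
      using roots_with_given_sigma_coords[of a n] by (auto simp: U_def)
    obtain x where x: "Qpoly n lam = full_poly n x" using full_poly_exists[OF n2] by blast
    have "regularity n x \<noteq> 0" using Bx[of lam x] a lam(2) x by (auto simp: B_def)
    then have "lam \<in> Z_roots n" by (rule regular_roots_in_Z_roots[OF n2 lam(1) x])
    then show "a \<in> Z_set n" using lam(2) by (auto simp: Z_set_def)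
  qed
  moreover have "(\<exists>\<rho>. has_HP_invariant n q (qh 1 q n lam) \<rho>) \<and>
      (\<forall>\<rho>. has_HP_invariant n q (qh 1 q n lam) \<rho> \<longrightarrow>
        card (fiber_orbits n \<rho>) = n ^ (n - 3) \<and> card (analytic_types n q \<rho>) = n ^ (n - 3))"
    if U: "sigma_coords n lam \<in> U" for lam
  proof -
    obtain x where x: "Qpoly n lam = full_poly n x" using full_poly_exists[OF n2] by blast
    have w: "mean_value n x \<noteq> 0" using Bx[OF U x] by (auto simp: B_def regularity_def)
    from normalization[OF n q x w] obtain u \<kappa> f where u: "u ^ n = 1 / mean_value n x" and kW: "\<kappa> \<in> W0 n"
      and ki': "\<forall>i\<in>{1..n - 1}. \<kappa> i = u * (x i - crit_mean n x)"
      and val': "\<forall>t. poly (crit_poly n \<kappa>) (u * (t - crit_mean n x)) =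
        (poly (full_poly n x) t - poly (full_poly n x) (crit_mean n x)) / mean_value n x"
      and f: "represents n q \<kappa> f" "analytic_equiv f (qh 1 q n lam)"
      by (elim exE conjE)
    note ki = bspec[OF ki'] and val = spec[OF val']
    have "\<kappa> \<in> fiber n (Upsilon n \<kappa>)" using kW by (simp add: fiber_def)
    then have ex: "has_HP_invariant n q (qh 1 q n lam) (Upsilon n \<kappa>)"
      unfolding has_HP_invariant_def using f by blast
    have "card (fiber_orbits n \<rho>) = n ^ (n - 3) \<and> card (analytic_types n q \<rho>) = n ^ (n - 3)"
      if inv: "has_HP_invariant n q (qh 1 q n lam) \<rho>" for \<rho>
    proof -
      obtain \<kappa>' g' where k': "\<kappa>' \<in> fiber n \<rho>" and g': "represents n q \<kappa>' g'" "analytic_equiv g' (qh 1 q n lam)"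
        using inv unfolding has_HP_invariant_def by blast
      have k'W: "\<kappa>' \<in> W0 n" and rho: "\<rho> = Upsilon n \<kappa>'" using k' by (auto simp: fiber_def)
      have "analytic_equiv f g'" by (rule analytic_equiv_trans[OF f(2) analytic_equiv_sym[OF g'(2)]])
      then obtain \<pi> where p: "\<pi> permutes {1..n - 1}" "\<kappa>' \<in> Zn_orbit n (\<kappa> \<circ> \<pi>)"
        unfolding analytic_equiv_iff_permuted_orbit[OF n2 q kW k'W f(1) g'(1)] by blast
      then obtain \<zeta> where z: "\<zeta> ^ n = 1" "\<And>j. j \<in> {1..n - 1} \<Longrightarrow> \<kappa>' j = \<zeta> * \<kappa> (\<pi> j)"
        using Zn_orbit_iff[OF W0_cvec[OF k'W]] by auto
      \<comment> \<open>The critical points of the function, numbered like those of \<open>\<kappa>'\<close>.\<close>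
      define x' where "x' = x \<circ> \<pi>"
      have pn: "\<pi> n = n" using p(1) n1 by (intro permutes_not_in) auto
      have full: "full_poly n x' = full_poly n x"
        unfolding full_poly_def x'_def crit_poly_permuted[OF p(1) n1] by (simp add: pn)
      have "(\<Sum>i\<in>{1..n - 1}. x' i) = (\<Sum>i\<in>{1..n - 1}. x i)" unfolding x'_def by (rule sum.permute[OF p(1), symmetric])
      then have mean: "crit_mean n x' = crit_mean n x" by (simp add: crit_mean_def)
      have mv: "mean_value n x' = mean_value n x" by (simp add: mean_value_def full mean)
      have "B x' \<noteq> 0" using Bx[OF U, of x'] x full by simp
      then have "G (\<lambda>j. y j x' / mean_value n x) \<noteq> 0" using Hx[of x'] w by (auto simp: B_def mv)
      moreover have "G (\<lambda>j. y j x' / mean_value n x) = G (\<lambda>j. poly (crit_poly n \<kappa>') (\<kappa>' j))"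
      proof (rule pfun_cong[OF G])
        fix j assume "j \<in> {1..n - 2}"
        then have j: "j \<in> {1..n - 1}" by auto
        then have pj: "\<pi> j \<in> {1..n - 1}" using p(1) permutes_in_image by metis
        have "poly (crit_poly n \<kappa>') (\<kappa>' j) = poly (crit_poly n \<kappa>) (\<kappa> (\<pi> j))"
          unfolding z(2)[OF j] by (rule crit_poly_rotated[of n \<pi> \<zeta> \<kappa>' \<kappa>, OF n1 p(1) z])
        also have "\<dots> = y j x' / mean_value n x" unfolding ki[OF pj] val by (simp add: y_def full mean) (simp add: x'_def)
        finally show "y j x' / mean_value n x = poly (crit_poly n \<kappa>') (\<kappa>' j)" by simp
      qed
      ultimately have "G (\<lambda>j. poly (crit_poly n \<kappa>') (\<kappa>' j)) \<noteq> 0" by simp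
      then have "card (fiber n (Upsilon n \<kappa>')) = n ^ (n - 2)" "\<forall>\<kappa>\<in>fiber n (Upsilon n \<kappa>'). good_parameter n \<kappa>"
        using Gfib k'W by blast+
      from generic_fiber_counts[OF n q k'W this] show ?thesis by (simp only: rho)
    qed
    then show ?thesis using ex by blast
  qed
  ultimately show ?thesis by blast
qed

theorem theorem4p1:
  fixes n q :: nat
  assumes "n \<ge> 3" and "q \<ge> 2"
  shows
    "(\<forall>\<rho>\<in>HP_II n. \<not> degenerate n \<rho> \<longrightarrow>
        (\<forall>\<kappa>\<in>fiber n \<rho>. \<forall>\<kappa>'\<in>fiber n \<rho>. \<forall>f f'.
           represents n q \<kappa> f \<longrightarrow> represents n q \<kappa>' f' \<longrightarrow>
           (labelled_equiv n q (f, \<kappa>) (f', \<kappa>') \<longleftrightarrow> \<kappa>' \<in> Zn_orbit n \<kappa>)))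
     \<and>
     (\<forall>\<kappa>\<in>W0 n. \<forall>\<kappa>'\<in>W0 n. \<forall>f f'.
        represents n q \<kappa> f \<longrightarrow> represents n q \<kappa>' f' \<longrightarrow>
        (analytic_equiv f f' \<longleftrightarrow> (\<exists>\<pi>. \<pi> permutes {1..n - 1} \<and> \<kappa>' \<in> Zn_orbit n (\<kappa> \<circ> \<pi>))))
     \<and>
     (\<forall>\<rho>\<in>HP_II n.
        finite (fiber_orbits n \<rho>) \<and>
        card (labelled_types n q \<rho>) = card (fiber_orbits n \<rho>) \<and>
        ((\<forall>\<kappa>\<in>fiber n \<rho>. \<forall>lam. roots_of n \<kappa> lam \<longrightarrow> lam \<in> Z_roots n) \<longrightarrow>
           card (analytic_types n q \<rho>) = card (fiber_orbits n \<rho>)) \<and>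
        card (fiber_orbits n \<rho>) \<le> n ^ (n - 3))
     \<and>
     (\<exists>U. zariski_open n U \<and> U \<noteq> {} \<and> U \<subseteq> Z_set n \<and>
        (\<forall>lam\<in>H_roots n. sigma_coords n lam \<in> U \<longrightarrow>
           (\<exists>\<rho>. has_HP_invariant n q (qh 1 q n lam) \<rho>) \<and>
           (\<forall>\<rho>. has_HP_invariant n q (qh 1 q n lam) \<rho> \<longrightarrow>
              card (fiber_orbits n \<rho>) = n ^ (n - 3) \<and>
              card (analytic_types n q \<rho>) = n ^ (n - 3))))"
proof -
  have n2: "n \<ge> 2" using assms(1) by simp
  have W: "\<kappa> \<in> W0 n" if "\<kappa> \<in> fiber n \<rho>" for \<kappa> \<rho> using that by (simp add: fiber_def)
  show ?thesis
  proof (rule conjI, goal_cases)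
    case 1
    show ?case by (intro ballI impI allI labelled_equiv_iff_orbit[OF n2 assms(2)] W)
  next
    case 2
    show ?case
    proof (rule conjI, goal_cases)
      case 1
      show ?case by (intro ballI impI allI analytic_equiv_iff_permuted_orbit[OF n2 assms(2)])
    next
      case 2
      show ?case
      proof (intro conjI generic_family_members[OF assms] ballI)
        fix \<rho> assume r: "\<rho> \<in> HP_II n"
        show "finite (fiber_orbits n \<rho>)" "card (fiber_orbits n \<rho>) \<le> n ^ (n - 3)"
          using card_fiber_orbits_le[OF assms(1) r] by auto
        show "card (labelled_types n q \<rho>) = card (fiber_orbits n \<rho>)" by (rule card_labelled_types[OF assms])
        show "(\<forall>\<kappa>\<in>fiber n \<rho>. \<forall>lam. roots_of n \<kappa> lam \<longrightarrow> lam \<in> Z_roots n) \<longrightarrow>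
           card (analytic_types n q \<rho>) = card (fiber_orbits n \<rho>)"
        proof
          assume Z: "\<forall>\<kappa>\<in>fiber n \<rho>. \<forall>lam. roots_of n \<kappa> lam \<longrightarrow> lam \<in> Z_roots n"
          show "card (analytic_types n q \<rho>) = card (fiber_orbits n \<rho>)"
          proof (rule card_analytic_types[OF assms])
            fix \<kappa> assume k: "\<kappa> \<in> fiber n \<rho>"
            obtain lam where lam: "roots_of n \<kappa> lam" using roots_of_exists[OF n2 W[OF k]] by blast
            then show "inj_on (\<lambda>i. poly (crit_poly n \<kappa>) (\<kappa> i)) {1..n - 1}"
              using Z k by (intro Z_roots_imp_inj_critical_values[OF assms(1) W[OF k] lam]) blast
          qed
        qed
      qed
    qed
  qed
qed

end
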